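(* Let $\mathcal L=(L^+,L^-,L)$ be a finitary biframe. Then: (1) The biframe $\mathsf A(\mathcal L)$ has the universal property that it provides bicomplements freely to all elements of $L^+\cup L^-$; that is, with $\nabla:\mathcal L\to\mathsf A(\mathcal L)$ the canonical embedding, $\nabla(x)$ has a bicomplement for every $x\in L^+\cup L^-$, and for every biframe map $f:\mathcal L\to\mathcal M$ such that $f^+(x^+)$ and $f^-(x^-)$ have bicomplements in $\mathcal M$ for all $x^+\in L^+$, $x^-\in L^-$, there is a unique biframe map $\tilde f:\mathsf A(\mathcal L)\to\mathcal M$ with $\tilde f\circ\nabla=f$. (2) The main component of $\mathsf A(\mathcal L)$ is anti-isomorphic to the coframe $\mathsf S(\mathcal L)$ of all biquotients of $\mathcal L$. (3) There is a bihomeomorphism $\alpha_{\mathcal L}:Sk(\mathsf{bpt}(\mathcal L))\cong\mathsf{bpt}(\mathsf A(\mathcal L))$, where $\alpha_{\mathcal L}$ sends a bipoint $f$ to the unique $\tilde f$ with $\tilde f\circ\nabla=f$. (4) The patch-closed sets of $\mathsf{bpt}(\mathsf A(\mathcal L))$, under the bijection $\alpha_{\mathcal L}$ between the underlying sets of $\mathsf{bpt}(\mathcal L)$ and $\mathsf{bpt}(\mathsf A(\mathcal L))$, coincide with the underlying sets of the bisober bisubspaces of $\mathsf{bpt}(\mathcal L)$.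
   Context: A biframe is a triple $\mathcal L=(L^+,L^-,L)$ of frames with injective frame maps $e_L^{\pm}:L^{\pm}\to L$ such that every element of $L$ (the main component) is a join of elements $e_L^+(x^+)\wedge e_L^-(x^-)$; we identify $x^{\pm}\in L^{\pm}$ with $e_L^{\pm}(x^{\pm})\in L$. A biframe map $(f^+,f^-):\mathcal L\to\mathcal M$ is a pair of frame maps $f^{\pm}:L^{\pm}\to M^{\pm}$ for which there is a (necessarily unique) frame map $f:L\to M$ with $f\circ e_L^{\pm}=e_M^{\pm}\circ f^{\pm}$. A bicomplement of $x^+\in L^+$ is an $x^-\in L^-$ with $x^+\wedge x^-=0$ and $x^+\vee x^-=1$ in $L$; similarly for elements of $L^-$. A relation $R$ on a frame is treated as a set of inequalities: the quotient by $R$ is the universal frame quotient $q$ with $q(a)\le q(b)$ for $(a,b)\in R$; the congruence generated by $R$ is the kernel of $q$. $\mathsf{fin}(L)\subseteq L$ is the set of finite joins of elements $x^+\wedge x^-$; a congruence on $L$ is finitary if generated by some $R\subseteq\mathsf{fin}(L)\times\mathsf{fin}(L)$. With $L^+\oplus L^-$ the frame coproduct and $C_L$ the kernel of the canonical surjection $L^+\oplus L^-\to L$, $\mathcal L$ is finitary if $C_L$ is a finitary congruence on $L^+\oplus L^-$ (the main component of $(L^+,L^-,L^+\oplus L^-)$). For a congruence $C$ on $L$, $\mathcal L/C=(L^+/C^+,L^-/C^-,L/C)$ with $C^{\pm}$ the restriction of $C$ to $L^{\pm}$. For $\mathcal L$ finitary, a biquotient of $\mathcal L$ is a quotient $\mathcal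 L/C$ with $C$ a finitary congruence on $L$; $\mathsf S(\mathcal L)$ is the collection of biquotients, ordered by $\mathcal L/C\le\mathcal L/D$ iff $D\subseteq C$. $\mathsf A(L)$ is the frame of congruences on $L$ ordered by inclusion; $\nabla(a)=\{(x,y):x\vee a=y\vee a\}$, $\Delta(a)=\{(x,y):x\wedge a=y\wedge a\}$. The assembly of $\mathcal L$ is the biframe $\mathsf A(\mathcal L)=(\mathsf A_{\nabla^+\Delta^-}(L),\mathsf A_{\nabla^-\Delta^+}(L),\mathsf A_{\mathsf{fin}}(L))$ (with inclusions), where these are the subframes of $\mathsf A(L)$ generated respectively by $\{\nabla(a^+):a^+\in L^+\}\cup\{\Delta(a^-):a^-\in L^-\}$, by $\{\nabla(a^-):a^-\in L^-\}\cup\{\Delta(a^+):a^+\in L^+\}$, and by $\{\nabla(x):x\in L\}\cup\{\Delta(s):s\in\mathsf{fin}(L)\}$. $\nabla:\mathcal L\to\mathsf A(\mathcal L)$ is $a^{\pm}\mapsto\nabla(a^{\pm})$. A bispace is a set $X$ with two topologies $\Omega^+(X),\Omega^-(X)$; its patch topology is the one generated by $\Omega^+(X)\cup\Omega^-(X)$, and patch-closed means closed in it. A bihomeomorphism is a bijection that is a homeomorphism for both the positive and the negative topologies. A bisubspace is a subset with both subspace topologies. $Sk(X)$ (Skula bispace) has the same points as $X$; its positive topology is generated by the positive opens and the negative closed sets of $X$, its negative topology by the negative opens and the positive closed sets of $X$. $\mathsf{bpt}(\mathcal L)$ is the bispace of biframe maps (bipoints) $\mathcal L\to(2,2,2)$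 with positive opens $\{f:f^+(a^+)=1\}$ ($a^+\in L^+$) and negative opens $\{f:f^-(a^-)=1\}$ ($a^-\in L^-$). $\mathsf{b}\Omega_{\mathsf{fin}}(X)=(\Omega^+(X),\Omega^-(X),\Omega_{\mathsf{fin}}(X))$, with $\Omega_{\mathsf{fin}}(X)$ the quotient of $\Omega^+(X)\oplus\Omega^-(X)$ by $\{(U^+\wedge U^-,V^+\vee V^-):U^+\cap U^-\subseteq V^+\cup V^-\}$. $X$ is bisober if the map $X\to\mathsf{bpt}(\mathsf{b}\Omega_{\mathsf{fin}}(X))$, $x\mapsto(N_x^+,N_x^-)$ with $N_x^{\pm}(U)=1$ iff $x\in U$, is a bihomeomorphism. *)

theory Defs
  imports "HOL-Algebra.Complete_Lattice" "HOL-Analysis.Abstract_Topology" "HOL-Library.FuncSet"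
begin

section \<open>Frames\<close>

locale frame = complete_lattice +
  assumes meet_sup_distrib:
    "\<lbrakk>x \<in> carrier L; A \<subseteq> carrier L\<rbrakk> \<Longrightarrow> x \<sqinter> \<Squnion>A = \<Squnion>((\<lambda>a. x \<sqinter> a) ` A)"

definition coframe :: "'a gorder \<Rightarrow> bool"
  where "coframe L \<longleftrightarrow> frame (inv_gorder L)"

text \<open>Maps are extensional, so that two frame maps are equal as soon as they agree on the carrier.
  The case \<open>A = {}\<close> of the condition on joins is preservation of the bottom element.\<close>

definition frame_maps :: "'a gorder \<Rightarrow> 'b gorder \<Rightarrow> ('a \<Rightarrow> 'b) set"
  where "frame_maps L M =
    {f \<in> carrier L \<rightarrow>\<^sub>E carrier M.
       (\<forall>A. A \<subseteq> carrier L \<longrightarrow> f (\<Squnion>\<^bsub>L\<^esub> A) = \<Squnion>\<^bsub>M\<^esub> (f ` A)) \<and>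
       f \<top>\<^bsub>L\<^esub> = \<top>\<^bsub>M\<^esub> \<and>
       (\<forall>x\<in>carrier L. \<forall>y\<in>carrier L. f (x \<sqinter>\<^bsub>L\<^esub> y) = f x \<sqinter>\<^bsub>M\<^esub> f y)}"

definition frame_kernel :: "'a gorder \<Rightarrow> ('a \<Rightarrow> 'b) \<Rightarrow> ('a \<times> 'a) set"
  where "frame_kernel L f = {(x, y). x \<in> carrier L \<and> y \<in> carrier L \<and> f x = f y}"

definition subframe :: "'a gorder \<Rightarrow> 'a set \<Rightarrow> bool"
  where "subframe L S \<longleftrightarrow>
    S \<subseteq> carrier L \<and> (\<forall>A. A \<subseteq> S \<longrightarrow> \<Squnion>\<^bsub>L\<^esub> A \<in> S) \<and>
    \<top>\<^bsub>L\<^esub> \<in> S \<and> (\<forall>x\<in>S. \<forall>y\<in>S. x \<sqinter>\<^bsub>L\<^esub> y \<in> S)"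

definition generated_subframe :: "'a gorder \<Rightarrow> 'a set \<Rightarrow> 'a gorder"
  where "generated_subframe L G = L\<lparr>carrier := \<Inter>{S. subframe L S \<and> G \<subseteq> S}\<rparr>"

definition inclusion_order :: "'a set set \<Rightarrow> 'a set gorder"
  where "inclusion_order S = \<lparr>carrier = S, eq = (=), le = (\<subseteq>)\<rparr>"


section \<open>Congruences and quotients\<close>

definition frame_congruence :: "'a gorder \<Rightarrow> ('a \<times> 'a) set \<Rightarrow> bool"
  where "frame_congruence L C \<longleftrightarrow>
    equiv (carrier L) C \<and>
    (\<forall>B. B \<subseteq> C \<longrightarrow> (\<Squnion>\<^bsub>L\<^esub> (fst ` B), \<Squnion>\<^bsub>L\<^esub> (snd ` B)) \<in> C) \<and>
    (\<forall>(a, b)\<in>C. \<forall>(c, d)\<in>C. (a \<sqinter>\<^bsub>L\<^esub> c, b \<sqinter>\<^bsub>L\<^esub> d) \<in> C)"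

text \<open>A pair \<open>(a, b)\<close> of a relation stands for the inequality \<open>a \<le> b\<close>, that is for the
  identification of \<open>a \<sqinter> b\<close> with \<open>a\<close>. The quotient by the least congruence making
  these identifications is the universal one (\<open>quotient_universal\<close>).\<close>

definition generated_congruence :: "'a gorder \<Rightarrow> ('a \<times> 'a) set \<Rightarrow> ('a \<times> 'a) set"
  where "generated_congruence L R =
    \<Inter>{C. frame_congruence L C \<and> (\<forall>(a, b)\<in>R. (a \<sqinter>\<^bsub>L\<^esub> b, a) \<in> C)}"

definition quotient_frame :: "'a gorder \<Rightarrow> ('a \<times> 'a) set \<Rightarrow> 'a set gorder"
  where "quotient_frame L C =
    \<lparr>carrier = carrier L // C, eq = (=), le = (\<lambda>X Y. \<exists>x\<in>X. \<exists>y\<in>Y. x \<sqsubseteq>\<^bsub>L\<^esub> y)\<rparr>"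

definition quotient_map :: "'a gorder \<Rightarrow> ('a \<times> 'a) set \<Rightarrow> 'a \<Rightarrow> 'a set"
  where "quotient_map L C = (\<lambda>x\<in>carrier L. C `` {x})"

definition congruence_frame :: "'a gorder \<Rightarrow> ('a \<times> 'a) set gorder"
  where "congruence_frame L = inclusion_order {C. frame_congruence L C}"

definition nabla :: "'a gorder \<Rightarrow> 'a \<Rightarrow> ('a \<times> 'a) set"
  where "nabla L a = {(x, y). x \<in> carrier L \<and> y \<in> carrier L \<and> x \<squnion>\<^bsub>L\<^esub> a = y \<squnion>\<^bsub>L\<^esub> a}"

definition delta :: "'a gorder \<Rightarrow> 'a \<Rightarrow> ('a \<times> 'a) set"
  where "delta L a = {(x, y). x \<in> carrier L \<and> y \<in> carrier L \<and> x \<sqinter>\<^bsub>L\<^esub> a = y \<sqinter>\<^bsub>L\<^esub> a}"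


section \<open>Coproducts of two frames\<close>

text \<open>The coproduct is realised as usual by the down-sets of the product order that are closed under
  all joins, including the empty one, in each coordinate separately
  (\<open>coproduct_universal\<close>).\<close>

definition coproduct_ideal :: "'p gorder \<Rightarrow> 'n gorder \<Rightarrow> ('p \<times> 'n) set \<Rightarrow> bool"
  where "coproduct_ideal P N D \<longleftrightarrow>
    D \<subseteq> carrier P \<times> carrier N \<and>
    (\<forall>(a, b)\<in>D. \<forall>a'\<in>carrier P. \<forall>b'\<in>carrier N. a' \<sqsubseteq>\<^bsub>P\<^esub> a \<and> b' \<sqsubseteq>\<^bsub>N\<^esub> b \<longrightarrow> (a', b') \<in> D) \<and>
    (\<forall>A. \<forall>b\<in>carrier N. A \<subseteq> carrier P \<and> A \<times> {b} \<subseteq> D \<longrightarrow> (\<Squnion>\<^bsub>P\<^esub> A, b) \<in> D) \<and>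
    (\<forall>a\<in>carrier P. \<forall>B. B \<subseteq> carrier N \<and> {a} \<times> B \<subseteq> D \<longrightarrow> (a, \<Squnion>\<^bsub>N\<^esub> B) \<in> D)"

definition coproduct_frame :: "'p gorder \<Rightarrow> 'n gorder \<Rightarrow> ('p \<times> 'n) set gorder"
  where "coproduct_frame P N = inclusion_order {D. coproduct_ideal P N D}"

definition coproduct_inl :: "'p gorder \<Rightarrow> 'n gorder \<Rightarrow> 'p \<Rightarrow> ('p \<times> 'n) set"
  where "coproduct_inl P N =
    (\<lambda>x\<in>carrier P. {(a, b) \<in> carrier P \<times> carrier N. a \<sqsubseteq>\<^bsub>P\<^esub> x \<or> b = \<bottom>\<^bsub>N\<^esub>})"

definition coproduct_inr :: "'p gorder \<Rightarrow> 'n gorder \<Rightarrow> 'n \<Rightarrow> ('p \<times> 'n) set"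
  where "coproduct_inr P N =
    (\<lambda>y\<in>carrier N. {(a, b) \<in> carrier P \<times> carrier N. b \<sqsubseteq>\<^bsub>N\<^esub> y \<or> a = \<bottom>\<^bsub>P\<^esub>})"

definition copairing ::
  "'p gorder \<Rightarrow> 'n gorder \<Rightarrow> 'a gorder \<Rightarrow> ('p \<Rightarrow> 'a) \<Rightarrow> ('n \<Rightarrow> 'a) \<Rightarrow> ('p \<times> 'n) set \<Rightarrow> 'a"
  where "copairing P N M f g =
    (\<lambda>D\<in>carrier (coproduct_frame P N). \<Squnion>\<^bsub>M\<^esub> ((\<lambda>(a, b). f a \<sqinter>\<^bsub>M\<^esub> g b) ` D))"


section \<open>Biframes\<close>

record ('p, 'n, 'a) biframe =
  pos_part :: "'p gorder"
  neg_part :: "'n gorder"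
  main_part :: "'a gorder"
  emb_pos :: "'p \<Rightarrow> 'a"
  emb_neg :: "'n \<Rightarrow> 'a"

definition rectangles :: "('p, 'n, 'a) biframe \<Rightarrow> 'a set"
  where "rectangles L =
    {emb_pos L x \<sqinter>\<^bsub>main_part L\<^esub> emb_neg L y | x y.
       x \<in> carrier (pos_part L) \<and> y \<in> carrier (neg_part L)}"

definition biframe :: "('p, 'n, 'a) biframe \<Rightarrow> bool"
  where "biframe L \<longleftrightarrow>
    frame (pos_part L) \<and> frame (neg_part L) \<and> frame (main_part L) \<and>
    emb_pos L \<in> frame_maps (pos_part L) (main_part L) \<and>
    emb_neg L \<in> frame_maps (neg_part L) (main_part L) \<and>
    inj_on (emb_pos L) (carrier (pos_part L)) \<and>
    inj_on (emb_neg L) (carrier (neg_part L)) \<and>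
    (\<forall>x\<in>carrier (main_part L). \<exists>A. A \<subseteq> rectangles L \<and> x = \<Squnion>\<^bsub>main_part L\<^esub> A)"

definition biframe_maps ::
  "('p, 'n, 'a) biframe \<Rightarrow> ('q, 'm, 'b) biframe \<Rightarrow> (('p \<Rightarrow> 'q) \<times> ('n \<Rightarrow> 'm)) set"
  where "biframe_maps L M =
    {(fp, fn).
       fp \<in> frame_maps (pos_part L) (pos_part M) \<and>
       fn \<in> frame_maps (neg_part L) (neg_part M) \<and>
       (\<exists>f \<in> frame_maps (main_part L) (main_part M).
          (\<forall>x\<in>carrier (pos_part L). f (emb_pos L x) = emb_pos M (fp x)) \<and>
          (\<forall>y\<in>carrier (neg_part L). f (emb_neg L y) = emb_neg M (fn y)))}"

definition biframe_comp ::
  "('p, 'n, 'a) biframe \<Rightarrow> ('q \<Rightarrow> 'r) \<times> ('m \<Rightarrow> 'k) \<Rightarrow> ('p \<Rightarrow> 'q) \<times> ('n \<Rightarrow> 'm)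
    \<Rightarrow> ('p \<Rightarrow> 'r) \<times> ('n \<Rightarrow> 'k)"
  where "biframe_comp L g f =
    (compose (carrier (pos_part L)) (fst g) (fst f), compose (carrier (neg_part L)) (snd g) (snd f))"

definition bicomplementary :: "('p, 'n, 'a) biframe \<Rightarrow> 'p \<Rightarrow> 'n \<Rightarrow> bool"
  where "bicomplementary L x y \<longleftrightarrow>
    x \<in> carrier (pos_part L) \<and> y \<in> carrier (neg_part L) \<and>
    emb_pos L x \<sqinter>\<^bsub>main_part L\<^esub> emb_neg L y = \<bottom>\<^bsub>main_part L\<^esub> \<and>
    emb_pos L x \<squnion>\<^bsub>main_part L\<^esub> emb_neg L y = \<top>\<^bsub>main_part L\<^esub>"

definition has_bicomplement_pos :: "('p, 'n, 'a) biframe \<Rightarrow> 'p \<Rightarrow> bool"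
  where "has_bicomplement_pos L x \<longleftrightarrow> (\<exists>y. bicomplementary L x y)"

definition has_bicomplement_neg :: "('p, 'n, 'a) biframe \<Rightarrow> 'n \<Rightarrow> bool"
  where "has_bicomplement_neg L y \<longleftrightarrow> (\<exists>x. bicomplementary L x y)"


section \<open>Finitary biframes and biquotients\<close>

definition fin_elements :: "('p, 'n, 'a) biframe \<Rightarrow> 'a set"
  where "fin_elements L = {\<Squnion>\<^bsub>main_part L\<^esub> A | A. finite A \<and> A \<subseteq> rectangles L}"

definition finitary_congruence :: "('p, 'n, 'a) biframe \<Rightarrow> ('a \<times> 'a) set \<Rightarrow> bool"
  where "finitary_congruence L C \<longleftrightarrow>
    (\<exists>R. R \<subseteq> fin_elements L \<times> fin_elements L \<and> C = generated_congruence (main_part L) R)"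

definition coproduct_biframe :: "'p gorder \<Rightarrow> 'n gorder \<Rightarrow> ('p, 'n, ('p \<times> 'n) set) biframe"
  where "coproduct_biframe P N =
    \<lparr>pos_part = P, neg_part = N, main_part = coproduct_frame P N,
     emb_pos = coproduct_inl P N, emb_neg = coproduct_inr P N\<rparr>"

definition coproduct_kernel :: "('p, 'n, 'a) biframe \<Rightarrow> (('p \<times> 'n) set \<times> ('p \<times> 'n) set) set"
  where "coproduct_kernel L =
    frame_kernel (coproduct_frame (pos_part L) (neg_part L))
      (copairing (pos_part L) (neg_part L) (main_part L) (emb_pos L) (emb_neg L))"

definition finitary_biframe :: "('p, 'n, 'a) biframe \<Rightarrow> bool"
  where "finitary_biframe L \<longleftrightarrow>
    biframe L \<and>
    finitary_congruence (coproduct_biframe (pos_part L) (neg_part L)) (coproduct_kernel L)"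

definition congruence_restriction :: "'p gorder \<Rightarrow> ('p \<Rightarrow> 'a) \<Rightarrow> ('a \<times> 'a) set \<Rightarrow> ('p \<times> 'p) set"
  where "congruence_restriction P e C =
    {(x, y). x \<in> carrier P \<and> y \<in> carrier P \<and> (e x, e y) \<in> C}"

definition quotient_biframe ::
  "('p, 'n, 'a) biframe \<Rightarrow> ('a \<times> 'a) set \<Rightarrow> ('p set, 'n set, 'a set) biframe"
  where "quotient_biframe L C =
    (let P = quotient_frame (pos_part L) (congruence_restriction (pos_part L) (emb_pos L) C);
         N = quotient_frame (neg_part L) (congruence_restriction (neg_part L) (emb_neg L) C)
     in \<lparr>pos_part = P, neg_part = N, main_part = quotient_frame (main_part L) C,
         emb_pos = (\<lambda>X\<in>carrier P. C `` (emb_pos L ` X)),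
         emb_neg = (\<lambda>Y\<in>carrier N. C `` (emb_neg L ` Y))\<rparr>)"

text \<open>The congruence \<open>C\<close> is determined by the carrier of the main component of
  \<open>quotient_biframe L C\<close>, so the existential quantifier in the order is harmless.\<close>

definition biquotients :: "('p, 'n, 'a) biframe \<Rightarrow> ('p set, 'n set, 'a set) biframe gorder"
  where "biquotients L =
    \<lparr>carrier = {quotient_biframe L C | C. finitary_congruence L C},
     eq = (=),
     le = (\<lambda>X Y. \<exists>C D. finitary_congruence L C \<and> finitary_congruence L D \<and>
            X = quotient_biframe L C \<and> Y = quotient_biframe L D \<and> D \<subseteq> C)\<rparr>"

definition anti_isomorphic :: "'a gorder \<Rightarrow> 'b gorder \<Rightarrow> bool"
  where "anti_isomorphic A B \<longleftrightarrow>
    (\<exists>\<phi>. bij_betw \<phi> (carrier A) (carrier B) \<and> order_emb A (inv_gorder B) \<phi>)"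


section \<open>The assembly\<close>

definition assembly ::
  "('p, 'n, 'a) biframe \<Rightarrow> (('a \<times> 'a) set, ('a \<times> 'a) set, ('a \<times> 'a) set) biframe"
  where "assembly L =
    (let M = main_part L;
         Lp = emb_pos L ` carrier (pos_part L);
         Ln = emb_neg L ` carrier (neg_part L);
         P = generated_subframe (congruence_frame M) (nabla M ` Lp \<union> delta M ` Ln);
         N = generated_subframe (congruence_frame M) (nabla M ` Ln \<union> delta M ` Lp);
         A = generated_subframe (congruence_frame M)
               (nabla M ` carrier M \<union> delta M ` fin_elements L)
     in \<lparr>pos_part = P, neg_part = N, main_part = A,
         emb_pos = (\<lambda>C\<in>carrier P. C), emb_neg = (\<lambda>C\<in>carrier N. C)\<rparr>)"

definition nabla_map ::
  "('p, 'n, 'a) biframe \<Rightarrow> ('p \<Rightarrow> ('a \<times> 'a) set) \<times> ('n \<Rightarrow> ('a \<times> 'a) set)"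
  where "nabla_map L =
    ((\<lambda>x\<in>carrier (pos_part L). nabla (main_part L) (emb_pos L x)),
     (\<lambda>y\<in>carrier (neg_part L). nabla (main_part L) (emb_neg L y)))"


section \<open>Bispaces\<close>

text \<open>Only pairs of topologies with the same \<^const>\<open>topspace\<close> are bispaces.\<close>

type_synonym 'x bispace = "'x topology \<times> 'x topology"

definition bispace :: "'x bispace \<Rightarrow> bool"
  where "bispace X \<longleftrightarrow> topspace (fst X) = topspace (snd X)"

definition points :: "'x bispace \<Rightarrow> 'x set"
  where "points X = topspace (fst X)"

definition patch :: "'x bispace \<Rightarrow> 'x topology"
  where "patch X = topology_generated_by ({U. openin (fst X) U} \<union> {U. openin (snd X) U})"

definition bihomeomorphism :: "'x bispace \<Rightarrow> 'y bispace \<Rightarrow> ('x \<Rightarrow> 'y) \<Rightarrow> bool"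
  where "bihomeomorphism X Y f \<longleftrightarrow>
    bij_betw f (points X) (points Y) \<and>
    homeomorphic_map (fst X) (fst Y) f \<and> homeomorphic_map (snd X) (snd Y) f"

definition bisubspace :: "'x bispace \<Rightarrow> 'x set \<Rightarrow> 'x bispace"
  where "bisubspace X S = (subtopology (fst X) S, subtopology (snd X) S)"

definition skula :: "'x bispace \<Rightarrow> 'x bispace"
  where "skula X =
    (topology_generated_by ({U. openin (fst X) U} \<union> {K. closedin (snd X) K}),
     topology_generated_by ({U. openin (snd X) U} \<union> {K. closedin (fst X) K}))"

definition two_frame :: "bool gorder"
  where "two_frame = \<lparr>carrier = UNIV, eq = (=), le = (\<le>)\<rparr>"

definition two_biframe :: "(bool, bool, bool) biframe"
  where "two_biframe =
    \<lparr>pos_part = two_frame, neg_part = two_frame, main_part = two_frame,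
     emb_pos = id, emb_neg = id\<rparr>"

definition bipoints :: "('p, 'n, 'a) biframe \<Rightarrow> (('p \<Rightarrow> bool) \<times> ('n \<Rightarrow> bool)) set"
  where "bipoints L = biframe_maps L two_biframe"

definition bpt :: "('p, 'n, 'a) biframe \<Rightarrow> (('p \<Rightarrow> bool) \<times> ('n \<Rightarrow> bool)) bispace"
  where "bpt L =
    (topology (\<lambda>U. \<exists>a\<in>carrier (pos_part L). U = {f \<in> bipoints L. fst f a}),
     topology (\<lambda>U. \<exists>a\<in>carrier (neg_part L). U = {f \<in> bipoints L. snd f a}))"

definition opens_frame :: "'x topology \<Rightarrow> 'x set gorder"
  where "opens_frame T = inclusion_order {U. openin T U}"

definition opens_biframe ::
  "'x bispace \<Rightarrow> ('x set, 'x set, ('x set \<times> 'x set) set set) biframe"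
  where "opens_biframe X =
    (let P = opens_frame (fst X);
         N = opens_frame (snd X);
         K = coproduct_frame P N;
         i = coproduct_inl P N;
         j = coproduct_inr P N;
         C = generated_congruence K
               {(i U \<sqinter>\<^bsub>K\<^esub> j U', i V \<squnion>\<^bsub>K\<^esub> j V') | U U' V V'.
                  openin (fst X) U \<and> openin (snd X) U' \<and> openin (fst X) V \<and> openin (snd X) V' \<and>
                  U \<inter> U' \<subseteq> V \<union> V'}
     in \<lparr>pos_part = P, neg_part = N, main_part = quotient_frame K C,
         emb_pos = compose (carrier P) (quotient_map K C) i,
         emb_neg = compose (carrier N) (quotient_map K C) j\<rparr>)"

definition neighbourhood_bipoint :: "'x bispace \<Rightarrow> 'x \<Rightarrow> ('x set \<Rightarrow> bool) \<times> ('x set \<Rightarrow> bool)"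
  where "neighbourhood_bipoint X x =
    ((\<lambda>U\<in>{U. openin (fst X) U}. x \<in> U), (\<lambda>U\<in>{U. openin (snd X) U}. x \<in> U))"

definition bisober :: "'x bispace \<Rightarrow> bool"
  where "bisober X \<longleftrightarrow>
    bihomeomorphism X (bpt (opens_biframe X)) (neighbourhood_bipoint X)"

definition alpha ::
  "('p, 'n, 'a) biframe \<Rightarrow> ('p \<Rightarrow> bool) \<times> ('n \<Rightarrow> bool)
    \<Rightarrow> (('a \<times> 'a) set \<Rightarrow> bool) \<times> (('a \<times> 'a) set \<Rightarrow> bool)"
  where "alpha L f = (THE g. g \<in> bipoints (assembly L) \<and> biframe_comp L g (nabla_map L) = f)"


section \<open>Universal properties of the constructions\<close>

lemma complete_sup_eqI:
  fixes L (structure)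
  assumes "complete_lattice L" "A \<subseteq> carrier L" "x \<in> carrier L" "\<And>a. a \<in> A \<Longrightarrow> a \<sqsubseteq> x"
    "\<And>y. \<lbrakk>y \<in> carrier L; \<And>a. a \<in> A \<Longrightarrow> a \<sqsubseteq> y\<rbrakk> \<Longrightarrow> x \<sqsubseteq> y"
  shows "\<Squnion>A = x"
proof -
  interpret complete_lattice L by fact
  show ?thesis
    by (rule le_antisym) (use assms in \<open>auto intro!: sup_least simp: sup_upper\<close>)
qed

lemma complete_meet_eqI:
  fixes L (structure)
  assumes "complete_lattice L" "a \<in> carrier L" "b \<in> carrier L" "x \<in> carrier L" "x \<sqsubseteq> a" "x \<sqsubseteq> b"
    "\<And>y. \<lbrakk>y \<in> carrier L; y \<sqsubseteq> a; y \<sqsubseteq> b\<rbrakk> \<Longrightarrow> y \<sqsubseteq> x"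
  shows "a \<sqinter> b = x"
proof -
  interpret complete_lattice L by fact
  show ?thesis
    by (rule le_antisym) (use assms in \<open>auto simp: meet_le meet_left meet_right\<close>)
qed

lemma complete_top_eqI:
  fixes L (structure)
  assumes "complete_lattice L" "x \<in> carrier L" "\<And>y. y \<in> carrier L \<Longrightarrow> y \<sqsubseteq> x"
  shows "\<top> = x"
proof -
  interpret complete_lattice L by fact
  show ?thesis
    by (rule le_antisym) (use assms in auto)
qed

lemma frame_mapsD:
  assumes "f \<in> frame_maps L M"
  shows "f \<in> carrier L \<rightarrow>\<^sub>E carrier M" "x \<in> carrier L \<Longrightarrow> f x \<in> carrier M"
    "A \<subseteq> carrier L \<Longrightarrow> f (\<Squnion>\<^bsub>L\<^esub> A) = \<Squnion>\<^bsub>M\<^esub> (f ` A)" "f \<top>\<^bsub>L\<^esub> = \<top>\<^bsub>M\<^esub>"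
    "x \<in> carrier L \<Longrightarrow> y \<in> carrier L \<Longrightarrow> f (x \<sqinter>\<^bsub>L\<^esub> y) = f x \<sqinter>\<^bsub>M\<^esub> f y"
  using assms unfolding frame_maps_def by auto

lemma frame_maps_mono:
  assumes "complete_lattice L" "complete_lattice M" "f \<in> frame_maps L M"
    "x \<in> carrier L" "y \<in> carrier L" "x \<sqsubseteq>\<^bsub>L\<^esub> y"
  shows "f x \<sqsubseteq>\<^bsub>M\<^esub> f y"
proof -
  interpret L: complete_lattice L by fact
  interpret M: complete_lattice M by fact
  have "x \<sqinter>\<^bsub>L\<^esub> y = x"
    using assms by (intro complete_meet_eqI) auto
  then have "f x = f x \<sqinter>\<^bsub>M\<^esub> f y" using frame_mapsD(5)[OF assms(3-5)] by simp
  then show ?thesis using M.meet_right assms frame_mapsD(2) by metis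
qed

lemma inclusion_order_simps [simp]:
  "carrier (inclusion_order S) = S"
  "eq (inclusion_order S) = (=)"
  "le (inclusion_order S) = (\<subseteq>)"
  by (simp_all add: inclusion_order_def)

lemma inclusion_order_complete:
  assumes "T \<in> S" and "\<And>X. X \<in> S \<Longrightarrow> X \<subseteq> T" and Inter: "\<And>A. A \<subseteq> S \<Longrightarrow> A \<noteq> {} \<Longrightarrow> \<Inter>A \<in> S"
  shows "complete_lattice (inclusion_order S)"
proof -
  interpret partial_order "inclusion_order S"
    by unfold_locales (auto simp: inclusion_order_def)
  show ?thesis
  proof (rule complete_lattice_criterion1)
    show "\<exists>g. greatest (inclusion_order S) g (carrier (inclusion_order S))"
      using assms by (auto simp: greatest_def)
    show "\<exists>i. greatest (inclusion_order S) i (Lower (inclusion_order S) A)"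
      if "A \<subseteq> carrier (inclusion_order S)" "A \<noteq> {}" for A
      using Inter[of A] that
      by (intro exI[of _ "\<Inter>A"] greatest_LowerI) (auto simp: Lower_def)
  qed
qed


subsection \<open>Quotients\<close>

lemma quotient_frame_simps [simp]:
  "carrier (quotient_frame L C) = carrier L // C"
  "eq (quotient_frame L C) = (=)"
  "le (quotient_frame L C) = (\<lambda>X Y. \<exists>x\<in>X. \<exists>y\<in>Y. x \<sqsubseteq>\<^bsub>L\<^esub> y)"
  by (simp_all add: quotient_frame_def)

context
  fixes L :: "'a gorder" and C
  assumes L: "frame L" and C: "frame_congruence L C"
begin

interpretation L: frame L by (rule L)

lemma cong_equiv: "equiv (carrier L) C"
  using C by (simp add: frame_congruence_def)

lemma cong_closed: "(a, b) \<in> C \<Longrightarrow> a \<in> carrier L" "(a, b) \<in> C \<Longrightarrow> b \<in> carrier L"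
  using cong_equiv by (auto simp: equiv_def)

lemma cong_refl: "a \<in> carrier L \<Longrightarrow> (a, a) \<in> C"
  using cong_equiv by (auto simp: equiv_def refl_on_def)

lemma cong_sym: "(a, b) \<in> C \<Longrightarrow> (b, a) \<in> C"
  using cong_equiv unfolding equiv_def by (blast dest: symD)

lemma cong_trans: "(a, b) \<in> C \<Longrightarrow> (b, c) \<in> C \<Longrightarrow> (a, c) \<in> C"
  using cong_equiv unfolding equiv_def by (blast dest: transD)

lemma cong_meet: "(a, b) \<in> C \<Longrightarrow> (c, d) \<in> C \<Longrightarrow> (a \<sqinter>\<^bsub>L\<^esub> c, b \<sqinter>\<^bsub>L\<^esub> d) \<in> C"
  using bspec[OF bspec[OF C[unfolded frame_congruence_def, THEN conjunct2, THEN conjunct2], of "(a, b)", simplified], of "(c, d)"]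
  by simp

lemma cong_sup:
  assumes "\<And>i. i \<in> I \<Longrightarrow> (u i, v i) \<in> C"
  shows "(\<Squnion>\<^bsub>L\<^esub> (u ` I), \<Squnion>\<^bsub>L\<^esub> (v ` I)) \<in> C"
proof -
  have "(\<Squnion>\<^bsub>L\<^esub> (fst ` (\<lambda>i. (u i, v i)) ` I), \<Squnion>\<^bsub>L\<^esub> (snd ` (\<lambda>i. (u i, v i)) ` I)) \<in> C"
    by (rule C[unfolded frame_congruence_def, THEN conjunct2, THEN conjunct1, rule_format])
      (use assms in blast)
  then show ?thesis by (simp add: image_image)
qed

lemma quotient_class_eq_iff:
  "a \<in> carrier L \<Longrightarrow> b \<in> carrier L \<Longrightarrow> C `` {a} = C `` {b} \<longleftrightarrow> (a, b) \<in> C"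
  by (rule eq_equiv_class_iff[OF cong_equiv])

lemma quotient_class_le_iff:
  assumes "a \<in> carrier L" "b \<in> carrier L"
  shows "C `` {a} \<sqsubseteq>\<^bsub>quotient_frame L C\<^esub> C `` {b} \<longleftrightarrow> (a \<sqinter>\<^bsub>L\<^esub> b, a) \<in> C"
proof
  assume "C `` {a} \<sqsubseteq>\<^bsub>quotient_frame L C\<^esub> C `` {b}"
  then obtain x y where xy: "(a, x) \<in> C" "(b, y) \<in> C" "x \<sqsubseteq>\<^bsub>L\<^esub> y" by auto
  then have "x \<sqinter>\<^bsub>L\<^esub> y = x"
    using cong_closed by (intro complete_meet_eqI L.complete_lattice_axioms) auto
  then have "(a \<sqinter>\<^bsub>L\<^esub> b, x) \<in> C" using cong_meet[OF xy(1,2)] by simp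
  then show "(a \<sqinter>\<^bsub>L\<^esub> b, a) \<in> C" using cong_sym[OF xy(1)] cong_trans by blast
next
  assume "(a \<sqinter>\<^bsub>L\<^esub> b, a) \<in> C"
  then have "a \<sqinter>\<^bsub>L\<^esub> b \<in> C `` {a}" "b \<in> C `` {b}" "a \<sqinter>\<^bsub>L\<^esub> b \<sqsubseteq>\<^bsub>L\<^esub> b"
    using cong_sym cong_refl assms L.meet_right by auto
  then show "C `` {a} \<sqsubseteq>\<^bsub>quotient_frame L C\<^esub> C `` {b}" by auto
qed

lemma quotient_carrierE:
  assumes "X \<in> carrier (quotient_frame L C)"
  obtains a where "a \<in> carrier L" "X = C `` {a}"
  using assms by (auto elim: quotientE)

lemma quotient_class_closed: "a \<in> carrier L \<Longrightarrow> C `` {a} \<in> carrier (quotient_frame L C)"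
  by (auto intro: quotientI)

lemma frame_meet_idem: "a \<in> carrier L \<Longrightarrow> a \<sqinter>\<^bsub>L\<^esub> a = a"
  by (simp add: meet_def)

lemma quotient_class_mono: "a \<in> carrier L \<Longrightarrow> b \<in> carrier L \<Longrightarrow> a \<sqsubseteq>\<^bsub>L\<^esub> b \<Longrightarrow> C `` {a} \<sqsubseteq>\<^bsub>quotient_frame L C\<^esub> C `` {b}"
  using cong_refl by auto

lemma quotient_partial_order: "partial_order (quotient_frame L C)"
proof (unfold_locales; (elim quotient_carrierE)?)
  fix X Y Z x y z assume "X \<sqsubseteq>\<^bsub>quotient_frame L C\<^esub> Y" "Y \<sqsubseteq>\<^bsub>quotient_frame L C\<^esub> Z"
    "x \<in> carrier L" "X = C `` {x}" "y \<in> carrier L" "Y = C `` {y}" "z \<in> carrier L" "Z = C `` {z}"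
  then have c: "x \<in> carrier L" "y \<in> carrier L" "z \<in> carrier L"
    and xy: "(x \<sqinter>\<^bsub>L\<^esub> y, x) \<in> C" and yz: "(y \<sqinter>\<^bsub>L\<^esub> z, y) \<in> C"
    by (simp_all only: quotient_class_le_iff)
  have "(x \<sqinter>\<^bsub>L\<^esub> y \<sqinter>\<^bsub>L\<^esub> z, x \<sqinter>\<^bsub>L\<^esub> z) \<in> C" by (rule cong_meet[OF xy cong_refl[OF c(3)]])
  moreover have "(x \<sqinter>\<^bsub>L\<^esub> (y \<sqinter>\<^bsub>L\<^esub> z), x \<sqinter>\<^bsub>L\<^esub> y) \<in> C" by (rule cong_meet[OF cong_refl[OF c(1)] yz])
  moreover have "x \<sqinter>\<^bsub>L\<^esub> (y \<sqinter>\<^bsub>L\<^esub> z) = x \<sqinter>\<^bsub>L\<^esub> y \<sqinter>\<^bsub>L\<^esub> z" by (simp add: L.meet_assoc c)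
  ultimately have "(x \<sqinter>\<^bsub>L\<^esub> z, x) \<in> C" using xy cong_sym cong_trans by metis
  then show "X \<sqsubseteq>\<^bsub>quotient_frame L C\<^esub> Z"
    unfolding \<open>X = _\<close> \<open>Z = _\<close> using c by (simp only: quotient_class_le_iff)
next
  fix X x assume "x \<in> carrier L" "X = C `` {x}"
  then show "X \<sqsubseteq>\<^bsub>quotient_frame L C\<^esub> X" by (simp only: quotient_class_le_iff frame_meet_idem cong_refl)
next
  fix X Y x y assume "X \<sqsubseteq>\<^bsub>quotient_frame L C\<^esub> Y" "Y \<sqsubseteq>\<^bsub>quotient_frame L C\<^esub> X"
    "x \<in> carrier L" "X = C `` {x}" "y \<in> carrier L" "Y = C `` {y}"
  then have "(x \<sqinter>\<^bsub>L\<^esub> y, x) \<in> C" "(x \<sqinter>\<^bsub>L\<^esub> y, y) \<in> C"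
    by (simp_all only: quotient_class_le_iff meet_comm[of L y x])
  then have "(x, y) \<in> C" using cong_sym cong_trans by blast
  then show "X .=\<^bsub>quotient_frame L C\<^esub> Y"
    using \<open>X = _\<close> \<open>Y = _\<close> \<open>x \<in> _\<close> \<open>y \<in> _\<close> by (simp add: quotient_class_eq_iff)
qed auto

interpretation Q: partial_order "quotient_frame L C" by (rule quotient_partial_order)

lemma quotient_class_sup:
  assumes A: "A \<subseteq> carrier L"
  shows "is_lub (quotient_frame L C) (C `` {\<Squnion>\<^bsub>L\<^esub> A}) ((\<lambda>a. C `` {a}) ` A)"
proof (rule least_UpperI)
  have s: "\<Squnion>\<^bsub>L\<^esub> A \<in> carrier L" using A by simp
  show "(\<lambda>a. C `` {a}) ` A \<subseteq> carrier (quotient_frame L C)" using A quotient_class_closed by blast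
  show "C `` {\<Squnion>\<^bsub>L\<^esub> A} \<in> carrier (quotient_frame L C)" using s by (rule quotient_class_closed)
  show "X \<sqsubseteq>\<^bsub>quotient_frame L C\<^esub> C `` {\<Squnion>\<^bsub>L\<^esub> A}" if "X \<in> (\<lambda>a. C `` {a}) ` A" for X
  proof -
    obtain a where a: "a \<in> A" "X = C `` {a}" using \<open>X \<in> _\<close> by (elim imageE)
    show ?thesis
      unfolding a(2) by (rule quotient_class_mono[OF subsetD[OF A a(1)] s L.sup_upper[OF A a(1)]])
  qed
  fix Y assume Y: "Y \<in> Upper (quotient_frame L C) ((\<lambda>a. C `` {a}) ` A)"
  then have "Y \<in> carrier (quotient_frame L C)" by (rule subsetD[OF Upper_closed])
  then obtain y where y: "y \<in> carrier L" "Y = C `` {y}" by (rule quotient_carrierE)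
  have ay: "(y \<sqinter>\<^bsub>L\<^esub> a, a) \<in> C" if "a \<in> A" for a
  proof -
    have "a \<in> carrier L" using that A by blast
    moreover have "C `` {a} \<sqsubseteq>\<^bsub>quotient_frame L C\<^esub> Y"
      by (rule conjunct1[OF Upper_memD[OF Y imageI[OF that]]])
        (use A quotient_class_closed in \<open>auto simp del: quotient_frame_simps\<close>)
    ultimately show ?thesis using y by (simp only: quotient_class_le_iff meet_comm[of L y a])
  qed
  have "(\<Squnion>\<^bsub>L\<^esub> ((\<lambda>a. y \<sqinter>\<^bsub>L\<^esub> a) ` A), \<Squnion>\<^bsub>L\<^esub> ((\<lambda>a. a) ` A)) \<in> C"
    by (rule cong_sup) (rule ay)
  then have "(\<Squnion>\<^bsub>L\<^esub> A \<sqinter>\<^bsub>L\<^esub> y, \<Squnion>\<^bsub>L\<^esub> A) \<in> C"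
    unfolding L.meet_sup_distrib[OF y(1) A, symmetric] image_ident by (subst meet_comm)
  then show "C `` {\<Squnion>\<^bsub>L\<^esub> A} \<sqsubseteq>\<^bsub>quotient_frame L C\<^esub> Y"
    using y s by (simp only: quotient_class_le_iff)
qed

lemma quotient_set_as_image:
  assumes "A \<subseteq> carrier (quotient_frame L C)"
  obtains B where "B \<subseteq> carrier L" "A = (\<lambda>a. C `` {a}) ` B"
proof
  let ?B = "{a \<in> carrier L. C `` {a} \<in> A}"
  show "?B \<subseteq> carrier L" by blast
  show "A = (\<lambda>a. C `` {a}) ` ?B"
  proof
    show "A \<subseteq> (\<lambda>a. C `` {a}) ` ?B"
    proof
      fix X assume X: "X \<in> A"
      then obtain a where "a \<in> carrier L" "X = C `` {a}" using assms quotient_carrierE by blast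
      then show "X \<in> (\<lambda>a. C `` {a}) ` ?B" using X by blast
    qed
  qed blast
qed

lemma quotient_complete: "complete_lattice (quotient_frame L C)"
proof unfold_locales
  have *: "\<exists>s. is_lub (quotient_frame L C) s A" if A: "A \<subseteq> carrier (quotient_frame L C)" for A
  proof -
    obtain B where "B \<subseteq> carrier L" "A = (\<lambda>a. C `` {a}) ` B" using quotient_set_as_image[OF A] .
    then show ?thesis using quotient_class_sup by blast
  qed
  show "\<exists>s. is_lub (quotient_frame L C) s A" if "A \<subseteq> carrier (quotient_frame L C)" for A
    using that by (rule *)
  show "\<exists>s. is_glb (quotient_frame L C) s A" if A: "A \<subseteq> carrier (quotient_frame L C)" for A
  proof -
    obtain s where s: "is_lub (quotient_frame L C) s (Lower (quotient_frame L C) A)"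
      using *[OF Lower_closed] by blast
    have "is_glb (quotient_frame L C) s A"
    proof (rule greatest_LowerI)
      show "s \<in> carrier (quotient_frame L C)" using s by (rule least_closed)
      show "s \<sqsubseteq>\<^bsub>quotient_frame L C\<^esub> x" if x: "x \<in> A" for x
      proof (rule least_le[OF s])
        show "x \<in> Upper (quotient_frame L C) (Lower (quotient_frame L C) A)"
        proof (rule Upper_memI)
          fix y assume "y \<in> Lower (quotient_frame L C) A"
          from Lower_memD[OF this x A] show "y \<sqsubseteq>\<^bsub>quotient_frame L C\<^esub> x" by (rule conjunct1)
        qed (use A x in blast)
      qed
      show "y \<sqsubseteq>\<^bsub>quotient_frame L C\<^esub> s" if "y \<in> Lower (quotient_frame L C) A" for y
        using least_Upper_above[OF s that Lower_closed] .
    qed (rule A)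
    then show ?thesis by blast
  qed
qed

interpretation Q: complete_lattice "quotient_frame L C" by (rule quotient_complete)

lemma quotient_class_sup_eq:
  "A \<subseteq> carrier L \<Longrightarrow> \<Squnion>\<^bsub>quotient_frame L C\<^esub> ((\<lambda>a. C `` {a}) ` A) = C `` {\<Squnion>\<^bsub>L\<^esub> A}"
  by (rule Q.least_unique[OF Q.sup_lub quotient_class_sup])
    (auto intro: quotient_class_closed simp del: quotient_frame_simps)

lemma quotient_class_meet_eq:
  assumes "a \<in> carrier L" "b \<in> carrier L"
  shows "C `` {a} \<sqinter>\<^bsub>quotient_frame L C\<^esub> C `` {b} = C `` {a \<sqinter>\<^bsub>L\<^esub> b}"
proof (rule complete_meet_eqI[OF quotient_complete])
  show "C `` {a} \<in> carrier (quotient_frame L C)" "C `` {b} \<in> carrier (quotient_frame L C)"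
    "C `` {a \<sqinter>\<^bsub>L\<^esub> b} \<in> carrier (quotient_frame L C)"
    using assms by (auto intro!: quotient_class_closed simp del: quotient_frame_simps)
  show "C `` {a \<sqinter>\<^bsub>L\<^esub> b} \<sqsubseteq>\<^bsub>quotient_frame L C\<^esub> C `` {a}" "C `` {a \<sqinter>\<^bsub>L\<^esub> b} \<sqsubseteq>\<^bsub>quotient_frame L C\<^esub> C `` {b}"
    using assms by (auto intro!: quotient_class_mono L.meet_left L.meet_right simp del: quotient_frame_simps)
  fix Y assume "Y \<in> carrier (quotient_frame L C)" and le: "Y \<sqsubseteq>\<^bsub>quotient_frame L C\<^esub> C `` {a}" "Y \<sqsubseteq>\<^bsub>quotient_frame L C\<^esub> C `` {b}"
  then obtain y where y: "y \<in> carrier L" "Y = C `` {y}" by (elim quotient_carrierE)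
  have ya: "(y \<sqinter>\<^bsub>L\<^esub> a, y) \<in> C" and yb: "(y \<sqinter>\<^bsub>L\<^esub> b, y) \<in> C"
    using le assms y by (simp_all only: quotient_class_le_iff)
  have "(y \<sqinter>\<^bsub>L\<^esub> a \<sqinter>\<^bsub>L\<^esub> b, y \<sqinter>\<^bsub>L\<^esub> b) \<in> C" by (rule cong_meet[OF ya cong_refl[OF assms(2)]])
  then have "(y \<sqinter>\<^bsub>L\<^esub> (a \<sqinter>\<^bsub>L\<^esub> b), y) \<in> C"
    using yb cong_trans assms y by (metis L.meet_assoc)
  then show "Y \<sqsubseteq>\<^bsub>quotient_frame L C\<^esub> C `` {a \<sqinter>\<^bsub>L\<^esub> b}"
    using assms y by (simp only: quotient_class_le_iff L.meet_closed)
qed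

lemma quotient_class_top_eq: "\<top>\<^bsub>quotient_frame L C\<^esub> = C `` {\<top>\<^bsub>L\<^esub>}"
proof (rule complete_top_eqI[OF quotient_complete quotient_class_closed[OF L.top_closed]])
  fix Y assume "Y \<in> carrier (quotient_frame L C)"
  then obtain y where y: "y \<in> carrier L" "Y = C `` {y}" by (elim quotient_carrierE)
  then show "Y \<sqsubseteq>\<^bsub>quotient_frame L C\<^esub> C `` {\<top>\<^bsub>L\<^esub>}"
    by (simp only: quotient_class_mono L.top_closed L.top_higher)
qed

lemma quotient_is_frame: "frame (quotient_frame L C)"
proof (intro frame.intro quotient_complete frame_axioms.intro)
  fix X A assume "X \<in> carrier (quotient_frame L C)" and A: "A \<subseteq> carrier (quotient_frame L C)"
  then obtain x where x: "x \<in> carrier L" "X = C `` {x}" by (elim quotient_carrierE)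
  obtain B where B: "B \<subseteq> carrier L" "A = (\<lambda>a. C `` {a}) ` B" using quotient_set_as_image[OF A] .
  have "X \<sqinter>\<^bsub>quotient_frame L C\<^esub> \<Squnion>\<^bsub>quotient_frame L C\<^esub> A = C `` {x \<sqinter>\<^bsub>L\<^esub> \<Squnion>\<^bsub>L\<^esub> B}"
    using x B by (simp only: quotient_class_sup_eq quotient_class_meet_eq L.sup_closed)
  also have "\<dots> = C `` {\<Squnion>\<^bsub>L\<^esub> ((\<lambda>b. x \<sqinter>\<^bsub>L\<^esub> b) ` B)}"
    by (simp only: L.meet_sup_distrib[OF x(1) B(1)])
  also have "\<dots> = \<Squnion>\<^bsub>quotient_frame L C\<^esub> ((\<lambda>a. C `` {a}) ` (\<lambda>b. x \<sqinter>\<^bsub>L\<^esub> b) ` B)"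
    by (rule quotient_class_sup_eq[symmetric]) (use x B in auto)
  also have "(\<lambda>a. C `` {a}) ` (\<lambda>b. x \<sqinter>\<^bsub>L\<^esub> b) ` B = (\<lambda>Y. X \<sqinter>\<^bsub>quotient_frame L C\<^esub> Y) ` A"
    unfolding B(2) image_image x(2)
  proof (rule image_cong[OF refl])
    fix b assume "b \<in> B"
    then have "b \<in> carrier L" using B by blast
    then show "C `` {x \<sqinter>\<^bsub>L\<^esub> b} = C `` {x} \<sqinter>\<^bsub>quotient_frame L C\<^esub> C `` {b}"
      using x by (simp only: quotient_class_meet_eq)
  qed
  finally show "X \<sqinter>\<^bsub>quotient_frame L C\<^esub> \<Squnion>\<^bsub>quotient_frame L C\<^esub> A =
    \<Squnion>\<^bsub>quotient_frame L C\<^esub> ((\<lambda>Y. X \<sqinter>\<^bsub>quotient_frame L C\<^esub> Y) ` A)" .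
qed

lemma quotient_map_eq: "a \<in> carrier L \<Longrightarrow> quotient_map L C a = C `` {a}"
  by (simp add: quotient_map_def)

lemma quotient_map_frame_map: "quotient_map L C \<in> frame_maps L (quotient_frame L C)"
  unfolding frame_maps_def mem_Collect_eq
proof (intro conjI allI ballI impI)
  show "quotient_map L C \<in> carrier L \<rightarrow>\<^sub>E carrier (quotient_frame L C)"
    by (intro PiE_I) (simp_all only: quotient_map_eq quotient_class_closed, simp add: quotient_map_def)
  show "quotient_map L C \<top>\<^bsub>L\<^esub> = \<top>\<^bsub>quotient_frame L C\<^esub>"
    by (simp only: quotient_map_eq quotient_class_top_eq L.top_closed)
  show "quotient_map L C (x \<sqinter>\<^bsub>L\<^esub> y) = quotient_map L C x \<sqinter>\<^bsub>quotient_frame L C\<^esub> quotient_map L C y"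
    if "x \<in> carrier L" "y \<in> carrier L" for x y
    using that by (simp only: quotient_map_eq quotient_class_meet_eq L.meet_closed)
  show "quotient_map L C (\<Squnion>\<^bsub>L\<^esub> A) = \<Squnion>\<^bsub>quotient_frame L C\<^esub> (quotient_map L C ` A)" if A: "A \<subseteq> carrier L" for A
  proof -
    have "quotient_map L C ` A = (\<lambda>a. C `` {a}) ` A"
      by (rule image_cong[OF refl]) (use A quotient_map_eq in blast)
    then show ?thesis using A by (simp only: quotient_map_eq quotient_class_sup_eq L.sup_closed)
  qed
qed

lemma quotient_map_kernel: "frame_kernel L (quotient_map L C) = C"
proof -
  have "(a, b) \<in> frame_kernel L (quotient_map L C) \<longleftrightarrow> (a, b) \<in> C" for a b
  proof (cases "a \<in> carrier L \<and> b \<in> carrier L")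
    case True
    then show ?thesis by (simp add: frame_kernel_def quotient_map_eq quotient_class_eq_iff)
  next
    case False
    then show ?thesis using cong_closed[of a b] by (auto simp: frame_kernel_def)
  qed
  then show ?thesis by auto
qed

end

lemma kernel_congruence:
  assumes L: "frame L" and M: "frame M" and h: "h \<in> frame_maps L M"
  shows "frame_congruence L (frame_kernel L h)"
proof -
  interpret L: frame L by (rule L)
  have "equiv (carrier L) (frame_kernel L h)"
    by (rule equivI) (auto simp: frame_kernel_def refl_on_def sym_def trans_def)
  moreover have "(\<Squnion>\<^bsub>L\<^esub> (fst ` B), \<Squnion>\<^bsub>L\<^esub> (snd ` B)) \<in> frame_kernel L h" if B: "B \<subseteq> frame_kernel L h" for B
  proof -
    have c: "fst ` B \<subseteq> carrier L" "snd ` B \<subseteq> carrier L" using B by (auto simp: frame_kernel_def)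
    have "h ` fst ` B = h ` snd ` B"
      unfolding image_image by (rule image_cong[OF refl]) (use B in \<open>auto simp: frame_kernel_def\<close>)
    then show ?thesis using c by (simp add: frame_kernel_def frame_mapsD(3)[OF h])
  qed
  moreover have "(a \<sqinter>\<^bsub>L\<^esub> c, b \<sqinter>\<^bsub>L\<^esub> d) \<in> frame_kernel L h"
    if "(a, b) \<in> frame_kernel L h" "(c, d) \<in> frame_kernel L h" for a b c d
    using that by (simp add: frame_kernel_def frame_mapsD(5)[OF h])
  ultimately show ?thesis unfolding frame_congruence_def by blast
qed

lemma generated_congruence_least:
  assumes "frame_congruence L C" "\<And>a b. (a, b) \<in> R \<Longrightarrow> (a \<sqinter>\<^bsub>L\<^esub> b, a) \<in> C"
  shows "generated_congruence L R \<subseteq> C"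
  unfolding generated_congruence_def using assms by blast

lemma total_congruence:
  assumes "frame L"
  shows "frame_congruence L (carrier L \<times> carrier L)"
proof -
  interpret frame L by fact
  have "(\<Squnion>\<^bsub>L\<^esub> (fst ` B), \<Squnion>\<^bsub>L\<^esub> (snd ` B)) \<in> carrier L \<times> carrier L" if "B \<subseteq> carrier L \<times> carrier L" for B
    using that by (intro SigmaI sup_closed) auto
  moreover have "equiv (carrier L) (carrier L \<times> carrier L)"
    by (rule equivI) (auto simp: refl_on_def sym_def trans_def)
  ultimately show ?thesis unfolding frame_congruence_def by auto
qed

lemma generated_congruence_congruence:
  assumes L: "frame L" and R: "R \<subseteq> carrier L \<times> carrier L"
  shows "frame_congruence L (generated_congruence L R)"
proof -
  interpret frame L by (rule L)
  let ?G = "generated_congruence L R"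
  have G: "p \<in> ?G \<longleftrightarrow> (\<forall>C. frame_congruence L C \<and> (\<forall>(a, b)\<in>R. (a \<sqinter>\<^bsub>L\<^esub> b, a) \<in> C) \<longrightarrow> p \<in> C)" for p
    by (simp add: generated_congruence_def)
  show ?thesis
    unfolding frame_congruence_def
  proof (intro conjI equivI)
    show "?G \<subseteq> carrier L \<times> carrier L"
      by (rule generated_congruence_least[OF total_congruence[OF L]]) (use R in auto)
    show "refl_on (carrier L) ?G"
      by (rule refl_onI) (simp add: G cong_refl[OF L])
    show "sym ?G"
      by (rule symI) (simp add: G cong_sym[OF L])
    show "trans ?G"
    proof (rule transI)
      fix x y z assume "(x, y) \<in> ?G" "(y, z) \<in> ?G"
      then show "(x, z) \<in> ?G" unfolding G using cong_trans[OF L, of _ x y z] by simp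
    qed
    show "\<forall>B. B \<subseteq> ?G \<longrightarrow> (\<Squnion>\<^bsub>L\<^esub> (fst ` B), \<Squnion>\<^bsub>L\<^esub> (snd ` B)) \<in> ?G"
    proof (intro allI impI)
      fix B assume B: "B \<subseteq> ?G"
      show "(\<Squnion>\<^bsub>L\<^esub> (fst ` B), \<Squnion>\<^bsub>L\<^esub> (snd ` B)) \<in> ?G"
        unfolding G
      proof (intro allI impI)
        fix C assume C: "frame_congruence L C \<and> (\<forall>(a, b)\<in>R. (a \<sqinter>\<^bsub>L\<^esub> b, a) \<in> C)"
        show "(\<Squnion>\<^bsub>L\<^esub> (fst ` B), \<Squnion>\<^bsub>L\<^esub> (snd ` B)) \<in> C"
        proof (rule cong_sup[OF L conjunct1[OF C]])
          fix p assume "p \<in> B"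
          then have "p \<in> ?G" using B by blast
          then show "(fst p, snd p) \<in> C" unfolding G using C by simp
        qed
      qed
    qed
    show "\<forall>(a, b)\<in>?G. \<forall>(c, d)\<in>?G. (a \<sqinter>\<^bsub>L\<^esub> c, b \<sqinter>\<^bsub>L\<^esub> d) \<in> ?G"
    proof (clarify)
      fix a b c d assume "(a, b) \<in> ?G" "(c, d) \<in> ?G"
      then show "(a \<sqinter>\<^bsub>L\<^esub> c, b \<sqinter>\<^bsub>L\<^esub> d) \<in> ?G" unfolding G using cong_meet[OF L, of _ a b c d] by simp
    qed
  qed
qed

lemma generated_congruence_contains:
  "(a, b) \<in> R \<Longrightarrow> (a \<sqinter>\<^bsub>L\<^esub> b, a) \<in> generated_congruence L R"
  unfolding generated_congruence_def by blast

theorem quotient_universal: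
  assumes L: "frame L" and R: "R \<subseteq> carrier L \<times> carrier L"
  defines "C \<equiv> generated_congruence L R"
  defines "q \<equiv> quotient_map L C"
  shows "frame (quotient_frame L C)"
    and "q \<in> frame_maps L (quotient_frame L C)"
    and "frame_kernel L q = C"
    and "(a, b) \<in> R \<Longrightarrow> q a \<sqsubseteq>\<^bsub>quotient_frame L C\<^esub> q b"
    and "\<lbrakk>frame M; h \<in> frame_maps L M; \<And>a b. (a, b) \<in> R \<Longrightarrow> h a \<sqsubseteq>\<^bsub>M\<^esub> h b\<rbrakk> \<Longrightarrow>
         \<exists>!k. k \<in> frame_maps (quotient_frame L C) M \<and> compose (carrier L) k q = h"
proof -
  interpret L: frame L by (rule L)
  have C: "frame_congruence L C"
    unfolding C_def by (rule generated_congruence_congruence[OF L R])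
  show "frame (quotient_frame L C)" by (rule quotient_is_frame[OF L C])
  show q: "q \<in> frame_maps L (quotient_frame L C)"
    unfolding q_def by (rule quotient_map_frame_map[OF L C])
  show "frame_kernel L q = C" unfolding q_def by (rule quotient_map_kernel[OF L C])
  show "q a \<sqsubseteq>\<^bsub>quotient_frame L C\<^esub> q b" if "(a, b) \<in> R"
  proof -
    have c: "a \<in> carrier L" "b \<in> carrier L" using R that by auto
    have "(a \<sqinter>\<^bsub>L\<^esub> b, a) \<in> C" unfolding C_def by (rule generated_congruence_contains[OF that])
    then show ?thesis
      unfolding q_def using c by (simp only: quotient_map_eq[OF L C] quotient_class_le_iff[OF L C])
  qed
  assume M: "frame M" and h: "h \<in> frame_maps L M" and hR: "\<And>a b. (a, b) \<in> R \<Longrightarrow> h a \<sqsubseteq>\<^bsub>M\<^esub> h b"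
  interpret M: frame M by (rule M)
  interpret Q: frame "quotient_frame L C" by (rule quotient_is_frame[OF L C])
  have "C \<subseteq> frame_kernel L h"
    unfolding C_def
  proof (rule generated_congruence_least[OF kernel_congruence[OF L M h]])
    fix a b assume ab: "(a, b) \<in> R"
    then have c: "a \<in> carrier L" "b \<in> carrier L" using R by auto
    have "h (a \<sqinter>\<^bsub>L\<^esub> b) = h a \<sqinter>\<^bsub>M\<^esub> h b" by (rule frame_mapsD(5)[OF h c])
    also have "\<dots> = h a"
      by (rule complete_meet_eqI[OF M.complete_lattice_axioms])
        (use hR[OF ab] frame_mapsD(2)[OF h c(1)] frame_mapsD(2)[OF h c(2)] in simp_all)
    finally show "(a \<sqinter>\<^bsub>L\<^esub> b, a) \<in> frame_kernel L h" using c by (simp add: frame_kernel_def)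
  qed
  then have hC: "h a = h b" if "(a, b) \<in> C" for a b using subsetD[OF \<open>C \<subseteq> _\<close> that] by (simp add: frame_kernel_def)
  define k where "k = (\<lambda>X\<in>carrier (quotient_frame L C). h (SOME a. a \<in> X))"
  have k: "k (C `` {a}) = h a" if a: "a \<in> carrier L" for a
  proof -
    have "a \<in> C `` {a}" using cong_refl[OF L C a] by simp
    then have "(SOME b. b \<in> C `` {a}) \<in> C `` {a}" by (rule someI)
    then have "h (SOME b. b \<in> C `` {a}) = h a" using hC[of a "SOME b. b \<in> C `` {a}"] by simp
    then show ?thesis unfolding k_def using quotient_class_closed[OF L C a] by simp
  qed
  have kq: "compose (carrier L) k q = h"
  proof
    fix x show "compose (carrier L) k q x = h x"
    proof (cases "x \<in> carrier L")
      case True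
      then show ?thesis by (simp add: compose_def q_def quotient_map_eq[OF L C] k)
    next
      case False
      then show ?thesis by (simp add: compose_def PiE_arb[OF frame_mapsD(1)[OF h] False])
    qed
  qed
  have kf: "k \<in> frame_maps (quotient_frame L C) M"
    unfolding frame_maps_def mem_Collect_eq
  proof (intro conjI allI ballI impI)
    show "k \<in> carrier (quotient_frame L C) \<rightarrow>\<^sub>E carrier M"
    proof (rule PiE_I)
      fix X assume "X \<in> carrier (quotient_frame L C)"
      then obtain x where "x \<in> carrier L" "X = C `` {x}" by (rule quotient_carrierE[OF L C])
      then show "k X \<in> carrier M" using k frame_mapsD(2)[OF h] by simp
    qed (simp add: k_def)
    show "k \<top>\<^bsub>quotient_frame L C\<^esub> = \<top>\<^bsub>M\<^esub>"
      by (simp only: quotient_class_top_eq[OF L C] k L.top_closed frame_mapsD(4)[OF h])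
    show "k (X \<sqinter>\<^bsub>quotient_frame L C\<^esub> Y) = k X \<sqinter>\<^bsub>M\<^esub> k Y"
      if X: "X \<in> carrier (quotient_frame L C)" and Y: "Y \<in> carrier (quotient_frame L C)" for X Y
    proof -
      obtain x where x: "x \<in> carrier L" "X = C `` {x}" using quotient_carrierE[OF L C X] .
      obtain y where y: "y \<in> carrier L" "Y = C `` {y}" using quotient_carrierE[OF L C Y] .
      show ?thesis
        unfolding x(2) y(2) using x(1) y(1)
        by (simp only: quotient_class_meet_eq[OF L C] k L.meet_closed frame_mapsD(5)[OF h])
    qed
    show "k (\<Squnion>\<^bsub>quotient_frame L C\<^esub> A) = \<Squnion>\<^bsub>M\<^esub> (k ` A)" if A: "A \<subseteq> carrier (quotient_frame L C)" for A
    proof -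
      obtain B where B: "B \<subseteq> carrier L" "A = (\<lambda>a. C `` {a}) ` B" using quotient_set_as_image[OF L C A] .
      have "k ` A = h ` B" unfolding B(2) image_image by (rule image_cong[OF refl]) (rule k[OF subsetD[OF B(1)]])
      then show ?thesis
        unfolding B(2) using B(1) by (simp only: quotient_class_sup_eq[OF L C] k L.sup_closed frame_mapsD(3)[OF h])
    qed
  qed
  have uniq: "k' = k"
    if k': "k' \<in> frame_maps (quotient_frame L C) M" "compose (carrier L) k' q = h" for k'
  proof (rule PiE_ext[OF frame_mapsD(1)[OF k'(1)] frame_mapsD(1)[OF kf]])
    fix X assume "X \<in> carrier (quotient_frame L C)"
    then obtain x where x: "x \<in> carrier L" "X = C `` {x}" by (rule quotient_carrierE[OF L C])
    have "k' X = h x"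
      using fun_cong[OF k'(2), of x] x by (simp add: compose_def q_def quotient_map_eq[OF L C])
    then show "k' X = k X" using k x by simp
  qed
  show "\<exists>!k. k \<in> frame_maps (quotient_frame L C) M \<and> compose (carrier L) k q = h"
  proof (rule ex1I[of _ k])
    show "k \<in> frame_maps (quotient_frame L C) M \<and> compose (carrier L) k q = h"
      using kf kq by (rule conjI)
    show "k' = k" if "k' \<in> frame_maps (quotient_frame L C) M \<and> compose (carrier L) k' q = h" for k'
      by (rule uniq[OF conjunct1[OF that] conjunct2[OF that]])
  qed
qed


subsection \<open>Coproducts\<close>

lemma coproduct_frame_simps [simp]:
  "carrier (coproduct_frame P N) = {D. coproduct_ideal P N D}"
  "le (coproduct_frame P N) = (\<subseteq>)"
  by (simp_all add: coproduct_frame_def)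

lemma coproduct_idealI:
  assumes "D \<subseteq> carrier P \<times> carrier N"
    "\<And>a b a' b'. \<lbrakk>(a, b) \<in> D; a' \<in> carrier P; b' \<in> carrier N; a' \<sqsubseteq>\<^bsub>P\<^esub> a; b' \<sqsubseteq>\<^bsub>N\<^esub> b\<rbrakk> \<Longrightarrow> (a', b') \<in> D"
    "\<And>A b. \<lbrakk>A \<subseteq> carrier P; b \<in> carrier N; \<And>a. a \<in> A \<Longrightarrow> (a, b) \<in> D\<rbrakk> \<Longrightarrow> (\<Squnion>\<^bsub>P\<^esub> A, b) \<in> D"
    "\<And>a B. \<lbrakk>B \<subseteq> carrier N; a \<in> carrier P; \<And>b. b \<in> B \<Longrightarrow> (a, b) \<in> D\<rbrakk> \<Longrightarrow> (a, \<Squnion>\<^bsub>N\<^esub> B) \<in> D"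
  shows "coproduct_ideal P N D"
  unfolding coproduct_ideal_def
  using assms(1)
  apply (intro conjI)
     apply blast
    apply (clarsimp; rule assms(2); blast)
   apply (clarsimp; rule assms(3); blast)
  apply (clarsimp; rule assms(4); blast)
  done

lemma coproduct_idealD:
  assumes "coproduct_ideal P N D"
  shows "D \<subseteq> carrier P \<times> carrier N" "(a, b) \<in> D \<Longrightarrow> a \<in> carrier P" "(a, b) \<in> D \<Longrightarrow> b \<in> carrier N"
    "\<lbrakk>(a, b) \<in> D; a' \<in> carrier P; b' \<in> carrier N; a' \<sqsubseteq>\<^bsub>P\<^esub> a; b' \<sqsubseteq>\<^bsub>N\<^esub> b\<rbrakk> \<Longrightarrow> (a', b') \<in> D"
    "\<lbrakk>A \<subseteq> carrier P; b \<in> carrier N; \<And>a. a \<in> A \<Longrightarrow> (a, b) \<in> D\<rbrakk> \<Longrightarrow> (\<Squnion>\<^bsub>P\<^esub> A, b) \<in> D"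
    "\<lbrakk>B \<subseteq> carrier N; a \<in> carrier P; \<And>b. b \<in> B \<Longrightarrow> (a, b) \<in> D\<rbrakk> \<Longrightarrow> (a, \<Squnion>\<^bsub>N\<^esub> B) \<in> D"
proof -
  note A = assms[unfolded coproduct_ideal_def]
  note A1 = A[THEN conjunct1] and A2 = A[THEN conjunct2, THEN conjunct1]
    and A3 = A[THEN conjunct2, THEN conjunct2, THEN conjunct1]
    and A4 = A[THEN conjunct2, THEN conjunct2, THEN conjunct2]
  show "D \<subseteq> carrier P \<times> carrier N" "(a, b) \<in> D \<Longrightarrow> a \<in> carrier P" "(a, b) \<in> D \<Longrightarrow> b \<in> carrier N"
    using A1 by blast+
  show "(a', b') \<in> D" if "(a, b) \<in> D" "a' \<in> carrier P" "b' \<in> carrier N" "a' \<sqsubseteq>\<^bsub>P\<^esub> a" "b' \<sqsubseteq>\<^bsub>N\<^esub> b"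
    using bspec[OF A2 that(1)] that(2-) by simp
  show "(\<Squnion>\<^bsub>P\<^esub> A, b) \<in> D" if "A \<subseteq> carrier P" "b \<in> carrier N" "\<And>a. a \<in> A \<Longrightarrow> (a, b) \<in> D"
    using A3[rule_format, of b A] that by blast
  show "(a, \<Squnion>\<^bsub>N\<^esub> B) \<in> D" if "B \<subseteq> carrier N" "a \<in> carrier P" "\<And>b. b \<in> B \<Longrightarrow> (a, b) \<in> D"
    using A4[rule_format, of a B] that by blast
qed

context
  fixes P :: "'p gorder" and N :: "'n gorder"
  assumes P: "frame P" and N: "frame N"
begin

interpretation P: frame P by (rule P)
interpretation N: frame N by (rule N)

lemma coproduct_complete: "complete_lattice (coproduct_frame P N)"
  unfolding coproduct_frame_def
proof (rule inclusion_order_complete[of "carrier P \<times> carrier N"])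
  show "carrier P \<times> carrier N \<in> {D. coproduct_ideal P N D}"
    by (auto intro!: coproduct_idealI)
  show "\<Inter>A \<in> {D. coproduct_ideal P N D}" if "A \<subseteq> {D. coproduct_ideal P N D}" "A \<noteq> {}" for A
  proof -
    have *: "coproduct_ideal P N D" if "D \<in> A" for D using that \<open>A \<subseteq> _\<close> by blast
    from \<open>A \<noteq> {}\<close> obtain D0 where D0: "D0 \<in> A" by blast
    have "coproduct_ideal P N (\<Inter>A)"
    proof (rule coproduct_idealI)
      show "\<Inter>A \<subseteq> carrier P \<times> carrier N" using coproduct_idealD(1)[OF *[OF D0]] D0 by blast
      show "(a', b') \<in> \<Inter>A" if "(a, b) \<in> \<Inter>A" "a' \<in> carrier P" "b' \<in> carrier N"
        "a' \<sqsubseteq>\<^bsub>P\<^esub> a" "b' \<sqsubseteq>\<^bsub>N\<^esub> b" for a b a' b'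
        using that coproduct_idealD(4)[OF *] by blast
      show "(\<Squnion>\<^bsub>P\<^esub> B, b) \<in> \<Inter>A" if "B \<subseteq> carrier P" "b \<in> carrier N"
        "\<And>a. a \<in> B \<Longrightarrow> (a, b) \<in> \<Inter>A" for B b
        using that coproduct_idealD(5)[OF *, of _ B b] by blast
      show "(a, \<Squnion>\<^bsub>N\<^esub> B) \<in> \<Inter>A" if "B \<subseteq> carrier N" "a \<in> carrier P"
        "\<And>b. b \<in> B \<Longrightarrow> (a, b) \<in> \<Inter>A" for B a
        using that coproduct_idealD(6)[OF *, of _ B a] by blast
    qed
    then show ?thesis by simp
  qed
qed (auto dest: coproduct_idealD)

interpretation K: complete_lattice "coproduct_frame P N" by (rule coproduct_complete)

lemma coproduct_Int: "coproduct_ideal P N D \<Longrightarrow> coproduct_ideal P N E \<Longrightarrow> coproduct_ideal P N (D \<inter> E)"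
  by (rule coproduct_idealI) (auto dest: coproduct_idealD(2,3) intro: coproduct_idealD(4-6))

lemma coproduct_meet: "coproduct_ideal P N D \<Longrightarrow> coproduct_ideal P N E \<Longrightarrow> D \<sqinter>\<^bsub>coproduct_frame P N\<^esub> E = D \<inter> E"
  by (rule complete_meet_eqI) (auto simp: coproduct_complete coproduct_Int)

lemma coproduct_pos_bot_le: "a \<in> carrier P \<Longrightarrow> a \<sqsubseteq>\<^bsub>P\<^esub> \<bottom>\<^bsub>P\<^esub> \<Longrightarrow> a = \<bottom>\<^bsub>P\<^esub>"
  by (simp add: P.le_antisym)
lemma coproduct_neg_bot_le: "a \<in> carrier N \<Longrightarrow> a \<sqsubseteq>\<^bsub>N\<^esub> \<bottom>\<^bsub>N\<^esub> \<Longrightarrow> a = \<bottom>\<^bsub>N\<^esub>"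
  by (simp add: N.le_antisym)

lemma coproduct_pos_sup_bot: "A \<subseteq> carrier P \<Longrightarrow> (\<And>a. a \<in> A \<Longrightarrow> a = \<bottom>\<^bsub>P\<^esub>) \<Longrightarrow> \<Squnion>\<^bsub>P\<^esub> A = \<bottom>\<^bsub>P\<^esub>"
  by (rule complete_sup_eqI) (auto simp: P.complete_lattice_axioms)
lemma coproduct_neg_sup_bot: "A \<subseteq> carrier N \<Longrightarrow> (\<And>a. a \<in> A \<Longrightarrow> a = \<bottom>\<^bsub>N\<^esub>) \<Longrightarrow> \<Squnion>\<^bsub>N\<^esub> A = \<bottom>\<^bsub>N\<^esub>"
  by (rule complete_sup_eqI) (auto simp: N.complete_lattice_axioms)

lemma coproduct_bot_mem:
  assumes "coproduct_ideal P N D"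
  shows "b \<in> carrier N \<Longrightarrow> (\<bottom>\<^bsub>P\<^esub>, b) \<in> D" "a \<in> carrier P \<Longrightarrow> (a, \<bottom>\<^bsub>N\<^esub>) \<in> D"
  using coproduct_idealD(5)[OF assms, of "{}" b] coproduct_idealD(6)[OF assms, of "{}" a]
    coproduct_pos_sup_bot[of "{}"] coproduct_neg_sup_bot[of "{}"] by auto

lemma coproduct_inl_ideal: "x \<in> carrier P \<Longrightarrow> coproduct_ideal P N (coproduct_inl P N x)"
  unfolding coproduct_inl_def
  apply simp
  apply (rule coproduct_idealI)
     apply auto[1]
    apply (auto intro: P.le_trans dest: coproduct_neg_bot_le)[1]
   apply (auto intro!: P.sup_least)[1]
  subgoal for a B by (auto intro!: coproduct_neg_sup_bot)
  done

lemma coproduct_inr_ideal: "y \<in> carrier N \<Longrightarrow> coproduct_ideal P N (coproduct_inr P N y)"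
  unfolding coproduct_inr_def
  apply simp
  apply (rule coproduct_idealI)
     apply auto[1]
    apply (auto intro: N.le_trans dest: coproduct_pos_bot_le)[1]
  subgoal for A b by (auto intro!: coproduct_pos_sup_bot)
  apply (auto intro!: N.sup_least)[1]
  done


lemma coproduct_inl_mem: "x \<in> carrier P \<Longrightarrow>
  (a, b) \<in> coproduct_inl P N x \<longleftrightarrow> a \<in> carrier P \<and> b \<in> carrier N \<and> (a \<sqsubseteq>\<^bsub>P\<^esub> x \<or> b = \<bottom>\<^bsub>N\<^esub>)"
  by (auto simp: coproduct_inl_def)

lemma coproduct_inr_mem: "y \<in> carrier N \<Longrightarrow>
  (a, b) \<in> coproduct_inr P N y \<longleftrightarrow> a \<in> carrier P \<and> b \<in> carrier N \<and> (b \<sqsubseteq>\<^bsub>N\<^esub> y \<or> a = \<bottom>\<^bsub>P\<^esub>)"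
  by (auto simp: coproduct_inr_def)

lemma coproduct_top: "\<top>\<^bsub>coproduct_frame P N\<^esub> = carrier P \<times> carrier N"
  by (rule complete_top_eqI[OF coproduct_complete]) (auto intro!: coproduct_idealI dest: coproduct_idealD)

lemma coproduct_inl_frame_map: "coproduct_inl P N \<in> frame_maps P (coproduct_frame P N)"
  unfolding frame_maps_def mem_Collect_eq
proof (intro conjI allI ballI impI)
  show "coproduct_inl P N \<in> carrier P \<rightarrow>\<^sub>E carrier (coproduct_frame P N)"
    by (intro PiE_I) (simp_all add: coproduct_inl_ideal, simp add: coproduct_inl_def)
  show "coproduct_inl P N \<top>\<^bsub>P\<^esub> = \<top>\<^bsub>coproduct_frame P N\<^esub>"
    by (auto simp: coproduct_top coproduct_inl_def)
  show "coproduct_inl P N (x \<sqinter>\<^bsub>P\<^esub> y) = coproduct_inl P N x \<sqinter>\<^bsub>coproduct_frame P N\<^esub> coproduct_inl P N y"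
    if "x \<in> carrier P" "y \<in> carrier P" for x y
  proof -
    have "coproduct_inl P N x \<sqinter>\<^bsub>coproduct_frame P N\<^esub> coproduct_inl P N y = coproduct_inl P N x \<inter> coproduct_inl P N y"
      by (rule coproduct_meet) (auto simp: coproduct_inl_ideal that)
    moreover have "a \<sqsubseteq>\<^bsub>P\<^esub> x \<sqinter>\<^bsub>P\<^esub> y \<longleftrightarrow> a \<sqsubseteq>\<^bsub>P\<^esub> x \<and> a \<sqsubseteq>\<^bsub>P\<^esub> y" if "a \<in> carrier P" for a
      using that \<open>x \<in> _\<close> \<open>y \<in> _\<close>
      by (meson P.le_trans P.meet_closed P.meet_le P.meet_left P.meet_right)
    ultimately show ?thesis using that
      by (auto simp: coproduct_inl_mem)
  qed
  show "coproduct_inl P N (\<Squnion>\<^bsub>P\<^esub> A) = \<Squnion>\<^bsub>coproduct_frame P N\<^esub> (coproduct_inl P N ` A)" if "A \<subseteq> carrier P" for A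
  proof (rule sym, rule complete_sup_eqI[OF coproduct_complete])
    show "coproduct_inl P N ` A \<subseteq> carrier (coproduct_frame P N)" using that by (auto simp: coproduct_inl_ideal)
    show "coproduct_inl P N (\<Squnion>\<^bsub>P\<^esub> A) \<in> carrier (coproduct_frame P N)" using that by (auto simp: coproduct_inl_ideal)
    show "D \<sqsubseteq>\<^bsub>coproduct_frame P N\<^esub> coproduct_inl P N (\<Squnion>\<^bsub>P\<^esub> A)" if D: "D \<in> coproduct_inl P N ` A" for D
    proof -
      obtain x where x: "x \<in> A" "D = coproduct_inl P N x" using D by blast
      then have "x \<in> carrier P" "x \<sqsubseteq>\<^bsub>P\<^esub> \<Squnion>\<^bsub>P\<^esub> A" using \<open>A \<subseteq> _\<close> P.sup_upper by auto
      then show ?thesis using x \<open>A \<subseteq> _\<close> P.le_trans P.sup_closed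
        by (auto simp: coproduct_inl_mem)
    qed
    show "coproduct_inl P N (\<Squnion>\<^bsub>P\<^esub> A) \<sqsubseteq>\<^bsub>coproduct_frame P N\<^esub> E" if "E \<in> carrier (coproduct_frame P N)" and
      E: "\<And>D. D \<in> coproduct_inl P N ` A \<Longrightarrow> D \<sqsubseteq>\<^bsub>coproduct_frame P N\<^esub> E" for E
    proof -
      have E': "coproduct_ideal P N E" using that by simp
      have "(a, b) \<in> E" if "(a, b) \<in> coproduct_inl P N (\<Squnion>\<^bsub>P\<^esub> A)" for a b
      proof (cases "b = \<bottom>\<^bsub>N\<^esub>")
        case True
        then show ?thesis using that \<open>A \<subseteq> _\<close> coproduct_bot_mem[OF E'] by (auto simp: coproduct_inl_mem)
      next
        case False
        then have ab: "a \<in> carrier P" "b \<in> carrier N" "a \<sqsubseteq>\<^bsub>P\<^esub> \<Squnion>\<^bsub>P\<^esub> A"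
          using that \<open>A \<subseteq> _\<close> by (auto simp: coproduct_inl_mem)
        have "(x, b) \<in> E" if "x \<in> A" for x
          using E[of "coproduct_inl P N x"] that \<open>A \<subseteq> _\<close> ab
          by (auto simp: subset_eq coproduct_inl_mem)
        then have "(\<Squnion>\<^bsub>P\<^esub> A, b) \<in> E" using coproduct_idealD(5)[OF E'] \<open>A \<subseteq> _\<close> ab by blast
        then show ?thesis using coproduct_idealD(4)[OF E' _ ab(1,2,3), of b] ab by auto
      qed
      then show ?thesis by auto
    qed
  qed
qed

lemma coproduct_inr_frame_map: "coproduct_inr P N \<in> frame_maps N (coproduct_frame P N)"
  unfolding frame_maps_def mem_Collect_eq
proof (intro conjI allI ballI impI)
  show "coproduct_inr P N \<in> carrier N \<rightarrow>\<^sub>E carrier (coproduct_frame P N)"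
    by (intro PiE_I) (simp_all add: coproduct_inr_ideal, simp add: coproduct_inr_def)
  show "coproduct_inr P N \<top>\<^bsub>N\<^esub> = \<top>\<^bsub>coproduct_frame P N\<^esub>"
    by (auto simp: coproduct_top coproduct_inr_def)
  show "coproduct_inr P N (x \<sqinter>\<^bsub>N\<^esub> y) = coproduct_inr P N x \<sqinter>\<^bsub>coproduct_frame P N\<^esub> coproduct_inr P N y"
    if "x \<in> carrier N" "y \<in> carrier N" for x y
  proof -
    have "coproduct_inr P N x \<sqinter>\<^bsub>coproduct_frame P N\<^esub> coproduct_inr P N y = coproduct_inr P N x \<inter> coproduct_inr P N y"
      by (rule coproduct_meet) (auto simp: coproduct_inr_ideal that)
    moreover have "a \<sqsubseteq>\<^bsub>N\<^esub> x \<sqinter>\<^bsub>N\<^esub> y \<longleftrightarrow> a \<sqsubseteq>\<^bsub>N\<^esub> x \<and> a \<sqsubseteq>\<^bsub>N\<^esub> y" if "a \<in> carrier N" for a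
      using that \<open>x \<in> _\<close> \<open>y \<in> _\<close>
      by (meson N.le_trans N.meet_closed N.meet_le N.meet_left N.meet_right)
    ultimately show ?thesis using that
      by (auto simp: coproduct_inr_mem)
  qed
  show "coproduct_inr P N (\<Squnion>\<^bsub>N\<^esub> A) = \<Squnion>\<^bsub>coproduct_frame P N\<^esub> (coproduct_inr P N ` A)" if "A \<subseteq> carrier N" for A
  proof (rule sym, rule complete_sup_eqI[OF coproduct_complete])
    show "coproduct_inr P N ` A \<subseteq> carrier (coproduct_frame P N)" using that by (auto simp: coproduct_inr_ideal)
    show "coproduct_inr P N (\<Squnion>\<^bsub>N\<^esub> A) \<in> carrier (coproduct_frame P N)" using that by (auto simp: coproduct_inr_ideal)
    show "D \<sqsubseteq>\<^bsub>coproduct_frame P N\<^esub> coproduct_inr P N (\<Squnion>\<^bsub>N\<^esub> A)" if D: "D \<in> coproduct_inr P N ` A" for D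
    proof -
      obtain x where x: "x \<in> A" "D = coproduct_inr P N x" using D by blast
      then have "x \<in> carrier N" "x \<sqsubseteq>\<^bsub>N\<^esub> \<Squnion>\<^bsub>N\<^esub> A" using \<open>A \<subseteq> _\<close> N.sup_upper by auto
      then show ?thesis using x \<open>A \<subseteq> _\<close> N.le_trans N.sup_closed
        by (auto simp: coproduct_inr_mem)
    qed
    show "coproduct_inr P N (\<Squnion>\<^bsub>N\<^esub> A) \<sqsubseteq>\<^bsub>coproduct_frame P N\<^esub> E" if "E \<in> carrier (coproduct_frame P N)" and
      E: "\<And>D. D \<in> coproduct_inr P N ` A \<Longrightarrow> D \<sqsubseteq>\<^bsub>coproduct_frame P N\<^esub> E" for E
    proof -
      have E': "coproduct_ideal P N E" using that by simp
      have "(a, b) \<in> E" if "(a, b) \<in> coproduct_inr P N (\<Squnion>\<^bsub>N\<^esub> A)" for a b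
      proof (cases "a = \<bottom>\<^bsub>P\<^esub>")
        case True
        then show ?thesis using that \<open>A \<subseteq> _\<close> coproduct_bot_mem[OF E'] by (auto simp: coproduct_inr_mem)
      next
        case False
        then have ab: "a \<in> carrier P" "b \<in> carrier N" "b \<sqsubseteq>\<^bsub>N\<^esub> \<Squnion>\<^bsub>N\<^esub> A"
          using that \<open>A \<subseteq> _\<close> by (auto simp: coproduct_inr_mem)
        have "(a, x) \<in> E" if "x \<in> A" for x
          using E[of "coproduct_inr P N x"] that \<open>A \<subseteq> _\<close> ab
          by (auto simp: subset_eq coproduct_inr_mem)
        then have "(a, \<Squnion>\<^bsub>N\<^esub> A) \<in> E" using coproduct_idealD(6)[OF E'] \<open>A \<subseteq> _\<close> ab by blast
        then show ?thesis using coproduct_idealD(4)[OF E' _ ab(1,2), of a] ab by auto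
      qed
      then show ?thesis by auto
    qed
  qed
qed

lemma coproduct_is_frame: "frame (coproduct_frame P N)"
proof (intro frame.intro coproduct_complete frame_axioms.intro)
  fix D \<A> assume D: "D \<in> carrier (coproduct_frame P N)" and \<A>: "\<A> \<subseteq> carrier (coproduct_frame P N)"
  have D': "coproduct_ideal P N D" using D by simp
  have \<A>': "coproduct_ideal P N E" if "E \<in> \<A>" for E using \<A> that by auto
  let ?S = "(\<lambda>E. D \<sqinter>\<^bsub>coproduct_frame P N\<^esub> E) ` \<A>"
  let ?E = "\<Squnion>\<^bsub>coproduct_frame P N\<^esub> ?S"
  let ?I = "{(x, y) \<in> carrier P \<times> carrier N. \<forall>(u, v) \<in> D. (x \<sqinter>\<^bsub>P\<^esub> u, y \<sqinter>\<^bsub>N\<^esub> v) \<in> ?E}"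
  have SK: "?S \<subseteq> carrier (coproduct_frame P N)" using D \<A> by (auto simp del: coproduct_frame_simps)
  have E: "coproduct_ideal P N ?E" using K.sup_closed[OF SK] by simp
  have Dc: "u \<in> carrier P" "v \<in> carrier N" if "(u, v) \<in> D" for u v
    using coproduct_idealD(2,3)[OF D'] that by auto
  have I: "coproduct_ideal P N ?I"
  proof (rule coproduct_idealI)
    fix a b a' b' assume A: "(a, b) \<in> ?I" "a' \<in> carrier P" "b' \<in> carrier N" "a' \<sqsubseteq>\<^bsub>P\<^esub> a" "b' \<sqsubseteq>\<^bsub>N\<^esub> b"
    have "(a' \<sqinter>\<^bsub>P\<^esub> u, b' \<sqinter>\<^bsub>N\<^esub> v) \<in> ?E" if "(u, v) \<in> D" for u v
    proof (rule coproduct_idealD(4)[OF E])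
      show "(a \<sqinter>\<^bsub>P\<^esub> u, b \<sqinter>\<^bsub>N\<^esub> v) \<in> ?E" using A that by auto
      show "a' \<sqinter>\<^bsub>P\<^esub> u \<sqsubseteq>\<^bsub>P\<^esub> a \<sqinter>\<^bsub>P\<^esub> u"
        using A Dc[OF that] by (intro P.meet_le P.meet_right P.le_trans[OF P.meet_left[of a' u]]) auto
      show "b' \<sqinter>\<^bsub>N\<^esub> v \<sqsubseteq>\<^bsub>N\<^esub> b \<sqinter>\<^bsub>N\<^esub> v"
        using A Dc[OF that] by (intro N.meet_le N.meet_right N.le_trans[OF N.meet_left[of b' v]]) auto
    qed (use A Dc[OF that] in auto)
    then show "(a', b') \<in> ?I" using A by auto
  next
    fix A b assume A: "A \<subseteq> carrier P" "b \<in> carrier N" and AI: "\<And>a. a \<in> A \<Longrightarrow> (a, b) \<in> ?I"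
    have "(\<Squnion>\<^bsub>P\<^esub> A \<sqinter>\<^bsub>P\<^esub> u, b \<sqinter>\<^bsub>N\<^esub> v) \<in> ?E" if uv: "(u, v) \<in> D" for u v
    proof -
      have "\<Squnion>\<^bsub>P\<^esub> A \<sqinter>\<^bsub>P\<^esub> u = u \<sqinter>\<^bsub>P\<^esub> \<Squnion>\<^bsub>P\<^esub> A" by (rule meet_comm)
      also have "\<dots> = \<Squnion>\<^bsub>P\<^esub> ((\<lambda>a. u \<sqinter>\<^bsub>P\<^esub> a) ` A)"
        using A Dc[OF uv] by (intro P.meet_sup_distrib)
      finally have eq: "\<Squnion>\<^bsub>P\<^esub> A \<sqinter>\<^bsub>P\<^esub> u = \<Squnion>\<^bsub>P\<^esub> ((\<lambda>a. u \<sqinter>\<^bsub>P\<^esub> a) ` A)" .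
      show ?thesis unfolding eq
      proof (rule coproduct_idealD(5)[OF E])
        fix c assume "c \<in> (\<lambda>a. u \<sqinter>\<^bsub>P\<^esub> a) ` A"
        then obtain a where "a \<in> A" "c = a \<sqinter>\<^bsub>P\<^esub> u" by (auto simp: meet_comm)
        then show "(c, b \<sqinter>\<^bsub>N\<^esub> v) \<in> ?E" using AI[of a] uv by auto
      qed (use A Dc[OF uv] in auto)
    qed
    then show "(\<Squnion>\<^bsub>P\<^esub> A, b) \<in> ?I" using A by auto
  next
    fix A a assume A: "A \<subseteq> carrier N" "a \<in> carrier P" and AI: "\<And>b. b \<in> A \<Longrightarrow> (a, b) \<in> ?I"
    have "(a \<sqinter>\<^bsub>P\<^esub> u, \<Squnion>\<^bsub>N\<^esub> A \<sqinter>\<^bsub>N\<^esub> v) \<in> ?E" if uv: "(u, v) \<in> D" for u v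
    proof -
      have "\<Squnion>\<^bsub>N\<^esub> A \<sqinter>\<^bsub>N\<^esub> v = v \<sqinter>\<^bsub>N\<^esub> \<Squnion>\<^bsub>N\<^esub> A" by (rule meet_comm)
      also have "\<dots> = \<Squnion>\<^bsub>N\<^esub> ((\<lambda>a. v \<sqinter>\<^bsub>N\<^esub> a) ` A)"
        using A Dc[OF uv] by (intro N.meet_sup_distrib)
      finally have eq: "\<Squnion>\<^bsub>N\<^esub> A \<sqinter>\<^bsub>N\<^esub> v = \<Squnion>\<^bsub>N\<^esub> ((\<lambda>a. v \<sqinter>\<^bsub>N\<^esub> a) ` A)" .
      show ?thesis unfolding eq
      proof (rule coproduct_idealD(6)[OF E])
        fix c assume "c \<in> (\<lambda>a. v \<sqinter>\<^bsub>N\<^esub> a) ` A"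
        then obtain b where "b \<in> A" "c = b \<sqinter>\<^bsub>N\<^esub> v" by (auto simp: meet_comm)
        then show "(a \<sqinter>\<^bsub>P\<^esub> u, c) \<in> ?E" using AI[of b] uv by auto
      qed (use A Dc[OF uv] in auto)
    qed
    then show "(a, \<Squnion>\<^bsub>N\<^esub> A) \<in> ?I" using A by auto
  qed auto
  have AI: "\<Squnion>\<^bsub>coproduct_frame P N\<^esub> \<A> \<sqsubseteq>\<^bsub>coproduct_frame P N\<^esub> ?I"
  proof (rule K.sup_least[OF \<A>])
    show "?I \<in> carrier (coproduct_frame P N)" using I by simp
    fix F assume F: "F \<in> \<A>"
    have "(x \<sqinter>\<^bsub>P\<^esub> u, y \<sqinter>\<^bsub>N\<^esub> v) \<in> ?E" if xy: "(x, y) \<in> F" and uv: "(u, v) \<in> D" for x y u v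
    proof -
      have Fc: "x \<in> carrier P" "y \<in> carrier N" using coproduct_idealD(2,3)[OF \<A>'[OF F]] xy by auto
      have "(x \<sqinter>\<^bsub>P\<^esub> u, y \<sqinter>\<^bsub>N\<^esub> v) \<in> F"
        by (rule coproduct_idealD(4)[OF \<A>'[OF F] xy]) (use Fc Dc[OF uv] in \<open>auto intro: P.meet_left N.meet_left\<close>)
      moreover have "(x \<sqinter>\<^bsub>P\<^esub> u, y \<sqinter>\<^bsub>N\<^esub> v) \<in> D"
        by (rule coproduct_idealD(4)[OF D' uv]) (use Fc Dc[OF uv] in \<open>auto intro: P.meet_right N.meet_right\<close>)
      moreover have "D \<sqinter>\<^bsub>coproduct_frame P N\<^esub> F = D \<inter> F" by (rule coproduct_meet[OF D' \<A>'[OF F]])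
      moreover have "D \<sqinter>\<^bsub>coproduct_frame P N\<^esub> F \<sqsubseteq>\<^bsub>coproduct_frame P N\<^esub> ?E" using SK F by (intro K.sup_upper) auto
      ultimately show ?thesis by auto
    qed
    then show "F \<sqsubseteq>\<^bsub>coproduct_frame P N\<^esub> ?I" using coproduct_idealD(1)[OF \<A>'[OF F]] by auto
  qed
  have supA: "coproduct_ideal P N (\<Squnion>\<^bsub>coproduct_frame P N\<^esub> \<A>)" using K.sup_closed[OF \<A>] by simp
  show "D \<sqinter>\<^bsub>coproduct_frame P N\<^esub> \<Squnion>\<^bsub>coproduct_frame P N\<^esub> \<A> = ?E"
  proof (rule K.le_antisym)
    have "(x, y) \<in> ?E" if "(x, y) \<in> D" "(x, y) \<in> \<Squnion>\<^bsub>coproduct_frame P N\<^esub> \<A>" for x y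
    proof -
      have "(x, y) \<in> ?I" using AI that by auto
      then have "(x \<sqinter>\<^bsub>P\<^esub> x, y \<sqinter>\<^bsub>N\<^esub> y) \<in> ?E" using that by blast
      moreover have "x \<sqinter>\<^bsub>P\<^esub> x = x" "y \<sqinter>\<^bsub>N\<^esub> y = y"
        using Dc[OF that(1)] by (auto simp: meet_def)
      ultimately show ?thesis by simp
    qed
    then show "D \<sqinter>\<^bsub>coproduct_frame P N\<^esub> \<Squnion>\<^bsub>coproduct_frame P N\<^esub> \<A> \<sqsubseteq>\<^bsub>coproduct_frame P N\<^esub> ?E"
      by (auto simp: coproduct_meet[OF D' supA])
    show "?E \<sqsubseteq>\<^bsub>coproduct_frame P N\<^esub> D \<sqinter>\<^bsub>coproduct_frame P N\<^esub> \<Squnion>\<^bsub>coproduct_frame P N\<^esub> \<A>"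
    proof (rule K.sup_least[OF SK])
      show "D \<sqinter>\<^bsub>coproduct_frame P N\<^esub> \<Squnion>\<^bsub>coproduct_frame P N\<^esub> \<A> \<in> carrier (coproduct_frame P N)" using D \<A> by (intro K.meet_closed K.sup_closed)
      fix X assume "X \<in> ?S"
      then obtain F where F: "F \<in> \<A>" "X = D \<inter> F" using coproduct_meet[OF D' \<A>'] by auto
      moreover have "F \<sqsubseteq>\<^bsub>coproduct_frame P N\<^esub> \<Squnion>\<^bsub>coproduct_frame P N\<^esub> \<A>" using F \<A> by (intro K.sup_upper)
      ultimately show "X \<sqsubseteq>\<^bsub>coproduct_frame P N\<^esub> D \<sqinter>\<^bsub>coproduct_frame P N\<^esub> \<Squnion>\<^bsub>coproduct_frame P N\<^esub> \<A>" by (auto simp: coproduct_meet[OF D' supA])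
    qed
    show "D \<sqinter>\<^bsub>coproduct_frame P N\<^esub> \<Squnion>\<^bsub>coproduct_frame P N\<^esub> \<A> \<in> carrier (coproduct_frame P N)" using D \<A> by (intro K.meet_closed K.sup_closed)
    show "?E \<in> carrier (coproduct_frame P N)" using SK by (rule K.sup_closed)
  qed
qed


context
  fixes M :: "'a gorder" and f g
  assumes M: "frame M" and f: "f \<in> frame_maps P M" and g: "g \<in> frame_maps N M"
begin

interpretation M: frame M by (rule M)

lemma copairing_left_closed: "x \<in> carrier P \<Longrightarrow> f x \<in> carrier M" by (rule frame_mapsD(2)[OF f])
lemma copairing_right_closed: "x \<in> carrier N \<Longrightarrow> g x \<in> carrier M" by (rule frame_mapsD(2)[OF g])

lemma copairing_rect_closed:
  assumes "coproduct_ideal P N D"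
  shows "(\<lambda>(a, b). f a \<sqinter>\<^bsub>M\<^esub> g b) ` D \<subseteq> carrier M"
  using coproduct_idealD(2,3)[OF assms] by (auto intro!: M.meet_closed copairing_left_closed copairing_right_closed)

lemma copairing_eq: "coproduct_ideal P N D \<Longrightarrow>
  copairing P N M f g D = \<Squnion>\<^bsub>M\<^esub> ((\<lambda>(a, b). f a \<sqinter>\<^bsub>M\<^esub> g b) ` D)"
  by (simp add: copairing_def)

lemma copairing_closed: "coproduct_ideal P N D \<Longrightarrow> copairing P N M f g D \<in> carrier M"
  by (simp only: copairing_eq M.sup_closed copairing_rect_closed)

lemma copairing_upper:
  assumes "coproduct_ideal P N D" "(a, b) \<in> D"
  shows "f a \<sqinter>\<^bsub>M\<^esub> g b \<sqsubseteq>\<^bsub>M\<^esub> copairing P N M f g D"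
  unfolding copairing_eq[OF assms(1)]
  by (rule M.sup_upper[OF copairing_rect_closed[OF assms(1)]]) (use assms in force)

lemma copairing_least:
  assumes "coproduct_ideal P N D" "k \<in> carrier M" "\<And>a b. (a, b) \<in> D \<Longrightarrow> f a \<sqinter>\<^bsub>M\<^esub> g b \<sqsubseteq>\<^bsub>M\<^esub> k"
  shows "copairing P N M f g D \<sqsubseteq>\<^bsub>M\<^esub> k"
  unfolding copairing_eq[OF assms(1)]
  by (rule M.sup_least[OF copairing_rect_closed[OF assms(1)] assms(2)]) (use assms(3) in force)

lemma copairing_residual_ideal:
  assumes k: "k \<in> carrier M"
  shows "coproduct_ideal P N {(a, b) \<in> carrier P \<times> carrier N. f a \<sqinter>\<^bsub>M\<^esub> g b \<sqsubseteq>\<^bsub>M\<^esub> k}" (is "coproduct_ideal P N ?R")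
proof (rule coproduct_idealI)
  fix a b a' b' assume A: "(a, b) \<in> ?R" "a' \<in> carrier P" "b' \<in> carrier N" "a' \<sqsubseteq>\<^bsub>P\<^esub> a" "b' \<sqsubseteq>\<^bsub>N\<^esub> b"
  then have c: "a \<in> carrier P" "b \<in> carrier N" "f a \<sqinter>\<^bsub>M\<^esub> g b \<sqsubseteq>\<^bsub>M\<^esub> k" by auto
  note cl = copairing_left_closed[OF c(1)] copairing_left_closed[OF A(2)] copairing_right_closed[OF c(2)] copairing_right_closed[OF A(3)] k
  have "f a' \<sqsubseteq>\<^bsub>M\<^esub> f a" "g b' \<sqsubseteq>\<^bsub>M\<^esub> g b"
    using frame_maps_mono[OF P.complete_lattice_axioms M.complete_lattice_axioms f A(2) c(1) A(4)]
      frame_maps_mono[OF N.complete_lattice_axioms M.complete_lattice_axioms g A(3) c(2) A(5)] .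
  then have "f a' \<sqinter>\<^bsub>M\<^esub> g b' \<sqsubseteq>\<^bsub>M\<^esub> f a \<sqinter>\<^bsub>M\<^esub> g b"
    using cl by (meson M.le_trans M.meet_closed M.meet_le M.meet_left M.meet_right)
  then have "f a' \<sqinter>\<^bsub>M\<^esub> g b' \<sqsubseteq>\<^bsub>M\<^esub> k"
    using cl c(3) by (meson M.le_trans M.meet_closed)
  then show "(a', b') \<in> ?R" using A by auto
next
  fix A b assume A: "A \<subseteq> carrier P" "b \<in> carrier N" and AI: "\<And>a. a \<in> A \<Longrightarrow> (a, b) \<in> ?R"
  have fA: "f ` A \<subseteq> carrier M" using A copairing_left_closed by blast
  have "f (\<Squnion>\<^bsub>P\<^esub> A) \<sqinter>\<^bsub>M\<^esub> g b = g b \<sqinter>\<^bsub>M\<^esub> \<Squnion>\<^bsub>M\<^esub> (f ` A)"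
    by (simp only: frame_mapsD(3)[OF f A(1)] meet_comm)
  also have "\<dots> = \<Squnion>\<^bsub>M\<^esub> ((\<lambda>x. g b \<sqinter>\<^bsub>M\<^esub> x) ` f ` A)"
    using fA copairing_right_closed[OF A(2)] by (intro M.meet_sup_distrib)
  also have "\<dots> \<sqsubseteq>\<^bsub>M\<^esub> k"
  proof (rule M.sup_least[OF _ k])
    show "(\<lambda>x. g b \<sqinter>\<^bsub>M\<^esub> x) ` f ` A \<subseteq> carrier M" using fA copairing_right_closed[OF A(2)] by auto
    fix x assume "x \<in> (\<lambda>x. g b \<sqinter>\<^bsub>M\<^esub> x) ` f ` A"
    then obtain a where a: "a \<in> A" "x = f a \<sqinter>\<^bsub>M\<^esub> g b" by (auto simp: meet_comm)
    then show "x \<sqsubseteq>\<^bsub>M\<^esub> k" using AI[OF a(1)] by simp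
  qed
  finally show "(\<Squnion>\<^bsub>P\<^esub> A, b) \<in> ?R" using A by auto
next
  fix A a assume A: "A \<subseteq> carrier N" "a \<in> carrier P" and AI: "\<And>b. b \<in> A \<Longrightarrow> (a, b) \<in> ?R"
  have fA: "g ` A \<subseteq> carrier M" using A copairing_right_closed by blast
  have "f a \<sqinter>\<^bsub>M\<^esub> g (\<Squnion>\<^bsub>N\<^esub> A) = f a \<sqinter>\<^bsub>M\<^esub> \<Squnion>\<^bsub>M\<^esub> (g ` A)"
    by (simp only: frame_mapsD(3)[OF g A(1)])
  also have "\<dots> = \<Squnion>\<^bsub>M\<^esub> ((\<lambda>x. f a \<sqinter>\<^bsub>M\<^esub> x) ` g ` A)"
    using fA copairing_left_closed[OF A(2)] by (intro M.meet_sup_distrib)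
  also have "\<dots> \<sqsubseteq>\<^bsub>M\<^esub> k"
  proof (rule M.sup_least[OF _ k])
    show "(\<lambda>x. f a \<sqinter>\<^bsub>M\<^esub> x) ` g ` A \<subseteq> carrier M" using fA copairing_left_closed[OF A(2)] by auto
    fix x assume "x \<in> (\<lambda>x. f a \<sqinter>\<^bsub>M\<^esub> x) ` g ` A"
    then obtain b where b: "b \<in> A" "x = f a \<sqinter>\<^bsub>M\<^esub> g b" by auto
    then show "x \<sqsubseteq>\<^bsub>M\<^esub> k" using AI[OF b(1)] by simp
  qed
  finally show "(a, \<Squnion>\<^bsub>N\<^esub> A) \<in> ?R" using A by auto
qed auto

lemma copairing_mono:
  assumes "coproduct_ideal P N D" "coproduct_ideal P N E" "D \<subseteq> E"
  shows "copairing P N M f g D \<sqsubseteq>\<^bsub>M\<^esub> copairing P N M f g E"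
  by (rule copairing_least[OF assms(1) copairing_closed[OF assms(2)]])
    (use assms(3) in \<open>auto intro!: copairing_upper[OF assms(2)]\<close>)

lemma copairing_sup:
  assumes A: "\<A> \<subseteq> carrier (coproduct_frame P N)"
  shows "copairing P N M f g (\<Squnion>\<^bsub>coproduct_frame P N\<^esub> \<A>) = \<Squnion>\<^bsub>M\<^esub> (copairing P N M f g ` \<A>)"
proof (rule sym, rule complete_sup_eqI[OF M.complete_lattice_axioms])
  have A': "coproduct_ideal P N D" if "D \<in> \<A>" for D using A that by auto
  have S: "coproduct_ideal P N (\<Squnion>\<^bsub>coproduct_frame P N\<^esub> \<A>)" using K.sup_closed[OF A] by simp
  show "copairing P N M f g ` \<A> \<subseteq> carrier M" using A' copairing_closed by blast
  show "copairing P N M f g (\<Squnion>\<^bsub>coproduct_frame P N\<^esub> \<A>) \<in> carrier M" using S by (rule copairing_closed)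
  show "a \<sqsubseteq>\<^bsub>M\<^esub> copairing P N M f g (\<Squnion>\<^bsub>coproduct_frame P N\<^esub> \<A>)" if a: "a \<in> copairing P N M f g ` \<A>" for a
  proof -
    obtain D where D: "D \<in> \<A>" "a = copairing P N M f g D" using a by blast
    have "D \<sqsubseteq>\<^bsub>coproduct_frame P N\<^esub> \<Squnion>\<^bsub>coproduct_frame P N\<^esub> \<A>" by (rule K.sup_upper[OF A D(1)])
    then show ?thesis unfolding D(2) by (intro copairing_mono A' D S) simp
  qed
  show "copairing P N M f g (\<Squnion>\<^bsub>coproduct_frame P N\<^esub> \<A>) \<sqsubseteq>\<^bsub>M\<^esub> k"
    if k: "k \<in> carrier M" and le: "\<And>a. a \<in> copairing P N M f g ` \<A> \<Longrightarrow> a \<sqsubseteq>\<^bsub>M\<^esub> k" for k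
  proof -
    let ?R = "{(a, b) \<in> carrier P \<times> carrier N. f a \<sqinter>\<^bsub>M\<^esub> g b \<sqsubseteq>\<^bsub>M\<^esub> k}"
    have "\<Squnion>\<^bsub>coproduct_frame P N\<^esub> \<A> \<sqsubseteq>\<^bsub>coproduct_frame P N\<^esub> ?R"
    proof (rule K.sup_least[OF A])
      show "?R \<in> carrier (coproduct_frame P N)" using copairing_residual_ideal[OF k] by simp
      fix D assume D: "D \<in> \<A>"
      have "f a \<sqinter>\<^bsub>M\<^esub> g b \<sqsubseteq>\<^bsub>M\<^esub> k \<and> a \<in> carrier P \<and> b \<in> carrier N" if "(a, b) \<in> D" for a b
      proof -
        have c: "a \<in> carrier P" "b \<in> carrier N" using coproduct_idealD(2,3)[OF A'[OF D]] that by auto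
        have "copairing P N M f g D \<sqsubseteq>\<^bsub>M\<^esub> k" using le D by blast
        from M.le_trans[OF copairing_upper[OF A'[OF D] that] this] show ?thesis
          using c k copairing_closed[OF A'[OF D]] copairing_left_closed copairing_right_closed by simp
      qed
      then show "D \<sqsubseteq>\<^bsub>coproduct_frame P N\<^esub> ?R" by auto
    qed
    then have "\<Squnion>\<^bsub>coproduct_frame P N\<^esub> \<A> \<subseteq> ?R" by simp
    then show ?thesis by (intro copairing_least S k) auto
  qed
qed

lemma copairing_meet:
  assumes D: "coproduct_ideal P N D" and E: "coproduct_ideal P N E"
  shows "copairing P N M f g (D \<inter> E) = copairing P N M f g D \<sqinter>\<^bsub>M\<^esub> copairing P N M f g E"
proof (rule M.le_antisym)
  let ?h = "copairing P N M f g"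
  note DE = coproduct_Int[OF D E]
  note cl = copairing_closed[OF D] copairing_closed[OF E] copairing_closed[OF DE]
  show "?h (D \<inter> E) \<sqsubseteq>\<^bsub>M\<^esub> ?h D \<sqinter>\<^bsub>M\<^esub> ?h E"
    by (intro M.meet_le copairing_mono DE D E cl) auto
  have *: "(f a \<sqinter>\<^bsub>M\<^esub> g b) \<sqinter>\<^bsub>M\<^esub> (f c \<sqinter>\<^bsub>M\<^esub> g d) \<sqsubseteq>\<^bsub>M\<^esub> ?h (D \<inter> E)" if ab: "(a, b) \<in> D" and cd: "(c, d) \<in> E" for a b c d
  proof -
    have c: "a \<in> carrier P" "b \<in> carrier N" "c \<in> carrier P" "d \<in> carrier N"
      using coproduct_idealD(2,3)[OF D ab] coproduct_idealD(2,3)[OF E cd] by auto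
    have "(a \<sqinter>\<^bsub>P\<^esub> c, b \<sqinter>\<^bsub>N\<^esub> d) \<in> D"
      by (rule coproduct_idealD(4)[OF D ab]) (use c in \<open>auto intro: P.meet_left N.meet_left\<close>)
    moreover have "(a \<sqinter>\<^bsub>P\<^esub> c, b \<sqinter>\<^bsub>N\<^esub> d) \<in> E"
      by (rule coproduct_idealD(4)[OF E cd]) (use c in \<open>auto intro: P.meet_right N.meet_right\<close>)
    ultimately have "f (a \<sqinter>\<^bsub>P\<^esub> c) \<sqinter>\<^bsub>M\<^esub> g (b \<sqinter>\<^bsub>N\<^esub> d) \<sqsubseteq>\<^bsub>M\<^esub> ?h (D \<inter> E)"
      by (intro copairing_upper DE) auto
    moreover have "f (a \<sqinter>\<^bsub>P\<^esub> c) \<sqinter>\<^bsub>M\<^esub> g (b \<sqinter>\<^bsub>N\<^esub> d) = (f a \<sqinter>\<^bsub>M\<^esub> g b) \<sqinter>\<^bsub>M\<^esub> (f c \<sqinter>\<^bsub>M\<^esub> g d)"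
    proof -
      note cl = copairing_left_closed[OF c(1)] copairing_left_closed[OF c(3)] copairing_right_closed[OF c(2)] copairing_right_closed[OF c(4)]
      have "(f a \<sqinter>\<^bsub>M\<^esub> f c) \<sqinter>\<^bsub>M\<^esub> (g b \<sqinter>\<^bsub>M\<^esub> g d) = f a \<sqinter>\<^bsub>M\<^esub> ((f c \<sqinter>\<^bsub>M\<^esub> g b) \<sqinter>\<^bsub>M\<^esub> g d)"
        by (simp only: cl M.meet_assoc M.meet_closed)
      also have "f c \<sqinter>\<^bsub>M\<^esub> g b = g b \<sqinter>\<^bsub>M\<^esub> f c" by (rule meet_comm)
      also have "f a \<sqinter>\<^bsub>M\<^esub> ((g b \<sqinter>\<^bsub>M\<^esub> f c) \<sqinter>\<^bsub>M\<^esub> g d) = (f a \<sqinter>\<^bsub>M\<^esub> g b) \<sqinter>\<^bsub>M\<^esub> (f c \<sqinter>\<^bsub>M\<^esub> g d)"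
        by (simp only: cl M.meet_assoc M.meet_closed)
      finally show ?thesis by (simp only: frame_mapsD(5)[OF f c(1,3)] frame_mapsD(5)[OF g c(2,4)])
    qed
    ultimately show ?thesis by simp
  qed
  have **: "x \<sqinter>\<^bsub>M\<^esub> ?h E \<sqsubseteq>\<^bsub>M\<^esub> ?h (D \<inter> E)" if x: "x \<in> (\<lambda>(a, b). f a \<sqinter>\<^bsub>M\<^esub> g b) ` D" for x
  proof -
    have xc: "x \<in> carrier M" using copairing_rect_closed[OF D] x by blast
    have "x \<sqinter>\<^bsub>M\<^esub> ?h E = \<Squnion>\<^bsub>M\<^esub> ((\<lambda>y. x \<sqinter>\<^bsub>M\<^esub> y) ` (\<lambda>(a, b). f a \<sqinter>\<^bsub>M\<^esub> g b) ` E)"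
      unfolding copairing_eq[OF E] by (rule M.meet_sup_distrib[OF xc copairing_rect_closed[OF E]])
    also have "\<dots> \<sqsubseteq>\<^bsub>M\<^esub> ?h (D \<inter> E)"
    proof (rule M.sup_least[OF _ cl(3)])
      show "(\<lambda>y. x \<sqinter>\<^bsub>M\<^esub> y) ` (\<lambda>(a, b). f a \<sqinter>\<^bsub>M\<^esub> g b) ` E \<subseteq> carrier M"
        using copairing_rect_closed[OF E] xc by (intro image_subsetI M.meet_closed) auto
    qed (use * x in auto)
    finally show ?thesis .
  qed
  have "?h D \<sqinter>\<^bsub>M\<^esub> ?h E = ?h E \<sqinter>\<^bsub>M\<^esub> ?h D" by (rule meet_comm)
  also have "\<dots> = \<Squnion>\<^bsub>M\<^esub> ((\<lambda>x. ?h E \<sqinter>\<^bsub>M\<^esub> x) ` (\<lambda>(a, b). f a \<sqinter>\<^bsub>M\<^esub> g b) ` D)"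
    unfolding copairing_eq[OF D] by (rule M.meet_sup_distrib[OF cl(2) copairing_rect_closed[OF D]])
  also have "\<dots> \<sqsubseteq>\<^bsub>M\<^esub> ?h (D \<inter> E)"
  proof (rule M.sup_least[OF _ cl(3)])
    show "(\<lambda>x. ?h E \<sqinter>\<^bsub>M\<^esub> x) ` (\<lambda>(a, b). f a \<sqinter>\<^bsub>M\<^esub> g b) ` D \<subseteq> carrier M"
      using copairing_rect_closed[OF D] cl(2) by (intro image_subsetI M.meet_closed) auto
    fix y assume "y \<in> (\<lambda>x. ?h E \<sqinter>\<^bsub>M\<^esub> x) ` (\<lambda>(a, b). f a \<sqinter>\<^bsub>M\<^esub> g b) ` D"
    then obtain x where x: "x \<in> (\<lambda>(a, b). f a \<sqinter>\<^bsub>M\<^esub> g b) ` D" "y = ?h E \<sqinter>\<^bsub>M\<^esub> x" by blast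
    show "y \<sqsubseteq>\<^bsub>M\<^esub> ?h (D \<inter> E)" using **[OF x(1)] unfolding x(2) by (simp only: meet_comm)
  qed
  finally show "?h D \<sqinter>\<^bsub>M\<^esub> ?h E \<sqsubseteq>\<^bsub>M\<^esub> ?h (D \<inter> E)" .
qed (auto intro!: M.meet_closed copairing_closed D E coproduct_Int)

lemma copairing_frame_map: "copairing P N M f g \<in> frame_maps (coproduct_frame P N) M"
  unfolding frame_maps_def mem_Collect_eq
proof (intro conjI allI ballI impI)
  let ?h = "copairing P N M f g"
  show "?h \<in> carrier (coproduct_frame P N) \<rightarrow>\<^sub>E carrier M"
    by (intro PiE_I) (simp_all add: copairing_closed, simp add: copairing_def)
  show "?h (\<Squnion>\<^bsub>coproduct_frame P N\<^esub> A) = \<Squnion>\<^bsub>M\<^esub> (?h ` A)" if "A \<subseteq> carrier (coproduct_frame P N)" for A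
    using that by (rule copairing_sup)
  show "?h (x \<sqinter>\<^bsub>coproduct_frame P N\<^esub> y) = ?h x \<sqinter>\<^bsub>M\<^esub> ?h y" if "x \<in> carrier (coproduct_frame P N)" "y \<in> carrier (coproduct_frame P N)" for x y
    using that by (simp add: coproduct_meet copairing_meet)
  have top: "coproduct_ideal P N \<top>\<^bsub>coproduct_frame P N\<^esub>" using K.top_closed by simp
  have "f \<top>\<^bsub>P\<^esub> \<sqinter>\<^bsub>M\<^esub> g \<top>\<^bsub>N\<^esub> \<sqsubseteq>\<^bsub>M\<^esub> ?h \<top>\<^bsub>coproduct_frame P N\<^esub>"
    by (rule copairing_upper[OF top]) (simp add: coproduct_top)
  moreover have "f \<top>\<^bsub>P\<^esub> \<sqinter>\<^bsub>M\<^esub> g \<top>\<^bsub>N\<^esub> = \<top>\<^bsub>M\<^esub>"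
    by (simp only: frame_mapsD(4)[OF f] frame_mapsD(4)[OF g] M.top_closed M.top_meet[unfolded M.eq_is_equal])
  ultimately show "?h \<top>\<^bsub>coproduct_frame P N\<^esub> = \<top>\<^bsub>M\<^esub>"
    using copairing_closed[OF top] by (intro M.le_antisym) auto
qed

lemma copairing_left_bot: "f \<bottom>\<^bsub>P\<^esub> = \<bottom>\<^bsub>M\<^esub>"
  using frame_mapsD(3)[OF f, of "{}"] P.weak_sup_empty M.weak_sup_empty
  by (simp add: P.eq_is_equal M.eq_is_equal)
lemma copairing_right_bot: "g \<bottom>\<^bsub>N\<^esub> = \<bottom>\<^bsub>M\<^esub>"
  using frame_mapsD(3)[OF g, of "{}"] N.weak_sup_empty M.weak_sup_empty
  by (simp add: N.eq_is_equal M.eq_is_equal)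

lemma copairing_inl: "x \<in> carrier P \<Longrightarrow> copairing P N M f g (coproduct_inl P N x) = f x"
proof (rule M.le_antisym)
  assume x: "x \<in> carrier P"
  note I = coproduct_inl_ideal[OF x]
  show "f x \<in> carrier M" "copairing P N M f g (coproduct_inl P N x) \<in> carrier M"
    by (rule copairing_left_closed[OF x] copairing_closed[OF I])+
  show "copairing P N M f g (coproduct_inl P N x) \<sqsubseteq>\<^bsub>M\<^esub> f x"
  proof (rule copairing_least[OF I copairing_left_closed[OF x]])
    fix a b assume "(a, b) \<in> coproduct_inl P N x"
    then have ab: "a \<in> carrier P" "b \<in> carrier N" "a \<sqsubseteq>\<^bsub>P\<^esub> x \<or> b = \<bottom>\<^bsub>N\<^esub>" using x by (auto simp: coproduct_inl_mem)
    note cl = copairing_left_closed[OF ab(1)] copairing_right_closed[OF ab(2)] copairing_left_closed[OF x]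
    from ab(3) show "f a \<sqinter>\<^bsub>M\<^esub> g b \<sqsubseteq>\<^bsub>M\<^esub> f x"
    proof
      assume "a \<sqsubseteq>\<^bsub>P\<^esub> x"
      then have "f a \<sqsubseteq>\<^bsub>M\<^esub> f x"
        by (rule frame_maps_mono[OF P.complete_lattice_axioms M.complete_lattice_axioms f ab(1) x])
      then show ?thesis using M.le_trans[OF M.meet_left[OF cl(1,2)]] cl by simp
    next
      assume "b = \<bottom>\<^bsub>N\<^esub>"
      then have "f a \<sqinter>\<^bsub>M\<^esub> g b \<sqsubseteq>\<^bsub>M\<^esub> \<bottom>\<^bsub>M\<^esub>" using M.meet_right[OF cl(1,2)] by (simp add: copairing_right_bot)
      then show ?thesis using M.le_trans[OF _ M.bottom_lower[OF cl(3)]] cl by simp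
    qed
  qed
  have "f x \<sqinter>\<^bsub>M\<^esub> g \<top>\<^bsub>N\<^esub> \<sqsubseteq>\<^bsub>M\<^esub> copairing P N M f g (coproduct_inl P N x)"
    by (rule copairing_upper[OF I]) (simp add: coproduct_inl_mem x)
  moreover have "f x \<sqinter>\<^bsub>M\<^esub> g \<top>\<^bsub>N\<^esub> = f x"
    using copairing_left_closed[OF x] by (simp add: frame_mapsD(4)[OF g] meet_comm[of M "f x"] M.top_meet[unfolded M.eq_is_equal])
  ultimately show "f x \<sqsubseteq>\<^bsub>M\<^esub> copairing P N M f g (coproduct_inl P N x)" by simp
qed

lemma copairing_inr: "y \<in> carrier N \<Longrightarrow> copairing P N M f g (coproduct_inr P N y) = g y"
proof (rule M.le_antisym)
  assume y: "y \<in> carrier N"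
  note I = coproduct_inr_ideal[OF y]
  show "g y \<in> carrier M" "copairing P N M f g (coproduct_inr P N y) \<in> carrier M"
    by (rule copairing_right_closed[OF y] copairing_closed[OF I])+
  show "copairing P N M f g (coproduct_inr P N y) \<sqsubseteq>\<^bsub>M\<^esub> g y"
  proof (rule copairing_least[OF I copairing_right_closed[OF y]])
    fix a b assume "(a, b) \<in> coproduct_inr P N y"
    then have ab: "a \<in> carrier P" "b \<in> carrier N" "b \<sqsubseteq>\<^bsub>N\<^esub> y \<or> a = \<bottom>\<^bsub>P\<^esub>" using y by (auto simp: coproduct_inr_mem)
    note cl = copairing_left_closed[OF ab(1)] copairing_right_closed[OF ab(2)] copairing_right_closed[OF y]
    from ab(3) show "f a \<sqinter>\<^bsub>M\<^esub> g b \<sqsubseteq>\<^bsub>M\<^esub> g y"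
    proof
      assume "b \<sqsubseteq>\<^bsub>N\<^esub> y"
      then have "g b \<sqsubseteq>\<^bsub>M\<^esub> g y"
        by (rule frame_maps_mono[OF N.complete_lattice_axioms M.complete_lattice_axioms g ab(2) y])
      then show ?thesis using M.le_trans[OF M.meet_right[OF cl(1,2)]] cl by simp
    next
      assume "a = \<bottom>\<^bsub>P\<^esub>"
      then have "f a \<sqinter>\<^bsub>M\<^esub> g b \<sqsubseteq>\<^bsub>M\<^esub> \<bottom>\<^bsub>M\<^esub>" using M.meet_left[OF cl(1,2)] by (simp add: copairing_left_bot)
      then show ?thesis using M.le_trans[OF _ M.bottom_lower[OF cl(3)]] cl by simp
    qed
  qed
  have "f \<top>\<^bsub>P\<^esub> \<sqinter>\<^bsub>M\<^esub> g y \<sqsubseteq>\<^bsub>M\<^esub> copairing P N M f g (coproduct_inr P N y)"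
    by (rule copairing_upper[OF I]) (simp add: coproduct_inr_mem y)
  moreover have "f \<top>\<^bsub>P\<^esub> \<sqinter>\<^bsub>M\<^esub> g y = g y"
    using copairing_right_closed[OF y] by (simp add: frame_mapsD(4)[OF f] M.top_meet[unfolded M.eq_is_equal])
  ultimately show "g y \<sqsubseteq>\<^bsub>M\<^esub> copairing P N M f g (coproduct_inr P N y)" by simp
qed

lemma copairing_unique:
  assumes h: "h \<in> frame_maps (coproduct_frame P N) M"
    and hl: "compose (carrier P) h (coproduct_inl P N) = f"
    and hr: "compose (carrier N) h (coproduct_inr P N) = g"
  shows "h = copairing P N M f g"
proof (rule PiE_ext[OF frame_mapsD(1)[OF h] frame_mapsD(1)[OF copairing_frame_map]])
  fix D assume D: "D \<in> carrier (coproduct_frame P N)"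
  then have D': "coproduct_ideal P N D" by simp
  let ?r = "\<lambda>(a, b). coproduct_inl P N a \<sqinter>\<^bsub>coproduct_frame P N\<^esub> coproduct_inr P N b"
  have c: "a \<in> carrier P" "b \<in> carrier N" if "(a, b) \<in> D" for a b
    using coproduct_idealD(2,3)[OF D' that] by auto
  have r: "?r (a, b) = coproduct_inl P N a \<inter> coproduct_inr P N b" if "(a, b) \<in> D" for a b
    using c[OF that] by (simp add: coproduct_meet coproduct_inl_ideal coproduct_inr_ideal)
  have rc: "?r ` D \<subseteq> carrier (coproduct_frame P N)"
    using r c by (auto simp: coproduct_Int coproduct_inl_ideal coproduct_inr_ideal)
  have "\<Squnion>\<^bsub>coproduct_frame P N\<^esub> (?r ` D) = D"
  proof (rule complete_sup_eqI[OF coproduct_complete rc D])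
    fix E assume "E \<in> ?r ` D"
    then obtain a b where ab: "(a, b) \<in> D" "E = ?r (a, b)" by auto
    have "(x, y) \<in> D" if "(x, y) \<in> E" for x y
    proof -
      have xy: "x \<in> carrier P" "y \<in> carrier N" "x \<sqsubseteq>\<^bsub>P\<^esub> a \<or> y = \<bottom>\<^bsub>N\<^esub>" "y \<sqsubseteq>\<^bsub>N\<^esub> b \<or> x = \<bottom>\<^bsub>P\<^esub>"
        using that c[OF ab(1)] unfolding ab(2) r[OF ab(1)] by (auto simp: coproduct_inl_mem coproduct_inr_mem)
      then show ?thesis
        using coproduct_bot_mem[OF D'] coproduct_idealD(4)[OF D' ab(1) xy(1,2)] by blast
    qed
    then show "E \<sqsubseteq>\<^bsub>coproduct_frame P N\<^esub> D" by auto
  next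
    fix E assume E: "E \<in> carrier (coproduct_frame P N)" and le: "\<And>X. X \<in> ?r ` D \<Longrightarrow> X \<sqsubseteq>\<^bsub>coproduct_frame P N\<^esub> E"
    have "(a, b) \<in> E" if "(a, b) \<in> D" for a b
    proof -
      have "?r (a, b) \<subseteq> E" using le[of "?r (a, b)"] that by (simp add: image_iff) blast
      moreover have "(a, b) \<in> ?r (a, b)" unfolding r[OF that] using c[OF that] by (simp add: coproduct_inl_mem coproduct_inr_mem)
      ultimately show ?thesis by blast
    qed
    then show "D \<sqsubseteq>\<^bsub>coproduct_frame P N\<^esub> E" by auto
  qed
  then have "h D = \<Squnion>\<^bsub>M\<^esub> (h ` ?r ` D)" using frame_mapsD(3)[OF h rc] by simp
  also have "h ` ?r ` D = (\<lambda>(a, b). f a \<sqinter>\<^bsub>M\<^esub> g b) ` D"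
    unfolding image_image
  proof (rule image_cong[OF refl])
    fix p assume p: "p \<in> D"
    obtain a b where ab: "p = (a, b)" by force
    note c' = c[OF p[unfolded ab]]
    have "h (coproduct_inl P N a \<sqinter>\<^bsub>coproduct_frame P N\<^esub> coproduct_inr P N b) = h (coproduct_inl P N a) \<sqinter>\<^bsub>M\<^esub> h (coproduct_inr P N b)"
      by (rule frame_mapsD(5)[OF h]) (use c' coproduct_inl_ideal coproduct_inr_ideal in auto)
    also have "h (coproduct_inl P N a) = f a" using fun_cong[OF hl, of a] c' by (simp add: compose_def)
    also have "h (coproduct_inr P N b) = g b" using fun_cong[OF hr, of b] c' by (simp add: compose_def)
    finally show "h (?r p) = (case p of (a, b) \<Rightarrow> f a \<sqinter>\<^bsub>M\<^esub> g b)" using ab by simp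
  qed
  finally show "h D = copairing P N M f g D" by (simp add: copairing_eq[OF D'])
qed

lemma copairing_comp:
  "compose (carrier P) (copairing P N M f g) (coproduct_inl P N) = f"
  "compose (carrier N) (copairing P N M f g) (coproduct_inr P N) = g"
proof -
  have "f \<in> extensional (carrier P)" "g \<in> extensional (carrier N)"
    using frame_mapsD(1)[OF f] frame_mapsD(1)[OF g] by (auto simp: PiE_def)
  then show "compose (carrier P) (copairing P N M f g) (coproduct_inl P N) = f"
    "compose (carrier N) (copairing P N M f g) (coproduct_inr P N) = g"
    by (auto simp: compose_def copairing_inl copairing_inr extensional_def fun_eq_iff)
qed

end

end

theorem coproduct_universal:
  assumes "frame P" and "frame N"
  shows "frame (coproduct_frame P N)"
    and "coproduct_inl P N \<in> frame_maps P (coproduct_frame P N)"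
    and "coproduct_inr P N \<in> frame_maps N (coproduct_frame P N)"
    and "\<lbrakk>frame M; f \<in> frame_maps P M; g \<in> frame_maps N M;
          h \<in> frame_maps (coproduct_frame P N) M\<rbrakk> \<Longrightarrow>
         compose (carrier P) h (coproduct_inl P N) = f \<and>
         compose (carrier N) h (coproduct_inr P N) = g \<longleftrightarrow> h = copairing P N M f g"
    and "\<lbrakk>frame M; f \<in> frame_maps P M; g \<in> frame_maps N M\<rbrakk> \<Longrightarrow>
         copairing P N M f g \<in> frame_maps (coproduct_frame P N) M"
proof -
  show "frame (coproduct_frame P N)" by (rule coproduct_is_frame[OF assms])
  show "coproduct_inl P N \<in> frame_maps P (coproduct_frame P N)" by (rule coproduct_inl_frame_map[OF assms])
  show "coproduct_inr P N \<in> frame_maps N (coproduct_frame P N)" by (rule coproduct_inr_frame_map[OF assms])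
  assume M: "frame M" and f: "f \<in> frame_maps P M" and g: "g \<in> frame_maps N M"
  show "copairing P N M f g \<in> frame_maps (coproduct_frame P N) M"
    by (rule copairing_frame_map[OF assms M f g])
  show "compose (carrier P) h (coproduct_inl P N) = f \<and>
     compose (carrier N) h (coproduct_inr P N) = g \<longleftrightarrow> h = copairing P N M f g"
    if h: "h \<in> frame_maps (coproduct_frame P N) M"
    using copairing_unique[OF assms M f g h] copairing_comp[OF assms M f g] by (iprover)
qed


subsection \<open>The bispace of bipoints\<close>

lemma two_frame_simps [simp]:
  "carrier two_frame = UNIV" "eq two_frame = (=)" "le two_frame = (\<le>)"
  by (simp_all add: two_frame_def)

lemma two_frame_complete: "complete_lattice two_frame"
proof -
  interpret partial_order two_frame
    by unfold_locales auto
  show ?thesis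
  proof unfold_locales
    show "\<exists>s. is_lub two_frame s A" for A
      by (intro exI[of _ "True \<in> A"] least_UpperI) (auto simp: Upper_def)
    show "\<exists>s. is_glb two_frame s A" for A
    proof (intro exI[of _ "False \<notin> A"] greatest_LowerI)
      show "(False \<notin> A) \<sqsubseteq>\<^bsub>two_frame\<^esub> x" if "x \<in> A" for x
        using that by (cases x) auto
    qed (auto simp: Lower_def)
  qed
qed

lemma two_frame_sup: "\<Squnion>\<^bsub>two_frame\<^esub> A = (True \<in> A)"
proof (rule complete_sup_eqI[OF two_frame_complete])
  show "a \<sqsubseteq>\<^bsub>two_frame\<^esub> (True \<in> A)" if "a \<in> A" for a
    using that by (cases a) auto
qed auto

lemma two_frame_meet: "x \<sqinter>\<^bsub>two_frame\<^esub> y = (x \<and> y)"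
  by (rule complete_meet_eqI[OF two_frame_complete]) auto

lemma two_frame_top: "\<top>\<^bsub>two_frame\<^esub> = True"
  by (rule complete_top_eqI[OF two_frame_complete]) auto

lemma evaluation_topology:
  assumes P: "frame P" and B: "\<And>f. f \<in> B \<Longrightarrow> e f \<in> frame_maps P two_frame"
  shows "istopology (\<lambda>U. \<exists>a\<in>carrier P. U = {f \<in> B. e f a})" (is "istopology ?T")
    and "topspace (topology (\<lambda>U. \<exists>a\<in>carrier P. U = {f \<in> B. e f a})) = B"
proof -
  interpret P: frame P by (rule P)
  show top: "istopology ?T"
    unfolding istopology_def
  proof (intro conjI allI impI)
    fix S T assume "?T S" "?T T"
    then obtain a b where ab: "a \<in> carrier P" "b \<in> carrier P" "S = {f \<in> B. e f a}" "T = {f \<in> B. e f b}"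
      by blast
    have "e f (a \<sqinter>\<^bsub>P\<^esub> b) \<longleftrightarrow> e f a \<and> e f b" if "f \<in> B" for f
      by (simp only: frame_mapsD(5)[OF B[OF that] ab(1,2)] two_frame_meet)
    then have "S \<inter> T = {f \<in> B. e f (a \<sqinter>\<^bsub>P\<^esub> b)}" using ab(3,4) by blast
    then show "?T (S \<inter> T)" using P.meet_closed[OF ab(1,2)] by blast
  next
    fix \<K> assume K: "\<forall>U\<in>\<K>. ?T U"
    let ?A = "{a \<in> carrier P. {f \<in> B. e f a} \<in> \<K>}"
    have A: "?A \<subseteq> carrier P" by blast
    have "e f (\<Squnion>\<^bsub>P\<^esub> ?A) \<longleftrightarrow> (\<exists>a\<in>?A. e f a)" if "f \<in> B" for f
      unfolding frame_mapsD(3)[OF B[OF that] A] two_frame_sup by (auto simp: image_iff)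
    note sup = this
    have "\<Union>\<K> = {f \<in> B. e f (\<Squnion>\<^bsub>P\<^esub> ?A)}"
    proof (rule Set.set_eqI)
      fix f
      show "f \<in> \<Union>\<K> \<longleftrightarrow> f \<in> {f \<in> B. e f (\<Squnion>\<^bsub>P\<^esub> ?A)}"
      proof
        assume "f \<in> \<Union>\<K>"
        then obtain U where U: "U \<in> \<K>" "f \<in> U" by blast
        obtain a where "a \<in> carrier P" "U = {f \<in> B. e f a}" using bspec[OF K U(1)] by (elim bexE)
        then have "f \<in> B" "e f a" "a \<in> ?A" using U by simp_all
        then show "f \<in> {f \<in> B. e f (\<Squnion>\<^bsub>P\<^esub> ?A)}" using sup[OF \<open>f \<in> B\<close>] by blast
      next
        assume "f \<in> {f \<in> B. e f (\<Squnion>\<^bsub>P\<^esub> ?A)}"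
        then have f: "f \<in> B" "e f (\<Squnion>\<^bsub>P\<^esub> ?A)" by simp_all
        obtain a where "a \<in> ?A" "e f a" using f(2) sup[OF f(1)] by (elim iffD1[THEN bexE])
        then show "f \<in> \<Union>\<K>" using f(1) by blast
      qed
    qed
    then show "?T (\<Union>\<K>)" by (rule bexI[OF _ P.sup_closed[OF A]])
  qed
  have "e f \<top>\<^bsub>P\<^esub>" if "f \<in> B" for f
    by (simp only: frame_mapsD(4)[OF B[OF that]] two_frame_top)
  then have "B = {f \<in> B. e f \<top>\<^bsub>P\<^esub>}" by blast
  then have TB: "?T B" by (rule bexI[OF _ P.top_closed])
  show "topspace (topology ?T) = B"
  proof
    show "B \<subseteq> topspace (topology ?T)"
      by (rule openin_subset) (use TB in \<open>simp only: topology_inverse'[OF top]\<close>)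
    show "topspace (topology ?T) \<subseteq> B"
      unfolding topspace_def topology_inverse'[OF top] by blast
  qed
qed

lemma bpt_opens:
  assumes "biframe L"
  shows "openin (fst (bpt L)) U \<longleftrightarrow> (\<exists>a\<in>carrier (pos_part L). U = {f \<in> bipoints L. fst f a})"
    and "openin (snd (bpt L)) U \<longleftrightarrow> (\<exists>a\<in>carrier (neg_part L). U = {f \<in> bipoints L. snd f a})"
    and "points (bpt L) = bipoints L"
    and "bispace (bpt L)"
proof -
  have P: "frame (pos_part L)" and N: "frame (neg_part L)"
    using assms by (simp_all add: biframe_def)
  have fp: "fst f \<in> frame_maps (pos_part L) two_frame"
    and fn: "snd f \<in> frame_maps (neg_part L) two_frame" if "f \<in> bipoints L" for f
    using that by (auto simp: bipoints_def biframe_maps_def two_biframe_def)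
  show "openin (fst (bpt L)) U \<longleftrightarrow> (\<exists>a\<in>carrier (pos_part L). U = {f \<in> bipoints L. fst f a})"
    "openin (snd (bpt L)) U \<longleftrightarrow> (\<exists>a\<in>carrier (neg_part L). U = {f \<in> bipoints L. snd f a})"
    by (simp_all only: bpt_def fst_conv snd_conv
        topology_inverse'[OF evaluation_topology(1)[OF P fp]] topology_inverse'[OF evaluation_topology(1)[OF N fn]])
  have "topspace (fst (bpt L)) = bipoints L" "topspace (snd (bpt L)) = bipoints L"
    by (simp_all only: bpt_def fst_conv snd_conv evaluation_topology(2)[OF P fp] evaluation_topology(2)[OF N fn])
  then show "points (bpt L) = bipoints L" "bispace (bpt L)"
    by (simp_all add: points_def bispace_def)
qed

end

theory Submission
  imports Defs
begin

text \<open>The congruence \<open>\<nabla>(t) \<inter> \<Delta>(s)\<close> is the least one forcing \<open>t \<le> s\<close>, and for \<open>t, s\<close> in \<open>fin(L)\<close> these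
  congruences are closed under finite intersections. So the finitary congruences, which are the
  joins of congruences of this form, are a subframe of the frame of all congruences, and this
  subframe is the main component of the assembly; this gives (2).

  Let \<open>f : L \<rightarrow> T\<close> be a biframe map sending the elements of both parts to bicomplemented elements.
  Then \<open>f(s)\<close> is complemented for all \<open>s\<close> in \<open>fin(L)\<close>, and the extension of \<open>f\<close> in (1) sends \<open>C\<close> to
  the join of all \<open>f(t) \<and> \<not>f(s)\<close> such that \<open>C\<close> forces \<open>t \<le> s\<close>. This join lies below \<open>m\<close> iff \<open>C\<close> is
  contained in the pullback of \<open>\<nabla>(m)\<close> along \<open>f\<close>, so the extension is a left adjoint and preserves
  joins.

  Part (3) is the case where \<open>T\<close> is the two-element biframe. For (4), the sets of bipoints \<open>f\<close> with
  \<open>f\<^sup>+(a) = 1\<close>, \<open>f\<^sup>-(b) = 1\<close>, \<open>f\<^sup>+(c) = 0\<close>, \<open>f\<^sup>-(d) = 0\<close> correspond to a base of the patch topology of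
  the assembly, while the bipoints of \<open>b\<Omega>\<^sub>f\<^sub>i\<^sub>n(Y)\<close> are the bipoints of \<open>L\<close> all of whose basic
  neighbourhoods meet \<open>Y\<close>.\<close>


section \<open>Frames\<close>

text \<open>The finiteness in \<open>fin\<close> is forced by complements: an infinite join of
  complemented elements need not be complemented, so \<open>delta s\<close> can be extended only for
  finite joins \<open>s\<close> of rectangles, while \<open>nabla\<close> preserves all joins and
  needs no restriction. The extension preserves joins by adjointness, which says nothing about
  finite meets; for those the explicit formula by differences is needed. Uniqueness comes from the
  uniqueness of complements: the value at \<open>nabla s\<close> determines the value at
  \<open>delta s\<close>. For \<open>s\<close> from one part of the biframe these two congruences
  lie in opposite parts of the assembly, so they are compared in the main component and pulled back
  along injective embeddings.

  For (4) the obstacle is that a cover by rectangles in the main component may be infinite, whereas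
  the relations defining the main component for a bispace have the form
  \<open>U \<inter> U' \<subseteq> V \<union> V'\<close>. A cover by rectangles of value 0 is
  reduced to this form by gathering the left sides of value 0 in one join and the right sides of
  value 0 in another; points preserve both joins.\<close>

context frame
begin

lemma le_meet_iff:
  "\<lbrakk>x \<in> carrier L; y \<in> carrier L; z \<in> carrier L\<rbrakk> \<Longrightarrow> x \<sqsubseteq> y \<sqinter> z \<longleftrightarrow> x \<sqsubseteq> y \<and> x \<sqsubseteq> z"
  by (meson le_trans meet_closed meet_le meet_left meet_right)

lemma join_le_iff:
  "\<lbrakk>x \<in> carrier L; y \<in> carrier L; z \<in> carrier L\<rbrakk> \<Longrightarrow> y \<squnion> z \<sqsubseteq> x \<longleftrightarrow> y \<sqsubseteq> x \<and> z \<sqsubseteq> x"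
  by (meson le_trans join_closed join_le join_left join_right)

lemma sup_le_iff: "\<lbrakk>A \<subseteq> carrier L; x \<in> carrier L\<rbrakk> \<Longrightarrow> \<Squnion>A \<sqsubseteq> x \<longleftrightarrow> (\<forall>a\<in>A. a \<sqsubseteq> x)"
  by (meson sup_least sup_upper sup_closed le_trans subsetD)

lemma meet_eq_left: "\<lbrakk>x \<in> carrier L; y \<in> carrier L; x \<sqsubseteq> y\<rbrakk> \<Longrightarrow> x \<sqinter> y = x"
  by (simp add: le_iff_join[symmetric] eq_commute)

lemma join_eq_right: "\<lbrakk>x \<in> carrier L; y \<in> carrier L; x \<sqsubseteq> y\<rbrakk> \<Longrightarrow> x \<squnion> y = y"
  by (simp add: le_iff_meet[symmetric])

lemma join_eq_left: "\<lbrakk>x \<in> carrier L; y \<in> carrier L; x \<sqsubseteq> y\<rbrakk> \<Longrightarrow> y \<squnion> x = y"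
  by (metis join_eq_right join_comm)

lemma meet_eq_right: "\<lbrakk>x \<in> carrier L; y \<in> carrier L; x \<sqsubseteq> y\<rbrakk> \<Longrightarrow> y \<sqinter> x = x"
  by (metis meet_eq_left meet_comm)

lemma sup_empty: "\<Squnion>{} = \<bottom>"
  using weak_sup_empty by (simp add: eq_is_equal)

lemma meet_idem: "x \<in> carrier L \<Longrightarrow> x \<sqinter> x = x"
  by (simp add: meet_eq_left)

lemma join_idem: "x \<in> carrier L \<Longrightarrow> x \<squnion> x = x"
  by (simp add: join_eq_right)

lemma bottom_join_eq: "x \<in> carrier L \<Longrightarrow> \<bottom> \<squnion> x = x" "x \<in> carrier L \<Longrightarrow> x \<squnion> \<bottom> = x"
  by (simp_all add: join_eq_right join_eq_left)

lemma bottom_meet_eq: "x \<in> carrier L \<Longrightarrow> \<bottom> \<sqinter> x = \<bottom>" "x \<in> carrier L \<Longrightarrow> x \<sqinter> \<bottom> = \<bottom>"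
  by (simp_all add: meet_eq_left meet_eq_right)

lemma top_join_eq: "x \<in> carrier L \<Longrightarrow> \<top> \<squnion> x = \<top>" "x \<in> carrier L \<Longrightarrow> x \<squnion> \<top> = \<top>"
  by (simp_all add: join_eq_right join_eq_left)

lemma top_meet_eq: "x \<in> carrier L \<Longrightarrow> \<top> \<sqinter> x = x" "x \<in> carrier L \<Longrightarrow> x \<sqinter> \<top> = x"
  by (simp_all add: meet_eq_left meet_eq_right)

lemma meet_mono:
  assumes "x \<sqsubseteq> x'" "y \<sqsubseteq> y'" "x \<in> carrier L" "x' \<in> carrier L" "y \<in> carrier L" "y' \<in> carrier L"
  shows "x \<sqinter> y \<sqsubseteq> x' \<sqinter> y'"
  using assms le_trans[OF meet_left[of x y] assms(1)] le_trans[OF meet_right[of x y] assms(2)]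
  by (simp add: le_meet_iff)

lemma meet_interchange:
  assumes c: "a \<in> carrier L" "b \<in> carrier L" "c \<in> carrier L" "d \<in> carrier L"
  shows "(a \<sqinter> b) \<sqinter> (c \<sqinter> d) = (a \<sqinter> c) \<sqinter> (b \<sqinter> d)"
proof -
  have "(a \<sqinter> b) \<sqinter> (c \<sqinter> d) = a \<sqinter> ((b \<sqinter> c) \<sqinter> d)" using c by (simp only: meet_assoc meet_closed)
  also have "b \<sqinter> c = c \<sqinter> b" by (rule meet_comm)
  also have "a \<sqinter> ((c \<sqinter> b) \<sqinter> d) = (a \<sqinter> c) \<sqinter> (b \<sqinter> d)" using c by (simp only: meet_assoc meet_closed)
  finally show ?thesis .
qed

lemma meet_join_distrib:
  "\<lbrakk>x \<in> carrier L; y \<in> carrier L; z \<in> carrier L\<rbrakk> \<Longrightarrow> x \<sqinter> (y \<squnion> z) = (x \<sqinter> y) \<squnion> (x \<sqinter> z)"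
  unfolding join_def using meet_sup_distrib[of x "{y, z}"] by simp

lemma join_meet_distrib_right:
  "\<lbrakk>x \<in> carrier L; y \<in> carrier L; z \<in> carrier L\<rbrakk> \<Longrightarrow> (y \<squnion> z) \<sqinter> x = (y \<sqinter> x) \<squnion> (z \<sqinter> x)"
  by (metis meet_comm meet_join_distrib)

lemma join_meet_distrib:
  assumes c: "x \<in> carrier L" "y \<in> carrier L" "z \<in> carrier L"
  shows "x \<squnion> (y \<sqinter> z) = (x \<squnion> y) \<sqinter> (x \<squnion> z)"
proof -
  have "(x \<squnion> y) \<sqinter> (x \<squnion> z) = (x \<squnion> y) \<sqinter> x \<squnion> (x \<squnion> y) \<sqinter> z"
    using c by (simp add: meet_join_distrib)
  also have "(x \<squnion> y) \<sqinter> x = x" using c by (simp add: meet_eq_right join_left)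
  also have "(x \<squnion> y) \<sqinter> z = (x \<sqinter> z) \<squnion> (y \<sqinter> z)" using c by (simp add: join_meet_distrib_right)
  also have "x \<squnion> ((x \<sqinter> z) \<squnion> (y \<sqinter> z)) = (x \<squnion> (x \<sqinter> z)) \<squnion> (y \<sqinter> z)" using c by (simp add: join_assoc)
  also have "x \<squnion> (x \<sqinter> z) = x" using c by (simp add: join_eq_left meet_left)
  finally show ?thesis by simp
qed

lemma sup_meet_distrib: "\<lbrakk>x \<in> carrier L; A \<subseteq> carrier L\<rbrakk> \<Longrightarrow> \<Squnion>A \<sqinter> x = \<Squnion>((\<lambda>a. a \<sqinter> x) ` A)"
  using meet_sup_distrib[of x A] by (simp only: meet_comm[of L _ x])

text \<open>The infinite distributive law is applied to one factor at a time. The set on the right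
  shows that joins of members of a meet-closed set are closed under meets.\<close>

lemma sup_meet_sup:
  assumes "A \<subseteq> carrier L" "B \<subseteq> carrier L"
  shows "\<Squnion>A \<sqinter> \<Squnion>B = \<Squnion>{a \<sqinter> b | a b. a \<in> A \<and> b \<in> B}"
proof -
  have c: "a \<in> A \<Longrightarrow> a \<in> carrier L" "a \<in> B \<Longrightarrow> a \<in> carrier L" for a using assms by auto
  have S: "{a \<sqinter> b | a b. a \<in> A \<and> b \<in> B} \<subseteq> carrier L" using c by auto
  have "\<Squnion>A \<sqinter> \<Squnion>B \<sqsubseteq> \<Squnion>{a \<sqinter> b | a b. a \<in> A \<and> b \<in> B}"
  proof -
    have "a \<sqinter> \<Squnion>B \<sqsubseteq> \<Squnion>{a \<sqinter> b | a b. a \<in> A \<and> b \<in> B}" if a: "a \<in> A" for a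
    proof -
      have "a \<sqinter> b \<sqsubseteq> \<Squnion>{a \<sqinter> b | a b. a \<in> A \<and> b \<in> B}" if "b \<in> B" for b
        by (rule sup_upper[OF S]) (use a that in auto)
      then show ?thesis
        using c a S assms by (subst meet_sup_distrib) (auto intro!: sup_least)
    qed
    then show ?thesis using c S assms by (subst sup_meet_distrib) (auto intro!: sup_least)
  qed
  moreover have "\<Squnion>{a \<sqinter> b | a b. a \<in> A \<and> b \<in> B} \<sqsubseteq> \<Squnion>A \<sqinter> \<Squnion>B"
    using assms c S by (auto simp: sup_le_iff intro!: meet_mono sup_upper)
  ultimately show ?thesis using assms S by (auto intro: le_antisym)
qed

lemma sup_mono: "\<lbrakk>A \<subseteq> B; B \<subseteq> carrier L\<rbrakk> \<Longrightarrow> \<Squnion>A \<sqsubseteq> \<Squnion>B"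
  by (auto simp: sup_le_iff sup_upper)

lemma sup_Un: "\<lbrakk>A \<subseteq> carrier L; B \<subseteq> carrier L\<rbrakk> \<Longrightarrow> \<Squnion>(A \<union> B) = \<Squnion>A \<squnion> \<Squnion>B"
proof (rule complete_sup_eqI[OF complete_lattice_axioms])
  assume A: "A \<subseteq> carrier L" and B: "B \<subseteq> carrier L"
  show "a \<sqsubseteq> \<Squnion>A \<squnion> \<Squnion>B" if "a \<in> A \<union> B" for a
    using that A B le_trans[OF sup_upper[OF A] join_left[of "\<Squnion>A" "\<Squnion>B"]]
      le_trans[OF sup_upper[OF B] join_right[of "\<Squnion>A" "\<Squnion>B"]] by auto
  show "\<Squnion>A \<squnion> \<Squnion>B \<sqsubseteq> y" if "y \<in> carrier L" "\<And>a. a \<in> A \<union> B \<Longrightarrow> a \<sqsubseteq> y" for y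
    using that A B by (simp add: join_le_iff sup_le_iff)
qed auto

lemma sup_UN:
  assumes "\<And>X. X \<in> \<A> \<Longrightarrow> X \<subseteq> carrier L"
  shows "\<Squnion>(\<Union>\<A>) = \<Squnion>((\<lambda>X. \<Squnion>\<^bsub>L\<^esub> X) ` \<A>)"
proof (rule complete_sup_eqI[OF complete_lattice_axioms])
  show U: "\<Union>\<A> \<subseteq> carrier L" using assms by blast
  have I: "(\<lambda>X. \<Squnion>\<^bsub>L\<^esub> X) ` \<A> \<subseteq> carrier L" using assms by auto
  then show "\<Squnion>((\<lambda>X. \<Squnion>\<^bsub>L\<^esub> X) ` \<A>) \<in> carrier L" by simp
  show "a \<sqsubseteq> \<Squnion>((\<lambda>X. \<Squnion>\<^bsub>L\<^esub> X) ` \<A>)" if "a \<in> \<Union>\<A>" for a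
  proof -
    obtain X where X: "X \<in> \<A>" "a \<in> X" using \<open>a \<in> \<Union>\<A>\<close> by blast
    have "a \<sqsubseteq> \<Squnion>X" by (rule sup_upper) (use X assms in auto)
    moreover have "\<Squnion>X \<sqsubseteq> \<Squnion>((\<lambda>X. \<Squnion>\<^bsub>L\<^esub> X) ` \<A>)" by (rule sup_upper[OF I]) (use X in auto)
    ultimately show ?thesis using le_trans assms[OF X(1)] X I by (meson subsetD sup_closed)
  qed
  show "\<Squnion>((\<lambda>X. \<Squnion>\<^bsub>L\<^esub> X) ` \<A>) \<sqsubseteq> y" if "y \<in> carrier L" "\<And>a. a \<in> \<Union>\<A> \<Longrightarrow> a \<sqsubseteq> y" for y
    using that I assms by (auto simp: sup_le_iff)
qed

lemma complement_unique:
  assumes c: "x \<in> carrier L" "y \<in> carrier L" "z \<in> carrier L"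
    and "x \<sqinter> y = \<bottom>" "x \<squnion> y = \<top>" "x \<sqinter> z = \<bottom>" "x \<squnion> z = \<top>"
  shows "y = z"
proof -
  \<comment> \<open>Half of the conclusion, \<open>y \<sqsubseteq> z\<close>; exchanging the roles
    of \<open>y\<close> and \<open>z\<close> gives the other half.\<close>
  have "y \<sqinter> z = y" if "x \<sqinter> y = \<bottom>" "x \<squnion> z = \<top>" "y \<in> carrier L" "z \<in> carrier L" for y z
  proof -
    have "y = y \<sqinter> (x \<squnion> z)" unfolding that(2) using that by (simp add: top_meet_eq)
    also have "\<dots> = (y \<sqinter> x) \<squnion> (y \<sqinter> z)" using that(3,4) c by (simp add: meet_join_distrib)
    also have "y \<sqinter> x = \<bottom>" using that by (metis meet_comm)
    finally show ?thesis using that by (simp add: bottom_join_eq)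
  qed
  from this[of y z] this[of z y] assms show ?thesis by (metis meet_comm)
qed

text \<open>For a complemented \<open>s\<close>, meeting with the complement is left adjoint to
  joining with \<open>s\<close>. This turns bounds on differences into inequalities free of
  complements.\<close>

lemma meet_complement_le_iff:
  assumes c: "t \<in> carrier L" "s \<in> carrier L" "s' \<in> carrier L" "m \<in> carrier L"
    and "s \<sqinter> s' = \<bottom>" "s \<squnion> s' = \<top>"
  shows "t \<sqinter> s' \<sqsubseteq> m \<longleftrightarrow> t \<sqsubseteq> s \<squnion> m"
proof
  assume "t \<sqinter> s' \<sqsubseteq> m"
  have "t = t \<sqinter> (s \<squnion> s')" using assms by (simp add: top_meet_eq)
  also have "\<dots> = (t \<sqinter> s) \<squnion> (t \<sqinter> s')" using c by (simp add: meet_join_distrib)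
  also have "\<dots> \<sqsubseteq> s \<squnion> m"
    using c \<open>t \<sqinter> s' \<sqsubseteq> m\<close> by (simp add: join_le_iff) (meson join_closed join_left join_right le_trans meet_closed meet_right)
  finally show "t \<sqsubseteq> s \<squnion> m" .
next
  assume "t \<sqsubseteq> s \<squnion> m"
  then have "t \<sqinter> s' \<sqsubseteq> (s \<squnion> m) \<sqinter> s'" using c by (simp add: meet_mono)
  also have "(s \<squnion> m) \<sqinter> s' = m \<sqinter> s'" using assms by (simp add: join_meet_distrib_right bottom_join_eq)
  also have "\<dots> \<sqsubseteq> m" using c by (simp add: meet_left)
  finally show "t \<sqinter> s' \<sqsubseteq> m" using c by simp
qed

end

lemma frame_maps_bottom:
  assumes "frame L" "frame M" "f \<in> frame_maps L M"
  shows "f \<bottom>\<^bsub>L\<^esub> = \<bottom>\<^bsub>M\<^esub>"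
  using frame_mapsD(3)[OF assms(3), of "{}"] by (simp add: frame.sup_empty assms)

lemma frame_maps_join:
  assumes "f \<in> frame_maps L M" "x \<in> carrier L" "y \<in> carrier L"
  shows "f (x \<squnion>\<^bsub>L\<^esub> y) = f x \<squnion>\<^bsub>M\<^esub> f y"
  using frame_mapsD(3)[OF assms(1), of "{x, y}"] assms by (simp add: join_def)


section \<open>Subframes\<close>

lemma subframeD:
  assumes "subframe L S"
  shows "S \<subseteq> carrier L" "A \<subseteq> S \<Longrightarrow> \<Squnion>\<^bsub>L\<^esub> A \<in> S" "\<top>\<^bsub>L\<^esub> \<in> S" "x \<in> S \<Longrightarrow> y \<in> S \<Longrightarrow> x \<sqinter>\<^bsub>L\<^esub> y \<in> S"
  using assms by (auto simp: subframe_def)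

context
  fixes L :: "'a gorder" and S
  assumes L: "frame L" and S: "subframe L S"
begin

interpretation frame L by (rule L)

lemma subframe_is_lub: "A \<subseteq> S \<Longrightarrow> is_lub (L\<lparr>carrier := S\<rparr>) (\<Squnion>\<^bsub>L\<^esub> A) A"
  using subframeD[OF S] by (intro least_UpperI) (auto simp: Upper_def intro!: sup_upper sup_least)

lemma subframe_complete: "complete_lattice (L\<lparr>carrier := S\<rparr>)"
proof -
  note c = subsetD[OF subframeD(1)[OF S]]
  interpret P: partial_order "L\<lparr>carrier := S\<rparr>"
  proof unfold_locales
    show "x .=\<^bsub>L\<lparr>carrier := S\<rparr>\<^esub> x" for x by (simp add: eq_is_equal)
    show "x \<sqsubseteq>\<^bsub>L\<lparr>carrier := S\<rparr>\<^esub> x" if "x \<in> carrier (L\<lparr>carrier := S\<rparr>)" for x using that c by simp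
    show "x .=\<^bsub>L\<lparr>carrier := S\<rparr>\<^esub> y" if "x \<sqsubseteq>\<^bsub>L\<lparr>carrier := S\<rparr>\<^esub> y" "y \<sqsubseteq>\<^bsub>L\<lparr>carrier := S\<rparr>\<^esub> x"
      "x \<in> carrier (L\<lparr>carrier := S\<rparr>)" "y \<in> carrier (L\<lparr>carrier := S\<rparr>)" for x y
      using that c by (simp add: eq_is_equal le_antisym)
    show "x \<sqsubseteq>\<^bsub>L\<lparr>carrier := S\<rparr>\<^esub> z" if "x \<sqsubseteq>\<^bsub>L\<lparr>carrier := S\<rparr>\<^esub> y" "y \<sqsubseteq>\<^bsub>L\<lparr>carrier := S\<rparr>\<^esub> z"
      "x \<in> carrier (L\<lparr>carrier := S\<rparr>)" "y \<in> carrier (L\<lparr>carrier := S\<rparr>)" "z \<in> carrier (L\<lparr>carrier := S\<rparr>)" for x y z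
      using that le_trans[of x y z] c by simp
  qed (simp_all add: eq_is_equal)
  show ?thesis
  proof unfold_locales
    fix A assume A: "A \<subseteq> carrier (L\<lparr>carrier := S\<rparr>)"
    then have A: "A \<subseteq> S" by simp
    then show "\<exists>s. is_lub (L\<lparr>carrier := S\<rparr>) s A" using subframe_is_lub by blast
    \<comment> \<open>A subframe need not be closed under infinite meets of \<open>L\<close>; the
      infimum is the join of the lower bounds that lie in \<open>S\<close>.\<close>
    let ?B = "{b \<in> S. \<forall>a\<in>A. b \<sqsubseteq>\<^bsub>L\<^esub> a}"
    have "is_glb (L\<lparr>carrier := S\<rparr>) (\<Squnion>\<^bsub>L\<^esub> ?B) A"
    proof (rule greatest_LowerI)
      show "x \<in> A \<Longrightarrow> \<Squnion>\<^bsub>L\<^esub> ?B \<sqsubseteq>\<^bsub>L\<lparr>carrier := S\<rparr>\<^esub> x" for x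
        using A c by (auto intro!: sup_least)
      show "y \<in> Lower (L\<lparr>carrier := S\<rparr>) A \<Longrightarrow> y \<sqsubseteq>\<^bsub>L\<lparr>carrier := S\<rparr>\<^esub> \<Squnion>\<^bsub>L\<^esub> ?B" for y
        using A c by (auto intro!: sup_upper simp: Lower_def)
      show "\<Squnion>\<^bsub>L\<^esub> ?B \<in> carrier (L\<lparr>carrier := S\<rparr>)" using subframeD(2)[OF S, of ?B] by auto
    qed (use A in simp)
    then show "\<exists>s. is_glb (L\<lparr>carrier := S\<rparr>) s A" by blast
  qed
qed

lemma subframe_sup: "A \<subseteq> S \<Longrightarrow> \<Squnion>\<^bsub>L\<lparr>carrier := S\<rparr>\<^esub> A = \<Squnion>\<^bsub>L\<^esub> A"
  using subframeD(1,2)[OF S] by (intro complete_sup_eqI[OF subframe_complete]) (auto intro!: sup_upper sup_least)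

lemma subframe_meet: "x \<in> S \<Longrightarrow> y \<in> S \<Longrightarrow> x \<sqinter>\<^bsub>L\<lparr>carrier := S\<rparr>\<^esub> y = x \<sqinter>\<^bsub>L\<^esub> y"
  using subframeD(1,4)[OF S]
  by (intro complete_meet_eqI[OF subframe_complete]) (auto intro: meet_left meet_right meet_le)

lemma subframe_top: "\<top>\<^bsub>L\<lparr>carrier := S\<rparr>\<^esub> = \<top>\<^bsub>L\<^esub>"
  using subframeD(1,3)[OF S] by (intro complete_top_eqI[OF subframe_complete]) auto

lemma subframe_join: "x \<in> S \<Longrightarrow> y \<in> S \<Longrightarrow> x \<squnion>\<^bsub>L\<lparr>carrier := S\<rparr>\<^esub> y = x \<squnion>\<^bsub>L\<^esub> y"
  by (simp add: join_def subframe_sup)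

lemma subframe_frame: "frame (L\<lparr>carrier := S\<rparr>)"
proof (intro frame.intro subframe_complete frame_axioms.intro)
  fix x A assume x: "x \<in> carrier (L\<lparr>carrier := S\<rparr>)" and A: "A \<subseteq> carrier (L\<lparr>carrier := S\<rparr>)"
  have eq: "(\<lambda>a. x \<sqinter>\<^bsub>L\<lparr>carrier := S\<rparr>\<^esub> a) ` A = (\<lambda>a. x \<sqinter>\<^bsub>L\<^esub> a) ` A"
    by (rule image_cong[OF HOL.refl]) (use x A subframe_meet in auto)
  have "(\<lambda>a. x \<sqinter>\<^bsub>L\<^esub> a) ` A \<subseteq> S" using x A subframeD(4)[OF S] by auto
  moreover have "x \<in> carrier L" "A \<subseteq> carrier L" using x A subframeD(1)[OF S] by auto
  ultimately show "x \<sqinter>\<^bsub>L\<lparr>carrier := S\<rparr>\<^esub> \<Squnion>\<^bsub>L\<lparr>carrier := S\<rparr>\<^esub> A = \<Squnion>\<^bsub>L\<lparr>carrier := S\<rparr>\<^esub> ((\<lambda>a. x \<sqinter>\<^bsub>L\<lparr>carrier := S\<rparr>\<^esub> a) ` A)"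
    using x A subframeD(2)[OF S] unfolding eq
    by (simp add: subframe_sup subframe_meet meet_sup_distrib)
qed

end

lemma generated_subframe_subframe:
  assumes "frame L" "G \<subseteq> carrier L"
  shows "subframe L (carrier (generated_subframe L G))" "G \<subseteq> carrier (generated_subframe L G)"
proof -
  interpret frame L by fact
  \<comment> \<open>Makes the intersected family nonempty, so that the intersection stays inside the
    carrier.\<close>
  have "subframe L (carrier L)" by (auto simp: subframe_def)
  then show "subframe L (carrier (generated_subframe L G))"
    using assms(2) unfolding subframe_def[of L "carrier (generated_subframe L G)"]
    apply (simp add: generated_subframe_def)
    apply (intro conjI allI impI ballI)
    subgoal by auto
    subgoal by (auto intro!: subframeD(2))
    subgoal by (auto intro: subframeD(3))
    subgoal by (auto intro: subframeD(4))
    done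
qed (auto simp: generated_subframe_def)

lemma generated_subframe_least:
  "subframe L S \<Longrightarrow> G \<subseteq> S \<Longrightarrow> carrier (generated_subframe L G) \<subseteq> S"
  by (auto simp: generated_subframe_def)

lemma generated_subframe_eq: "generated_subframe L G = L\<lparr>carrier := carrier (generated_subframe L G)\<rparr>"
  by (simp add: generated_subframe_def)

text \<open>Meets distribute over joins, so closing a meet-closed set under joins once already gives
  a subframe.\<close>

lemma sups_subframe:
  assumes "frame L" "B \<subseteq> carrier L" "\<top>\<^bsub>L\<^esub> \<in> B" "\<And>x y. x \<in> B \<Longrightarrow> y \<in> B \<Longrightarrow> x \<sqinter>\<^bsub>L\<^esub> y \<in> B"
  shows "subframe L {\<Squnion>\<^bsub>L\<^esub> A | A. A \<subseteq> B}" "B \<subseteq> {\<Squnion>\<^bsub>L\<^esub> A | A. A \<subseteq> B}"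
proof -
  interpret frame L by fact
  show B: "B \<subseteq> {\<Squnion>\<^bsub>L\<^esub> A | A. A \<subseteq> B}"
  proof
    fix b assume "b \<in> B"
    then have "b = \<Squnion>\<^bsub>L\<^esub> {b}" "{b} \<subseteq> B" using assms(2) by auto
    then show "b \<in> {\<Squnion>\<^bsub>L\<^esub> A | A. A \<subseteq> B}" by blast
  qed
  show "subframe L {\<Squnion>\<^bsub>L\<^esub> A | A. A \<subseteq> B}"
    unfolding subframe_def
  proof (intro conjI allI impI ballI)
    show "{\<Squnion>\<^bsub>L\<^esub> A | A. A \<subseteq> B} \<subseteq> carrier L" using assms(2) by auto
    show "\<top>\<^bsub>L\<^esub> \<in> {\<Squnion>\<^bsub>L\<^esub> A | A. A \<subseteq> B}" using B assms(3) by blast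
    fix X assume X: "X \<subseteq> {\<Squnion>\<^bsub>L\<^esub> A | A. A \<subseteq> B}"
    \<comment> \<open>All subsets of \<open>B\<close> with join in \<open>X\<close> are taken, which
      avoids choosing one for each element of \<open>X\<close>.\<close>
    let ?Y = "{A. A \<subseteq> B \<and> \<Squnion>\<^bsub>L\<^esub> A \<in> X}"
    have "X = (\<lambda>X. \<Squnion>\<^bsub>L\<^esub> X) ` ?Y" using X by auto
    moreover have "\<Squnion>\<^bsub>L\<^esub> (\<Union>?Y) = \<Squnion>\<^bsub>L\<^esub> ((\<lambda>X. \<Squnion>\<^bsub>L\<^esub> X) ` ?Y)" by (rule sup_UN) (use assms(2) in auto)
    moreover have "\<Union>?Y \<subseteq> B" by blast
    ultimately show "\<Squnion>\<^bsub>L\<^esub> X \<in> {\<Squnion>\<^bsub>L\<^esub> A | A. A \<subseteq> B}"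
      by (intro CollectI exI[of _ "\<Union>?Y"]) simp
  next
    fix x y assume "x \<in> {\<Squnion>\<^bsub>L\<^esub> A | A. A \<subseteq> B}" "y \<in> {\<Squnion>\<^bsub>L\<^esub> A | A. A \<subseteq> B}"
    then obtain A A' where A: "A \<subseteq> B" "A' \<subseteq> B" "x = \<Squnion>\<^bsub>L\<^esub> A" "y = \<Squnion>\<^bsub>L\<^esub> A'" by blast
    have "x \<sqinter>\<^bsub>L\<^esub> y = \<Squnion>\<^bsub>L\<^esub> {a \<sqinter>\<^bsub>L\<^esub> b | a b. a \<in> A \<and> b \<in> A'}"
      unfolding A using A assms(2) by (intro sup_meet_sup) auto
    moreover have "{a \<sqinter>\<^bsub>L\<^esub> b | a b. a \<in> A \<and> b \<in> A'} \<subseteq> B" using A assms(4) by auto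
    ultimately show "x \<sqinter>\<^bsub>L\<^esub> y \<in> {\<Squnion>\<^bsub>L\<^esub> A | A. A \<subseteq> B}" by auto
  qed
qed

text \<open>The set where two frame maps agree is a subframe, hence everything once it contains the
  generators.\<close>

lemma generated_subframe_map_eq:
  assumes K: "frame K" and G: "G \<subseteq> carrier K" and M: "frame M"
    and h: "h \<in> frame_maps (generated_subframe K G) M" "k \<in> frame_maps (generated_subframe K G) M"
    and eq: "\<And>x. x \<in> G \<Longrightarrow> h x = k x"
  shows "h = k"
proof -
  interpret M: frame M by fact
  let ?S = "carrier (generated_subframe K G)"
  note sub = generated_subframe_subframe[OF K G]
  have s: "\<Squnion>\<^bsub>generated_subframe K G\<^esub> A = \<Squnion>\<^bsub>K\<^esub> A" if "A \<subseteq> ?S" for A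
    using subframe_sup[OF K sub(1) that] generated_subframe_eq[of K G] by simp
  have m: "x \<sqinter>\<^bsub>generated_subframe K G\<^esub> y = x \<sqinter>\<^bsub>K\<^esub> y" if "x \<in> ?S" "y \<in> ?S" for x y
    using subframe_meet[OF K sub(1) that] generated_subframe_eq[of K G] by simp
  have t: "\<top>\<^bsub>generated_subframe K G\<^esub> = \<top>\<^bsub>K\<^esub>"
    using subframe_top[OF K sub(1)] generated_subframe_eq[of K G] by simp
  have "subframe K {x \<in> ?S. h x = k x}"
    unfolding subframe_def
  proof (intro conjI allI impI ballI)
    show "{x \<in> ?S. h x = k x} \<subseteq> carrier K" using subframeD(1)[OF sub(1)] by blast
    show "\<top>\<^bsub>K\<^esub> \<in> {x \<in> ?S. h x = k x}"
      using subframeD(3)[OF sub(1)] frame_mapsD(4)[OF h(1)] frame_mapsD(4)[OF h(2)] t by simp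
    fix A assume A: "A \<subseteq> {x \<in> ?S. h x = k x}"
    then have A': "A \<subseteq> ?S" by blast
    have "h ` A = k ` A" by (rule image_cong[OF refl]) (use A in blast)
    then show "\<Squnion>\<^bsub>K\<^esub> A \<in> {x \<in> ?S. h x = k x}"
      using subframeD(2)[OF sub(1) A'] frame_mapsD(3)[OF h(1) A'] frame_mapsD(3)[OF h(2) A'] s[OF A'] by simp
  next
    fix x y assume "x \<in> {x \<in> ?S. h x = k x}" "y \<in> {x \<in> ?S. h x = k x}"
    then show "x \<sqinter>\<^bsub>K\<^esub> y \<in> {x \<in> ?S. h x = k x}"
      using subframeD(4)[OF sub(1), of x y] frame_mapsD(5)[OF h(1), of x y] frame_mapsD(5)[OF h(2), of x y] m[of x y] by simp
  qed
  then have "?S \<subseteq> {x \<in> ?S. h x = k x}"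
    by (rule generated_subframe_least) (use sub eq in blast)
  then show ?thesis
    by (intro PiE_ext[OF frame_mapsD(1)[OF h(1)] frame_mapsD(1)[OF h(2)]]) blast
qed


section \<open>The frame of congruences\<close>

lemma congruence_frame_simps [simp]:
  "carrier (congruence_frame L) = {C. frame_congruence L C}"
  "eq (congruence_frame L) = (=)"
  "le (congruence_frame L) = (\<subseteq>)"
  by (simp_all add: congruence_frame_def)

lemma frame_congruenceI:
  assumes "C \<subseteq> carrier L \<times> carrier L"
    and "\<And>x. x \<in> carrier L \<Longrightarrow> (x, x) \<in> C"
    and "\<And>x y. (x, y) \<in> C \<Longrightarrow> (y, x) \<in> C"
    and "\<And>x y z. (x, y) \<in> C \<Longrightarrow> (y, z) \<in> C \<Longrightarrow> (x, z) \<in> C"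
    and "\<And>B. B \<subseteq> C \<Longrightarrow> (\<Squnion>\<^bsub>L\<^esub> (fst ` B), \<Squnion>\<^bsub>L\<^esub> (snd ` B)) \<in> C"
    and "\<And>a b c d. (a, b) \<in> C \<Longrightarrow> (c, d) \<in> C \<Longrightarrow> (a \<sqinter>\<^bsub>L\<^esub> c, b \<sqinter>\<^bsub>L\<^esub> d) \<in> C"
  shows "frame_congruence L C"
proof -
  have "equiv (carrier L) C"
    using assms(1-4) by (intro equivI refl_onI symI transI)
  then show ?thesis unfolding frame_congruence_def using assms(5,6) by auto
qed

lemma Inter_congruence:
  assumes L: "frame L" and A: "\<And>C. C \<in> \<A> \<Longrightarrow> frame_congruence L C" and "\<A> \<noteq> {}"
  shows "frame_congruence L (\<Inter>\<A>)"
proof (rule frame_congruenceI)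
  show "\<Inter>\<A> \<subseteq> carrier L \<times> carrier L" using \<open>\<A> \<noteq> {}\<close> cong_closed[OF L A] by fastforce
  show "(x, x) \<in> \<Inter>\<A>" if "x \<in> carrier L" for x using that cong_refl[OF L A] by blast
  show "(y, x) \<in> \<Inter>\<A>" if "(x, y) \<in> \<Inter>\<A>" for x y using that cong_sym[OF L A] by blast
  show "(x, z) \<in> \<Inter>\<A>" if "(x, y) \<in> \<Inter>\<A>" "(y, z) \<in> \<Inter>\<A>" for x y z using that cong_trans[OF L A] by blast
  show "(\<Squnion>\<^bsub>L\<^esub> (fst ` B), \<Squnion>\<^bsub>L\<^esub> (snd ` B)) \<in> \<Inter>\<A>" if "B \<subseteq> \<Inter>\<A>" for B
  proof
    fix C assume C: "C \<in> \<A>"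
    show "(\<Squnion>\<^bsub>L\<^esub> (fst ` B), \<Squnion>\<^bsub>L\<^esub> (snd ` B)) \<in> C"
      by (rule cong_sup[OF L A[OF C]]) (use C that in auto)
  qed
  show "(a \<sqinter>\<^bsub>L\<^esub> c, b \<sqinter>\<^bsub>L\<^esub> d) \<in> \<Inter>\<A>" if "(a, b) \<in> \<Inter>\<A>" "(c, d) \<in> \<Inter>\<A>" for a b c d
    using that cong_meet[OF L A] by blast
qed

lemma Int_congruence:
  "\<lbrakk>frame L; frame_congruence L C; frame_congruence L D\<rbrakk> \<Longrightarrow> frame_congruence L (C \<inter> D)"
  using Inter_congruence[of L "{C, D}"] by auto

lemma congruence_frame_complete:
  assumes "frame L"
  shows "complete_lattice (congruence_frame L)"
  unfolding congruence_frame_def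
proof (rule inclusion_order_complete)
  show "carrier L \<times> carrier L \<in> {C. frame_congruence L C}"
    by (simp add: total_congruence[OF assms])
  show "\<Inter>A \<in> {C. frame_congruence L C}" if "A \<subseteq> {C. frame_congruence L C}" "A \<noteq> {}" for A
    using Inter_congruence[OF assms, of A] that by auto
  show "X \<subseteq> carrier L \<times> carrier L" if "X \<in> {C. frame_congruence L C}" for X
    using that cong_closed[OF assms, of X] by auto
qed

lemma congruence_frame_meet:
  "\<lbrakk>frame L; frame_congruence L C; frame_congruence L D\<rbrakk> \<Longrightarrow> C \<sqinter>\<^bsub>congruence_frame L\<^esub> D = C \<inter> D"
  by (rule complete_meet_eqI[OF congruence_frame_complete]) (auto simp: Int_congruence)

lemma congruence_frame_top: "frame L \<Longrightarrow> \<top>\<^bsub>congruence_frame L\<^esub> = carrier L \<times> carrier L"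
  by (rule complete_top_eqI[OF congruence_frame_complete])
    (auto simp: total_congruence dest: cong_closed)

text \<open>The locale \<open>frame\<close> allows extensions of the record \<open>gorder\<close>,
  but \<open>nabla\<close>, \<open>delta\<close> and \<open>congruence_frame\<close> take a plain
  \<open>gorder\<close>; this copy fixes the type.\<close>

locale gorder_frame = frame L for L :: "'a gorder" (structure)
begin

section \<open>Clipping to an interval, and distributivity of the lattice of congruences\<close>

lemma meet_join_distrib_right:
  "\<lbrakk>x \<in> carrier L; y \<in> carrier L; z \<in> carrier L\<rbrakk> \<Longrightarrow> (y \<sqinter> z) \<squnion> x = (y \<squnion> x) \<sqinter> (z \<squnion> x)"
  using join_meet_distrib[of x y z] by (simp only: join_comm[of L x])

lemma meet_meet_distrib_right:
  assumes c: "x \<in> carrier L" "y \<in> carrier L" "z \<in> carrier L"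
  shows "(y \<sqinter> z) \<sqinter> x = (y \<sqinter> x) \<sqinter> (z \<sqinter> x)"
  using meet_interchange[of y z x x] assms by (simp add: meet_idem)

lemma cong_join:
  assumes C: "frame_congruence L C" and "(a, b) \<in> C" "(c, d) \<in> C"
  shows "(a \<squnion> c, b \<squnion> d) \<in> C"
proof -
  \<comment> \<open>\<open>cong_sup\<close> joins indexed families; the two pairs are indexed by the
    Booleans.\<close>
  have "(\<Squnion>((\<lambda>i. if i then a else c) ` UNIV), \<Squnion>((\<lambda>i. if i then b else d) ` UNIV)) \<in> C"
    by (rule cong_sup[OF frame_axioms C]) (use assms in auto)
  moreover have "range (\<lambda>i. if i then a else c) = {a, c}" "range (\<lambda>i. if i then b else d) = {b, d}" for a b c d :: 'a
    by (auto simp: UNIV_bool)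
  ultimately show ?thesis by (simp add: join_def)
qed

lemma cong_convex:
  assumes C: "frame_congruence L C" and ab: "(a, b) \<in> C" and x: "x \<in> carrier L" "a \<sqsubseteq> x" "x \<sqsubseteq> b"
  shows "(a, x) \<in> C"
proof -
  have c: "a \<in> carrier L" "b \<in> carrier L" using cong_closed[OF frame_axioms C ab] by auto
  have "(a \<sqinter> x, b \<sqinter> x) \<in> C" by (rule cong_meet[OF frame_axioms C ab cong_refl[OF frame_axioms C x(1)]])
  then show ?thesis using c x by (simp add: meet_eq_left meet_eq_right)
qed

text \<open>For \<open>a \<sqsubseteq> b\<close> this is the retraction of the frame onto the
  interval from \<open>a\<close> to \<open>b\<close>. An implication of congruences must test a pair
  inside every interval that the first congruence collapses.\<close>

definition clip :: "'a \<Rightarrow> 'a \<Rightarrow> 'a \<Rightarrow> 'a"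
  where "clip a b x = (x \<sqinter> b) \<squnion> a"

lemma clip_meet:
  assumes "a \<in> carrier L" "b \<in> carrier L" "x \<in> carrier L" "y \<in> carrier L"
  shows "clip a b (x \<sqinter> y) = clip a b x \<sqinter> clip a b y"
  using assms by (simp add: clip_def meet_join_distrib_right meet_meet_distrib_right[of b x y])

text \<open>The join with \<open>a\<close> on the right accounts for the empty family, since
  \<open>clip a b\<close> sends the bottom element to \<open>a\<close>.\<close>

lemma clip_sup:
  assumes "a \<in> carrier L" "b \<in> carrier L" "A \<subseteq> carrier L"
  shows "clip a b (\<Squnion>A) = a \<squnion> \<Squnion>(clip a b ` A)"
proof -
  have c: "x \<in> A \<Longrightarrow> x \<in> carrier L" for x using assms by auto
  have t: "clip a b ` A \<subseteq> carrier L" "(\<lambda>x. x \<sqinter> b) ` A \<subseteq> carrier L" using assms c by (auto simp: clip_def)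
  show ?thesis
  proof (rule le_antisym)
    have "x \<sqinter> b \<sqsubseteq> a \<squnion> \<Squnion>(clip a b ` A)" if "x \<in> A" for x
    proof -
      have "x \<sqinter> b \<sqsubseteq> clip a b x" using assms c[OF that] by (simp add: clip_def join_left)
      also have "\<dots> \<sqsubseteq> \<Squnion>(clip a b ` A)" by (rule sup_upper[OF t(1)]) (use that in auto)
      also have "\<dots> \<sqsubseteq> a \<squnion> \<Squnion>(clip a b ` A)" using assms t by (simp add: join_right)
      finally show ?thesis using assms t c[OF that] by (auto simp: clip_def)
    qed
    then show "clip a b (\<Squnion>A) \<sqsubseteq> a \<squnion> \<Squnion>(clip a b ` A)"
      using assms t c unfolding clip_def[of a b "\<Squnion>A"]
      by (subst sup_meet_distrib) (auto simp: join_le_iff join_left intro!: sup_least)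
    have "clip a b x \<sqsubseteq> clip a b (\<Squnion>A)" if "x \<in> A" for x
    proof -
      have "x \<sqinter> b \<sqsubseteq> \<Squnion>A \<sqinter> b" using assms c[OF that] that by (intro meet_mono sup_upper) auto
      moreover have "\<Squnion>A \<sqinter> b \<sqsubseteq> (\<Squnion>A \<sqinter> b) \<squnion> a" using assms by (simp add: join_left)
      ultimately have "x \<sqinter> b \<sqsubseteq> (\<Squnion>A \<sqinter> b) \<squnion> a" using assms c[OF that] by (auto elim: le_trans)
      then show ?thesis using assms c[OF that] unfolding clip_def by (simp add: join_le_iff join_right)
    qed
    then show "a \<squnion> \<Squnion>(clip a b ` A) \<sqsubseteq> clip a b (\<Squnion>A)"
      using assms t by (auto simp: join_le_iff clip_def[of a b "\<Squnion>A"] join_right intro!: sup_least)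
  qed (use assms t in \<open>auto simp: clip_def[of a b "\<Squnion>A"]\<close>)
qed

text \<open>Clipping preserves binary meets, and joins up to a join with \<open>a\<close>; this
  defect is absorbed by the pair \<open>(a, a)\<close> of \<open>E\<close>.\<close>

lemma clip_inverse_congruence:
  assumes E: "frame_congruence L E" and c: "a \<in> carrier L" "b \<in> carrier L"
  shows "frame_congruence L {(x, y) \<in> carrier L \<times> carrier L. (clip a b x, clip a b y) \<in> E}" (is "frame_congruence L ?I")
proof (rule frame_congruenceI)
  note E' = frame_axioms E
  have tc: "x \<in> carrier L \<Longrightarrow> clip a b x \<in> carrier L" for x using c by (simp add: clip_def)
  show "?I \<subseteq> carrier L \<times> carrier L" by blast
  show "(x, x) \<in> ?I" if "x \<in> carrier L" for x using that tc cong_refl[OF E'] by auto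
  show "(y, x) \<in> ?I" if "(x, y) \<in> ?I" for x y using that cong_sym[OF E'] by auto
  show "(x, z) \<in> ?I" if "(x, y) \<in> ?I" "(y, z) \<in> ?I" for x y z using that cong_trans[OF E'] by auto
  show "(x \<sqinter> u, y \<sqinter> v) \<in> ?I" if "(x, y) \<in> ?I" "(u, v) \<in> ?I" for x y u v
    using that c cong_meet[OF E'] by (auto simp: clip_meet)
  show "(\<Squnion>(fst ` B), \<Squnion>(snd ` B)) \<in> ?I" if "B \<subseteq> ?I" for B
  proof -
    have cl: "fst ` B \<subseteq> carrier L" "snd ` B \<subseteq> carrier L" using that by auto
    have "(\<Squnion>((\<lambda>p. clip a b (fst p)) ` B), \<Squnion>((\<lambda>p. clip a b (snd p)) ` B)) \<in> E"
      by (rule cong_sup[OF E']) (use that in auto)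
    then have "(a \<squnion> \<Squnion>(clip a b ` fst ` B), a \<squnion> \<Squnion>(clip a b ` snd ` B)) \<in> E"
      unfolding image_image by (rule cong_join[OF E cong_refl[OF E' c(1)]])
    then show ?thesis using cl c by (simp add: clip_sup)
  qed
qed

text \<open>\<open>{(x, y). \<forall>(a, b) \<in> C. a \<sqsubseteq> b \<longrightarrow> (clip a b x, clip a b y) \<in> E}\<close> is the Heyting implication
  \<open>C \<Rightarrow> E\<close> of congruences, and the existence of implications is the infinite distributive law.\<close>

lemma congruence_implication:
  assumes C: "frame_congruence L C" and E: "frame_congruence L E"
  obtains I where "frame_congruence L I"
    and "\<And>D. frame_congruence L D \<Longrightarrow> D \<inter> C \<subseteq> E \<longleftrightarrow> D \<subseteq> I"
proof
  let ?J = "\<lambda>a b. {(x, y) \<in> carrier L \<times> carrier L. (clip a b x, clip a b y) \<in> E}"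
  let ?A = "{?J a b | a b. (a, b) \<in> C \<and> a \<sqsubseteq> b}"
  note C' = frame_axioms C and E' = frame_axioms E
  have "(\<top>, \<top>) \<in> C" by (rule cong_refl[OF C']) simp
  then have "?A \<noteq> {}" by force
  moreover have "frame_congruence L J" if "J \<in> ?A" for J
  proof -
    obtain a b where "J = ?J a b" "(a, b) \<in> C" using \<open>J \<in> ?A\<close> by blast
    then show ?thesis using clip_inverse_congruence[OF E] cong_closed[OF C'] by simp
  qed
  ultimately show "frame_congruence L (\<Inter>?A)" by (intro Inter_congruence frame_axioms)
  fix D assume D: "frame_congruence L D"
  note D' = frame_axioms D
  show "D \<inter> C \<subseteq> E \<longleftrightarrow> D \<subseteq> \<Inter>?A"
  proof
    assume le: "D \<inter> C \<subseteq> E"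
    have "(clip a b x, clip a b y) \<in> E" if xy: "(x, y) \<in> D" and ab: "(a, b) \<in> C" "a \<sqsubseteq> b" for x y a b
    proof -
      have c: "a \<in> carrier L" "b \<in> carrier L" "x \<in> carrier L" "y \<in> carrier L"
        using cong_closed[OF C' ab(1)] cong_closed[OF D' xy] by auto
      have "(clip a b x, clip a b y) \<in> D"
        unfolding clip_def by (rule cong_join[OF D cong_meet[OF D' xy cong_refl[OF D' c(2)]] cong_refl[OF D' c(1)]])
      \<comment> \<open>Clipped elements lie between \<open>a\<close> and \<open>b\<close>, which
        \<open>C\<close> identifies, so by convexity they all belong to one class of
        \<open>C\<close>. The clipped pair is thus in \<open>D \<inter> C\<close>.\<close>
      moreover have *: "(a, clip a b z) \<in> C" if "z \<in> carrier L" for z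
        by (rule cong_convex[OF C ab(1)])
          (use c ab(2) that in \<open>auto simp: clip_def join_right join_le_iff meet_right\<close>)
      have "(clip a b x, clip a b y) \<in> C"
        by (rule cong_trans[OF C' cong_sym[OF C' *[OF c(3)]] *[OF c(4)]])
      ultimately show ?thesis using le by blast
    qed
    then show "D \<subseteq> \<Inter>?A" using cong_closed[OF D'] by auto
  next
    assume le: "D \<subseteq> \<Inter>?A"
    show "D \<inter> C \<subseteq> E"
    proof
      fix p assume p: "p \<in> D \<inter> C"
      obtain x y where xy: "p = (x, y)" by force
      have c: "x \<in> carrier L" "y \<in> carrier L" using p xy cong_closed[OF D'] by auto
      \<comment> \<open>\<open>C\<close> collapses the interval from \<open>x \<sqinter> y\<close>
        to \<open>x \<squnion> y\<close>. Clipping to it fixes both members of the pair, so this one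
        interval already yields \<open>(x, y) \<in> E\<close>.\<close>
      have 1: "(x \<sqinter> y, y) \<in> C" "(x, y) \<in> C"
        using cong_meet[OF C', of x y y y] cong_refl[OF C'] p xy c by (auto simp: meet_idem)
      have 2: "(x, x \<squnion> y) \<in> C"
        using cong_join[OF C, of x x x y] cong_refl[OF C'] 1(2) c by (auto simp: join_idem)
      have "(x \<sqinter> y, x \<squnion> y) \<in> C" by (rule cong_trans[OF C' cong_trans[OF C' 1(1) cong_sym[OF C' 1(2)]] 2])
      moreover have "x \<sqinter> y \<sqsubseteq> x \<squnion> y"
        by (rule le_trans[OF meet_left[OF c] join_left[OF c]]) (use c in auto)
      ultimately have "?J (x \<sqinter> y) (x \<squnion> y) \<in> ?A" by blast
      then have "(x, y) \<in> ?J (x \<sqinter> y) (x \<squnion> y)" using le p xy by blast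
      moreover have "clip (x \<sqinter> y) (x \<squnion> y) x = x" "clip (x \<sqinter> y) (x \<squnion> y) y = y"
        using c by (simp_all add: clip_def meet_eq_left join_left join_right join_eq_left meet_left meet_right)
      ultimately show "p \<in> E" using xy by simp
    qed
  qed
qed

text \<open>Meeting with \<open>C\<close> has implication as right adjoint. Taking the implication
  \<open>I\<close> from \<open>C\<close> to the join of all meets, every member of
  \<open>\<D>\<close> lies below \<open>I\<close>, hence so does their join.\<close>

lemma congruence_frame_frame: "frame (congruence_frame L)"
proof (rule frame.intro[OF congruence_frame_complete[OF frame_axioms] frame_axioms.intro])
  interpret K: complete_lattice "congruence_frame L" by (rule congruence_frame_complete[OF frame_axioms])
  fix C \<D> assume C: "C \<in> carrier (congruence_frame L)" and D: "\<D> \<subseteq> carrier (congruence_frame L)"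
  let ?M = "(\<lambda>D. C \<sqinter>\<^bsub>congruence_frame L\<^esub> D) ` \<D>"
  have M: "?M \<subseteq> carrier (congruence_frame L)" using C D by (auto simp del: congruence_frame_simps)
  note S = K.sup_closed[OF D] and SM = K.sup_closed[OF M]
  obtain I where I: "frame_congruence L I"
    "\<And>D. frame_congruence L D \<Longrightarrow> D \<inter> C \<subseteq> \<Squnion>\<^bsub>congruence_frame L\<^esub> ?M \<longleftrightarrow> D \<subseteq> I"
    using congruence_implication[of C "\<Squnion>\<^bsub>congruence_frame L\<^esub> ?M"] C SM by auto
  have "\<Squnion>\<^bsub>congruence_frame L\<^esub> \<D> \<sqsubseteq>\<^bsub>congruence_frame L\<^esub> I"
  proof (rule K.sup_least[OF D])
    fix X assume X: "X \<in> \<D>"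
    have "C \<sqinter>\<^bsub>congruence_frame L\<^esub> X \<sqsubseteq>\<^bsub>congruence_frame L\<^esub> \<Squnion>\<^bsub>congruence_frame L\<^esub> ?M"
      by (rule K.sup_upper[OF M]) (use X in blast)
    then have "X \<inter> C \<subseteq> \<Squnion>\<^bsub>congruence_frame L\<^esub> ?M"
      using X C D by (subst (asm) congruence_frame_meet) (auto simp: frame_axioms)
    then show "X \<sqsubseteq>\<^bsub>congruence_frame L\<^esub> I" using I(2)[of X] X D by auto
  qed (use I in simp)
  then have "C \<sqinter>\<^bsub>congruence_frame L\<^esub> \<Squnion>\<^bsub>congruence_frame L\<^esub> \<D> \<sqsubseteq>\<^bsub>congruence_frame L\<^esub> \<Squnion>\<^bsub>congruence_frame L\<^esub> ?M"
    using I(2)[of "\<Squnion>\<^bsub>congruence_frame L\<^esub> \<D>"] C S by (subst congruence_frame_meet) (auto simp: frame_axioms)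
  moreover have "\<Squnion>\<^bsub>congruence_frame L\<^esub> ?M \<sqsubseteq>\<^bsub>congruence_frame L\<^esub> C \<sqinter>\<^bsub>congruence_frame L\<^esub> \<Squnion>\<^bsub>congruence_frame L\<^esub> \<D>"
  proof (rule K.sup_least[OF M])
    fix X assume "X \<in> ?M"
    then obtain D' where D': "D' \<in> \<D>" "X = C \<sqinter>\<^bsub>congruence_frame L\<^esub> D'" by blast
    have "D' \<sqsubseteq>\<^bsub>congruence_frame L\<^esub> \<Squnion>\<^bsub>congruence_frame L\<^esub> \<D>" by (rule K.sup_upper[OF D D'(1)])
    moreover have "D' \<in> carrier (congruence_frame L)" using D' D by blast
    ultimately show "X \<sqsubseteq>\<^bsub>congruence_frame L\<^esub> C \<sqinter>\<^bsub>congruence_frame L\<^esub> \<Squnion>\<^bsub>congruence_frame L\<^esub> \<D>"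
      unfolding D'(2) using C S
      by (intro K.meet_le K.le_trans[OF K.meet_right[of C D']] K.meet_left) (simp_all del: congruence_frame_simps)
  qed (use C S in \<open>simp del: congruence_frame_simps\<close>)
  ultimately show "C \<sqinter>\<^bsub>congruence_frame L\<^esub> \<Squnion>\<^bsub>congruence_frame L\<^esub> \<D> = \<Squnion>\<^bsub>congruence_frame L\<^esub> ?M"
    by (rule K.le_antisym) (use C S SM in \<open>simp_all del: congruence_frame_simps\<close>)
qed

lemma congruence_sup_le_iff:
  "\<lbrakk>\<And>C. C \<in> \<A> \<Longrightarrow> frame_congruence L C; frame_congruence L E\<rbrakk> \<Longrightarrow>
    \<Squnion>\<^bsub>congruence_frame L\<^esub> \<A> \<subseteq> E \<longleftrightarrow> (\<forall>C\<in>\<A>. C \<subseteq> E)"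
  using frame.sup_le_iff[OF congruence_frame_frame, of \<A> E] by auto

lemma congruence_sup_closed:
  "(\<And>C. C \<in> \<A> \<Longrightarrow> frame_congruence L C) \<Longrightarrow> frame_congruence L (\<Squnion>\<^bsub>congruence_frame L\<^esub> \<A>)"
proof -
  interpret K: frame "congruence_frame L" by (rule congruence_frame_frame)
  show "(\<And>C. C \<in> \<A> \<Longrightarrow> frame_congruence L C) \<Longrightarrow> frame_congruence L (\<Squnion>\<^bsub>congruence_frame L\<^esub> \<A>)"
    using K.sup_closed[of \<A>] by auto
qed

lemma congruence_sup_upper:
  "\<lbrakk>\<And>C. C \<in> \<A> \<Longrightarrow> frame_congruence L C; C \<in> \<A>\<rbrakk> \<Longrightarrow> C \<subseteq> \<Squnion>\<^bsub>congruence_frame L\<^esub> \<A>"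
  by (meson congruence_sup_closed congruence_sup_le_iff equalityE)

text \<open>A join of congruences is known through the congruences above it, not through its pairs;
  comparing upper bounds avoids describing those pairs.\<close>

lemma congruence_eqI:
  assumes "frame_congruence L C" "frame_congruence L D"
    and "\<And>E. frame_congruence L E \<Longrightarrow> C \<subseteq> E \<longleftrightarrow> D \<subseteq> E"
  shows "C = D"
  using assms by blast


section \<open>Open and closed congruences\<close>

lemma nabla_congruence:
  assumes a: "a \<in> carrier L"
  shows "frame_congruence L (nabla L a)"
proof (rule frame_congruenceI)
  show "(\<Squnion>(fst ` B), \<Squnion>(snd ` B)) \<in> nabla L a" if "B \<subseteq> nabla L a" for B
  proof -
    have cl: "fst ` B \<subseteq> carrier L" "snd ` B \<subseteq> carrier L" using that by (auto simp: nabla_def)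
    \<comment> \<open>Joining with \<open>a\<close> is clipping to the interval from
      \<open>a\<close> to \<open>\<top>\<close>.\<close>
    have t: "\<Squnion>A \<squnion> a = a \<squnion> \<Squnion>((\<lambda>x. x \<squnion> a) ` A)" if "A \<subseteq> carrier L" for A
    proof -
      have "(\<lambda>x. clip a \<top> x) ` A = (\<lambda>x. x \<squnion> a) ` A"
        by (rule image_cong) (use that in \<open>auto simp: clip_def top_meet_eq\<close>)
      then show ?thesis using clip_sup[of a \<top> A] that a by (simp add: clip_def top_meet_eq)
    qed
    have "(\<lambda>x. x \<squnion> a) ` fst ` B = (\<lambda>x. x \<squnion> a) ` snd ` B"
      unfolding image_image by (rule image_cong) (use that in \<open>auto simp: nabla_def\<close>)
    then show ?thesis using cl t by (auto simp: nabla_def)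
  qed
qed (use a in \<open>auto simp: nabla_def meet_join_distrib_right\<close>)

lemma delta_congruence:
  assumes a: "a \<in> carrier L"
  shows "frame_congruence L (delta L a)"
proof (rule frame_congruenceI)
  show "(\<Squnion>(fst ` B), \<Squnion>(snd ` B)) \<in> delta L a" if "B \<subseteq> delta L a" for B
  proof -
    have cl: "fst ` B \<subseteq> carrier L" "snd ` B \<subseteq> carrier L" using that by (auto simp: delta_def)
    have "(\<lambda>x. x \<sqinter> a) ` fst ` B = (\<lambda>x. x \<sqinter> a) ` snd ` B"
      unfolding image_image by (rule image_cong) (use that in \<open>auto simp: delta_def\<close>)
    then show ?thesis using cl a by (auto simp: delta_def sup_meet_distrib)
  qed
  show "(u \<sqinter> v, x \<sqinter> y) \<in> delta L a" if "(u, x) \<in> delta L a" "(v, y) \<in> delta L a" for u v x y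
    using that a by (auto simp: delta_def meet_meet_distrib_right[of a u v] meet_meet_distrib_right[of a x y])
qed (use a in \<open>auto simp: delta_def\<close>)

text \<open>If \<open>x\<close> and \<open>y\<close> have the same join with \<open>t\<close> and
  the same meet with \<open>s\<close>, then
  \<open>x = (x \<sqinter> y) \<squnion> (x \<sqinter> t)\<close>. Modulo \<open>C\<close> one may
  replace \<open>t\<close> by \<open>t \<sqinter> s\<close>, and then the second term falls below
  \<open>x \<sqinter> y\<close>. By symmetry both elements are congruent to
  \<open>x \<sqinter> y\<close>.\<close>

lemma nabla_delta_le_iff:
  assumes t: "t \<in> carrier L" and s: "s \<in> carrier L" and C: "frame_congruence L C"
  shows "nabla L t \<inter> delta L s \<subseteq> C \<longleftrightarrow> (t \<sqinter> s, t) \<in> C"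
proof
  have "(t \<sqinter> s, t) \<in> nabla L t \<inter> delta L s"
    using t s by (simp add: nabla_def delta_def join_eq_right meet_left join_idem meet_assoc meet_idem)
  then show "nabla L t \<inter> delta L s \<subseteq> C \<Longrightarrow> (t \<sqinter> s, t) \<in> C" by blast
next
  assume ts: "(t \<sqinter> s, t) \<in> C"
  note C' = frame_axioms C
  have *: "(x, x \<sqinter> y) \<in> C"
    if c: "x \<in> carrier L" "y \<in> carrier L" and "x \<squnion> t = y \<squnion> t" "x \<sqinter> s = y \<sqinter> s" for x y
  proof -
    have "x = x \<sqinter> (x \<squnion> t)" using c t by (simp add: meet_eq_left join_left)
    also have "\<dots> = (x \<sqinter> y) \<squnion> (x \<sqinter> t)" unfolding that(3) using c t by (simp add: meet_join_distrib)
    finally have x: "x = (x \<sqinter> y) \<squnion> (x \<sqinter> t)" .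
    have "x \<sqinter> (t \<sqinter> s) = (x \<sqinter> s) \<sqinter> t" using c s t by (simp add: meet_assoc meet_comm[of L t s])
    also have "x \<sqinter> s = (x \<sqinter> s) \<sqinter> (y \<sqinter> s)" unfolding that(4) using c s by (simp add: meet_idem)
    also have "(x \<sqinter> s) \<sqinter> (y \<sqinter> s) \<sqinter> t \<sqsubseteq> x \<sqinter> y"
    proof -
      have "(x \<sqinter> s) \<sqinter> (y \<sqinter> s) \<sqsubseteq> x \<sqinter> y" using c s by (intro meet_mono meet_left) auto
      moreover have "(x \<sqinter> s) \<sqinter> (y \<sqinter> s) \<sqinter> t \<sqsubseteq> (x \<sqinter> s) \<sqinter> (y \<sqinter> s)" using c s t by (simp add: meet_left)
      ultimately show ?thesis using c s t by (auto elim: le_trans)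
    qed
    finally have "(x \<sqinter> y) \<squnion> (x \<sqinter> (t \<sqinter> s)) = x \<sqinter> y" using c s t by (simp add: join_eq_left)
    moreover have "((x \<sqinter> y) \<squnion> (x \<sqinter> (t \<sqinter> s)), (x \<sqinter> y) \<squnion> (x \<sqinter> t)) \<in> C"
      by (rule cong_join[OF C cong_refl[OF C'] cong_meet[OF C' cong_refl[OF C'] ts]]) (use c in auto)
    ultimately show ?thesis using x cong_sym[OF C'] by simp
  qed
  show "nabla L t \<inter> delta L s \<subseteq> C"
  proof
    fix p assume "p \<in> nabla L t \<inter> delta L s"
    then obtain x y where p: "p = (x, y)" and xy: "x \<in> carrier L" "y \<in> carrier L" "x \<squnion> t = y \<squnion> t" "x \<sqinter> s = y \<sqinter> s"
      by (auto simp: nabla_def delta_def)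
    have "(x, x \<sqinter> y) \<in> C" "(y, x \<sqinter> y) \<in> C" using *[of x y] *[of y x] xy by (auto simp: meet_comm)
    then show "p \<in> C" unfolding p by (rule cong_trans[OF C' _ cong_sym[OF C']])
  qed
qed

lemma delta_bottom: "delta L \<bottom> = carrier L \<times> carrier L"
  by (auto simp: delta_def bottom_meet_eq)

lemma nabla_top: "nabla L \<top> = carrier L \<times> carrier L"
  by (auto simp: nabla_def top_join_eq)

text \<open>This is the inequality \<open>t \<sqsubseteq> \<bottom>\<close>, since
  \<open>delta L \<bottom>\<close> is total; dually, \<open>delta_le_iff\<close> below is the
  inequality \<open>\<top> \<sqsubseteq> s\<close>.\<close>

lemma nabla_le_iff:
  assumes "t \<in> carrier L" "frame_congruence L C"
  shows "nabla L t \<subseteq> C \<longleftrightarrow> (\<bottom>, t) \<in> C"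
proof -
  have "nabla L t \<inter> delta L \<bottom> = nabla L t" unfolding delta_bottom by (auto simp: nabla_def)
  then show ?thesis using nabla_delta_le_iff[of t \<bottom> C] assms by (simp add: bottom_meet_eq)
qed

lemma delta_le_iff:
  assumes "s \<in> carrier L" "frame_congruence L C"
  shows "delta L s \<subseteq> C \<longleftrightarrow> (s, \<top>) \<in> C"
proof -
  have "nabla L \<top> \<inter> delta L s = delta L s" unfolding nabla_top by (auto simp: delta_def)
  then show ?thesis using nabla_delta_le_iff[of \<top> s C] assms by (simp add: top_meet_eq)
qed

lemma nabla_Int: "\<lbrakk>a \<in> carrier L; b \<in> carrier L\<rbrakk> \<Longrightarrow> nabla L a \<inter> nabla L b = nabla L (a \<sqinter> b)"
proof -
  assume c: "a \<in> carrier L" "b \<in> carrier L"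
  have "nabla L (a \<sqinter> b) \<subseteq> nabla L x" if "x \<in> {a, b}" for x
  proof -
    have "(\<bottom>, a \<sqinter> b) \<in> nabla L x"
      using that c by (auto simp: nabla_def bottom_join_eq join_eq_right meet_left meet_right)
    then show ?thesis using c that by (subst nabla_le_iff) (auto simp: nabla_congruence)
  qed
  moreover have "nabla L a \<inter> nabla L b \<subseteq> nabla L (a \<sqinter> b)"
    using c by (auto simp: nabla_def join_meet_distrib)
  ultimately show ?thesis by blast
qed

lemma delta_Int: "\<lbrakk>a \<in> carrier L; b \<in> carrier L\<rbrakk> \<Longrightarrow> delta L a \<inter> delta L b = delta L (a \<squnion> b)"
proof -
  assume c: "a \<in> carrier L" "b \<in> carrier L"
  have "delta L (a \<squnion> b) \<subseteq> delta L x" if "x \<in> {a, b}" for x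
  proof -
    have "(a \<squnion> b, \<top>) \<in> delta L x"
      using that c by (auto simp: delta_def top_meet_eq meet_eq_right join_left join_right)
    then show ?thesis using c that by (subst delta_le_iff) (auto simp: delta_congruence)
  qed
  moreover have "delta L a \<inter> delta L b \<subseteq> delta L (a \<squnion> b)"
    using c by (auto simp: delta_def meet_join_distrib)
  ultimately show ?thesis by blast
qed

text \<open>A congruence identifies bottom with a join iff it does so with every member: by
  convexity in one direction, by compatibility with joins in the other.\<close>

lemma nabla_sup:
  assumes "A \<subseteq> carrier L"
  shows "nabla L (\<Squnion>A) = \<Squnion>\<^bsub>congruence_frame L\<^esub> (nabla L ` A)"
proof (rule congruence_eqI)
  have n: "\<And>C. C \<in> nabla L ` A \<Longrightarrow> frame_congruence L C" using assms nabla_congruence by auto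
  show "frame_congruence L (\<Squnion>\<^bsub>congruence_frame L\<^esub> (nabla L ` A))" by (rule congruence_sup_closed[OF n])
  show "frame_congruence L (nabla L (\<Squnion>A))" using assms by (simp add: nabla_congruence)
  fix E assume E: "frame_congruence L E"
  note E' = frame_axioms E
  have "(\<bottom>, \<Squnion>A) \<in> E \<longleftrightarrow> (\<forall>a\<in>A. (\<bottom>, a) \<in> E)"
  proof
    assume *: "(\<bottom>, \<Squnion>A) \<in> E"
    show "\<forall>a\<in>A. (\<bottom>, a) \<in> E"
      using cong_convex[OF E *] assms sup_upper[OF assms] by auto
  next
    assume *: "\<forall>a\<in>A. (\<bottom>, a) \<in> E"
    have "(\<Squnion>((\<lambda>a. \<bottom>) ` A), \<Squnion>((\<lambda>a. a) ` A)) \<in> E" by (rule cong_sup[OF E']) (use * in blast)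
    moreover have "\<Squnion>((\<lambda>a. \<bottom>) ` A) = \<bottom>" by (rule complete_sup_eqI[OF complete_lattice_axioms]) auto
    ultimately show "(\<bottom>, \<Squnion>A) \<in> E" by simp
  qed
  moreover have "\<Squnion>\<^bsub>congruence_frame L\<^esub> (nabla L ` A) \<subseteq> E \<longleftrightarrow> (\<forall>a\<in>A. (\<bottom>, a) \<in> E)"
    using congruence_sup_le_iff[of "nabla L ` A" E, OF n E] nabla_le_iff[OF subsetD[OF assms] E] by simp
  ultimately show "nabla L (\<Squnion>A) \<subseteq> E \<longleftrightarrow> \<Squnion>\<^bsub>congruence_frame L\<^esub> (nabla L ` A) \<subseteq> E"
    using nabla_le_iff[OF sup_closed[OF assms] E] by simp
qed

text \<open>A congruence identifies \<open>a \<sqinter> b\<close> with top iff it identifies both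
  factors with top.\<close>

lemma delta_meet:
  assumes c: "a \<in> carrier L" "b \<in> carrier L"
  shows "delta L (a \<sqinter> b) = delta L a \<squnion>\<^bsub>congruence_frame L\<^esub> delta L b"
  unfolding join_def
proof (rule congruence_eqI)
  have n: "\<And>C. C \<in> {delta L a, delta L b} \<Longrightarrow> frame_congruence L C" using assms delta_congruence by auto
  show "frame_congruence L (\<Squnion>\<^bsub>congruence_frame L\<^esub> {delta L a, delta L b})" by (rule congruence_sup_closed[OF n])
  show "frame_congruence L (delta L (a \<sqinter> b))" using assms by (simp add: delta_congruence)
  fix E assume E: "frame_congruence L E"
  note E' = frame_axioms E
  have "(a \<sqinter> b, \<top>) \<in> E \<longleftrightarrow> (a, \<top>) \<in> E \<and> (b, \<top>) \<in> E"
  proof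
    assume *: "(a \<sqinter> b, \<top>) \<in> E"
    have "(a \<sqinter> b, a) \<in> E" "(a \<sqinter> b, b) \<in> E"
      using cong_convex[OF E *] c by (auto simp: meet_left meet_right)
    then show "(a, \<top>) \<in> E \<and> (b, \<top>) \<in> E" using cong_trans[OF E' cong_sym[OF E'] *] by blast
  next
    assume "(a, \<top>) \<in> E \<and> (b, \<top>) \<in> E"
    then show "(a \<sqinter> b, \<top>) \<in> E" using cong_meet[OF E', of a \<top> b \<top>] by (simp add: meet_idem)
  qed
  then show "delta L (a \<sqinter> b) \<subseteq> E \<longleftrightarrow> \<Squnion>\<^bsub>congruence_frame L\<^esub> {delta L a, delta L b} \<subseteq> E"
    using c E by (subst congruence_sup_le_iff[OF n E]) (auto simp: delta_le_iff)
qed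

text \<open>The intersection only forces \<open>a \<sqsubseteq> a\<close>, so it is trivial. The
  join is total because it identifies bottom with \<open>a\<close> and \<open>a\<close> with
  top.\<close>

lemma nabla_delta_complement:
  assumes a: "a \<in> carrier L"
  shows "nabla L a \<sqinter>\<^bsub>congruence_frame L\<^esub> delta L a = \<bottom>\<^bsub>congruence_frame L\<^esub>"
    and "nabla L a \<squnion>\<^bsub>congruence_frame L\<^esub> delta L a = \<top>\<^bsub>congruence_frame L\<^esub>"
proof -
  interpret K: frame "congruence_frame L" by (rule congruence_frame_frame)
  have c: "nabla L a \<in> carrier (congruence_frame L)" "delta L a \<in> carrier (congruence_frame L)"
    using a by (simp_all add: nabla_congruence delta_congruence)
  have "nabla L a \<inter> delta L a \<subseteq> \<bottom>\<^bsub>congruence_frame L\<^esub>"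
    using a cong_refl[OF frame_axioms] K.bottom_closed by (subst nabla_delta_le_iff) (auto simp: meet_idem)
  then have "nabla L a \<sqinter>\<^bsub>congruence_frame L\<^esub> delta L a \<sqsubseteq>\<^bsub>congruence_frame L\<^esub> \<bottom>\<^bsub>congruence_frame L\<^esub>"
    using c by (subst congruence_frame_meet) (auto simp: frame_axioms)
  then show "nabla L a \<sqinter>\<^bsub>congruence_frame L\<^esub> delta L a = \<bottom>\<^bsub>congruence_frame L\<^esub>"
    using c by (intro K.le_antisym) (simp_all del: congruence_frame_simps)
  let ?J = "nabla L a \<squnion>\<^bsub>congruence_frame L\<^esub> delta L a"
  have J: "frame_congruence L ?J" using K.join_closed[OF c] by simp
  have "nabla L a \<subseteq> ?J" "delta L a \<subseteq> ?J" using K.join_left[OF c] K.join_right[OF c] by simp_all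
  then have "(\<bottom>, a) \<in> ?J" "(a, \<top>) \<in> ?J" using a J by (simp_all add: nabla_le_iff delta_le_iff)
  then have "(\<bottom>, \<top>) \<in> ?J" using cong_trans[OF frame_axioms J] by blast
  then have "nabla L \<top> \<subseteq> ?J" using J by (simp add: nabla_le_iff)
  then have "\<top>\<^bsub>congruence_frame L\<^esub> \<sqsubseteq>\<^bsub>congruence_frame L\<^esub> ?J"
    by (simp add: congruence_frame_top[OF frame_axioms] nabla_top)
  then show "?J = \<top>\<^bsub>congruence_frame L\<^esub>"
    using c by (intro K.le_antisym) (simp_all del: congruence_frame_simps)
qed

lemma nabla_inj: "inj_on (nabla L) (carrier L)"
proof (rule inj_onI)
  fix a b assume c: "a \<in> carrier L" "b \<in> carrier L" and "nabla L a = nabla L b"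
  then have "(\<bottom>, a) \<in> nabla L b" "(\<bottom>, b) \<in> nabla L a"
    using nabla_le_iff[of a "nabla L b"] nabla_le_iff[of b "nabla L a"] nabla_congruence by auto
  then have "b = a \<squnion> b" "a = b \<squnion> a" using c by (auto simp: nabla_def bottom_join_eq)
  then show "a = b" by (metis join_comm)
qed

end


section \<open>Finitary congruences\<close>

locale biframe_locale =
  fixes L :: "('p, 'n, 'a) biframe"
  assumes is_biframe: "biframe L"
begin

abbreviation "M \<equiv> main_part L"
abbreviation "P \<equiv> pos_part L"
abbreviation "N \<equiv> neg_part L"
abbreviation "K \<equiv> congruence_frame (main_part L)"
abbreviation "F \<equiv> fin_elements L"

lemma main_frame: "frame M" and pos_frame: "frame P" and neg_frame: "frame N"
  and emb_pos_map: "emb_pos L \<in> frame_maps P M" and emb_neg_map: "emb_neg L \<in> frame_maps N M"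
  and emb_pos_inj: "inj_on (emb_pos L) (carrier P)" and emb_neg_inj: "inj_on (emb_neg L) (carrier N)"
  and join_of_rectangles: "x \<in> carrier M \<Longrightarrow> \<exists>A. A \<subseteq> rectangles L \<and> x = \<Squnion>\<^bsub>M\<^esub> A"
  using is_biframe by (simp_all add: biframe_def)

end

sublocale biframe_locale \<subseteq> M: gorder_frame "main_part L"
  by (intro gorder_frame.intro main_frame)
sublocale biframe_locale \<subseteq> P: gorder_frame "pos_part L"
  by (intro gorder_frame.intro pos_frame)
sublocale biframe_locale \<subseteq> N: gorder_frame "neg_part L"
  by (intro gorder_frame.intro neg_frame)
sublocale biframe_locale \<subseteq> K: frame "congruence_frame (main_part L)"
  by (rule M.congruence_frame_frame)

context biframe_locale
begin

lemma emb_closed [simp]: "x \<in> carrier P \<Longrightarrow> emb_pos L x \<in> carrier M" "y \<in> carrier N \<Longrightarrow> emb_neg L y \<in> carrier M"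
  using frame_mapsD(2)[OF emb_pos_map] frame_mapsD(2)[OF emb_neg_map] by auto

lemma rectangleI: "x \<in> carrier P \<Longrightarrow> y \<in> carrier N \<Longrightarrow> emb_pos L x \<sqinter>\<^bsub>M\<^esub> emb_neg L y \<in> rectangles L"
  by (auto simp: rectangles_def)

lemma rectanglesE:
  assumes "r \<in> rectangles L"
  obtains x y where "x \<in> carrier P" "y \<in> carrier N" "r = emb_pos L x \<sqinter>\<^bsub>M\<^esub> emb_neg L y"
  using assms by (auto simp: rectangles_def)

lemma rectangles_closed: "rectangles L \<subseteq> carrier M"
  by (auto simp: rectangles_def)

lemma emb_rectangle: "x \<in> carrier P \<Longrightarrow> emb_pos L x \<in> rectangles L" "y \<in> carrier N \<Longrightarrow> emb_neg L y \<in> rectangles L"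
  using rectangleI[of x "\<top>\<^bsub>N\<^esub>"] rectangleI[of "\<top>\<^bsub>P\<^esub>" y]
  by (simp_all add: frame_mapsD(4)[OF emb_pos_map] frame_mapsD(4)[OF emb_neg_map] M.top_meet_eq)

lemma rectangle_meet:
  assumes "r \<in> rectangles L" "s \<in> rectangles L"
  shows "r \<sqinter>\<^bsub>M\<^esub> s \<in> rectangles L"
proof -
  obtain x y where r: "x \<in> carrier P" "y \<in> carrier N" "r = emb_pos L x \<sqinter>\<^bsub>M\<^esub> emb_neg L y"
    using assms(1) by (rule rectanglesE)
  obtain u v where s: "u \<in> carrier P" "v \<in> carrier N" "s = emb_pos L u \<sqinter>\<^bsub>M\<^esub> emb_neg L v"
    using assms(2) by (rule rectanglesE)
  have "r \<sqinter>\<^bsub>M\<^esub> s = (emb_pos L x \<sqinter>\<^bsub>M\<^esub> emb_pos L u) \<sqinter>\<^bsub>M\<^esub> (emb_neg L y \<sqinter>\<^bsub>M\<^esub> emb_neg L v)"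
    unfolding r s by (rule M.meet_interchange) (use r s in auto)
  also have "\<dots> = emb_pos L (x \<sqinter>\<^bsub>P\<^esub> u) \<sqinter>\<^bsub>M\<^esub> emb_neg L (y \<sqinter>\<^bsub>N\<^esub> v)"
    using r s by (simp add: frame_mapsD(5)[OF emb_pos_map] frame_mapsD(5)[OF emb_neg_map])
  finally show ?thesis using r s by (simp add: rectangleI)
qed

lemma fin_elementI: "finite A \<Longrightarrow> A \<subseteq> rectangles L \<Longrightarrow> \<Squnion>\<^bsub>M\<^esub> A \<in> F"
  by (auto simp: fin_elements_def)

lemma fin_elementsE:
  assumes "s \<in> F"
  obtains A where "finite A" "A \<subseteq> rectangles L" "s = \<Squnion>\<^bsub>M\<^esub> A"
  using assms by (auto simp: fin_elements_def)

lemma fin_closed: "F \<subseteq> carrier M"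
  using rectangles_closed by (auto simp: fin_elements_def intro!: M.sup_closed)

lemma fin_carrier [simp]: "s \<in> F \<Longrightarrow> s \<in> carrier M"
  using fin_closed by blast

lemma rectangle_fin: "rectangles L \<subseteq> F"
proof
  fix r assume "r \<in> rectangles L"
  then show "r \<in> F" using fin_elementI[of "{r}"] rectangles_closed by auto
qed

lemma fin_join: "\<lbrakk>s \<in> F; t \<in> F\<rbrakk> \<Longrightarrow> s \<squnion>\<^bsub>M\<^esub> t \<in> F"
proof (elim fin_elementsE)
  fix A B assume "finite A" "A \<subseteq> rectangles L" "s = \<Squnion>\<^bsub>M\<^esub> A" "finite B" "B \<subseteq> rectangles L" "t = \<Squnion>\<^bsub>M\<^esub> B"
  then show ?thesis
    using fin_elementI[of "A \<union> B"] rectangles_closed M.sup_Un[of A B] by auto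
qed

lemma fin_meet: "\<lbrakk>s \<in> F; t \<in> F\<rbrakk> \<Longrightarrow> s \<sqinter>\<^bsub>M\<^esub> t \<in> F"
proof (elim fin_elementsE)
  fix A B assume A: "finite A" "A \<subseteq> rectangles L" "s = \<Squnion>\<^bsub>M\<^esub> A" and B: "finite B" "B \<subseteq> rectangles L" "t = \<Squnion>\<^bsub>M\<^esub> B"
  have "{a \<sqinter>\<^bsub>M\<^esub> b | a b. a \<in> A \<and> b \<in> B} = (\<lambda>(a, b). a \<sqinter>\<^bsub>M\<^esub> b) ` (A \<times> B)" by auto
  then have "finite {a \<sqinter>\<^bsub>M\<^esub> b | a b. a \<in> A \<and> b \<in> B}" using A B by simp
  moreover have "{a \<sqinter>\<^bsub>M\<^esub> b | a b. a \<in> A \<and> b \<in> B} \<subseteq> rectangles L" using A B rectangle_meet by auto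
  ultimately show ?thesis
    using fin_elementI A B rectangles_closed M.sup_meet_sup[of A B] by auto
qed

lemma fin_bottom: "\<bottom>\<^bsub>M\<^esub> \<in> F"
  using fin_elementI[of "{}"] by (simp add: M.sup_empty)

lemma fin_top: "\<top>\<^bsub>M\<^esub> \<in> F"
  using emb_rectangle(1)[of "\<top>\<^bsub>P\<^esub>"] rectangle_fin by (auto simp: frame_mapsD(4)[OF emb_pos_map])

lemma emb_fin: "x \<in> carrier P \<Longrightarrow> emb_pos L x \<in> F" "y \<in> carrier N \<Longrightarrow> emb_neg L y \<in> F"
  using emb_rectangle rectangle_fin by auto

definition basic_congruences :: "('a \<times> 'a) set set"
  where "basic_congruences = {nabla M t \<inter> delta M s | t s. t \<in> F \<and> s \<in> F}"

lemma basic_congruence_closed: "basic_congruences \<subseteq> carrier K"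
  by (auto simp: basic_congruences_def intro!: Int_congruence main_frame M.nabla_congruence M.delta_congruence)

lemma nabla_basic: "t \<in> F \<Longrightarrow> nabla M t \<in> basic_congruences"
  unfolding basic_congruences_def using fin_bottom
  by (intro CollectI exI[of _ t] exI[of _ "\<bottom>\<^bsub>M\<^esub>"]) (auto simp: M.delta_bottom nabla_def)

lemma delta_basic: "s \<in> F \<Longrightarrow> delta M s \<in> basic_congruences"
  unfolding basic_congruences_def using fin_top
  by (intro CollectI exI[of _ "\<top>\<^bsub>M\<^esub>"] exI[of _ s]) (auto simp: M.nabla_top delta_def)

lemma basic_top: "\<top>\<^bsub>K\<^esub> \<in> basic_congruences"
  using nabla_basic[OF fin_top] by (simp add: congruence_frame_top[OF main_frame] M.nabla_top)

lemma basic_Int: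
  assumes "t \<in> F" "s \<in> F" "t' \<in> F" "s' \<in> F"
  shows "(nabla M t \<inter> delta M s) \<inter> (nabla M t' \<inter> delta M s')
    = nabla M (t \<sqinter>\<^bsub>M\<^esub> t') \<inter> delta M (s \<squnion>\<^bsub>M\<^esub> s')"
  using M.nabla_Int[of t t'] M.delta_Int[of s s'] assms by auto

lemma basic_meet: "\<lbrakk>C \<in> basic_congruences; D \<in> basic_congruences\<rbrakk> \<Longrightarrow> C \<sqinter>\<^bsub>K\<^esub> D \<in> basic_congruences"
proof -
  assume C: "C \<in> basic_congruences" and D: "D \<in> basic_congruences"
  have "C \<sqinter>\<^bsub>K\<^esub> D = C \<inter> D"
    using C D basic_congruence_closed by (intro congruence_frame_meet main_frame) auto
  moreover obtain t s where ts: "t \<in> F" "s \<in> F" "C = nabla M t \<inter> delta M s"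
    using C unfolding basic_congruences_def by blast
  moreover obtain t' s' where ts': "t' \<in> F" "s' \<in> F" "D = nabla M t' \<inter> delta M s'"
    using D unfolding basic_congruences_def by blast
  ultimately show ?thesis
    unfolding basic_congruences_def using basic_Int[OF ts(1,2) ts'(1,2)] fin_meet[OF ts(1) ts'(1)] fin_join[OF ts(2) ts'(2)]
    by auto
qed

text \<open>Both sides lie below exactly those congruences that force every inequality of
  \<open>R\<close>.\<close>

lemma generated_congruence_eq_sup:
  assumes R: "R \<subseteq> carrier M \<times> carrier M"
  shows "generated_congruence M R = \<Squnion>\<^bsub>K\<^esub> ((\<lambda>(t, s). nabla M t \<inter> delta M s) ` R)"
proof (rule M.congruence_eqI)
  have c: "frame_congruence M C" if "C \<in> (\<lambda>(t, s). nabla M t \<inter> delta M s) ` R" for C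
    using that R by (auto intro!: Int_congruence main_frame M.nabla_congruence M.delta_congruence)
  show "frame_congruence M (generated_congruence M R)"
    by (rule generated_congruence_congruence[OF main_frame R])
  show "frame_congruence M (\<Squnion>\<^bsub>K\<^esub> ((\<lambda>(t, s). nabla M t \<inter> delta M s) ` R))"
    by (rule M.congruence_sup_closed[OF c])
  fix E assume E: "frame_congruence M E"
  have "generated_congruence M R \<subseteq> E \<longleftrightarrow> (\<forall>(t, s)\<in>R. (t \<sqinter>\<^bsub>M\<^esub> s, t) \<in> E)"
    using generated_congruence_least[OF E, of R] generated_congruence_contains[of _ _ R M] by fast
  also have "\<dots> \<longleftrightarrow> (\<forall>(t, s)\<in>R. nabla M t \<inter> delta M s \<subseteq> E)"
    using R M.nabla_delta_le_iff[OF _ _ E] by (intro ball_cong HOL.refl) auto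
  also have "\<dots> \<longleftrightarrow> \<Squnion>\<^bsub>K\<^esub> ((\<lambda>(t, s). nabla M t \<inter> delta M s) ` R) \<subseteq> E"
    using M.congruence_sup_le_iff[OF c E] by auto
  finally show "generated_congruence M R \<subseteq> E \<longleftrightarrow> \<Squnion>\<^bsub>K\<^esub> ((\<lambda>(t, s). nabla M t \<inter> delta M s) ` R) \<subseteq> E" .
qed

lemma finitary_congruence_iff: "finitary_congruence L C \<longleftrightarrow> (\<exists>\<A>. \<A> \<subseteq> basic_congruences \<and> C = \<Squnion>\<^bsub>K\<^esub> \<A>)"
proof
  assume "finitary_congruence L C"
  then obtain R where R: "R \<subseteq> F \<times> F" "C = generated_congruence M R" by (auto simp: finitary_congruence_def)
  moreover have "R \<subseteq> carrier M \<times> carrier M" using R fin_closed by blast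
  ultimately have "C = \<Squnion>\<^bsub>K\<^esub> ((\<lambda>(t, s). nabla M t \<inter> delta M s) ` R)" by (simp add: generated_congruence_eq_sup)
  moreover have "(\<lambda>(t, s). nabla M t \<inter> delta M s) ` R \<subseteq> basic_congruences"
    using R by (auto simp: basic_congruences_def)
  ultimately show "\<exists>\<A>. \<A> \<subseteq> basic_congruences \<and> C = \<Squnion>\<^bsub>K\<^esub> \<A>" by blast
next
  assume "\<exists>\<A>. \<A> \<subseteq> basic_congruences \<and> C = \<Squnion>\<^bsub>K\<^esub> \<A>"
  then obtain \<A> where A: "\<A> \<subseteq> basic_congruences" "C = \<Squnion>\<^bsub>K\<^esub> \<A>" by blast
  \<comment> \<open>Taking all pairs whose basic congruence lies in \<open>\<A>\<close> recovers
    \<open>\<A>\<close> without choosing representatives.\<close>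
  let ?R = "{(t, s) \<in> F \<times> F. nabla M t \<inter> delta M s \<in> \<A>}"
  have "(\<lambda>(t, s). nabla M t \<inter> delta M s) ` ?R = \<A>"
  proof (intro equalityI subsetI)
    fix B assume B: "B \<in> \<A>"
    then obtain t s where "t \<in> F" "s \<in> F" "B = nabla M t \<inter> delta M s"
      using A by (auto simp: basic_congruences_def)
    then show "B \<in> (\<lambda>(t, s). nabla M t \<inter> delta M s) ` ?R"
      using B by (intro image_eqI[of _ _ "(t, s)"]) auto
  qed auto
  moreover have "?R \<subseteq> carrier M \<times> carrier M" using fin_closed by blast
  ultimately have "C = generated_congruence M ?R" using A by (simp add: generated_congruence_eq_sup)
  then show "finitary_congruence L C" unfolding finitary_congruence_def by (intro exI[of _ ?R]) auto
qed

abbreviation "finitary_congruences \<equiv> {C. finitary_congruence L C}"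

lemma finitary_eq: "finitary_congruences = {\<Squnion>\<^bsub>K\<^esub> \<A> | \<A>. \<A> \<subseteq> basic_congruences}"
  by (auto simp: finitary_congruence_iff)

lemma finitary_subframe: "subframe K finitary_congruences" and basic_finitary: "basic_congruences \<subseteq> finitary_congruences"
  unfolding finitary_eq
  using sups_subframe[OF M.congruence_frame_frame basic_congruence_closed basic_top basic_meet] by blast+

lemma finitary_closed: "finitary_congruence L C \<Longrightarrow> frame_congruence M C"
  using subframeD(1)[OF finitary_subframe] by auto

text \<open>A finitary congruence is a join of basic ones, and each of these is equivalent to a
  single inequality between elements of \<open>fin\<close>. So it is determined by the inequalities
  of this kind that it forces.\<close>

lemma finitary_le_iff:
  assumes C: "finitary_congruence L C" and E: "frame_congruence M E"
  shows "C \<subseteq> E \<longleftrightarrow> (\<forall>t\<in>F. \<forall>s\<in>F. (t \<sqinter>\<^bsub>M\<^esub> s, t) \<in> C \<longrightarrow> (t \<sqinter>\<^bsub>M\<^esub> s, t) \<in> E)"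
proof
  assume *: "\<forall>t\<in>F. \<forall>s\<in>F. (t \<sqinter>\<^bsub>M\<^esub> s, t) \<in> C \<longrightarrow> (t \<sqinter>\<^bsub>M\<^esub> s, t) \<in> E"
  obtain \<A> where A: "\<A> \<subseteq> basic_congruences" "C = \<Squnion>\<^bsub>K\<^esub> \<A>" using C by (auto simp: finitary_congruence_iff)
  have c: "frame_congruence M B" if "B \<in> \<A>" for B using that A basic_congruence_closed by auto
  have "B \<subseteq> E" if B: "B \<in> \<A>" for B
  proof -
    obtain t s where ts: "t \<in> F" "s \<in> F" "B = nabla M t \<inter> delta M s"
      using A B by (auto simp: basic_congruences_def)
    have "B \<subseteq> C" unfolding A(2) using c B by (rule M.congruence_sup_upper)
    then have "(t \<sqinter>\<^bsub>M\<^esub> s, t) \<in> C" using ts finitary_closed[OF C] by (simp add: M.nabla_delta_le_iff)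
    then show ?thesis using * ts E by (simp add: M.nabla_delta_le_iff)
  qed
  then show "C \<subseteq> E" unfolding A(2) using M.congruence_sup_le_iff[OF c E] by blast
qed blast


section \<open>The assembly\<close>

abbreviation "gen_pos \<equiv> nabla M ` emb_pos L ` carrier P \<union> delta M ` emb_neg L ` carrier N"
abbreviation "gen_neg \<equiv> nabla M ` emb_neg L ` carrier N \<union> delta M ` emb_pos L ` carrier P"
abbreviation "Ap \<equiv> carrier (pos_part (assembly L))"
abbreviation "An \<equiv> carrier (neg_part (assembly L))"

lemma assembly_parts:
  "pos_part (assembly L) = generated_subframe K gen_pos"
  "neg_part (assembly L) = generated_subframe K gen_neg"
  "main_part (assembly L) = generated_subframe K (nabla M ` carrier M \<union> delta M ` F)"
  "emb_pos (assembly L) = (\<lambda>C\<in>Ap. C)"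
  "emb_neg (assembly L) = (\<lambda>C\<in>An. C)"
  by (simp_all add: assembly_def Let_def)

lemma generators_closed: "gen_pos \<subseteq> carrier K" "gen_neg \<subseteq> carrier K" "nabla M ` carrier M \<union> delta M ` F \<subseteq> carrier K"
  by (auto simp: M.nabla_congruence M.delta_congruence)

text \<open>\<open>nabla\<close> preserves arbitrary joins, so all joins of rectangles are covered.
  \<open>delta\<close> turns joins into intersections, where only finite ones are available.\<close>

lemma nabla_finitary: "x \<in> carrier M \<Longrightarrow> finitary_congruence L (nabla M x)"
proof -
  assume "x \<in> carrier M"
  then obtain A where A: "A \<subseteq> rectangles L" "x = \<Squnion>\<^bsub>M\<^esub> A" using join_of_rectangles by blast
  then have "nabla M x = \<Squnion>\<^bsub>K\<^esub> (nabla M ` A)" using rectangles_closed by (simp add: M.nabla_sup)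
  moreover have "nabla M ` A \<subseteq> basic_congruences" using A rectangle_fin nabla_basic by auto
  ultimately show ?thesis by (auto simp: finitary_congruence_iff)
qed

lemma delta_finitary: "s \<in> F \<Longrightarrow> finitary_congruence L (delta M s)"
  using delta_basic basic_finitary by auto

text \<open>The generators are finitary; conversely, a basic congruence is the meet of two
  generators and every finitary congruence is a join of basic ones.\<close>

lemma main_assembly_carrier: "carrier (main_part (assembly L)) = finitary_congruences"
proof
  show "carrier (main_part (assembly L)) \<subseteq> finitary_congruences"
    unfolding assembly_parts
    by (rule generated_subframe_least[OF finitary_subframe]) (auto simp: nabla_finitary delta_finitary)
  note S = generated_subframe_subframe[OF M.congruence_frame_frame generators_closed(3), folded assembly_parts]
  have "nabla M t \<inter> delta M s \<in> carrier (main_part (assembly L))" if "t \<in> F" "s \<in> F" for t s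
  proof -
    have "nabla M t \<sqinter>\<^bsub>K\<^esub> delta M s \<in> carrier (main_part (assembly L))"
      using that by (intro subframeD(4)[OF S(1)] subsetD[OF S(2)]) auto
    then show ?thesis
      using that by (simp add: congruence_frame_meet main_frame M.nabla_congruence M.delta_congruence)
  qed
  then have B: "basic_congruences \<subseteq> carrier (main_part (assembly L))" by (auto simp: basic_congruences_def)
  then show "finitary_congruences \<subseteq> carrier (main_part (assembly L))"
    unfolding finitary_eq using subframeD(2)[OF S(1)] by blast
qed

text \<open>In this form the operations of the three parts are read off from the frame of all
  congruences by the lemmas on subframes.\<close>

lemma main_assembly: "main_part (assembly L) = K\<lparr>carrier := finitary_congruences\<rparr>"
  and pos_assembly: "pos_part (assembly L) = K\<lparr>carrier := Ap\<rparr>"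
  and neg_assembly: "neg_part (assembly L) = K\<lparr>carrier := An\<rparr>"
  using main_assembly_carrier by (simp_all add: assembly_parts generated_subframe_def)

lemma pos_subframe: "subframe K Ap" and pos_generators: "gen_pos \<subseteq> Ap"
  using generated_subframe_subframe[OF M.congruence_frame_frame generators_closed(1)] by (simp_all add: assembly_parts)

lemma neg_subframe: "subframe K An" and neg_generators: "gen_neg \<subseteq> An"
  using generated_subframe_subframe[OF M.congruence_frame_frame generators_closed(2)] by (simp_all add: assembly_parts)

text \<open>Induction over the parts of the assembly: a property stable under joins and finite meets
  has to be checked on generators only.\<close>

lemma pos_least: "subframe K S \<Longrightarrow> gen_pos \<subseteq> S \<Longrightarrow> Ap \<subseteq> S"
  and neg_least: "subframe K S \<Longrightarrow> gen_neg \<subseteq> S \<Longrightarrow> An \<subseteq> S"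
  by (simp_all add: assembly_parts generated_subframe_least)

lemma pos_finitary: "Ap \<subseteq> finitary_congruences"
  by (rule pos_least[OF finitary_subframe]) (auto simp: nabla_finitary delta_finitary emb_fin)

lemma neg_finitary: "An \<subseteq> finitary_congruences"
  by (rule neg_least[OF finitary_subframe]) (auto simp: nabla_finitary delta_finitary emb_fin)

lemma nabla_pos: "x \<in> carrier P \<Longrightarrow> nabla M (emb_pos L x) \<in> Ap"
  and delta_pos: "y \<in> carrier N \<Longrightarrow> delta M (emb_neg L y) \<in> Ap"
  and nabla_neg: "y \<in> carrier N \<Longrightarrow> nabla M (emb_neg L y) \<in> An"
  and delta_neg: "x \<in> carrier P \<Longrightarrow> delta M (emb_pos L x) \<in> An"
  using pos_generators neg_generators by auto

lemmas main_assembly_sup = subframe_sup[OF M.congruence_frame_frame finitary_subframe, folded main_assembly]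
  and main_assembly_meet = subframe_meet[OF M.congruence_frame_frame finitary_subframe, folded main_assembly]
  and main_assembly_top = subframe_top[OF M.congruence_frame_frame finitary_subframe, folded main_assembly]
  and main_assembly_join = subframe_join[OF M.congruence_frame_frame finitary_subframe, folded main_assembly]
  and main_assembly_frame = subframe_frame[OF M.congruence_frame_frame finitary_subframe, folded main_assembly]

lemmas pos_assembly_frame = subframe_frame[OF M.congruence_frame_frame pos_subframe, folded pos_assembly]
  and neg_assembly_frame = subframe_frame[OF M.congruence_frame_frame neg_subframe, folded neg_assembly]

lemma main_assembly_bottom: "\<bottom>\<^bsub>main_part (assembly L)\<^esub> = \<bottom>\<^bsub>K\<^esub>"
  using main_assembly_sup[of "{}"] frame.sup_empty[OF main_assembly_frame] K.sup_empty by simp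

end

section \<open>Frame maps between subframes\<close>

lemma frame_map_restrict:
  assumes K: "frame K" and S: "subframe K S" and T: "subframe K T" and "S \<subseteq> T"
    and g: "g \<in> frame_maps (K\<lparr>carrier := T\<rparr>) B"
  shows "restrict g S \<in> frame_maps (K\<lparr>carrier := S\<rparr>) B"
  unfolding frame_maps_def mem_Collect_eq
proof (intro conjI allI impI ballI)
  note gD = frame_mapsD[OF g, simplified]
  have ST: "x \<in> S \<Longrightarrow> x \<in> T" for x using \<open>S \<subseteq> T\<close> by blast
  show "restrict g S \<in> carrier (K\<lparr>carrier := S\<rparr>) \<rightarrow>\<^sub>E carrier B" using gD(2) ST by auto
  show "restrict g S \<top>\<^bsub>K\<lparr>carrier := S\<rparr>\<^esub> = \<top>\<^bsub>B\<^esub>"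
    using subframeD(3)[OF S] gD(4) by (simp add: subframe_top[OF K S] subframe_top[OF K T])
  fix A assume "A \<subseteq> carrier (K\<lparr>carrier := S\<rparr>)"
  then have A: "A \<subseteq> S" "A \<subseteq> T" using \<open>S \<subseteq> T\<close> by auto
  moreover have "restrict g S ` A = g ` A" using A(1) by auto
  ultimately show "restrict g S (\<Squnion>\<^bsub>K\<lparr>carrier := S\<rparr>\<^esub> A) = \<Squnion>\<^bsub>B\<^esub> (restrict g S ` A)"
    using subframeD(2)[OF S] gD(3)[OF A(2)] by (simp add: subframe_sup[OF K S] subframe_sup[OF K T])
next
  fix x y assume "x \<in> carrier (K\<lparr>carrier := S\<rparr>)" "y \<in> carrier (K\<lparr>carrier := S\<rparr>)"
  then have "x \<in> S" "y \<in> S" "x \<in> T" "y \<in> T" using \<open>S \<subseteq> T\<close> by auto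
  then show "restrict g S (x \<sqinter>\<^bsub>K\<lparr>carrier := S\<rparr>\<^esub> y) = restrict g S x \<sqinter>\<^bsub>B\<^esub> restrict g S y"
    using subframeD(4)[OF S] frame_mapsD(5)[OF g, of x y] by (simp add: subframe_meet[OF K S] subframe_meet[OF K T])
qed

lemma identity_frame_map: "frame Q \<Longrightarrow> (\<lambda>x\<in>carrier Q. x) \<in> frame_maps Q Q"
proof -
  assume "frame Q"
  then interpret frame Q .
  have "(\<lambda>x\<in>carrier Q. x) ` A = A" if "A \<subseteq> carrier Q" for A using that by auto
  then show ?thesis by (simp add: frame_maps_def)
qed

lemma subframe_inclusion:
  assumes "frame K" "subframe K S" "subframe K T" "S \<subseteq> T"
  shows "(\<lambda>x\<in>S. x) \<in> frame_maps (K\<lparr>carrier := S\<rparr>) (K\<lparr>carrier := T\<rparr>)"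
proof -
  have "restrict (\<lambda>x\<in>T. x) S = (\<lambda>x\<in>S. x)" using assms(4) by (auto simp: Int_absorb1)
  then show ?thesis
    using frame_map_restrict[OF assms identity_frame_map[OF subframe_frame[OF assms(1,3)]]] by simp
qed

section \<open>The assembly as a biframe\<close>

context biframe_locale
begin

lemma emb_assembly: "C \<in> Ap \<Longrightarrow> emb_pos (assembly L) C = C" "C \<in> An \<Longrightarrow> emb_neg (assembly L) C = C"
  by (simp_all add: assembly_parts(4,5))

lemma rectangles_assembly: "rectangles (assembly L) = {C \<sqinter>\<^bsub>K\<^esub> D | C D. C \<in> Ap \<and> D \<in> An}"
  using pos_finitary neg_finitary
  by (auto simp: rectangles_def emb_assembly main_assembly_meet subset_iff) (metis emb_assembly main_assembly_meet mem_Collect_eq)+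

lemma rectangles_assembly_closed: "rectangles (assembly L) \<subseteq> finitary_congruences"
  unfolding rectangles_assembly using pos_finitary neg_finitary subframeD(4)[OF finitary_subframe] by blast

text \<open>Reduces the density condition of the biframe to generators: rectangles contain the top
  element and are closed under meets, so their joins form a subframe.\<close>

lemma rectangles_assembly_join_subframe: "subframe K {\<Squnion>\<^bsub>K\<^esub> A | A. A \<subseteq> rectangles (assembly L)}"
  and rectangles_assembly_le: "rectangles (assembly L) \<subseteq> {\<Squnion>\<^bsub>K\<^esub> A | A. A \<subseteq> rectangles (assembly L)}"
proof -
  have c: "rectangles (assembly L) \<subseteq> carrier K" using rectangles_assembly_closed finitary_closed by auto
  have "\<top>\<^bsub>K\<^esub> \<in> Ap" "\<top>\<^bsub>K\<^esub> \<in> An" using subframeD(3) pos_subframe neg_subframe by auto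
  then have t: "\<top>\<^bsub>K\<^esub> \<in> rectangles (assembly L)"
    unfolding rectangles_assembly
    by (intro CollectI exI[of _ "\<top>\<^bsub>K\<^esub>"]) (simp add: K.meet_idem[OF K.top_closed])
  have m: "X \<sqinter>\<^bsub>K\<^esub> Y \<in> rectangles (assembly L)"
    if XY: "X \<in> rectangles (assembly L)" "Y \<in> rectangles (assembly L)" for X Y
  proof -
    obtain C D C' D' where CD: "C \<in> Ap" "D \<in> An" "X = C \<sqinter>\<^bsub>K\<^esub> D" "C' \<in> Ap" "D' \<in> An" "Y = C' \<sqinter>\<^bsub>K\<^esub> D'"
      using XY unfolding rectangles_assembly by blast
    then have cl: "C \<in> carrier K" "D \<in> carrier K" "C' \<in> carrier K" "D' \<in> carrier K"
      using subframeD(1)[OF pos_subframe] subframeD(1)[OF neg_subframe] by blast+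
    have "X \<sqinter>\<^bsub>K\<^esub> Y = (C \<sqinter>\<^bsub>K\<^esub> C') \<sqinter>\<^bsub>K\<^esub> (D \<sqinter>\<^bsub>K\<^esub> D')"
      unfolding CD by (rule K.meet_interchange[OF cl(1,2,3,4)])
    then show ?thesis
      unfolding rectangles_assembly using CD subframeD(4)[OF pos_subframe] subframeD(4)[OF neg_subframe] by blast
  qed
  show "subframe K {\<Squnion>\<^bsub>K\<^esub> A | A. A \<subseteq> rectangles (assembly L)}"
    "rectangles (assembly L) \<subseteq> {\<Squnion>\<^bsub>K\<^esub> A | A. A \<subseteq> rectangles (assembly L)}"
    using sups_subframe[OF M.congruence_frame_frame c t m] by blast+
qed

lemma assembly_pos_rectangle: "C \<in> Ap \<Longrightarrow> C \<in> rectangles (assembly L)"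
proof -
  assume C: "C \<in> Ap"
  then have "C \<in> carrier K" using subframeD(1)[OF pos_subframe] by blast
  then have "C = C \<sqinter>\<^bsub>K\<^esub> \<top>\<^bsub>K\<^esub>" by (rule K.top_meet_eq(2)[symmetric])
  then show ?thesis unfolding rectangles_assembly using C subframeD(3)[OF neg_subframe] by blast
qed

lemma assembly_neg_rectangle: "D \<in> An \<Longrightarrow> D \<in> rectangles (assembly L)"
proof -
  assume D: "D \<in> An"
  then have "D \<in> carrier K" using subframeD(1)[OF neg_subframe] by blast
  then have "D = \<top>\<^bsub>K\<^esub> \<sqinter>\<^bsub>K\<^esub> D" by (rule K.top_meet_eq(1)[symmetric])
  then show ?thesis unfolding rectangles_assembly using D subframeD(3)[OF pos_subframe] by blast
qed

text \<open>For a rectangle \<open>r\<close> of \<open>L\<close>, \<open>nabla M r\<close> is the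
  meet, and \<open>delta M r\<close> the join, of one generator from each part of the assembly. All
  other generators arise from these by joins or finite meets.\<close>

lemma finitary_join_of_rectangles: "finitary_congruences \<subseteq> {\<Squnion>\<^bsub>K\<^esub> A | A. A \<subseteq> rectangles (assembly L)}"
proof -
  define J where "J = {\<Squnion>\<^bsub>K\<^esub> A | A. A \<subseteq> rectangles (assembly L)}"
  note J = rectangles_assembly_join_subframe[folded J_def]
  note R = subsetD[OF rectangles_assembly_le[folded J_def]]
  note RP = R[OF assembly_pos_rectangle] and RN = R[OF assembly_neg_rectangle]
  have nr: "nabla M r \<in> J" if "r \<in> rectangles L" for r
  proof -
    obtain x y where r: "x \<in> carrier P" "y \<in> carrier N" "r = emb_pos L x \<sqinter>\<^bsub>M\<^esub> emb_neg L y"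
      using \<open>r \<in> rectangles L\<close> by (rule rectanglesE)
    have "nabla M (emb_pos L x) \<sqinter>\<^bsub>K\<^esub> nabla M (emb_neg L y) \<in> J"
      by (intro subframeD(4)[OF J] RP RN nabla_pos nabla_neg r)
    then show ?thesis
      using r by (simp add: congruence_frame_meet main_frame M.nabla_congruence M.nabla_Int)
  qed
  have n: "nabla M x \<in> J" if "x \<in> carrier M" for x
  proof -
    obtain A where A: "A \<subseteq> rectangles L" "x = \<Squnion>\<^bsub>M\<^esub> A" using \<open>x \<in> carrier M\<close> join_of_rectangles by blast
    then have "nabla M x = \<Squnion>\<^bsub>K\<^esub> (nabla M ` A)" using rectangles_closed by (simp add: M.nabla_sup)
    moreover have "nabla M ` A \<subseteq> J" using A nr by auto
    ultimately show ?thesis using subframeD(2)[OF J] by simp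
  qed
  have dr: "delta M r \<in> J" if "r \<in> rectangles L" for r
  proof -
    obtain x y where r: "x \<in> carrier P" "y \<in> carrier N" "r = emb_pos L x \<sqinter>\<^bsub>M\<^esub> emb_neg L y"
      using \<open>r \<in> rectangles L\<close> by (rule rectanglesE)
    have "\<Squnion>\<^bsub>K\<^esub> {delta M (emb_pos L x), delta M (emb_neg L y)} \<in> J"
      using RN[OF delta_neg[OF r(1)]] RP[OF delta_pos[OF r(2)]] by (intro subframeD(2)[OF J]) simp
    then show ?thesis
      using r by (simp add: M.delta_meet join_def)
  qed
  have d: "delta M s \<in> J" if "s \<in> F" for s
  proof -
    obtain A where A: "finite A" "A \<subseteq> rectangles L" "s = \<Squnion>\<^bsub>M\<^esub> A" using \<open>s \<in> F\<close> by (rule fin_elementsE)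
    \<comment> \<open>\<open>delta\<close> turns the join into a meet, and \<open>J\<close> is
      closed under finite meets only; the induction uses that elements of \<open>fin\<close> are
      finite joins.\<close>
    from A(1,2) have "delta M (\<Squnion>\<^bsub>M\<^esub> A) \<in> J"
    proof (induction A)
      case empty
      then show ?case using subframeD(3)[OF J] by (simp add: M.sup_empty M.delta_bottom congruence_frame_top main_frame)
    next
      case (insert r A)
      have c: "r \<in> carrier M" "A \<subseteq> carrier M" using insert rectangles_closed by auto
      have "\<Squnion>\<^bsub>M\<^esub> (insert r A) = r \<squnion>\<^bsub>M\<^esub> \<Squnion>\<^bsub>M\<^esub> A"
        using M.sup_Un[of "{r}" A] c by simp
      moreover have "delta M r \<sqinter>\<^bsub>K\<^esub> delta M (\<Squnion>\<^bsub>M\<^esub> A) \<in> J"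
        using insert dr by (intro subframeD(4)[OF J]) auto
      ultimately show ?case
        using c by (simp add: congruence_frame_meet main_frame M.delta_congruence M.delta_Int)
    qed
    then show ?thesis using A by simp
  qed
  have "nabla M ` carrier M \<union> delta M ` F \<subseteq> J" using n d by (simp add: image_subset_iff)
  from generated_subframe_least[OF J this] show ?thesis
    by (simp only: main_assembly_carrier[symmetric] assembly_parts(3) J_def)
qed

lemma assembly_biframe: "biframe (assembly L)"
  unfolding biframe_def
proof (intro conjI ballI)
  show "frame (pos_part (assembly L))" "frame (neg_part (assembly L))" "frame (main_part (assembly L))"
    by (fact pos_assembly_frame neg_assembly_frame main_assembly_frame)+
  show "emb_pos (assembly L) \<in> frame_maps (pos_part (assembly L)) (main_part (assembly L))"
    unfolding assembly_parts(4)
    by (rule subframe_inclusion[OF M.congruence_frame_frame pos_subframe finitary_subframe pos_finitary,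
          folded pos_assembly main_assembly])
  show "emb_neg (assembly L) \<in> frame_maps (neg_part (assembly L)) (main_part (assembly L))"
    unfolding assembly_parts(5)
    by (rule subframe_inclusion[OF M.congruence_frame_frame neg_subframe finitary_subframe neg_finitary,
          folded neg_assembly main_assembly])
  show "inj_on (emb_pos (assembly L)) Ap" "inj_on (emb_neg (assembly L)) An"
    by (simp_all add: inj_on_def emb_assembly)
  fix C assume "C \<in> carrier (main_part (assembly L))"
  then have "C \<in> {\<Squnion>\<^bsub>K\<^esub> A | A. A \<subseteq> rectangles (assembly L)}"
    unfolding main_assembly_carrier using finitary_join_of_rectangles by blast
  then obtain A where "A \<subseteq> rectangles (assembly L)" "C = \<Squnion>\<^bsub>K\<^esub> A" by blast
  then show "\<exists>A. A \<subseteq> rectangles (assembly L) \<and> C = \<Squnion>\<^bsub>main_part (assembly L)\<^esub> A"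
    using rectangles_assembly_closed main_assembly_sup[of A] by auto
qed

text \<open>Stated for a general frame map \<open>e\<close> into \<open>M\<close> so that it serves
  both parts, via their embeddings, and the main component, via the identity.\<close>

lemma nabla_frame_map:
  assumes Q: "frame Q" and e: "e \<in> frame_maps Q M" and S: "subframe K S" and eS: "\<And>x. x \<in> carrier Q \<Longrightarrow> nabla M (e x) \<in> S"
  shows "(\<lambda>x\<in>carrier Q. nabla M (e x)) \<in> frame_maps Q (K\<lparr>carrier := S\<rparr>)"
  unfolding frame_maps_def mem_Collect_eq
proof (intro conjI allI impI ballI)
  interpret Q: frame Q by (rule Q)
  note ec = frame_mapsD(2)[OF e]
  note KF = M.congruence_frame_frame
  show "(\<lambda>x\<in>carrier Q. nabla M (e x)) \<in> carrier Q \<rightarrow>\<^sub>E carrier (K\<lparr>carrier := S\<rparr>)" using eS by auto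
  show "(\<lambda>x\<in>carrier Q. nabla M (e x)) \<top>\<^bsub>Q\<^esub> = \<top>\<^bsub>K\<lparr>carrier := S\<rparr>\<^esub>"
    by (simp add: subframe_top[OF KF S] frame_mapsD(4)[OF e] M.nabla_top congruence_frame_top[OF main_frame])
  show "(\<lambda>x\<in>carrier Q. nabla M (e x)) (x \<sqinter>\<^bsub>Q\<^esub> y) =
     (\<lambda>x\<in>carrier Q. nabla M (e x)) x \<sqinter>\<^bsub>K\<lparr>carrier := S\<rparr>\<^esub> (\<lambda>x\<in>carrier Q. nabla M (e x)) y"
    if "x \<in> carrier Q" "y \<in> carrier Q" for x y
    using that eS ec by (simp add: subframe_meet[OF KF S] frame_mapsD(5)[OF e] congruence_frame_meet
        main_frame M.nabla_congruence M.nabla_Int)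
  fix A assume A: "A \<subseteq> carrier Q"
  have "(\<lambda>x\<in>carrier Q. nabla M (e x)) ` A = nabla M ` e ` A"
    unfolding image_image by (rule image_cong) (use A in auto)
  moreover have "nabla M ` e ` A \<subseteq> S" using A eS by auto
  moreover have "e ` A \<subseteq> carrier M" using A ec by auto
  ultimately show "(\<lambda>x\<in>carrier Q. nabla M (e x)) (\<Squnion>\<^bsub>Q\<^esub> A) =
      \<Squnion>\<^bsub>K\<lparr>carrier := S\<rparr>\<^esub> ((\<lambda>x\<in>carrier Q. nabla M (e x)) ` A)"
    using A by (simp add: subframe_sup[OF KF S] frame_mapsD(3)[OF e] M.nabla_sup)
qed

lemma nabla_map_biframe_map: "nabla_map L \<in> biframe_maps L (assembly L)"
  unfolding biframe_maps_def nabla_map_def mem_Collect_eq case_prod_conv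
proof (intro conjI bexI[of _ "\<lambda>x\<in>carrier M. nabla M x"] ballI)
  from nabla_frame_map[OF main_frame identity_frame_map[OF main_frame] finitary_subframe]
  show "(\<lambda>x\<in>carrier M. nabla M x) \<in> frame_maps M (main_part (assembly L))"
    by (simp add: main_assembly nabla_finitary cong: restrict_cong)
  show "(\<lambda>x\<in>carrier P. nabla M (emb_pos L x)) \<in> frame_maps P (pos_part (assembly L))"
    by (rule nabla_frame_map[OF pos_frame emb_pos_map pos_subframe nabla_pos, folded pos_assembly])
  show "(\<lambda>x\<in>carrier N. nabla M (emb_neg L x)) \<in> frame_maps N (neg_part (assembly L))"
    by (rule nabla_frame_map[OF neg_frame emb_neg_map neg_subframe nabla_neg, folded neg_assembly])
qed (simp_all add: emb_assembly nabla_pos nabla_neg)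

lemma nabla_map_inj:
  "inj_on (fst (nabla_map L)) (carrier P)" "inj_on (snd (nabla_map L)) (carrier N)"
  using emb_pos_inj emb_neg_inj M.nabla_inj
  by (auto simp: inj_on_def nabla_map_def)

text \<open>The generators are distributed so that \<open>nabla\<close> and \<open>delta\<close> of
  the same embedded element fall into opposite parts of the assembly.\<close>

lemma nabla_delta_bicomplementary:
  "x \<in> carrier P \<Longrightarrow> bicomplementary (assembly L) (nabla M (emb_pos L x)) (delta M (emb_pos L x))"
  "y \<in> carrier N \<Longrightarrow> bicomplementary (assembly L) (delta M (emb_neg L y)) (nabla M (emb_neg L y))"
  using M.nabla_delta_complement
  by (simp_all add: bicomplementary_def emb_assembly nabla_pos nabla_neg delta_pos delta_neg
      main_assembly_meet main_assembly_join main_assembly_bottom main_assembly_top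
      nabla_finitary delta_finitary emb_fin meet_comm[of K "delta M _"] join_comm[of K "delta M _"])

end


section \<open>The universal property of the assembly\<close>

context frame
begin

text \<open>What \<open>bicomplementary\<close> becomes after embedding both elements in the main
  component. There De Morgan's laws apply to elements belonging to neither part.\<close>

definition complementary :: "'a \<Rightarrow> 'a \<Rightarrow> bool"
  where "complementary x y \<longleftrightarrow> x \<in> carrier L \<and> y \<in> carrier L \<and> x \<sqinter> y = \<bottom> \<and> x \<squnion> y = \<top>"

lemma complementary_unique: "complementary x y \<Longrightarrow> complementary x z \<Longrightarrow> y = z"
  using complement_unique by (auto simp: complementary_def)

lemma complementary_commute: "complementary x y \<Longrightarrow> complementary y x"
  by (auto simp: complementary_def meet_comm[of L y] join_comm[of L y])

lemma complementary_bottom_top: "complementary \<bottom> \<top>"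
  by (simp add: complementary_def bottom_meet_eq bottom_join_eq)

lemma complementary_join:
  assumes x: "complementary x x'" and y: "complementary y y'"
  shows "complementary (x \<squnion> y) (x' \<sqinter> y')"
proof -
  note c = x[unfolded complementary_def] y[unfolded complementary_def]
  have cl: "x \<in> carrier L" "y \<in> carrier L" "x' \<in> carrier L" "y' \<in> carrier L" using c by auto
  have "(x \<squnion> y) \<sqinter> (x' \<sqinter> y') = (x \<sqinter> (x' \<sqinter> y')) \<squnion> (y \<sqinter> (x' \<sqinter> y'))"
    using cl by (simp add: join_meet_distrib_right)
  also have "x \<sqinter> (x' \<sqinter> y') = (x \<sqinter> x') \<sqinter> y'" using cl by (simp add: meet_assoc)
  also have "y \<sqinter> (x' \<sqinter> y') = x' \<sqinter> (y \<sqinter> y')"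
    using cl by (simp only: meet_assoc[symmetric] meet_comm[of L y x'])
  finally have "(x \<squnion> y) \<sqinter> (x' \<sqinter> y') = \<bottom>" using c by (simp add: bottom_meet_eq bottom_join_eq)
  moreover have "(x \<squnion> y) \<squnion> (x' \<sqinter> y') = (x \<squnion> y \<squnion> x') \<sqinter> (x \<squnion> y \<squnion> y')"
    using cl by (simp add: join_meet_distrib)
  moreover have "x \<squnion> y \<squnion> y' = \<top>" using c by (simp add: join_assoc top_join_eq)
  moreover have "x \<squnion> y \<squnion> x' = y \<squnion> (x \<squnion> x')"
    using cl by (simp only: join_assoc join_comm[of L x y])
  ultimately show ?thesis using c by (simp add: complementary_def top_join_eq top_meet_eq)
qed

lemma complementary_meet:
  assumes x: "complementary x x'" and y: "complementary y y'"
  shows "complementary (x \<sqinter> y) (x' \<squnion> y')"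
  by (rule complementary_commute[OF complementary_join[OF complementary_commute[OF x] complementary_commute[OF y]]])

lemma complementary_sup:
  assumes "finite A" "\<And>a. a \<in> A \<Longrightarrow> \<exists>b. complementary a b"
  shows "\<exists>b. complementary (\<Squnion>A) b"
  using assms
proof (induction A)
  case empty
  then show ?case using complementary_bottom_top by (auto simp: sup_empty)
next
  case (insert a A)
  obtain b c where b: "complementary a b" and c: "complementary (\<Squnion>A) c" using insert by blast
  have "insert a A \<subseteq> carrier L" using insert.prems by (auto simp: complementary_def)
  then have "\<Squnion>(insert a A) = a \<squnion> \<Squnion>A" using sup_Un[of "{a}" A] by simp
  then show ?case using complementary_join[OF b c] by auto
qed

end

lemma frame_map_complementary:
  assumes "frame A" "frame B" "f \<in> frame_maps A B" "frame.complementary A x y"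
  shows "frame.complementary B (f x) (f y)"
  using assms(4) frame_mapsD[OF assms(3)] frame_maps_bottom[OF assms(1-3)] frame_maps_join[OF assms(3)]
  unfolding frame.complementary_def[OF assms(1)] frame.complementary_def[OF assms(2)] by metis

section \<open>Transport of congruences and subframes along frame maps\<close>

lemma congruence_preimage:
  assumes A: "frame A" and B: "frame B" and f: "f \<in> frame_maps A B" and E: "frame_congruence B E"
  shows "frame_congruence A {(x, y) \<in> carrier A \<times> carrier A. (f x, f y) \<in> E}" (is "frame_congruence A ?I")
proof (rule frame_congruenceI)
  interpret A: frame A by (rule A)
  note E' = B E
  note fD = frame_mapsD[OF f]
  show "?I \<subseteq> carrier A \<times> carrier A" by blast
  show "(x, x) \<in> ?I" if "x \<in> carrier A" for x using that fD(2) cong_refl[OF E'] by auto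
  show "(y, x) \<in> ?I" if "(x, y) \<in> ?I" for x y using that cong_sym[OF E'] by auto
  show "(x, z) \<in> ?I" if "(x, y) \<in> ?I" "(y, z) \<in> ?I" for x y z using that cong_trans[OF E'] by auto
  show "(x \<sqinter>\<^bsub>A\<^esub> u, y \<sqinter>\<^bsub>A\<^esub> v) \<in> ?I" if "(x, y) \<in> ?I" "(u, v) \<in> ?I" for x y u v
    using that cong_meet[OF E'] by (auto simp: fD(5))
  show "(\<Squnion>\<^bsub>A\<^esub> (fst ` X), \<Squnion>\<^bsub>A\<^esub> (snd ` X)) \<in> ?I" if "X \<subseteq> ?I" for X
  proof -
    have cl: "fst ` X \<subseteq> carrier A" "snd ` X \<subseteq> carrier A" using that by auto
    have "(\<Squnion>\<^bsub>B\<^esub> ((\<lambda>p. f (fst p)) ` X), \<Squnion>\<^bsub>B\<^esub> ((\<lambda>p. f (snd p)) ` X)) \<in> E"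
      by (rule cong_sup[OF E']) (use that in auto)
    then show ?thesis using cl by (simp add: fD(3) image_image)
  qed
qed

lemma frame_map_image_subframe:
  assumes A: "frame A" and e: "e \<in> frame_maps A B"
  shows "subframe B (e ` carrier A)"
proof -
  interpret A: frame A by (rule A)
  note eD = frame_mapsD[OF e]
  show ?thesis
    unfolding subframe_def
  proof (intro conjI allI impI ballI)
    show "e ` carrier A \<subseteq> carrier B" using eD(2) by auto
    show "\<top>\<^bsub>B\<^esub> \<in> e ` carrier A" using imageI[OF A.top_closed, of e] by (simp only: eD(4))
    show "\<Squnion>\<^bsub>B\<^esub> X \<in> e ` carrier A" if X: "X \<subseteq> e ` carrier A" for X
    proof -
      obtain Y where Y: "Y \<subseteq> carrier A" "X = e ` Y" using X by (auto simp: subset_image_iff)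
      then show ?thesis using eD(3)[OF Y(1)] A.sup_closed[OF Y(1)] by (metis imageI)
    qed
    show "u \<sqinter>\<^bsub>B\<^esub> v \<in> e ` carrier A" if "u \<in> e ` carrier A" "v \<in> e ` carrier A" for u v
    proof -
      obtain x y where "x \<in> carrier A" "y \<in> carrier A" "u = e x" "v = e y"
        using \<open>u \<in> e ` carrier A\<close> \<open>v \<in> e ` carrier A\<close> by blast
      then show ?thesis using eD(5)[of x y] A.meet_closed[of x y] by (metis imageI)
    qed
  qed
qed

text \<open>Lets one check on generators that a frame map on a generated subframe takes values in a
  given subframe of the target.\<close>

lemma subframe_preimage:
  assumes K: "frame K" and T: "subframe K T" and g: "g \<in> frame_maps (K\<lparr>carrier := T\<rparr>) B" and S: "subframe B S"
  shows "subframe K {x \<in> T. g x \<in> S}"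
  unfolding subframe_def
proof (intro conjI allI impI ballI)
  note gD = frame_mapsD[OF g, simplified, unfolded subframe_top[OF K T]]
  show "{x \<in> T. g x \<in> S} \<subseteq> carrier K" using subframeD(1)[OF T] by blast
  show "\<top>\<^bsub>K\<^esub> \<in> {x \<in> T. g x \<in> S}" using gD(4) subframeD(3)[OF T] subframeD(3)[OF S] by simp
  show "\<Squnion>\<^bsub>K\<^esub> A \<in> {x \<in> T. g x \<in> S}" if A: "A \<subseteq> {x \<in> T. g x \<in> S}" for A
  proof -
    have "A \<subseteq> T" "g ` A \<subseteq> S" using A by auto
    then show ?thesis
      using gD(3)[of A] subframeD(2)[OF T] subframeD(2)[OF S] by (simp add: subframe_sup[OF K T])
  qed
  show "x \<sqinter>\<^bsub>K\<^esub> y \<in> {x \<in> T. g x \<in> S}" if "x \<in> {x \<in> T. g x \<in> S}" "y \<in> {x \<in> T. g x \<in> S}" for x y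
    using that frame_mapsD(5)[OF g, of x y] subframeD(4)[OF T, of x y] subframeD(4)[OF S, of "g x" "g y"]
    by (simp add: subframe_meet[OF K T])
qed

text \<open>Factors a frame map through an injective one containing its image; this recovers the two
  components of a biframe map from its main map.\<close>

lemma frame_map_lift:
  assumes A: "frame A" and X: "frame X" and e: "e \<in> frame_maps A B" "inj_on e (carrier A)"
    and g: "g \<in> frame_maps X B" and sub: "\<And>x. x \<in> carrier X \<Longrightarrow> g x \<in> e ` carrier A"
  shows "(\<lambda>x\<in>carrier X. inv_into (carrier A) e (g x)) \<in> frame_maps X A" (is "?k \<in> _")
    and "x \<in> carrier X \<Longrightarrow> e (inv_into (carrier A) e (g x)) = g x"
proof -
  interpret A: frame A by (rule A)
  interpret X: frame X by (rule X)
  note eD = frame_mapsD[OF e(1)] and gD = frame_mapsD[OF g]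
  have k: "?k x \<in> carrier A" "e (?k x) = g x" if "x \<in> carrier X" for x
    using that sub[OF that] by (auto simp: inv_into_into f_inv_into_f)
  then show "x \<in> carrier X \<Longrightarrow> e (inv_into (carrier A) e (g x)) = g x" by simp
  have eqI: "?k x = z" if "x \<in> carrier X" "z \<in> carrier A" "g x = e z" for x z
    using that inv_into_f_f[OF e(2)] by simp
  show "?k \<in> frame_maps X A"
    unfolding frame_maps_def mem_Collect_eq
  proof (intro conjI allI impI ballI)
    show "?k \<in> carrier X \<rightarrow>\<^sub>E carrier A" using k(1) by auto
    show "?k \<top>\<^bsub>X\<^esub> = \<top>\<^bsub>A\<^esub>" by (rule eqI) (simp_all add: gD(4) eD(4))
    show "?k (\<Squnion>\<^bsub>X\<^esub> Y) = \<Squnion>\<^bsub>A\<^esub> (?k ` Y)" if Y: "Y \<subseteq> carrier X" for Y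
    proof (rule eqI)
      have c: "?k ` Y \<subseteq> carrier A" using k(1) Y by blast
      have "e ` ?k ` Y = g ` Y" unfolding image_image by (rule image_cong) (use k(2) Y in auto)
      then show "g (\<Squnion>\<^bsub>X\<^esub> Y) = e (\<Squnion>\<^bsub>A\<^esub> (?k ` Y))" by (simp only: gD(3)[OF Y] eD(3)[OF c])
      show "\<Squnion>\<^bsub>A\<^esub> (?k ` Y) \<in> carrier A" by (rule A.sup_closed[OF c])
    qed (use Y in simp)
    show "?k (x \<sqinter>\<^bsub>X\<^esub> y) = ?k x \<sqinter>\<^bsub>A\<^esub> ?k y" if xy: "x \<in> carrier X" "y \<in> carrier X" for x y
    proof (rule eqI)
      show "g (x \<sqinter>\<^bsub>X\<^esub> y) = e (?k x \<sqinter>\<^bsub>A\<^esub> ?k y)"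
        by (simp only: gD(5)[OF xy] eD(5)[OF k(1)[OF xy(1)] k(1)[OF xy(2)]] k(2)[OF xy(1)] k(2)[OF xy(2)])
      show "?k x \<sqinter>\<^bsub>A\<^esub> ?k y \<in> carrier A" by (rule A.meet_closed[OF k(1)[OF xy(1)] k(1)[OF xy(2)]])
    qed (use xy in simp)
  qed
qed

section \<open>Extending a frame map with complemented values to the finitary congruences\<close>

lemma (in biframe_locale) assembly_complementary:
  "s \<in> F \<Longrightarrow> frame.complementary (main_part (assembly L)) (nabla M s) (delta M s)"
  unfolding frame.complementary_def[OF main_assembly_frame] main_assembly_carrier
  using M.nabla_delta_complement[of s]
  by (simp add: nabla_finitary delta_finitary main_assembly_meet main_assembly_join main_assembly_bottom main_assembly_top)

text \<open>The target is a plain frame: the two parts of a target biframe matter only when the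
  extension is restricted. \<open>neg\<close> need only be a choice of complements for elements of
  \<open>fin\<close>.\<close>

locale complemented_extension = biframe_locale L + T: gorder_frame T
  for L :: "('p, 'n, 'a) biframe" and T :: "'b gorder" +
  fixes h and neg
  assumes h: "h \<in> frame_maps M T"
    and neg: "s \<in> F \<Longrightarrow> T.complementary (h s) (neg s)"
begin

lemma h_closed [simp]: "x \<in> carrier M \<Longrightarrow> h x \<in> carrier T"
  by (rule frame_mapsD(2)[OF h])

lemma neg_closed [simp]: "s \<in> F \<Longrightarrow> neg s \<in> carrier T"
  using neg by (auto simp: T.complementary_def)

lemma le_neg_iff:
  "\<lbrakk>t \<in> F; s \<in> F; m \<in> carrier T\<rbrakk> \<Longrightarrow> h t \<sqinter>\<^bsub>T\<^esub> neg s \<sqsubseteq>\<^bsub>T\<^esub> m \<longleftrightarrow> h t \<sqsubseteq>\<^bsub>T\<^esub> h s \<squnion>\<^bsub>T\<^esub> m"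
  using neg[of s] by (intro T.meet_complement_le_iff) (auto simp: T.complementary_def)

lemma neg_join: "\<lbrakk>s \<in> F; t \<in> F\<rbrakk> \<Longrightarrow> neg (s \<squnion>\<^bsub>M\<^esub> t) = neg s \<sqinter>\<^bsub>T\<^esub> neg t"
  using T.complementary_unique[OF neg[OF fin_join, of s t]] T.complementary_join[OF neg neg, of s t]
  by (simp add: frame_maps_join[OF h])

lemma neg_bottom: "neg \<bottom>\<^bsub>M\<^esub> = \<top>\<^bsub>T\<^esub>"
  using T.complementary_unique[OF neg[OF fin_bottom]] T.complementary_bottom_top
  by (simp add: frame_maps_bottom[OF main_frame T.frame_axioms h])

definition differences :: "('a \<times> 'a) set \<Rightarrow> 'b set"
  where "differences C = {h t \<sqinter>\<^bsub>T\<^esub> neg s | t s. t \<in> F \<and> s \<in> F \<and> (t \<sqinter>\<^bsub>M\<^esub> s, t) \<in> C}"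

definition extension :: "('a \<times> 'a) set \<Rightarrow> 'b"
  where "extension = (\<lambda>C\<in>finitary_congruences. \<Squnion>\<^bsub>T\<^esub> (differences C))"

lemma differences_closed: "differences C \<subseteq> carrier T"
  by (auto simp: differences_def)

lemma differenceI: "\<lbrakk>t \<in> F; s \<in> F; (t \<sqinter>\<^bsub>M\<^esub> s, t) \<in> C\<rbrakk> \<Longrightarrow> h t \<sqinter>\<^bsub>T\<^esub> neg s \<in> differences C"
  by (auto simp: differences_def)

lemma extension_closed: "finitary_congruence L C \<Longrightarrow> extension C \<in> carrier T"
  by (simp add: extension_def differences_closed)

lemma difference_le_extension:
  "\<lbrakk>finitary_congruence L C; t \<in> F; s \<in> F; (t \<sqinter>\<^bsub>M\<^esub> s, t) \<in> C\<rbrakk> \<Longrightarrow> h t \<sqinter>\<^bsub>T\<^esub> neg s \<sqsubseteq>\<^bsub>T\<^esub> extension C"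
  by (simp add: extension_def T.sup_upper differences_closed differenceI)

text \<open>Moving the complement across turns a bound on the join into inequalities that no longer
  mention \<open>neg\<close>.\<close>

lemma extension_le_iff:
  assumes "finitary_congruence L C" "m \<in> carrier T"
  shows "extension C \<sqsubseteq>\<^bsub>T\<^esub> m \<longleftrightarrow> (\<forall>t\<in>F. \<forall>s\<in>F. (t \<sqinter>\<^bsub>M\<^esub> s, t) \<in> C \<longrightarrow> h t \<sqsubseteq>\<^bsub>T\<^esub> h s \<squnion>\<^bsub>T\<^esub> m)"
proof -
  have "(\<forall>a\<in>differences C. a \<sqsubseteq>\<^bsub>T\<^esub> m) \<longleftrightarrow> (\<forall>t\<in>F. \<forall>s\<in>F. (t \<sqinter>\<^bsub>M\<^esub> s, t) \<in> C \<longrightarrow> h t \<sqinter>\<^bsub>T\<^esub> neg s \<sqsubseteq>\<^bsub>T\<^esub> m)"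
    unfolding differences_def by blast
  then show ?thesis
    using assms by (simp add: extension_def T.sup_le_iff differences_closed le_neg_iff)
qed

text \<open>Inequalities modulo \<open>C\<close> hold modulo \<open>m\<close> in \<open>T\<close> iff \<open>C\<close> lies below the pullback of the closed
  congruence of \<open>m\<close>. A congruence generated by its finitary inequalities is thus controlled by
  its differences, which makes \<^const>\<open>extension\<close> a left adjoint.\<close>

lemma pulled_back_le_iff:
  assumes "t \<in> carrier M" "s \<in> carrier M" "m \<in> carrier T"
  shows "(h (t \<sqinter>\<^bsub>M\<^esub> s), h t) \<in> nabla T m \<longleftrightarrow> h t \<sqsubseteq>\<^bsub>T\<^esub> h s \<squnion>\<^bsub>T\<^esub> m"
proof -
  have eq: "h (t \<sqinter>\<^bsub>M\<^esub> s) \<squnion>\<^bsub>T\<^esub> m = (h t \<squnion>\<^bsub>T\<^esub> m) \<sqinter>\<^bsub>T\<^esub> (h s \<squnion>\<^bsub>T\<^esub> m)"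
    using assms by (simp add: frame_mapsD(5)[OF h] T.meet_join_distrib_right)
  have "h t \<sqsubseteq>\<^bsub>T\<^esub> h s \<squnion>\<^bsub>T\<^esub> m \<longleftrightarrow> h t \<squnion>\<^bsub>T\<^esub> m \<sqsubseteq>\<^bsub>T\<^esub> h s \<squnion>\<^bsub>T\<^esub> m"
    using assms by (simp add: T.join_le_iff T.join_right)
  also have "\<dots> \<longleftrightarrow> h (t \<sqinter>\<^bsub>M\<^esub> s) \<squnion>\<^bsub>T\<^esub> m = h t \<squnion>\<^bsub>T\<^esub> m"
    unfolding eq using assms T.le_iff_join[of "h t \<squnion>\<^bsub>T\<^esub> m" "h s \<squnion>\<^bsub>T\<^esub> m"] by auto
  finally show ?thesis using assms by (simp add: nabla_def)
qed

lemma extension_adjoint: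
  assumes C: "finitary_congruence L C" and m: "m \<in> carrier T"
  shows "extension C \<sqsubseteq>\<^bsub>T\<^esub> m \<longleftrightarrow> C \<subseteq> {(x, y) \<in> carrier M \<times> carrier M. (h x, h y) \<in> nabla T m}"
proof -
  have E: "frame_congruence M {(x, y) \<in> carrier M \<times> carrier M. (h x, h y) \<in> nabla T m}"
    by (rule congruence_preimage[OF main_frame T.frame_axioms h T.nabla_congruence[OF m]])
  show ?thesis
    \<comment> \<open>Both sides are now tested on the same inequalities between elements of
      \<open>fin\<close>, and the tests agree one by one.\<close>
    unfolding extension_le_iff[OF C m] finitary_le_iff[OF C E]
    by (intro ball_cong HOL.refl imp_cong) (use m pulled_back_le_iff in simp)
qed

text \<open>Distributivity writes the meet of the two extensions as a join of meets of differences.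
  Each such meet is itself a difference, that of the inequality
  \<open>t \<sqinter> t' \<sqsubseteq> s \<squnion> s'\<close>, which is forced by
  \<open>C \<inter> D\<close>.\<close>

lemma extension_meet:
  assumes C: "finitary_congruence L C" and D: "finitary_congruence L D"
  shows "extension (C \<inter> D) = extension C \<sqinter>\<^bsub>T\<^esub> extension D"
proof (rule T.le_antisym)
  have "C \<sqinter>\<^bsub>K\<^esub> D = C \<inter> D" by (rule congruence_frame_meet[OF main_frame finitary_closed[OF C] finitary_closed[OF D]])
  then have CD: "finitary_congruence L (C \<inter> D)" using subframeD(4)[OF finitary_subframe, of C D] C D by simp
  show cl: "extension (C \<inter> D) \<in> carrier T" "extension C \<sqinter>\<^bsub>T\<^esub> extension D \<in> carrier T"
    using extension_closed[OF C] extension_closed[OF D] extension_closed[OF CD] by simp_all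
  have "extension (C \<inter> D) \<sqsubseteq>\<^bsub>T\<^esub> extension X" if "X \<in> {C, D}" for X
  proof -
    have "differences (C \<inter> D) \<subseteq> differences X" using that by (auto simp: differences_def)
    then show ?thesis using that C D CD by (auto simp: extension_def intro!: T.sup_mono differences_closed)
  qed
  then show "extension (C \<inter> D) \<sqsubseteq>\<^bsub>T\<^esub> extension C \<sqinter>\<^bsub>T\<^esub> extension D"
    using extension_closed[OF C] extension_closed[OF D] cl by (simp add: T.le_meet_iff)
  have "extension C \<sqinter>\<^bsub>T\<^esub> extension D = \<Squnion>\<^bsub>T\<^esub> {a \<sqinter>\<^bsub>T\<^esub> b | a b. a \<in> differences C \<and> b \<in> differences D}"
    using C D by (simp add: extension_def T.sup_meet_sup differences_closed)
  also have "\<dots> \<sqsubseteq>\<^bsub>T\<^esub> extension (C \<inter> D)"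
  proof (rule T.sup_least[OF _ cl(1)])
    show "{a \<sqinter>\<^bsub>T\<^esub> b | a b. a \<in> differences C \<and> b \<in> differences D} \<subseteq> carrier T"
      using subsetD[OF differences_closed] by auto
    fix x assume "x \<in> {a \<sqinter>\<^bsub>T\<^esub> b | a b. a \<in> differences C \<and> b \<in> differences D}"
    then obtain t s t' s' where ts: "t \<in> F" "s \<in> F" "(t \<sqinter>\<^bsub>M\<^esub> s, t) \<in> C"
      and ts': "t' \<in> F" "s' \<in> F" "(t' \<sqinter>\<^bsub>M\<^esub> s', t') \<in> D"
      and x: "x = (h t \<sqinter>\<^bsub>T\<^esub> neg s) \<sqinter>\<^bsub>T\<^esub> (h t' \<sqinter>\<^bsub>T\<^esub> neg s')"
      unfolding differences_def by blast
    have "x = (h t \<sqinter>\<^bsub>T\<^esub> h t') \<sqinter>\<^bsub>T\<^esub> (neg s \<sqinter>\<^bsub>T\<^esub> neg s')"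
      unfolding x using ts ts' by (intro T.meet_interchange) simp_all
    also have "\<dots> = h (t \<sqinter>\<^bsub>M\<^esub> t') \<sqinter>\<^bsub>T\<^esub> neg (s \<squnion>\<^bsub>M\<^esub> s')"
      using ts ts' by (simp add: frame_mapsD(5)[OF h] neg_join)
    finally have x: "x = h (t \<sqinter>\<^bsub>M\<^esub> t') \<sqinter>\<^bsub>T\<^esub> neg (s \<squnion>\<^bsub>M\<^esub> s')" .
    \<comment> \<open>The least congruence forcing the combined inequality is the intersection of
      those forcing the two given ones, so it lies below \<open>C \<inter> D\<close>.\<close>
    have "nabla M t \<inter> delta M s \<subseteq> C" "nabla M t' \<inter> delta M s' \<subseteq> D"
      using ts ts' finitary_closed C D by (simp_all add: M.nabla_delta_le_iff)
    then have "nabla M (t \<sqinter>\<^bsub>M\<^esub> t') \<inter> delta M (s \<squnion>\<^bsub>M\<^esub> s') \<subseteq> C \<inter> D"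
      using basic_Int[OF ts(1,2) ts'(1,2)] by blast
    then have "((t \<sqinter>\<^bsub>M\<^esub> t') \<sqinter>\<^bsub>M\<^esub> (s \<squnion>\<^bsub>M\<^esub> s'), t \<sqinter>\<^bsub>M\<^esub> t') \<in> C \<inter> D"
      using ts ts' finitary_closed[OF CD] by (subst (asm) M.nabla_delta_le_iff) simp_all
    then show "x \<sqsubseteq>\<^bsub>T\<^esub> extension (C \<inter> D)"
      unfolding x using ts ts' by (intro difference_le_extension CD fin_meet fin_join)
  qed
  finally show "extension C \<sqinter>\<^bsub>T\<^esub> extension D \<sqsubseteq>\<^bsub>T\<^esub> extension (C \<inter> D)" .
qed

text \<open>A left adjoint preserves joins: both sides lie below the same elements \<open>m\<close>,
  because pullbacks of \<open>nabla T m\<close> bound a join of congruences iff they bound each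
  member.\<close>

lemma extension_sup:
  assumes A: "\<A> \<subseteq> finitary_congruences"
  shows "extension (\<Squnion>\<^bsub>K\<^esub> \<A>) = \<Squnion>\<^bsub>T\<^esub> (extension ` \<A>)"
proof (rule sym, rule complete_sup_eqI[OF T.complete_lattice_axioms])
  have c: "frame_congruence M C" if "C \<in> \<A>" for C using that A finitary_closed by blast
  have S: "finitary_congruence L (\<Squnion>\<^bsub>K\<^esub> \<A>)" using subframeD(2)[OF finitary_subframe A] by simp
  show "extension ` \<A> \<subseteq> carrier T" using A extension_closed by blast
  show "extension (\<Squnion>\<^bsub>K\<^esub> \<A>) \<in> carrier T" by (rule extension_closed[OF S])
  have adj: "extension (\<Squnion>\<^bsub>K\<^esub> \<A>) \<sqsubseteq>\<^bsub>T\<^esub> m \<longleftrightarrow> (\<forall>C\<in>\<A>. extension C \<sqsubseteq>\<^bsub>T\<^esub> m)" if m: "m \<in> carrier T" for m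
  proof -
    have E: "frame_congruence M {(x, y) \<in> carrier M \<times> carrier M. (h x, h y) \<in> nabla T m}"
      by (rule congruence_preimage[OF main_frame T.frame_axioms h T.nabla_congruence[OF m]])
    have "(\<forall>C\<in>\<A>. extension C \<sqsubseteq>\<^bsub>T\<^esub> m) \<longleftrightarrow>
      (\<forall>C\<in>\<A>. C \<subseteq> {(x, y) \<in> carrier M \<times> carrier M. (h x, h y) \<in> nabla T m})"
      by (intro ball_cong HOL.refl extension_adjoint m) (use A in auto)
    then show ?thesis
      unfolding extension_adjoint[OF S m] using M.congruence_sup_le_iff[OF c E] by simp
  qed
  show "a \<sqsubseteq>\<^bsub>T\<^esub> extension (\<Squnion>\<^bsub>K\<^esub> \<A>)" if "a \<in> extension ` \<A>" for a
    using that adj[OF extension_closed[OF S]] extension_closed[OF S] by auto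
  show "extension (\<Squnion>\<^bsub>K\<^esub> \<A>) \<sqsubseteq>\<^bsub>T\<^esub> m" if "m \<in> carrier T" "\<And>a. a \<in> extension ` \<A> \<Longrightarrow> a \<sqsubseteq>\<^bsub>T\<^esub> m" for m
    using that adj by auto
qed

text \<open>The difference of the inequality \<open>t \<sqsubseteq> \<bottom>\<close> is
  \<open>h t\<close>, which gives the lower bound. The upper bound is the adjunction at
  \<open>m = h t\<close>.\<close>

lemma extension_nabla_fin:
  assumes t: "t \<in> F"
  shows "extension (nabla M t) = h t"
proof (rule T.le_antisym)
  have n: "finitary_congruence L (nabla M t)" using t by (simp add: nabla_finitary)
  show "extension (nabla M t) \<in> carrier T" "h t \<in> carrier T" using extension_closed[OF n] t by simp_all
  have "(\<bottom>\<^bsub>M\<^esub>, t) \<in> nabla M t" using t by (simp add: nabla_def M.bottom_join_eq M.join_idem)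
  then have "h t \<sqinter>\<^bsub>T\<^esub> neg \<bottom>\<^bsub>M\<^esub> \<sqsubseteq>\<^bsub>T\<^esub> extension (nabla M t)"
    using t by (intro difference_le_extension[OF n] fin_bottom) (simp_all add: M.bottom_meet_eq)
  then show "h t \<sqsubseteq>\<^bsub>T\<^esub> extension (nabla M t)" using t by (simp add: neg_bottom T.top_meet_eq)
  have E: "frame_congruence M {(x, y) \<in> carrier M \<times> carrier M. (h x, h y) \<in> nabla T (h t)}"
    by (rule congruence_preimage[OF main_frame T.frame_axioms h T.nabla_congruence]) (use t in simp)
  have "(\<bottom>\<^bsub>M\<^esub>, t) \<in> {(x, y) \<in> carrier M \<times> carrier M. (h x, h y) \<in> nabla T (h t)}"
    using t frame_maps_bottom[OF main_frame T.frame_axioms h]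
    by (simp add: nabla_def T.bottom_join_eq T.join_idem)
  then have "nabla M t \<subseteq> {(x, y) \<in> carrier M \<times> carrier M. (h x, h y) \<in> nabla T (h t)}"
    using t by (subst M.nabla_le_iff[OF _ E]) simp_all
  then show "extension (nabla M t) \<sqsubseteq>\<^bsub>T\<^esub> h t" using t by (subst extension_adjoint[OF n]) simp_all
qed

lemma extension_frame_map: "extension \<in> frame_maps (main_part (assembly L)) T"
  unfolding frame_maps_def mem_Collect_eq
proof (intro conjI allI impI ballI)
  show "extension \<in> carrier (main_part (assembly L)) \<rightarrow>\<^sub>E carrier T"
    unfolding main_assembly_carrier using extension_closed by (auto simp: extension_def)
  \<comment> \<open>The total congruence is \<open>nabla\<close> of the top element, which belongs
    to \<open>fin\<close>.\<close>
  show "extension \<top>\<^bsub>main_part (assembly L)\<^esub> = \<top>\<^bsub>T\<^esub>"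
    using extension_nabla_fin[OF fin_top]
    by (simp add: main_assembly_top congruence_frame_top[OF main_frame] M.nabla_top frame_mapsD(4)[OF h])
  show "extension (\<Squnion>\<^bsub>main_part (assembly L)\<^esub> A) = \<Squnion>\<^bsub>T\<^esub> (extension ` A)"
    if "A \<subseteq> carrier (main_part (assembly L))" for A
    using that unfolding main_assembly_carrier by (simp add: main_assembly_sup extension_sup)
  show "extension (C \<sqinter>\<^bsub>main_part (assembly L)\<^esub> D) = extension C \<sqinter>\<^bsub>T\<^esub> extension D"
    if "C \<in> carrier (main_part (assembly L))" "D \<in> carrier (main_part (assembly L))" for C D
    using that unfolding main_assembly_carrier
    by (simp add: main_assembly_meet congruence_frame_meet[OF main_frame] finitary_closed extension_meet)
qed

text \<open>Frame maps preserve complements, and \<open>delta M s\<close> is the complement of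
  \<open>nabla M s\<close>.\<close>

lemma extension_delta_fin: "s \<in> F \<Longrightarrow> extension (delta M s) = neg s"
  using frame_map_complementary[OF main_assembly_frame T.frame_axioms extension_frame_map assembly_complementary, of s]
    T.complementary_unique[OF _ neg, of s] by (auto simp: extension_nabla_fin)

end

section \<open>From the main component back to biframe maps\<close>

context biframe_locale
begin

lemma bicomplementary_iff:
  "bicomplementary L x y \<longleftrightarrow> x \<in> carrier P \<and> y \<in> carrier N \<and> M.complementary (emb_pos L x) (emb_neg L y)"
  by (auto simp: bicomplementary_def M.complementary_def)

lemma comp_nabla_iff:
  assumes "fst f \<in> extensional (carrier P)" "snd f \<in> extensional (carrier N)"
  shows "biframe_comp L g (nabla_map L) = f \<longleftrightarrow>
    (\<forall>x\<in>carrier P. fst g (nabla M (emb_pos L x)) = fst f x) \<and>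
    (\<forall>y\<in>carrier N. snd g (nabla M (emb_neg L y)) = snd f y)"
proof -
  have "biframe_comp L g (nabla_map L) = f \<longleftrightarrow>
    (\<lambda>x\<in>carrier P. fst g (nabla M (emb_pos L x))) = fst f \<and> (\<lambda>y\<in>carrier N. snd g (nabla M (emb_neg L y))) = snd f"
    by (auto simp: biframe_comp_def nabla_map_def compose_def prod_eq_iff cong: restrict_cong)
  also have "\<dots> \<longleftrightarrow> (\<forall>x\<in>carrier P. fst g (nabla M (emb_pos L x)) = fst f x) \<and>
    (\<forall>y\<in>carrier N. snd g (nabla M (emb_neg L y)) = snd f y)"
    using assms by (auto simp: fun_eq_iff extensional_def)
  finally show ?thesis .
qed

text \<open>On \<open>nabla\<close> generators the maps agree by assumption. On a
  \<open>delta\<close> generator their main maps agree by uniqueness of complements, and the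
  injective embeddings of \<open>T\<close> carry this back to the two parts.\<close>

lemma assembly_map_unique:
  assumes T: "biframe T" and g: "g \<in> biframe_maps (assembly L) T" and k: "k \<in> biframe_maps (assembly L) T"
    and eq: "\<And>x. x \<in> carrier P \<Longrightarrow> fst g (nabla M (emb_pos L x)) = fst k (nabla M (emb_pos L x))"
      "\<And>y. y \<in> carrier N \<Longrightarrow> snd g (nabla M (emb_neg L y)) = snd k (nabla M (emb_neg L y))"
  shows "g = k"
proof -
  interpret T: biframe_locale T by unfold_locales (rule T)
  obtain g' where g': "fst g \<in> frame_maps (pos_part (assembly L)) T.P" "snd g \<in> frame_maps (neg_part (assembly L)) T.N"
    "g' \<in> frame_maps (main_part (assembly L)) T.M"
    "\<And>C. C \<in> Ap \<Longrightarrow> g' (emb_pos (assembly L) C) = emb_pos T (fst g C)"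
    "\<And>C. C \<in> An \<Longrightarrow> g' (emb_neg (assembly L) C) = emb_neg T (snd g C)"
    using g unfolding biframe_maps_def by auto
  obtain k' where k': "fst k \<in> frame_maps (pos_part (assembly L)) T.P" "snd k \<in> frame_maps (neg_part (assembly L)) T.N"
    "k' \<in> frame_maps (main_part (assembly L)) T.M"
    "\<And>C. C \<in> Ap \<Longrightarrow> k' (emb_pos (assembly L) C) = emb_pos T (fst k C)"
    "\<And>C. C \<in> An \<Longrightarrow> k' (emb_neg (assembly L) C) = emb_neg T (snd k C)"
    using k unfolding biframe_maps_def by auto
  have d: "g' (delta M s) = k' (delta M s)" if "s \<in> F" "g' (nabla M s) = k' (nabla M s)" for s
    using frame_map_complementary[OF main_assembly_frame T.main_frame g'(3) assembly_complementary[OF that(1)]]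
      frame_map_complementary[OF main_assembly_frame T.main_frame k'(3) assembly_complementary[OF that(1)]]
      that(2) T.M.complementary_unique by simp
  have "fst g C = fst k C" if "C \<in> gen_pos" for C
    using that
  proof
    assume "C \<in> delta M ` emb_neg L ` carrier N"
    then obtain y where y: "y \<in> carrier N" "C = delta M (emb_neg L y)" by blast
    have "g' C = k' C"
      unfolding y(2) using g'(5)[OF nabla_neg[OF y(1)]] k'(5)[OF nabla_neg[OF y(1)]] y
      by (intro d) (simp_all add: emb_assembly nabla_neg emb_fin eq)
    then have "emb_pos T (fst g C) = emb_pos T (fst k C)"
      using g'(4)[of C] k'(4)[of C] y by (simp add: emb_assembly delta_pos)
    then show ?thesis
      using inj_onD[OF T.emb_pos_inj] frame_mapsD(2)[OF g'(1)] frame_mapsD(2)[OF k'(1)] y delta_pos by simp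
  qed (use eq in auto)
  then have 1: "fst g = fst k"
    using g'(1) k'(1) unfolding assembly_parts(1)
    by (rule generated_subframe_map_eq[OF M.congruence_frame_frame generators_closed(1) T.pos_frame, rotated 2])
  have "snd g C = snd k C" if "C \<in> gen_neg" for C
    using that
  proof
    assume "C \<in> delta M ` emb_pos L ` carrier P"
    then obtain x where x: "x \<in> carrier P" "C = delta M (emb_pos L x)" by blast
    have "g' C = k' C"
      unfolding x(2) using g'(4)[OF nabla_pos[OF x(1)]] k'(4)[OF nabla_pos[OF x(1)]] x
      by (intro d) (simp_all add: emb_assembly nabla_pos emb_fin eq)
    then have "emb_neg T (snd g C) = emb_neg T (snd k C)"
      using g'(5)[of C] k'(5)[of C] x by (simp add: emb_assembly delta_neg)
    then show ?thesis
      using inj_onD[OF T.emb_neg_inj] frame_mapsD(2)[OF g'(2)] frame_mapsD(2)[OF k'(2)] x delta_neg by simp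
  qed (use eq in auto)
  then have 2: "snd g = snd k"
    using g'(2) k'(2) unfolding assembly_parts(2)
    by (rule generated_subframe_map_eq[OF M.congruence_frame_frame generators_closed(2) T.neg_frame, rotated 2])
  show ?thesis using 1 2 by (simp add: prod_eq_iff)
qed

text \<open>The main map is built first and then restricted. It respects the parts because the
  generators it sends to complements land in the part of \<open>T\<close> that contains the
  bicomplements.\<close>

lemma assembly_map_exists:
  fixes T :: "('q, 'm, 'b) biframe"
  assumes T: "biframe T" and f: "f \<in> biframe_maps L T"
    and cp: "\<And>x. x \<in> carrier P \<Longrightarrow> has_bicomplement_pos T (fst f x)"
    and cn: "\<And>y. y \<in> carrier N \<Longrightarrow> has_bicomplement_neg T (snd f y)"
  obtains g where "g \<in> biframe_maps (assembly L) T"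
    "\<And>x. x \<in> carrier P \<Longrightarrow> fst g (nabla M (emb_pos L x)) = fst f x"
    "\<And>y. y \<in> carrier N \<Longrightarrow> snd g (nabla M (emb_neg L y)) = snd f y"
proof -
  interpret T: biframe_locale T by unfold_locales (rule T)
  obtain h where h: "fst f \<in> frame_maps P T.P" "snd f \<in> frame_maps N T.N" "h \<in> frame_maps M T.M"
    "\<And>x. x \<in> carrier P \<Longrightarrow> h (emb_pos L x) = emb_pos T (fst f x)"
    "\<And>y. y \<in> carrier N \<Longrightarrow> h (emb_neg L y) = emb_neg T (snd f y)"
    using f unfolding biframe_maps_def by auto
  have ex_pos: "\<exists>y\<in>carrier T.N. T.M.complementary (h (emb_pos L x)) (emb_neg T y)" if "x \<in> carrier P" for x
    using cp[OF that] that by (auto simp: has_bicomplement_pos_def T.bicomplementary_iff h)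
  have ex_neg: "\<exists>x\<in>carrier T.P. T.M.complementary (h (emb_neg L y)) (emb_pos T x)" if "y \<in> carrier N" for y
    using cn[OF that] that T.M.complementary_commute
    by (fastforce simp: has_bicomplement_neg_def T.bicomplementary_iff h)
  \<comment> \<open>A rectangle goes to a meet of two complemented elements, and an element of
    \<open>fin\<close> to a finite join of such meets; De Morgan supplies a complement, in general
    only in the main component.\<close>
  have "\<exists>c. T.M.complementary (h s) c" if "s \<in> F" for s
  proof -
    obtain A where A: "finite A" "A \<subseteq> rectangles L" "s = \<Squnion>\<^bsub>M\<^esub> A" using \<open>s \<in> F\<close> by (rule fin_elementsE)
    have "\<exists>c. T.M.complementary (h r) c" if "r \<in> rectangles L" for r
    proof -
      obtain x y where r: "x \<in> carrier P" "y \<in> carrier N" "r = emb_pos L x \<sqinter>\<^bsub>M\<^esub> emb_neg L y"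
        using \<open>r \<in> rectangles L\<close> by (rule rectanglesE)
      then show ?thesis
        using ex_pos[OF r(1)] ex_neg[OF r(2)] T.M.complementary_meet
        by (simp add: frame_mapsD(5)[OF h(3)]) blast
    qed
    then have "\<exists>c. T.M.complementary (\<Squnion>\<^bsub>T.M\<^esub> (h ` A)) c"
      using A by (intro T.M.complementary_sup) auto
    then show ?thesis using A rectangles_closed by (simp add: frame_mapsD(3)[OF h(3)])
  qed
  then obtain neg where neg: "\<And>s. s \<in> F \<Longrightarrow> T.M.complementary (h s) (neg s)" by metis
  interpret E: complemented_extension L "main_part T" h neg
    by unfold_locales (use h neg in auto)
  note Emap = E.extension_frame_map[unfolded main_assembly]
  note KF = M.congruence_frame_frame
  have n: "E.extension (nabla M (emb_pos L x)) = emb_pos T (fst f x)" if "x \<in> carrier P" for x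
    using that by (simp add: E.extension_nabla_fin emb_fin h)
  have n': "E.extension (nabla M (emb_neg L y)) = emb_neg T (snd f y)" if "y \<in> carrier N" for y
    using that by (simp add: E.extension_nabla_fin emb_fin h)
  \<comment> \<open>\<open>neg\<close> is an arbitrary choice, but complements are unique, so its
    value here is the embedded bicomplement from the opposite part of \<open>T\<close>.\<close>
  have d: "E.extension (delta M (emb_pos L x)) \<in> emb_neg T ` carrier T.N" if x: "x \<in> carrier P" for x
    using ex_pos[OF x] T.M.complementary_unique[OF _ neg[OF emb_fin(1)[OF x]]]
    by (auto simp: E.extension_delta_fin emb_fin x)
  have d': "E.extension (delta M (emb_neg L y)) \<in> emb_pos T ` carrier T.P" if y: "y \<in> carrier N" for y
    using ex_neg[OF y] T.M.complementary_unique[OF _ neg[OF emb_fin(2)[OF y]]]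
    by (auto simp: E.extension_delta_fin emb_fin y)
  \<comment> \<open>The embedded positive part of \<open>T\<close> is a subframe of its main
    component, so only generators have to be checked.\<close>
  have "Ap \<subseteq> {C \<in> finitary_congruences. E.extension C \<in> emb_pos T ` carrier T.P}"
  proof (rule pos_least)
    show "subframe K {C \<in> finitary_congruences. E.extension C \<in> emb_pos T ` carrier T.P}"
      by (rule subframe_preimage[OF KF finitary_subframe Emap frame_map_image_subframe[OF T.pos_frame T.emb_pos_map]])
    show "gen_pos \<subseteq> {C \<in> finitary_congruences. E.extension C \<in> emb_pos T ` carrier T.P}"
      using n d' frame_mapsD(2)[OF h(1)] by (auto simp: nabla_finitary delta_finitary emb_fin)
  qed
  then have imp: "restrict E.extension Ap C \<in> emb_pos T ` carrier T.P" if "C \<in> Ap" for C using that by auto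
  have "An \<subseteq> {C \<in> finitary_congruences. E.extension C \<in> emb_neg T ` carrier T.N}"
  proof (rule neg_least)
    show "subframe K {C \<in> finitary_congruences. E.extension C \<in> emb_neg T ` carrier T.N}"
      by (rule subframe_preimage[OF KF finitary_subframe Emap frame_map_image_subframe[OF T.neg_frame T.emb_neg_map]])
    show "gen_neg \<subseteq> {C \<in> finitary_congruences. E.extension C \<in> emb_neg T ` carrier T.N}"
      using n' d frame_mapsD(2)[OF h(2)] by (auto simp: nabla_finitary delta_finitary emb_fin)
  qed
  then have imn: "restrict E.extension An C \<in> emb_neg T ` carrier T.N" if "C \<in> An" for C using that by auto
  note Ep = frame_map_restrict[OF KF pos_subframe finitary_subframe pos_finitary Emap, folded pos_assembly]
    and En = frame_map_restrict[OF KF neg_subframe finitary_subframe neg_finitary Emap, folded neg_assembly]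
  define gp where "gp = (\<lambda>C\<in>Ap. inv_into (carrier T.P) (emb_pos T) (restrict E.extension Ap C))"
  define gn where "gn = (\<lambda>C\<in>An. inv_into (carrier T.N) (emb_neg T) (restrict E.extension An C))"
  have gp: "gp \<in> frame_maps (pos_part (assembly L)) T.P" "\<And>C. C \<in> Ap \<Longrightarrow> emb_pos T (gp C) = E.extension C"
    using frame_map_lift[OF T.pos_frame pos_assembly_frame T.emb_pos_map T.emb_pos_inj Ep imp] unfolding gp_def by simp_all
  have gn: "gn \<in> frame_maps (neg_part (assembly L)) T.N" "\<And>C. C \<in> An \<Longrightarrow> emb_neg T (gn C) = E.extension C"
    using frame_map_lift[OF T.neg_frame neg_assembly_frame T.emb_neg_map T.emb_neg_inj En imn] unfolding gn_def by simp_all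
  show ?thesis
  proof
    show "(gp, gn) \<in> biframe_maps (assembly L) T"
      unfolding biframe_maps_def using gp gn E.extension_frame_map
      by (auto simp: emb_assembly intro!: bexI[of _ E.extension])
    show "fst (gp, gn) (nabla M (emb_pos L x)) = fst f x" if "x \<in> carrier P" for x
      using that n[OF that] gp(2)[of "nabla M (emb_pos L x)"] inj_onD[OF T.emb_pos_inj]
        frame_mapsD(2)[OF gp(1)] frame_mapsD(2)[OF h(1)] by (simp add: nabla_pos)
    show "snd (gp, gn) (nabla M (emb_neg L y)) = snd f y" if "y \<in> carrier N" for y
      using that n'[OF that] gn(2)[of "nabla M (emb_neg L y)"] inj_onD[OF T.emb_neg_inj]
        frame_mapsD(2)[OF gn(1)] frame_mapsD(2)[OF h(2)] by (simp add: nabla_neg)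
  qed
qed

theorem assembly_universal:
  fixes T :: "('q, 'm, 'b) biframe"
  assumes T: "biframe T" and f: "f \<in> biframe_maps L T"
    and "\<And>x. x \<in> carrier P \<Longrightarrow> has_bicomplement_pos T (fst f x)"
    and "\<And>y. y \<in> carrier N \<Longrightarrow> has_bicomplement_neg T (snd f y)"
  shows "\<exists>!g. g \<in> biframe_maps (assembly L) T \<and> biframe_comp L g (nabla_map L) = f"
proof -
  have "fst f \<in> frame_maps P (pos_part T)" "snd f \<in> frame_maps N (neg_part T)"
    using f by (auto simp: biframe_maps_def)
  then have ext: "fst f \<in> extensional (carrier P)" "snd f \<in> extensional (carrier N)"
    using frame_mapsD(1) by (auto simp: PiE_iff)
  obtain g where g: "g \<in> biframe_maps (assembly L) T"
    "\<And>x. x \<in> carrier P \<Longrightarrow> fst g (nabla M (emb_pos L x)) = fst f x"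
    "\<And>y. y \<in> carrier N \<Longrightarrow> snd g (nabla M (emb_neg L y)) = snd f y"
    using assembly_map_exists[OF assms] by blast
  show ?thesis
  proof (rule ex1I[of _ g])
    show "g \<in> biframe_maps (assembly L) T \<and> biframe_comp L g (nabla_map L) = f"
      using g by (simp add: comp_nabla_iff[OF ext])
    fix k assume k: "k \<in> biframe_maps (assembly L) T \<and> biframe_comp L k (nabla_map L) = f"
    then show "k = g"
      using g by (intro assembly_map_unique[OF T]) (auto simp: comp_nabla_iff[OF ext])
  qed
qed

end


section \<open>Biquotients\<close>

text \<open>Nothing is assumed about \<open>B\<close> beyond its equality being \<open>(=)\<close>:
  partial order, bounds and distributivity are all transported along the bijection.\<close>

lemma frame_order_iso:
  assumes A: "frame A" and bij: "bij_betw \<phi> (carrier A) (carrier B)" and eq: "eq B = (=)"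
    and le: "\<And>x y. x \<in> carrier A \<Longrightarrow> y \<in> carrier A \<Longrightarrow> \<phi> x \<sqsubseteq>\<^bsub>B\<^esub> \<phi> y \<longleftrightarrow> x \<sqsubseteq>\<^bsub>A\<^esub> y"
  shows "frame B"
proof -
  interpret A: frame A by (rule A)
  have car: "carrier B = \<phi> ` carrier A" using bij by (simp add: bij_betw_def)
  have sub: "\<exists>Y. Y \<subseteq> carrier A \<and> X = \<phi> ` Y" if "X \<subseteq> carrier B" for X
    using that unfolding car by (simp add: subset_image_iff)
  interpret B: partial_order B
  proof unfold_locales
    show "x .=\<^bsub>B\<^esub> y" if "x \<sqsubseteq>\<^bsub>B\<^esub> y" "y \<sqsubseteq>\<^bsub>B\<^esub> x" "x \<in> carrier B" "y \<in> carrier B" for x y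
      using that unfolding car eq by (auto simp: le intro!: arg_cong[of _ _ \<phi>] A.le_antisym)
    show "x \<sqsubseteq>\<^bsub>B\<^esub> z" if "x \<sqsubseteq>\<^bsub>B\<^esub> y" "y \<sqsubseteq>\<^bsub>B\<^esub> z" "x \<in> carrier B" "y \<in> carrier B" "z \<in> carrier B" for x y z
      using that unfolding car by (auto simp: le intro: A.le_trans)
  qed (auto simp: eq car le)
  have lub: "is_lub B (\<phi> (\<Squnion>\<^bsub>A\<^esub> Y)) (\<phi> ` Y)" if Y: "Y \<subseteq> carrier A" for Y
  proof (rule least_UpperI)
    show "y \<sqsubseteq>\<^bsub>B\<^esub> \<phi> (\<Squnion>\<^bsub>A\<^esub> Y)" if "y \<in> \<phi> ` Y" for y
      using that Y A.sup_upper[OF Y] by (auto simp: le subset_iff)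
    show "\<phi> (\<Squnion>\<^bsub>A\<^esub> Y) \<sqsubseteq>\<^bsub>B\<^esub> y" if "y \<in> Upper B (\<phi> ` Y)" for y
    proof -
      obtain a where "a \<in> carrier A" "y = \<phi> a" using \<open>y \<in> Upper B (\<phi> ` Y)\<close> by (auto simp: Upper_def car)
      then show ?thesis using that Y by (auto simp: le Upper_def car subset_iff intro!: A.sup_least)
    qed
  qed (use Y in \<open>auto simp: car\<close>)
  have glb: "is_glb B (\<phi> (\<Sqinter>\<^bsub>A\<^esub> Y)) (\<phi> ` Y)" if Y: "Y \<subseteq> carrier A" for Y
  proof (rule greatest_LowerI)
    show "\<phi> (\<Sqinter>\<^bsub>A\<^esub> Y) \<sqsubseteq>\<^bsub>B\<^esub> y" if "y \<in> \<phi> ` Y" for y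
      using that Y A.inf_lower[OF Y] by (auto simp: le subset_iff)
    show "y \<sqsubseteq>\<^bsub>B\<^esub> \<phi> (\<Sqinter>\<^bsub>A\<^esub> Y)" if "y \<in> Lower B (\<phi> ` Y)" for y
    proof -
      obtain a where "a \<in> carrier A" "y = \<phi> a" using \<open>y \<in> Lower B (\<phi> ` Y)\<close> by (auto simp: Lower_def car)
      then show ?thesis using that Y by (auto simp: le Lower_def car subset_iff intro!: A.inf_greatest)
    qed
  qed (use Y in \<open>auto simp: car\<close>)
  interpret B: complete_lattice B
  proof unfold_locales
    show "\<exists>s. is_lub B s X" if "X \<subseteq> carrier B" for X using sub[OF that] lub by blast
    show "\<exists>s. is_glb B s X" if "X \<subseteq> carrier B" for X using sub[OF that] glb by blast
  qed
  have c: "a \<in> carrier A \<Longrightarrow> \<phi> a \<in> carrier B" for a by (simp add: car)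
  have sup: "\<Squnion>\<^bsub>B\<^esub> (\<phi> ` Y) = \<phi> (\<Squnion>\<^bsub>A\<^esub> Y)" if Y: "Y \<subseteq> carrier A" for Y
    by (rule B.least_unique[OF B.sup_lub lub[OF Y]]) (use Y c in auto)
  have meet: "\<phi> x \<sqinter>\<^bsub>B\<^esub> \<phi> y = \<phi> (x \<sqinter>\<^bsub>A\<^esub> y)" if "x \<in> carrier A" "y \<in> carrier A" for x y
    unfolding meet_def using B.greatest_unique[OF B.inf_glb glb[of "{x, y}"]] that c by simp
  show ?thesis
  proof (intro frame.intro B.complete_lattice_axioms frame_axioms.intro)
    fix x X assume "x \<in> carrier B" "X \<subseteq> carrier B"
    then obtain a Y where a: "a \<in> carrier A" "x = \<phi> a" and Y: "Y \<subseteq> carrier A" "X = \<phi> ` Y"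
      using sub[of X] by (auto simp: car)
    have "(\<lambda>y. x \<sqinter>\<^bsub>B\<^esub> y) ` X = \<phi> ` (\<lambda>y. a \<sqinter>\<^bsub>A\<^esub> y) ` Y"
      unfolding a Y image_image by (rule image_cong) (use a Y meet in auto)
    moreover have "(\<lambda>y. a \<sqinter>\<^bsub>A\<^esub> y) ` Y \<subseteq> carrier A" using a Y by auto
    ultimately show "x \<sqinter>\<^bsub>B\<^esub> \<Squnion>\<^bsub>B\<^esub> X = \<Squnion>\<^bsub>B\<^esub> ((\<lambda>y. x \<sqinter>\<^bsub>B\<^esub> y) ` X)"
      using a Y by (simp add: sup meet A.meet_sup_distrib)
  qed
qed

context biframe_locale
begin

text \<open>The set of classes in the main component already determines the congruence, as the union
  of the squares of its classes.\<close>

lemma quotient_biframe_inj: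
  assumes C: "frame_congruence M C" and D: "frame_congruence M D" and eq: "quotient_biframe L C = quotient_biframe L D"
  shows "C = D"
proof -
  have "main_part (quotient_biframe L E) = quotient_frame M E" for E
    by (simp add: quotient_biframe_def Let_def)
  then have same: "carrier M // C = carrier M // D" using eq by (metis quotient_frame_simps(1))
  have "E = (\<Union>X\<in>carrier M // E. X \<times> X)" if E: "frame_congruence M E" for E
  proof (rule Set.set_eqI, clarify)
    note E' = main_frame E
    fix x y
    have "(x, y) \<in> E \<longleftrightarrow> (\<exists>z\<in>carrier M. (z, x) \<in> E \<and> (z, y) \<in> E)"
    proof
      assume "(x, y) \<in> E"
      then show "\<exists>z\<in>carrier M. (z, x) \<in> E \<and> (z, y) \<in> E" using cong_closed(1)[OF E'] cong_refl[OF E'] by blast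
    next
      assume "\<exists>z\<in>carrier M. (z, x) \<in> E \<and> (z, y) \<in> E"
      then obtain z where z: "(z, x) \<in> E" "(z, y) \<in> E" by blast
      show "(x, y) \<in> E" by (rule cong_trans[OF E' cong_sym[OF E' z(1)] z(2)])
    qed
    then show "(x, y) \<in> E \<longleftrightarrow> (x, y) \<in> (\<Union>X\<in>carrier M // E. X \<times> X)"
      by (simp add: quotient_def)
  qed
  note classes = this
  have "C = (\<Union>X\<in>carrier M // C. X \<times> X)" by (rule classes[OF C])
  also have "\<dots> = (\<Union>X\<in>carrier M // D. X \<times> X)" by (simp only: same)
  also have "\<dots> = D" by (rule classes[OF D, symmetric])
  finally show ?thesis .
qed

text \<open>The order asks for some representing congruences; by injectivity they are the given
  ones.\<close>

lemma biquotients_le_iff: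
  assumes "finitary_congruence L C" "finitary_congruence L D"
  shows "quotient_biframe L C \<sqsubseteq>\<^bsub>biquotients L\<^esub> quotient_biframe L D \<longleftrightarrow> D \<subseteq> C"
proof
  assume "quotient_biframe L C \<sqsubseteq>\<^bsub>biquotients L\<^esub> quotient_biframe L D"
  then obtain C' D' where "finitary_congruence L C'" "finitary_congruence L D'" "D' \<subseteq> C'"
    "quotient_biframe L C = quotient_biframe L C'" "quotient_biframe L D = quotient_biframe L D'"
    unfolding biquotients_def by auto
  moreover from this have "C = C'" "D = D'"
    using assms by (simp_all add: quotient_biframe_inj finitary_closed)
  ultimately show "D \<subseteq> C" by simp
next
  assume "D \<subseteq> C"
  then show "quotient_biframe L C \<sqsubseteq>\<^bsub>biquotients L\<^esub> quotient_biframe L D"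
    unfolding biquotients_def using assms by auto
qed

lemma quotient_biframe_bij:
  "bij_betw (quotient_biframe L) (carrier (main_part (assembly L))) (carrier (biquotients L))"
  unfolding main_assembly_carrier
  using quotient_biframe_inj finitary_closed
  by (auto simp: bij_betw_def inj_on_def biquotients_def)

lemma main_assembly_le: "le (main_part (assembly L)) = (\<subseteq>)"
  by (simp add: main_assembly)

lemma biquotients_eq: "eq (biquotients L) = (=)"
  by (simp add: biquotients_def)

theorem biquotients_coframe: "coframe (biquotients L)"
  unfolding coframe_def
proof (rule frame_order_iso[OF main_assembly_frame])
  show "bij_betw (quotient_biframe L) (carrier (main_part (assembly L))) (carrier (inv_gorder (biquotients L)))"
    using quotient_biframe_bij by simp
  show "quotient_biframe L C \<sqsubseteq>\<^bsub>inv_gorder (biquotients L)\<^esub> quotient_biframe L D \<longleftrightarrow> C \<sqsubseteq>\<^bsub>main_part (assembly L)\<^esub> D"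
    if "C \<in> carrier (main_part (assembly L))" "D \<in> carrier (main_part (assembly L))" for C D
    using that by (simp add: main_assembly_carrier main_assembly_le biquotients_le_iff)
qed (simp add: biquotients_eq)

theorem biquotients_anti_isomorphic: "anti_isomorphic (main_part (assembly L)) (biquotients L)"
proof -
  interpret A: frame "main_part (assembly L)" by (rule main_assembly_frame)
  interpret B: frame "inv_gorder (biquotients L)" using biquotients_coframe by (simp add: coframe_def)
  have "order_emb (main_part (assembly L)) (inv_gorder (biquotients L)) (quotient_biframe L)"
    unfolding order_emb_def
    using A.weak_partial_order_axioms B.weak_partial_order_axioms quotient_biframe_bij
    by (auto simp: main_assembly_carrier main_assembly_le biquotients_le_iff)
  then show ?thesis
    unfolding anti_isomorphic_def using quotient_biframe_bij by blast
qed

end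


section \<open>Bipoints\<close>

lemma two_frame_frame: "frame two_frame"
proof (intro frame.intro two_frame_complete frame_axioms.intro)
  fix x A
  show "x \<sqinter>\<^bsub>two_frame\<^esub> \<Squnion>\<^bsub>two_frame\<^esub> A = \<Squnion>\<^bsub>two_frame\<^esub> ((\<lambda>a. x \<sqinter>\<^bsub>two_frame\<^esub> a) ` A)"
    by (auto simp: two_frame_sup two_frame_meet)
qed

lemma two_frame_join: "x \<squnion>\<^bsub>two_frame\<^esub> y = (x \<or> y)"
  by (auto simp: join_def two_frame_sup)

lemma two_frame_bottom: "\<bottom>\<^bsub>two_frame\<^esub> = False"
  using frame.sup_empty[OF two_frame_frame] by (simp add: two_frame_sup)

lemma two_frame_complementary: "frame.complementary two_frame x y \<longleftrightarrow> y = (\<not> x)"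
  by (auto simp: frame.complementary_def[OF two_frame_frame] two_frame_meet two_frame_join two_frame_bottom two_frame_top)

lemma two_biframe_simps [simp]:
  "pos_part two_biframe = two_frame" "neg_part two_biframe = two_frame" "main_part two_biframe = two_frame"
  "emb_pos two_biframe = id" "emb_neg two_biframe = id"
  by (simp_all add: two_biframe_def)

lemma frame_maps_twoD:
  assumes "f \<in> frame_maps Q two_frame"
  shows "f \<in> extensional (carrier Q)"
    and "A \<subseteq> carrier Q \<Longrightarrow> f (\<Squnion>\<^bsub>Q\<^esub> A) \<longleftrightarrow> (\<exists>a\<in>A. f a)"
    and "f \<top>\<^bsub>Q\<^esub>"
    and "x \<in> carrier Q \<Longrightarrow> y \<in> carrier Q \<Longrightarrow> f (x \<sqinter>\<^bsub>Q\<^esub> y) \<longleftrightarrow> f x \<and> f y"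
  using assms frame_mapsD(3-5)[OF assms]
  by (auto simp: frame_maps_def PiE_iff two_frame_sup two_frame_meet two_frame_top image_iff)

lemma frame_maps_twoI:
  assumes "f \<in> extensional (carrier Q)"
    and "\<And>A. A \<subseteq> carrier Q \<Longrightarrow> f (\<Squnion>\<^bsub>Q\<^esub> A) \<longleftrightarrow> (\<exists>a\<in>A. f a)"
    and "f \<top>\<^bsub>Q\<^esub>"
    and "\<And>x y. x \<in> carrier Q \<Longrightarrow> y \<in> carrier Q \<Longrightarrow> f (x \<sqinter>\<^bsub>Q\<^esub> y) \<longleftrightarrow> f x \<and> f y"
  shows "f \<in> frame_maps Q two_frame"
  using assms by (auto simp: frame_maps_def PiE_iff two_frame_sup two_frame_meet two_frame_top image_iff)

lemma frame_maps_two_bottom: "frame Q \<Longrightarrow> f \<in> frame_maps Q two_frame \<Longrightarrow> \<not> f \<bottom>\<^bsub>Q\<^esub>"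
  using frame_maps_bottom[OF _ two_frame_frame] by (auto simp: two_frame_bottom)

lemma frame_maps_two_join:
  "f \<in> frame_maps Q two_frame \<Longrightarrow> x \<in> carrier Q \<Longrightarrow> y \<in> carrier Q \<Longrightarrow> f (x \<squnion>\<^bsub>Q\<^esub> y) \<longleftrightarrow> f x \<or> f y"
  by (simp add: frame_maps_join two_frame_join)

lemma two_biframe_biframe: "biframe two_biframe"
proof -
  have id: "id \<in> frame_maps two_frame two_frame"
    by (rule frame_maps_twoI) (auto simp: two_frame_sup two_frame_meet two_frame_top)
  have "\<exists>A. A \<subseteq> rectangles two_biframe \<and> x = \<Squnion>\<^bsub>two_frame\<^esub> A" for x
  proof -
    have "x \<in> rectangles two_biframe"
      unfolding rectangles_def by (intro CollectI exI[of _ x]) (simp add: two_frame_meet)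
    then show ?thesis by (intro exI[of _ "{x}"]) (simp add: two_frame_sup)
  qed
  then show ?thesis by (simp add: biframe_def two_frame_frame id)
qed

lemma two_biframe_bicomplements: "has_bicomplement_pos two_biframe x" "has_bicomplement_neg two_biframe x"
  unfolding has_bicomplement_pos_def has_bicomplement_neg_def bicomplementary_def
  by (rule exI[of _ "\<not> x"], simp add: two_frame_meet two_frame_join two_frame_bottom two_frame_top)+

lemma bipoints_frame_maps:
  assumes "f \<in> bipoints L"
  shows "fst f \<in> frame_maps (pos_part L) two_frame" "snd f \<in> frame_maps (neg_part L) two_frame"
  using assms by (auto simp: bipoints_def biframe_maps_def)

lemma bipoints_ext:
  assumes "f \<in> bipoints L" "g \<in> bipoints L"
    and "\<And>x. x \<in> carrier (pos_part L) \<Longrightarrow> fst f x = fst g x" "\<And>y. y \<in> carrier (neg_part L) \<Longrightarrow> snd f y = snd g y"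
  shows "f = g"
  using assms(3,4) frame_maps_twoD(1)[OF bipoints_frame_maps(1)[OF assms(1)]]
    frame_maps_twoD(1)[OF bipoints_frame_maps(2)[OF assms(1)]]
    frame_maps_twoD(1)[OF bipoints_frame_maps(1)[OF assms(2)]]
    frame_maps_twoD(1)[OF bipoints_frame_maps(2)[OF assms(2)]]
  by (auto intro!: prod_eqI extensionalityI)

lemma frame_maps_compose:
  assumes A: "frame A" and f: "f \<in> frame_maps A B" and g: "g \<in> frame_maps B C"
  shows "compose (carrier A) g f \<in> frame_maps A C"
  unfolding frame_maps_def mem_Collect_eq
proof (intro conjI allI ballI impI)
  interpret A: frame A by (rule A)
  note fD = frame_mapsD[OF f] and gD = frame_mapsD[OF g]
  show "compose (carrier A) g f \<in> carrier A \<rightarrow>\<^sub>E carrier C" using fD(2) gD(2) by (auto simp: compose_def)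
  show "compose (carrier A) g f \<top>\<^bsub>A\<^esub> = \<top>\<^bsub>C\<^esub>" by (simp add: compose_def fD(4) gD(4))
  show "compose (carrier A) g f (x \<sqinter>\<^bsub>A\<^esub> y) = compose (carrier A) g f x \<sqinter>\<^bsub>C\<^esub> compose (carrier A) g f y"
    if "x \<in> carrier A" "y \<in> carrier A" for x y
    using that fD(2) by (simp add: compose_def fD(5) gD(5))
  show "compose (carrier A) g f (\<Squnion>\<^bsub>A\<^esub> X) = \<Squnion>\<^bsub>C\<^esub> (compose (carrier A) g f ` X)" if X: "X \<subseteq> carrier A" for X
  proof -
    have "f ` X \<subseteq> carrier B" using X fD(2) by auto
    moreover have "compose (carrier A) g f ` X = g ` f ` X"
      unfolding image_image by (rule image_cong) (use X in \<open>auto simp: compose_def\<close>)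
    ultimately show ?thesis using X by (simp add: compose_def fD(3) gD(3))
  qed
qed

lemma biframe_maps_comp:
  assumes L: "biframe L" and f: "f \<in> biframe_maps L M" and g: "g \<in> biframe_maps M T"
  shows "biframe_comp L g f \<in> biframe_maps L T"
proof -
  interpret L: biframe_locale L by unfold_locales (rule L)
  obtain h where h: "fst f \<in> frame_maps L.P (pos_part M)" "snd f \<in> frame_maps L.N (neg_part M)"
    "h \<in> frame_maps L.M (main_part M)"
    "\<And>x. x \<in> carrier L.P \<Longrightarrow> h (emb_pos L x) = emb_pos M (fst f x)"
    "\<And>y. y \<in> carrier L.N \<Longrightarrow> h (emb_neg L y) = emb_neg M (snd f y)"
    using f unfolding biframe_maps_def by auto
  obtain k where k: "fst g \<in> frame_maps (pos_part M) (pos_part T)" "snd g \<in> frame_maps (neg_part M) (neg_part T)"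
    "k \<in> frame_maps (main_part M) (main_part T)"
    "\<And>x. x \<in> carrier (pos_part M) \<Longrightarrow> k (emb_pos M x) = emb_pos T (fst g x)"
    "\<And>y. y \<in> carrier (neg_part M) \<Longrightarrow> k (emb_neg M y) = emb_neg T (snd g y)"
    using g unfolding biframe_maps_def by auto
  note c = frame_mapsD(2)[OF h(1)] frame_mapsD(2)[OF h(2)]
  show ?thesis
    unfolding biframe_comp_def biframe_maps_def mem_Collect_eq case_prod_conv
    using frame_maps_compose[OF L.pos_frame h(1) k(1)] frame_maps_compose[OF L.neg_frame h(2) k(2)]
      frame_maps_compose[OF L.main_frame h(3) k(3)] c
    by (intro conjI bexI[of _ "compose (carrier L.M) k h"]) (simp_all add: compose_def h(4,5) k(4,5))
qed

section \<open>Bipoints as pairs of points\<close>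

context biframe_locale
begin

text \<open>With its converse \<open>bipointI\<close> this eliminates the main map: a pair of points
  is a bipoint iff no rectangle of value 1 is covered by rectangles of value 0.\<close>

lemma bipointD:
  assumes f: "f \<in> bipoints L" and xy: "x \<in> carrier P" "y \<in> carrier N" and R: "R \<subseteq> carrier P \<times> carrier N"
    and le: "emb_pos L x \<sqinter>\<^bsub>M\<^esub> emb_neg L y \<sqsubseteq>\<^bsub>M\<^esub> \<Squnion>\<^bsub>M\<^esub> ((\<lambda>(u, v). emb_pos L u \<sqinter>\<^bsub>M\<^esub> emb_neg L v) ` R)"
    and "fst f x" "snd f y"
  shows "\<exists>(u, v)\<in>R. fst f u \<and> snd f v"
proof -
  obtain h where h: "h \<in> frame_maps M two_frame"
    "\<And>x. x \<in> carrier P \<Longrightarrow> h (emb_pos L x) = fst f x" "\<And>y. y \<in> carrier N \<Longrightarrow> h (emb_neg L y) = snd f y"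
    using f by (auto simp: bipoints_def biframe_maps_def)
  note hD = frame_maps_twoD[OF h(1)]
  have cl: "(\<lambda>(u, v). emb_pos L u \<sqinter>\<^bsub>M\<^esub> emb_neg L v) ` R \<subseteq> carrier M" using R by auto
  have "h (emb_pos L x \<sqinter>\<^bsub>M\<^esub> emb_neg L y) \<le> h (\<Squnion>\<^bsub>M\<^esub> ((\<lambda>(u, v). emb_pos L u \<sqinter>\<^bsub>M\<^esub> emb_neg L v) ` R))"
    using frame_maps_mono[OF M.complete_lattice_axioms two_frame_complete h(1) _ _ le] xy cl by simp
  then have "\<exists>r\<in>(\<lambda>(u, v). emb_pos L u \<sqinter>\<^bsub>M\<^esub> emb_neg L v) ` R. h r"
    using xy assms(6,7) by (simp add: hD(2)[OF cl] hD(4) h(2,3))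
  then show ?thesis using R by (auto simp: hD(4) h(2,3) subset_iff) (metis (no_types, lifting) case_prodI emb_closed hD(4) h(2,3))
qed

text \<open>The main map gives an element value 1 iff a rectangle of value 1 lies below it. The
  cover condition is what makes this commute with joins and agree with the given points.\<close>

lemma bipointI:
  assumes \<phi>: "\<phi> \<in> frame_maps P two_frame" and \<psi>: "\<psi> \<in> frame_maps N two_frame"
    and *: "\<And>x y R. \<lbrakk>x \<in> carrier P; y \<in> carrier N; R \<subseteq> carrier P \<times> carrier N;
      emb_pos L x \<sqinter>\<^bsub>M\<^esub> emb_neg L y \<sqsubseteq>\<^bsub>M\<^esub> \<Squnion>\<^bsub>M\<^esub> ((\<lambda>(u, v). emb_pos L u \<sqinter>\<^bsub>M\<^esub> emb_neg L v) ` R);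
      \<phi> x; \<psi> y\<rbrakk> \<Longrightarrow> \<exists>(u, v)\<in>R. \<phi> u \<and> \<psi> v"
  shows "(\<phi>, \<psi>) \<in> bipoints L"
proof -
  note \<phi>D = frame_maps_twoD[OF \<phi>] and \<psi>D = frame_maps_twoD[OF \<psi>]
  let ?r = "\<lambda>(x, y). emb_pos L x \<sqinter>\<^bsub>M\<^esub> emb_neg L y"
  define k where "k = (\<lambda>z\<in>carrier M. \<exists>(x, y)\<in>carrier P \<times> carrier N. ?r (x, y) \<sqsubseteq>\<^bsub>M\<^esub> z \<and> \<phi> x \<and> \<psi> y)"
  have k: "k z \<longleftrightarrow> (\<exists>x\<in>carrier P. \<exists>y\<in>carrier N. ?r (x, y) \<sqsubseteq>\<^bsub>M\<^esub> z \<and> \<phi> x \<and> \<psi> y)" if "z \<in> carrier M" for z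
    using that by (auto simp: k_def)
  have top: "?r (x, \<top>\<^bsub>N\<^esub>) = emb_pos L x" "?r (\<top>\<^bsub>P\<^esub>, y) = emb_neg L y"
    if "x \<in> carrier P" "y \<in> carrier N" for x y
    using that by (simp_all add: frame_mapsD(4)[OF emb_pos_map] frame_mapsD(4)[OF emb_neg_map] M.top_meet_eq)
  have kp: "k (emb_pos L x) = \<phi> x" if x: "x \<in> carrier P" for x
  proof
    assume "k (emb_pos L x)"
    then obtain u v where "u \<in> carrier P" "v \<in> carrier N" "?r (u, v) \<sqsubseteq>\<^bsub>M\<^esub> emb_pos L x" "\<phi> u" "\<psi> v"
      using x by (auto simp: k)
    \<comment> \<open>\<open>emb_pos L x\<close> is the rectangle with sides \<open>x\<close> and
      top, so the hypothesis is used for a cover by one rectangle.\<close>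
    then have "\<exists>(u, v)\<in>{(x, \<top>\<^bsub>N\<^esub>)}. \<phi> u \<and> \<psi> v"
      using x top(1)[OF x N.top_closed] by (intro *[of u v]) auto
    then show "\<phi> x" by simp
  next
    assume "\<phi> x"
    then show "k (emb_pos L x)"
      using x top(1)[OF x N.top_closed] \<psi>D(3) by (subst k) (auto intro!: bexI[of _ x] bexI[of _ "\<top>\<^bsub>N\<^esub>"])
  qed
  have kn: "k (emb_neg L y) = \<psi> y" if y: "y \<in> carrier N" for y
  proof
    assume "k (emb_neg L y)"
    then obtain u v where "u \<in> carrier P" "v \<in> carrier N" "?r (u, v) \<sqsubseteq>\<^bsub>M\<^esub> emb_neg L y" "\<phi> u" "\<psi> v"
      using y by (auto simp: k)
    then have "\<exists>(u, v)\<in>{(\<top>\<^bsub>P\<^esub>, y)}. \<phi> u \<and> \<psi> v"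
      using y top(2)[OF P.top_closed y] by (intro *[of u v]) auto
    then show "\<psi> y" by simp
  next
    assume "\<psi> y"
    then show "k (emb_neg L y)"
      using y top(2)[OF P.top_closed y] \<phi>D(3) by (subst k) (auto intro!: bexI[of _ y] bexI[of _ "\<top>\<^bsub>P\<^esub>"])
  qed
  have mono: "k z'" if "k z" "z \<sqsubseteq>\<^bsub>M\<^esub> z'" "z \<in> carrier M" "z' \<in> carrier M" for z z'
  proof -
    obtain u v where "u \<in> carrier P" "v \<in> carrier N" "?r (u, v) \<sqsubseteq>\<^bsub>M\<^esub> z" "\<phi> u" "\<psi> v"
      using \<open>k z\<close> \<open>z \<in> carrier M\<close> by (auto simp: k)
    moreover from this have "?r (u, v) \<sqsubseteq>\<^bsub>M\<^esub> z'" using M.le_trans[OF _ that(2)] that by simp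
    ultimately show ?thesis using that(4) by (auto simp: k)
  qed
  have "k \<in> frame_maps M two_frame"
  proof (rule frame_maps_twoI)
    show "k \<in> extensional (carrier M)" by (simp add: k_def)
    show "k \<top>\<^bsub>M\<^esub>" using kp[of "\<top>\<^bsub>P\<^esub>"] \<phi>D(3) by (simp add: frame_mapsD(4)[OF emb_pos_map])
    show "k (z \<sqinter>\<^bsub>M\<^esub> z') \<longleftrightarrow> k z \<and> k z'" if z: "z \<in> carrier M" "z' \<in> carrier M" for z z'
    proof
      assume "k (z \<sqinter>\<^bsub>M\<^esub> z')"
      then show "k z \<and> k z'" using mono[OF _ M.meet_left[OF z]] mono[OF _ M.meet_right[OF z]] z by simp
    next
      assume "k z \<and> k z'"
      then obtain u v u' v' where uv: "u \<in> carrier P" "v \<in> carrier N" "?r (u, v) \<sqsubseteq>\<^bsub>M\<^esub> z" "\<phi> u" "\<psi> v"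
        and uv': "u' \<in> carrier P" "v' \<in> carrier N" "?r (u', v') \<sqsubseteq>\<^bsub>M\<^esub> z'" "\<phi> u'" "\<psi> v'"
        using z by (auto simp: k)
      have "?r (u \<sqinter>\<^bsub>P\<^esub> u', v \<sqinter>\<^bsub>N\<^esub> v') = ?r (u, v) \<sqinter>\<^bsub>M\<^esub> ?r (u', v')"
        using M.meet_interchange[of "emb_pos L u" "emb_neg L v" "emb_pos L u'" "emb_neg L v'"] uv uv'
        by (simp add: frame_mapsD(5)[OF emb_pos_map] frame_mapsD(5)[OF emb_neg_map])
      also have "\<dots> \<sqsubseteq>\<^bsub>M\<^esub> z \<sqinter>\<^bsub>M\<^esub> z'" using uv uv' z by (intro M.meet_mono) simp_all
      finally have "?r (u \<sqinter>\<^bsub>P\<^esub> u', v \<sqinter>\<^bsub>N\<^esub> v') \<sqsubseteq>\<^bsub>M\<^esub> z \<sqinter>\<^bsub>M\<^esub> z'" .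
      moreover have "\<phi> (u \<sqinter>\<^bsub>P\<^esub> u')" "\<psi> (v \<sqinter>\<^bsub>N\<^esub> v')" using uv uv' by (simp_all add: \<phi>D(4) \<psi>D(4))
      moreover have "u \<sqinter>\<^bsub>P\<^esub> u' \<in> carrier P" "v \<sqinter>\<^bsub>N\<^esub> v' \<in> carrier N" using uv uv' by simp_all
      ultimately show "k (z \<sqinter>\<^bsub>M\<^esub> z')"
        unfolding k[OF M.meet_closed[OF z]]
        by (intro bexI[of _ "u \<sqinter>\<^bsub>P\<^esub> u'"] bexI[of _ "v \<sqinter>\<^bsub>N\<^esub> v'"] conjI)
    qed
    show "k (\<Squnion>\<^bsub>M\<^esub> A) \<longleftrightarrow> (\<exists>a\<in>A. k a)" if A: "A \<subseteq> carrier M" for A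
    proof
      assume "\<exists>a\<in>A. k a"
      then obtain a where a: "a \<in> A" "k a" by blast
      show "k (\<Squnion>\<^bsub>M\<^esub> A)" using mono[OF a(2) M.sup_upper[OF A a(1)]] a A by auto
    next
      assume "k (\<Squnion>\<^bsub>M\<^esub> A)"
      then obtain x y where xy: "x \<in> carrier P" "y \<in> carrier N" "?r (x, y) \<sqsubseteq>\<^bsub>M\<^esub> \<Squnion>\<^bsub>M\<^esub> A" "\<phi> x" "\<psi> y"
        using A by (auto simp: k)
      \<comment> \<open>Each member of \<open>A\<close> is a join of rectangles, so the rectangles
        below single members of \<open>A\<close> cover as much as \<open>A\<close> itself; a
        rectangle of value 1 among them singles out the required member.\<close>
      let ?R = "{p \<in> carrier P \<times> carrier N. \<exists>a\<in>A. ?r p \<sqsubseteq>\<^bsub>M\<^esub> a}"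
      have cl: "?r ` ?R \<subseteq> carrier M" by auto
      have "a \<sqsubseteq>\<^bsub>M\<^esub> \<Squnion>\<^bsub>M\<^esub> (?r ` ?R)" if a: "a \<in> A" for a
      proof -
        obtain X where X: "X \<subseteq> rectangles L" "a = \<Squnion>\<^bsub>M\<^esub> X" using a A join_of_rectangles by blast
        have "r \<in> ?r ` ?R" if r: "r \<in> X" for r
        proof -
          obtain u v where uv: "u \<in> carrier P" "v \<in> carrier N" "r = emb_pos L u \<sqinter>\<^bsub>M\<^esub> emb_neg L v"
            using X r by (blast elim: rectanglesE)
          have "r \<sqsubseteq>\<^bsub>M\<^esub> a" unfolding X(2) by (rule M.sup_upper) (use X r rectangles_closed in auto)
          then show ?thesis using uv a by (intro image_eqI[of _ _ "(u, v)"]) auto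
        qed
        then show ?thesis unfolding X(2) by (intro M.sup_mono cl) auto
      qed
      then have "\<Squnion>\<^bsub>M\<^esub> A \<sqsubseteq>\<^bsub>M\<^esub> \<Squnion>\<^bsub>M\<^esub> (?r ` ?R)" using A cl by (intro M.sup_least) auto
      then have "?r (x, y) \<sqsubseteq>\<^bsub>M\<^esub> \<Squnion>\<^bsub>M\<^esub> (?r ` ?R)"
        using M.le_trans[OF xy(3)] xy A cl by simp
      then have "\<exists>(u, v)\<in>?R. \<phi> u \<and> \<psi> v" using xy by (intro *[of x y]) auto
      then obtain u v a where "u \<in> carrier P" "v \<in> carrier N" "a \<in> A" "?r (u, v) \<sqsubseteq>\<^bsub>M\<^esub> a" "\<phi> u" "\<psi> v" by auto
      moreover have "a \<in> carrier M" using A \<open>a \<in> A\<close> by blast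
      ultimately show "\<exists>a\<in>A. k a" by (intro bexI[of _ a]) (auto simp: k)
    qed
  qed
  then show ?thesis
    unfolding bipoints_def biframe_maps_def using \<phi> \<psi> kp kn by auto
qed

end


section \<open>Bipoints of the assembly and the Skula bispace\<close>

lemma homeomorphic_mapI_openin:
  assumes "bij_betw f (topspace S) (topspace T)" "\<And>U. openin S U \<Longrightarrow> openin T (f ` U)"
    "\<And>V. openin T V \<Longrightarrow> openin S {x \<in> topspace S. f x \<in> V}"
  shows "homeomorphic_map S T f"
proof (rule bijective_open_imp_homeomorphic_map)
  show "continuous_map S T f"
    unfolding continuous_map_def using assms(1,3) by (auto simp: bij_betw_def)
qed (use assms in \<open>auto simp: open_map_def bij_betw_def\<close>)

text \<open>Images always commute with unions, and by injectivity with intersections, so openness of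
  images passes from the subbase to all opens.\<close>

lemma generated_open_image:
  assumes "openin (topology_generated_by S) U" and inj: "inj_on f (\<Union>S)" and "\<And>s. s \<in> S \<Longrightarrow> openin T (f ` s)"
  shows "openin T (f ` U)"
proof -
  have "generate_topology_on S U" using assms(1) by (rule openin_topology_generated_by)
  then have "U \<subseteq> \<Union>S \<and> openin T (f ` U)"
  proof induction
    case (Int a b)
    then have "f ` (a \<inter> b) = f ` a \<inter> f ` b" by (intro inj_on_image_Int[OF inj]) auto
    then show ?case using Int by auto
  next
    case (UN \<K>)
    then show ?case by (auto simp: image_Union)
  qed (use assms(3) in auto)
  then show ?thesis by simp
qed

text \<open>The source topology has only a subbase, while every open of the target is the evaluation
  set of some element of \<open>A\<close>. Hence openness is checked on the subbase but continuity
  for every element of \<open>A\<close>.\<close>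

lemma generated_homeomorphism:
  assumes bij: "bij_betw f (\<Union>S) (topspace T)" and img: "\<And>s. s \<in> S \<Longrightarrow> openin T (f ` s)"
    and opens: "\<And>V. openin T V \<longleftrightarrow> (\<exists>C\<in>A. V = {g \<in> topspace T. ev g C})"
    and pre: "\<And>C. C \<in> A \<Longrightarrow> openin (topology_generated_by S) {x \<in> \<Union>S. ev (f x) C}"
  shows "homeomorphic_map (topology_generated_by S) T f"
proof (rule homeomorphic_mapI_openin)
  show "bij_betw f (topspace (topology_generated_by S)) (topspace T)" using bij by simp
  show "openin T (f ` U)" if "openin (topology_generated_by S) U" for U
    using generated_open_image[OF that bij_betw_imp_inj_on[OF bij] img] .
  show "openin (topology_generated_by S) {x \<in> topspace (topology_generated_by S). f x \<in> V}" if V: "openin T V" for V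
  proof -
    obtain C where C: "C \<in> A" "V = {g \<in> topspace T. ev g C}" using V opens by auto
    have "{x \<in> \<Union>S. f x \<in> V} = {x \<in> \<Union>S. ev (f x) C}" unfolding C(2) using bij_betwE[OF bij] by blast
    then show ?thesis using pre[OF C(1)] by simp
  qed
qed

text \<open>Evaluation turns joins into unions and finite meets into intersections, so openness of
  all evaluation sets can be verified on generators.\<close>

lemma open_evaluation_subframe:
  assumes K: "frame K" and S: "subframe K S" and T: "topspace T = B"
    and ev: "\<And>f. f \<in> B \<Longrightarrow> ev f \<in> frame_maps (K\<lparr>carrier := S\<rparr>) two_frame"
  shows "subframe K {C \<in> S. openin T {f \<in> B. ev f C}}"
  unfolding subframe_def
proof (intro conjI allI impI ballI)
  note evD = frame_maps_twoD[OF ev, simplified, unfolded subframe_top[OF K S]]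
  show "{C \<in> S. openin T {f \<in> B. ev f C}} \<subseteq> carrier K" using subframeD(1)[OF S] by blast
  have "{f \<in> B. ev f \<top>\<^bsub>K\<^esub>} = topspace T" using evD(3) T by auto
  then show "\<top>\<^bsub>K\<^esub> \<in> {C \<in> S. openin T {f \<in> B. ev f C}}" using subframeD(3)[OF S] by simp
  show "\<Squnion>\<^bsub>K\<^esub> A \<in> {C \<in> S. openin T {f \<in> B. ev f C}}" if A: "A \<subseteq> {C \<in> S. openin T {f \<in> B. ev f C}}" for A
  proof -
    have AS: "A \<subseteq> S" using A by blast
    then have "{f \<in> B. ev f (\<Squnion>\<^bsub>K\<^esub> A)} = (\<Union>C\<in>A. {f \<in> B. ev f C})"
      using evD(2)[of _ A] by (auto simp: subframe_sup[OF K S])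
    moreover have "openin T (\<Union>C\<in>A. {f \<in> B. ev f C})" by (rule openin_Union) (use A in auto)
    ultimately show ?thesis using subframeD(2)[OF S AS] by simp
  qed
  show "C \<sqinter>\<^bsub>K\<^esub> D \<in> {C \<in> S. openin T {f \<in> B. ev f C}}"
    if C: "C \<in> {C \<in> S. openin T {f \<in> B. ev f C}}" and D: "D \<in> {C \<in> S. openin T {f \<in> B. ev f C}}" for C D
  proof -
    have "{f \<in> B. ev f (C \<sqinter>\<^bsub>K\<^esub> D)} = {f \<in> B. ev f C} \<inter> {f \<in> B. ev f D}"
      using evD(4)[of _ C D] C D by (auto simp: subframe_meet[OF K S])
    then show ?thesis using C D subframeD(4)[OF S] by auto
  qed
qed

section \<open>The bijection between bipoints of \<open>L\<close> and of its assembly\<close>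

context biframe_locale
begin

lemma assembly_bipoint_ex1:
  "f \<in> bipoints L \<Longrightarrow> \<exists>!g. g \<in> bipoints (assembly L) \<and> biframe_comp L g (nabla_map L) = f"
  unfolding bipoints_def by (intro assembly_universal two_biframe_biframe two_biframe_bicomplements)

lemma alpha:
  assumes "f \<in> bipoints L"
  shows "alpha L f \<in> bipoints (assembly L)" "biframe_comp L (alpha L f) (nabla_map L) = f"
  using theI'[OF assembly_bipoint_ex1[OF assms]] by (simp_all add: alpha_def)

lemma alpha_nabla:
  assumes f: "f \<in> bipoints L"
  shows "x \<in> carrier P \<Longrightarrow> fst (alpha L f) (nabla M (emb_pos L x)) = fst f x"
    and "y \<in> carrier N \<Longrightarrow> snd (alpha L f) (nabla M (emb_neg L y)) = snd f y"
  using alpha(2)[OF f] comp_nabla_iff[of f "alpha L f"] frame_maps_twoD(1)[OF bipoints_frame_maps(1)[OF f]]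
    frame_maps_twoD(1)[OF bipoints_frame_maps(2)[OF f]] by simp_all

text \<open>The main map preserves complements, and complements in the two-element frame are
  negations. This is how closed sets for one topology of \<open>L\<close> become open for the
  opposite topology of the assembly.\<close>

lemma assembly_bipoint_delta:
  assumes g: "g \<in> bipoints (assembly L)"
  shows "y \<in> carrier N \<Longrightarrow> fst g (delta M (emb_neg L y)) \<longleftrightarrow> \<not> snd g (nabla M (emb_neg L y))"
    and "x \<in> carrier P \<Longrightarrow> snd g (delta M (emb_pos L x)) \<longleftrightarrow> \<not> fst g (nabla M (emb_pos L x))"
proof -
  obtain k where k: "k \<in> frame_maps (main_part (assembly L)) two_frame"
    "\<And>C. C \<in> Ap \<Longrightarrow> k (emb_pos (assembly L) C) = fst g C"
    "\<And>C. C \<in> An \<Longrightarrow> k (emb_neg (assembly L) C) = snd g C"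
    using g by (auto simp: bipoints_def biframe_maps_def)
  have *: "k (delta M s) \<longleftrightarrow> \<not> k (nabla M s)" if "s \<in> F" for s
    using frame_map_complementary[OF main_assembly_frame two_frame_frame k(1) assembly_complementary[OF that]]
    by (simp add: two_frame_complementary)
  show "fst g (delta M (emb_neg L y)) \<longleftrightarrow> \<not> snd g (nabla M (emb_neg L y))" if "y \<in> carrier N"
    using k(2)[OF delta_pos[OF that]] k(3)[OF nabla_neg[OF that]] *[OF emb_fin(2)[OF that]] that
    by (simp add: emb_assembly delta_pos nabla_neg)
  show "snd g (delta M (emb_pos L x)) \<longleftrightarrow> \<not> fst g (nabla M (emb_pos L x))" if "x \<in> carrier P"
    using k(3)[OF delta_neg[OF that]] k(2)[OF nabla_pos[OF that]] *[OF emb_fin(1)[OF that]] that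
    by (simp add: emb_assembly delta_neg nabla_pos)
qed

lemma alpha_delta:
  assumes f: "f \<in> bipoints L"
  shows "y \<in> carrier N \<Longrightarrow> fst (alpha L f) (delta M (emb_neg L y)) \<longleftrightarrow> \<not> snd f y"
    and "x \<in> carrier P \<Longrightarrow> snd (alpha L f) (delta M (emb_pos L x)) \<longleftrightarrow> \<not> fst f x"
  using assembly_bipoint_delta[OF alpha(1)[OF f]] alpha_nabla[OF f] by simp_all

text \<open>The inverse is composition with \<open>nabla_map L\<close>; uniqueness of extensions
  makes the two maps mutually inverse.\<close>

lemma alpha_bij: "bij_betw (alpha L) (bipoints L) (bipoints (assembly L))"
proof (rule bij_betwI')
  show "alpha L f = alpha L f' \<longleftrightarrow> f = f'" if "f \<in> bipoints L" "f' \<in> bipoints L" for f f'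
    using alpha(2)[OF that(1)] alpha(2)[OF that(2)] by metis
  show "alpha L f \<in> bipoints (assembly L)" if "f \<in> bipoints L" for f using that by (rule alpha)
  show "\<exists>f\<in>bipoints L. g = alpha L f" if g: "g \<in> bipoints (assembly L)" for g
  proof
    show f: "biframe_comp L g (nabla_map L) \<in> bipoints L"
      unfolding bipoints_def
      by (rule biframe_maps_comp[OF is_biframe nabla_map_biframe_map g[unfolded bipoints_def]])
    show "g = alpha L (biframe_comp L g (nabla_map L))"
      by (rule ex1E[OF assembly_bipoint_ex1[OF f]]) (use alpha[OF f] g in metis)
  qed
qed

lemma alpha_image: "alpha L ` {f \<in> bipoints L. Q (alpha L f)} = {g \<in> bipoints (assembly L). Q g}"
  unfolding bij_betw_imp_surj_on[OF alpha_bij, symmetric] by blast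

lemma alpha_image_pos:
  "x \<in> carrier P \<Longrightarrow> alpha L ` {f \<in> bipoints L. fst f x} = {g \<in> bipoints (assembly L). fst g (nabla M (emb_pos L x))}"
  "y \<in> carrier N \<Longrightarrow> alpha L ` {f \<in> bipoints L. \<not> snd f y} = {g \<in> bipoints (assembly L). fst g (delta M (emb_neg L y))}"
  unfolding alpha_image[symmetric] by (auto simp: alpha_nabla alpha_delta cong: conj_cong)

lemma alpha_image_neg:
  "y \<in> carrier N \<Longrightarrow> alpha L ` {f \<in> bipoints L. snd f y} = {g \<in> bipoints (assembly L). snd g (nabla M (emb_neg L y))}"
  "x \<in> carrier P \<Longrightarrow> alpha L ` {f \<in> bipoints L. \<not> fst f x} = {g \<in> bipoints (assembly L). snd g (delta M (emb_pos L x))}"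
  unfolding alpha_image[symmetric] by (auto simp: alpha_nabla alpha_delta cong: conj_cong)

lemma alpha_frame_map:
  assumes f: "f \<in> bipoints L"
  shows "fst (alpha L f) \<in> frame_maps (K\<lparr>carrier := Ap\<rparr>) two_frame"
    and "snd (alpha L f) \<in> frame_maps (K\<lparr>carrier := An\<rparr>) two_frame"
  unfolding pos_assembly[symmetric] neg_assembly[symmetric]
  using bipoints_frame_maps[OF alpha(1)[OF f]] by simp_all

text \<open>The topology is left arbitrary because two are needed: the Skula topology for (3) and
  the one generated by \<open>basic_opens\<close> for (4).\<close>

lemma pos_evaluation_open:
  assumes T: "topspace T = bipoints L" and "\<And>x. x \<in> carrier P \<Longrightarrow> openin T {f \<in> bipoints L. fst f x}"
    "\<And>y. y \<in> carrier N \<Longrightarrow> openin T {f \<in> bipoints L. \<not> snd f y}" and C: "C \<in> Ap"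
  shows "openin T {f \<in> bipoints L. fst (alpha L f) C}"
proof -
  have "Ap \<subseteq> {C \<in> Ap. openin T {f \<in> bipoints L. fst (alpha L f) C}}"
  proof (rule pos_least)
    show "subframe K {C \<in> Ap. openin T {f \<in> bipoints L. fst (alpha L f) C}}"
      using open_evaluation_subframe[OF M.congruence_frame_frame pos_subframe T alpha_frame_map(1)] .
    show "gen_pos \<subseteq> {C \<in> Ap. openin T {f \<in> bipoints L. fst (alpha L f) C}}"
      using assms(2,3) nabla_pos delta_pos by (auto simp: alpha_nabla alpha_delta cong: conj_cong)
  qed
  then show ?thesis using C by blast
qed

lemma neg_evaluation_open:
  assumes T: "topspace T = bipoints L" and "\<And>y. y \<in> carrier N \<Longrightarrow> openin T {f \<in> bipoints L. snd f y}"
    "\<And>x. x \<in> carrier P \<Longrightarrow> openin T {f \<in> bipoints L. \<not> fst f x}" and C: "C \<in> An"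
  shows "openin T {f \<in> bipoints L. snd (alpha L f) C}"
proof -
  have "An \<subseteq> {C \<in> An. openin T {f \<in> bipoints L. snd (alpha L f) C}}"
  proof (rule neg_least)
    show "subframe K {C \<in> An. openin T {f \<in> bipoints L. snd (alpha L f) C}}"
      using open_evaluation_subframe[OF M.congruence_frame_frame neg_subframe T alpha_frame_map(2)] .
    show "gen_neg \<subseteq> {C \<in> An. openin T {f \<in> bipoints L. snd (alpha L f) C}}"
      using assms(2,3) nabla_neg delta_neg by (auto simp: alpha_nabla alpha_delta cong: conj_cong)
  qed
  then show ?thesis using C by blast
qed

lemma bpt_topspace: "topspace (fst (bpt L)) = bipoints L" "topspace (snd (bpt L)) = bipoints L"
  using bpt_opens(3,4)[OF is_biframe] by (simp_all add: points_def bispace_def)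

lemma bpt_closed:
  "closedin (fst (bpt L)) A \<longleftrightarrow> (\<exists>x\<in>carrier P. A = {f \<in> bipoints L. \<not> fst f x})"
  "closedin (snd (bpt L)) A \<longleftrightarrow> (\<exists>y\<in>carrier N. A = {f \<in> bipoints L. \<not> snd f y})"
proof -
  have *: "A \<subseteq> B \<and> B - A = {f \<in> B. Q f} \<longleftrightarrow> A = {f \<in> B. \<not> Q f}" for A B :: "(('p \<Rightarrow> bool) \<times> ('n \<Rightarrow> bool)) set" and Q
    by auto
  show "closedin (fst (bpt L)) A \<longleftrightarrow> (\<exists>x\<in>carrier P. A = {f \<in> bipoints L. \<not> fst f x})"
    "closedin (snd (bpt L)) A \<longleftrightarrow> (\<exists>y\<in>carrier N. A = {f \<in> bipoints L. \<not> snd f y})"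
    unfolding closedin_def bpt_opens(1,2)[OF is_biframe] bpt_topspace *[symmetric] by auto
qed

lemma skula_topspace: "topspace (fst (skula (bpt L))) = bipoints L" "topspace (snd (skula (bpt L))) = bipoints L"
proof -
  have "\<Union>({U. openin S U} \<union> {A. closedin T A}) = topspace S" if "topspace S = topspace T" for S T :: "(('p \<Rightarrow> bool) \<times> ('n \<Rightarrow> bool)) topology"
    using that openin_topspace[of S] by (auto dest: openin_subset closedin_subset)
  then show "topspace (fst (skula (bpt L))) = bipoints L" "topspace (snd (skula (bpt L))) = bipoints L"
    using bpt_topspace by (simp_all only: skula_def fst_conv snd_conv topology_generated_by_topspace)
qed

lemma skula_basic_open:
  "x \<in> carrier P \<Longrightarrow> openin (fst (skula (bpt L))) {f \<in> bipoints L. fst f x}"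
  "y \<in> carrier N \<Longrightarrow> openin (fst (skula (bpt L))) {f \<in> bipoints L. \<not> snd f y}"
  "y \<in> carrier N \<Longrightarrow> openin (snd (skula (bpt L))) {f \<in> bipoints L. snd f y}"
  "x \<in> carrier P \<Longrightarrow> openin (snd (skula (bpt L))) {f \<in> bipoints L. \<not> fst f x}"
  unfolding skula_def fst_conv snd_conv
  by (rule topology_generated_by_Basis; auto simp: bpt_opens(1,2)[OF is_biframe] bpt_closed)+

lemma assembly_open:
  "C \<in> Ap \<Longrightarrow> openin (fst (bpt (assembly L))) {g \<in> bipoints (assembly L). fst g C}"
  "C \<in> An \<Longrightarrow> openin (snd (bpt (assembly L))) {g \<in> bipoints (assembly L). snd g C}"
  unfolding bpt_opens(1,2)[OF assembly_biframe] by blast+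

text \<open>The subbasic Skula opens correspond exactly to evaluation at \<open>nabla\<close> and
  \<open>delta\<close> generators. Evaluation at any other element of a part is reached by induction
  over that part.\<close>

theorem alpha_bihomeomorphism: "bihomeomorphism (skula (bpt L)) (bpt (assembly L)) (alpha L)"
proof -
  interpret A: biframe_locale "assembly L" by unfold_locales (rule assembly_biframe)
  note A_opens = bpt_opens(1,2)[OF assembly_biframe]
  note tops = skula_topspace[unfolded skula_def fst_conv snd_conv topology_generated_by_topspace]
  note pe = pos_evaluation_open[OF skula_topspace(1) skula_basic_open(1,2), unfolded skula_def fst_conv]
    and ne = neg_evaluation_open[OF skula_topspace(2) skula_basic_open(3,4), unfolded skula_def snd_conv]
  have "homeomorphic_map (fst (skula (bpt L))) (fst (bpt (assembly L))) (alpha L)"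
    unfolding skula_def fst_conv
  proof (rule generated_homeomorphism[where ev = fst and A = Ap]; (unfold tops A.bpt_topspace)?)
    show "openin (fst (bpt (assembly L))) (alpha L ` s)"
      if "s \<in> {U. openin (fst (bpt L)) U} \<union> {K. closedin (snd (bpt L)) K}" for s
      using that
      by (auto simp: bpt_opens(1)[OF is_biframe] bpt_closed alpha_image_pos intro!: assembly_open nabla_pos delta_pos)
  qed (rule alpha_bij A_opens pe; assumption?)+
  moreover have "homeomorphic_map (snd (skula (bpt L))) (snd (bpt (assembly L))) (alpha L)"
    unfolding skula_def snd_conv
  proof (rule generated_homeomorphism[where ev = snd and A = An]; (unfold tops A.bpt_topspace)?)
    show "openin (snd (bpt (assembly L))) (alpha L ` s)"
      if "s \<in> {U. openin (snd (bpt L)) U} \<union> {K. closedin (fst (bpt L)) K}" for s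
      using that
      by (auto simp: bpt_opens(2)[OF is_biframe] bpt_closed alpha_image_neg intro!: assembly_open nabla_neg delta_neg)
  qed (rule alpha_bij A_opens ne; assumption?)+
  ultimately show ?thesis
    using alpha_bij by (simp add: bihomeomorphism_def points_def skula_topspace A.bpt_topspace)
qed

section \<open>A base of the patch topology of the assembly, expressed on bipoints of
  \<open>L\<close>\<close>

definition basic_open :: "'p \<Rightarrow> 'n \<Rightarrow> 'p \<Rightarrow> 'n \<Rightarrow> (('p \<Rightarrow> bool) \<times> ('n \<Rightarrow> bool)) set"
  where "basic_open a b c d = {f \<in> bipoints L. fst f a \<and> snd f b \<and> \<not> fst f c \<and> \<not> snd f d}"

definition basic_opens :: "(('p \<Rightarrow> bool) \<times> ('n \<Rightarrow> bool)) set set"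
  where "basic_opens = {basic_open a b c d | a b c d. a \<in> carrier P \<and> b \<in> carrier N \<and> c \<in> carrier P \<and> d \<in> carrier N}"

text \<open>Four parameters suffice: conditions of value 1 merge under meets and conditions of value
  0 under joins.\<close>

lemma basic_open_Int:
  assumes "B \<in> basic_opens" "B' \<in> basic_opens"
  shows "B \<inter> B' \<in> basic_opens"
proof -
  obtain a b c d where B: "a \<in> carrier P" "b \<in> carrier N" "c \<in> carrier P" "d \<in> carrier N" "B = basic_open a b c d"
    using assms(1) unfolding basic_opens_def by blast
  obtain a' b' c' d' where B': "a' \<in> carrier P" "b' \<in> carrier N" "c' \<in> carrier P" "d' \<in> carrier N" "B' = basic_open a' b' c' d'"
    using assms(2) unfolding basic_opens_def by blast
  have "B \<inter> B' = basic_open (a \<sqinter>\<^bsub>P\<^esub> a') (b \<sqinter>\<^bsub>N\<^esub> b') (c \<squnion>\<^bsub>P\<^esub> c') (d \<squnion>\<^bsub>N\<^esub> d')"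
  proof (rule Set.set_eqI)
    fix f
    show "f \<in> B \<inter> B' \<longleftrightarrow> f \<in> basic_open (a \<sqinter>\<^bsub>P\<^esub> a') (b \<sqinter>\<^bsub>N\<^esub> b') (c \<squnion>\<^bsub>P\<^esub> c') (d \<squnion>\<^bsub>N\<^esub> d')"
    proof (cases "f \<in> bipoints L")
      case True
      note fD = bipoints_frame_maps[OF True]
      from True show ?thesis
        unfolding B(5) B'(5) using B(1-4) B'(1-4)
        by (simp add: basic_open_def frame_maps_twoD(4)[OF fD(1)] frame_maps_twoD(4)[OF fD(2)]
            frame_maps_two_join[OF fD(1)] frame_maps_two_join[OF fD(2)]) blast
    qed (simp add: basic_open_def B(5))
  qed
  then show ?thesis
    unfolding basic_opens_def using B(1-4) B'(1-4)
    by (intro CollectI exI conjI) (assumption | simp)+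
qed

lemma basic_openI:
  assumes "x \<in> carrier P" "y \<in> carrier N"
  shows "{f \<in> bipoints L. fst f x} \<in> basic_opens" "{f \<in> bipoints L. snd f y} \<in> basic_opens"
    "{f \<in> bipoints L. \<not> fst f x} \<in> basic_opens" "{f \<in> bipoints L. \<not> snd f y} \<in> basic_opens" "bipoints L \<in> basic_opens"
proof -
  note tb = frame_maps_twoD(3)[OF bipoints_frame_maps(1)] frame_maps_twoD(3)[OF bipoints_frame_maps(2)]
    frame_maps_two_bottom[OF pos_frame bipoints_frame_maps(1)] frame_maps_two_bottom[OF neg_frame bipoints_frame_maps(2)]
  have eq: "{f \<in> bipoints L. fst f x} = basic_open x \<top>\<^bsub>N\<^esub> \<bottom>\<^bsub>P\<^esub> \<bottom>\<^bsub>N\<^esub>"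
    "{f \<in> bipoints L. snd f y} = basic_open \<top>\<^bsub>P\<^esub> y \<bottom>\<^bsub>P\<^esub> \<bottom>\<^bsub>N\<^esub>"
    "{f \<in> bipoints L. \<not> fst f x} = basic_open \<top>\<^bsub>P\<^esub> \<top>\<^bsub>N\<^esub> x \<bottom>\<^bsub>N\<^esub>"
    "{f \<in> bipoints L. \<not> snd f y} = basic_open \<top>\<^bsub>P\<^esub> \<top>\<^bsub>N\<^esub> \<bottom>\<^bsub>P\<^esub> y"
    "bipoints L = basic_open \<top>\<^bsub>P\<^esub> \<top>\<^bsub>N\<^esub> \<bottom>\<^bsub>P\<^esub> \<bottom>\<^bsub>N\<^esub>"
    unfolding basic_open_def using tb by blast+
  have bo: "basic_open a b c d \<in> basic_opens"
    if "a \<in> carrier P" "b \<in> carrier N" "c \<in> carrier P" "d \<in> carrier N" for a b c d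
    unfolding basic_opens_def using that by blast
  show "{f \<in> bipoints L. fst f x} \<in> basic_opens" unfolding eq(1) by (rule bo) (use assms in simp_all)
  show "{f \<in> bipoints L. snd f y} \<in> basic_opens" unfolding eq(2) by (rule bo) (use assms in simp_all)
  show "{f \<in> bipoints L. \<not> fst f x} \<in> basic_opens" unfolding eq(3) by (rule bo) (use assms in simp_all)
  show "{f \<in> bipoints L. \<not> snd f y} \<in> basic_opens" unfolding eq(4) by (rule bo) (use assms in simp_all)
  show "bipoints L \<in> basic_opens" by (subst eq(5), rule bo) (use assms in simp_all)
qed

lemma basic_opens_Union: "\<Union>basic_opens = bipoints L"
proof
  show "\<Union>basic_opens \<subseteq> bipoints L" unfolding basic_opens_def basic_open_def by blast
  show "bipoints L \<subseteq> \<Union>basic_opens" by (rule Union_upper[OF basic_openI(5)[OF P.top_closed N.top_closed]])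
qed

lemma basic_topology:
  assumes "openin (topology_generated_by basic_opens) U" "f \<in> U"
  shows "\<exists>B\<in>basic_opens. f \<in> B \<and> B \<subseteq> U"
proof -
  have "generate_topology_on basic_opens U" using assms(1) by (rule openin_topology_generated_by)
  then have "\<forall>f\<in>U. \<exists>B\<in>basic_opens. f \<in> B \<and> B \<subseteq> U"
  proof induction
    case (Int a b)
    show ?case
    proof
      fix f assume "f \<in> a \<inter> b"
      then obtain B B' where "B \<in> basic_opens" "f \<in> B" "B \<subseteq> a" "B' \<in> basic_opens" "f \<in> B'" "B' \<subseteq> b"
        using Int by blast
      then show "\<exists>B\<in>basic_opens. f \<in> B \<and> B \<subseteq> a \<inter> b"
        using basic_open_Int[of B B'] by (intro bexI[of _ "B \<inter> B'"]) auto
    qed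
  next
    case (UN \<K>)
    then show ?case by (meson UnionE Union_upper order_trans)
  qed blast+
  then show ?thesis using assms(2) by blast
qed

text \<open>The induction used for the Skula topologies, now with the generators of both parts open
  in a single topology.\<close>

lemma alpha_preimage_patch_open:
  assumes "openin (patch (bpt (assembly L))) V"
  shows "openin (topology_generated_by basic_opens) {f \<in> bipoints L. alpha L f \<in> V}"
proof -
  let ?T = "topology_generated_by basic_opens"
  have T: "topspace ?T = bipoints L" by (simp add: basic_opens_Union)
  have b: "openin ?T B" if "B \<in> basic_opens" for B using that by (rule topology_generated_by_Basis)
  note A_opens = bpt_opens(1,2)[OF assembly_biframe]
  have "openin ?T {f \<in> bipoints L. alpha L f \<in> s}"
    if "s \<in> {U. openin (fst (bpt (assembly L))) U} \<union> {U. openin (snd (bpt (assembly L))) U}" for s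
    using that
  proof
    assume "s \<in> {U. openin (fst (bpt (assembly L))) U}"
    then obtain C where C: "C \<in> Ap" "s = {g \<in> bipoints (assembly L). fst g C}" by (auto simp: A_opens)
    then have "{f \<in> bipoints L. alpha L f \<in> s} = {f \<in> bipoints L. fst (alpha L f) C}" by (auto simp: alpha)
    then show ?thesis
      using pos_evaluation_open[OF T b[OF basic_openI(1)[OF _ N.top_closed]] b[OF basic_openI(4)[OF P.top_closed]] C(1)] by simp
  next
    assume "s \<in> {U. openin (snd (bpt (assembly L))) U}"
    then obtain C where C: "C \<in> An" "s = {g \<in> bipoints (assembly L). snd g C}" by (auto simp: A_opens)
    then have "{f \<in> bipoints L. alpha L f \<in> s} = {f \<in> bipoints L. snd (alpha L f) C}" by (auto simp: alpha)
    then show ?thesis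
      using neg_evaluation_open[OF T b[OF basic_openI(2)[OF P.top_closed]] b[OF basic_openI(3)[OF _ N.top_closed]] C(1)] by simp
  qed
  note basic = this
  have "generate_topology_on ({U. openin (fst (bpt (assembly L))) U} \<union> {U. openin (snd (bpt (assembly L))) U}) V"
    using assms unfolding patch_def by (rule openin_topology_generated_by)
  then show ?thesis
  proof induction
    case (Int a b)
    have "{f \<in> bipoints L. alpha L f \<in> a \<inter> b} = {f \<in> bipoints L. alpha L f \<in> a} \<inter> {f \<in> bipoints L. alpha L f \<in> b}" by auto
    then show ?case using Int by (simp only: openin_Int)
  next
    case (UN \<K>)
    have "{f \<in> bipoints L. alpha L f \<in> \<Union>\<K>} = (\<Union>k\<in>\<K>. {f \<in> bipoints L. alpha L f \<in> k})" by auto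
    moreover have "openin ?T (\<Union>k\<in>\<K>. {f \<in> bipoints L. alpha L f \<in> k})" by (rule openin_Union) (use UN in auto)
    ultimately show ?case by simp
  qed (use basic in auto)
qed

lemma patch_assembly_topspace: "topspace (patch (bpt (assembly L))) = bipoints (assembly L)"
proof -
  interpret A: biframe_locale "assembly L" by unfold_locales (rule assembly_biframe)
  have "\<Union>({U. openin S U} \<union> {U. openin T U}) = topspace S" if "topspace S = topspace T"
    for S T :: "((('a \<times> 'a) set \<Rightarrow> bool) \<times> (('a \<times> 'a) set \<Rightarrow> bool)) topology"
    using that openin_topspace[of S] by (auto dest: openin_subset)
  then show ?thesis
    unfolding patch_def topology_generated_by_topspace using A.bpt_topspace by simp
qed

lemma alpha_basic_open:
  assumes "B \<in> basic_opens"
  shows "openin (patch (bpt (assembly L))) (alpha L ` B)"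
proof -
  obtain a b c d where B: "a \<in> carrier P" "b \<in> carrier N" "c \<in> carrier P" "d \<in> carrier N" "B = basic_open a b c d"
    using assms unfolding basic_opens_def by blast
  have o: "openin (patch (bpt (assembly L))) U" if "openin (fst (bpt (assembly L))) U \<or> openin (snd (bpt (assembly L))) U" for U
    unfolding patch_def by (rule topology_generated_by_Basis) (use that in auto)
  let ?A = "bipoints (assembly L)"
  have "B = {f \<in> bipoints L. fst (alpha L f) (nabla M (emb_pos L a)) \<and> snd (alpha L f) (nabla M (emb_neg L b)) \<and>
    snd (alpha L f) (delta M (emb_pos L c)) \<and> fst (alpha L f) (delta M (emb_neg L d))}"
    unfolding B(5) basic_open_def using B(1-4) by (auto simp: alpha_nabla alpha_delta)
  then have "alpha L ` B = {g \<in> ?A. fst g (nabla M (emb_pos L a)) \<and> snd g (nabla M (emb_neg L b)) \<and>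
    snd g (delta M (emb_pos L c)) \<and> fst g (delta M (emb_neg L d))}"
    unfolding alpha_image[symmetric] by simp
  also have "\<dots> = ({g \<in> ?A. fst g (nabla M (emb_pos L a))} \<inter> {g \<in> ?A. snd g (nabla M (emb_neg L b))}) \<inter>
    ({g \<in> ?A. snd g (delta M (emb_pos L c))} \<inter> {g \<in> ?A. fst g (delta M (emb_neg L d))})"
    by auto
  also have "openin (patch (bpt (assembly L))) \<dots>"
    using B(1-4) by (intro openin_Int o) (simp_all add: assembly_open nabla_pos nabla_neg delta_pos delta_neg)
  finally show ?thesis .
qed

text \<open>The right-hand side says that \<open>Y\<close> contains its adherent points. Forwards,
  the open complement is pulled back along \<open>alpha\<close>; backwards, it is the image of the
  union of the basic opens missing \<open>Y\<close>.\<close>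

lemma patch_closed_iff:
  assumes Y: "Y \<subseteq> bipoints L"
  shows "closedin (patch (bpt (assembly L))) (alpha L ` Y) \<longleftrightarrow>
    (\<forall>h\<in>bipoints L. (\<forall>B\<in>basic_opens. h \<in> B \<longrightarrow> B \<inter> Y \<noteq> {}) \<longrightarrow> h \<in> Y)"
proof
  note inj = bij_betw_imp_inj_on[OF alpha_bij] and surj = bij_betw_imp_surj_on[OF alpha_bij]
  assume "closedin (patch (bpt (assembly L))) (alpha L ` Y)"
  then have "openin (topology_generated_by basic_opens) {f \<in> bipoints L. alpha L f \<in> bipoints (assembly L) - alpha L ` Y}"
    by (intro alpha_preimage_patch_open) (simp only: closedin_def patch_assembly_topspace)
  also have "{f \<in> bipoints L. alpha L f \<in> bipoints (assembly L) - alpha L ` Y} = bipoints L - Y"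
  proof (rule Set.set_eqI)
    fix f
    show "f \<in> {f \<in> bipoints L. alpha L f \<in> bipoints (assembly L) - alpha L ` Y} \<longleftrightarrow> f \<in> bipoints L - Y"
      using inj_on_image_mem_iff[OF inj _ Y, of f] alpha(1)[of f] by (cases "f \<in> bipoints L") simp_all
  qed
  finally show "\<forall>h\<in>bipoints L. (\<forall>B\<in>basic_opens. h \<in> B \<longrightarrow> B \<inter> Y \<noteq> {}) \<longrightarrow> h \<in> Y"
    using basic_topology[of "bipoints L - Y"] by fast
next
  note inj = bij_betw_imp_inj_on[OF alpha_bij] and surj = bij_betw_imp_surj_on[OF alpha_bij]
  assume *: "\<forall>h\<in>bipoints L. (\<forall>B\<in>basic_opens. h \<in> B \<longrightarrow> B \<inter> Y \<noteq> {}) \<longrightarrow> h \<in> Y"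
  have sub: "B \<subseteq> bipoints L" if "B \<in> basic_opens" for B using that by (auto simp: basic_opens_def basic_open_def)
  have "bipoints L - Y = \<Union>{B \<in> basic_opens. B \<inter> Y = {}}"
    using * sub by fast
  moreover have "bipoints (assembly L) - alpha L ` Y = alpha L ` (bipoints L - Y)"
    using inj_on_image_set_diff[OF inj, of "bipoints L" Y] Y surj by simp
  ultimately have "bipoints (assembly L) - alpha L ` Y = (\<Union>B\<in>{B \<in> basic_opens. B \<inter> Y = {}}. alpha L ` B)"
    by (simp only: image_Union)
  moreover have "openin (patch (bpt (assembly L))) (\<Union>B\<in>{B \<in> basic_opens. B \<inter> Y = {}}. alpha L ` B)"
    by (rule openin_Union) (auto simp: alpha_basic_open)
  moreover have "alpha L ` Y \<subseteq> bipoints (assembly L)" using Y alpha(1) by auto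
  ultimately show "closedin (patch (bpt (assembly L))) (alpha L ` Y)"
    by (simp add: closedin_def patch_assembly_topspace)
qed

end


section \<open>Bisober bispaces\<close>

lemma powerset_complete: "complete_lattice (inclusion_order (Pow X))"
  by (rule inclusion_order_complete[of X]) auto

lemma powerset_sup: "A \<subseteq> Pow X \<Longrightarrow> \<Squnion>\<^bsub>inclusion_order (Pow X)\<^esub> A = \<Union>A"
  by (rule complete_sup_eqI[OF powerset_complete]) (simp_all add: Union_upper Union_least, blast)

lemma powerset_meet: "U \<subseteq> X \<Longrightarrow> V \<subseteq> X \<Longrightarrow> U \<sqinter>\<^bsub>inclusion_order (Pow X)\<^esub> V = U \<inter> V"
  by (rule complete_meet_eqI[OF powerset_complete]) auto

lemma powerset_top: "\<top>\<^bsub>inclusion_order (Pow X)\<^esub> = X"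
  by (rule complete_top_eqI[OF powerset_complete]) auto

lemma powerset_frame: "frame (inclusion_order (Pow X))"
proof (intro frame.intro powerset_complete frame_axioms.intro)
  fix U \<A> assume U: "U \<in> carrier (inclusion_order (Pow X))" and A: "\<A> \<subseteq> carrier (inclusion_order (Pow X))"
  have m: "(\<lambda>V. U \<sqinter>\<^bsub>inclusion_order (Pow X)\<^esub> V) ` \<A> = (\<lambda>V. U \<inter> V) ` \<A>"
    by (intro image_cong HOL.refl powerset_meet) (use U A in auto)
  have "U \<sqinter>\<^bsub>inclusion_order (Pow X)\<^esub> \<Squnion>\<^bsub>inclusion_order (Pow X)\<^esub> \<A> = U \<inter> \<Union>\<A>"
    using U A by (subst powerset_sup) (auto intro!: powerset_meet)
  also have "\<dots> = \<Union>((\<lambda>V. U \<inter> V) ` \<A>)" by (rule Int_Union)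
  also have "\<dots> = \<Squnion>\<^bsub>inclusion_order (Pow X)\<^esub> ((\<lambda>V. U \<inter> V) ` \<A>)"
    by (rule powerset_sup[symmetric]) (use A in auto)
  finally show "U \<sqinter>\<^bsub>inclusion_order (Pow X)\<^esub> \<Squnion>\<^bsub>inclusion_order (Pow X)\<^esub> \<A> =
    \<Squnion>\<^bsub>inclusion_order (Pow X)\<^esub> ((\<lambda>V. U \<sqinter>\<^bsub>inclusion_order (Pow X)\<^esub> V) ` \<A>)"
    unfolding m .
qed

text \<open>Opens inherit the frame laws from the power set, and their joins and finite meets become
  unions and intersections.\<close>

lemma opens_subframe: "subframe (inclusion_order (Pow (topspace T))) {U. openin T U}"
  unfolding subframe_def
proof (intro conjI allI impI ballI)
  show sub: "{U. openin T U} \<subseteq> carrier (inclusion_order (Pow (topspace T)))"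
    by (auto dest: openin_subset)
  show "\<Squnion>\<^bsub>inclusion_order (Pow (topspace T))\<^esub> A \<in> {U. openin T U}" if "A \<subseteq> {U. openin T U}" for A
    using that sub by (subst powerset_sup) (auto intro: openin_Union)
  show "U \<sqinter>\<^bsub>inclusion_order (Pow (topspace T))\<^esub> V \<in> {U. openin T U}"
    if "U \<in> {U. openin T U}" "V \<in> {U. openin T U}" for U V
    using that sub by (subst powerset_meet) (auto simp: openin_Int)
qed (simp add: powerset_top)

lemma opens_frame_eq: "opens_frame T = (inclusion_order (Pow (topspace T)))\<lparr>carrier := {U. openin T U}\<rparr>"
  by (simp add: opens_frame_def inclusion_order_def)

lemma opens_frame_simps [simp]: "carrier (opens_frame T) = {U. openin T U}" "le (opens_frame T) = (\<subseteq>)"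
  by (simp_all add: opens_frame_def)

lemma opens_frame_frame: "frame (opens_frame T)"
  unfolding opens_frame_eq by (rule subframe_frame[OF powerset_frame opens_subframe])

lemma opens_frame_sup: "A \<subseteq> {U. openin T U} \<Longrightarrow> \<Squnion>\<^bsub>opens_frame T\<^esub> A = \<Union>A"
  unfolding opens_frame_eq subframe_sup[OF powerset_frame opens_subframe]
  by (rule powerset_sup) (auto dest: openin_subset)

lemma opens_frame_meet: "openin T U \<Longrightarrow> openin T V \<Longrightarrow> U \<sqinter>\<^bsub>opens_frame T\<^esub> V = U \<inter> V"
  by (intro complete_meet_eqI frame.axioms(1)[OF opens_frame_frame]) auto

lemma opens_frame_top: "\<top>\<^bsub>opens_frame T\<^esub> = topspace T"
  using openin_subset[of T] by (intro complete_top_eqI frame.axioms(1)[OF opens_frame_frame]) auto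

lemma frame_maps_opensD:
  assumes "\<phi> \<in> frame_maps (opens_frame T) two_frame"
  shows "\<phi> \<in> extensional {U. openin T U}"
    and "A \<subseteq> {U. openin T U} \<Longrightarrow> \<phi> (\<Union>A) \<longleftrightarrow> (\<exists>U\<in>A. \<phi> U)"
    and "\<phi> (topspace T)"
    and "openin T U \<Longrightarrow> openin T V \<Longrightarrow> \<phi> (U \<inter> V) \<longleftrightarrow> \<phi> U \<and> \<phi> V"
  using frame_maps_twoD[OF assms] by (simp_all add: opens_frame_sup opens_frame_meet opens_frame_top)

lemma frame_maps_opensI:
  assumes "\<phi> \<in> extensional {U. openin T U}"
    and "\<And>A. A \<subseteq> {U. openin T U} \<Longrightarrow> \<phi> (\<Union>A) \<longleftrightarrow> (\<exists>U\<in>A. \<phi> U)"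
    and "\<phi> (topspace T)"
    and "\<And>U V. openin T U \<Longrightarrow> openin T V \<Longrightarrow> \<phi> (U \<inter> V) \<longleftrightarrow> \<phi> U \<and> \<phi> V"
  shows "\<phi> \<in> frame_maps (opens_frame T) two_frame"
  by (rule frame_maps_twoI) (use assms in \<open>simp_all add: opens_frame_sup opens_frame_meet opens_frame_top\<close>)

lemma opens_biframe_parts [simp]:
  "pos_part (opens_biframe X) = opens_frame (fst X)" "neg_part (opens_biframe X) = opens_frame (snd X)"
  by (simp_all add: opens_biframe_def Let_def)

text \<open>The main component enters only through the existence of a map out of it. By the
  universal properties of quotient and coproduct, that map exists iff the copairing of the two
  points respects the defining inequalities.\<close>

lemma bipoints_opens_biframe_iff:
  "(\<phi>, \<psi>) \<in> bipoints (opens_biframe X) \<longleftrightarrow>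
    \<phi> \<in> frame_maps (opens_frame (fst X)) two_frame \<and> \<psi> \<in> frame_maps (opens_frame (snd X)) two_frame \<and>
    (\<forall>U U' V V'. openin (fst X) U \<and> openin (snd X) U' \<and> openin (fst X) V \<and> openin (snd X) V' \<and>
      U \<inter> U' \<subseteq> V \<union> V' \<and> \<phi> U \<and> \<psi> U' \<longrightarrow> \<phi> V \<or> \<psi> V')" (is "?l \<longleftrightarrow> ?p \<and> ?n \<and> ?r")
proof -
  let ?P = "opens_frame (fst X)" and ?N = "opens_frame (snd X)"
  let ?K = "coproduct_frame ?P ?N"
  let ?i = "coproduct_inl ?P ?N" and ?j = "coproduct_inr ?P ?N"
  define R where "R = {(?i U \<sqinter>\<^bsub>?K\<^esub> ?j U', ?i V \<squnion>\<^bsub>?K\<^esub> ?j V') | U U' V V'.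
    openin (fst X) U \<and> openin (snd X) U' \<and> openin (fst X) V \<and> openin (snd X) V' \<and> U \<inter> U' \<subseteq> V \<union> V'}"
  define C where "C = generated_congruence ?K R"
  define q where "q = quotient_map ?K C"
  have P: "frame ?P" and N: "frame ?N" by (rule opens_frame_frame)+
  have K: "frame ?K" by (rule coproduct_is_frame[OF P N])
  interpret K: frame ?K by (rule K)
  have i: "?i \<in> frame_maps ?P ?K" by (rule coproduct_inl_frame_map[OF P N])
  have j: "?j \<in> frame_maps ?N ?K" by (rule coproduct_inr_frame_map[OF P N])
  have ic: "openin (fst X) U \<Longrightarrow> ?i U \<in> carrier ?K" for U using frame_mapsD(2)[OF i] by simp
  have jc: "openin (snd X) U \<Longrightarrow> ?j U \<in> carrier ?K" for U using frame_mapsD(2)[OF j] by simp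
  have R: "R \<subseteq> carrier ?K \<times> carrier ?K"
    unfolding R_def using ic jc by (auto simp del: coproduct_frame_simps)
  note Q = quotient_universal[OF K R, folded C_def, folded q_def]
  have main: "main_part (opens_biframe X) = quotient_frame ?K C"
    "emb_pos (opens_biframe X) = compose (carrier ?P) q ?i"
    "emb_neg (opens_biframe X) = compose (carrier ?N) q ?j"
    unfolding opens_biframe_def Let_def C_def q_def R_def by simp_all
  have l: "?l \<longleftrightarrow> ?p \<and> ?n \<and> (\<exists>k\<in>frame_maps (quotient_frame ?K C) two_frame.
      (\<forall>U. openin (fst X) U \<longrightarrow> k (q (?i U)) = \<phi> U) \<and> (\<forall>U. openin (snd X) U \<longrightarrow> k (q (?j U)) = \<psi> U))"
    unfolding bipoints_def biframe_maps_def mem_Collect_eq case_prod_conv opens_biframe_parts two_biframe_simps main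
    by (simp add: compose_def)
  have "?r" if "?l"
  proof (intro allI impI, elim conjE)
    fix U U' V V' assume o: "openin (fst X) U" "openin (snd X) U'" "openin (fst X) V" "openin (snd X) V'"
      and "U \<inter> U' \<subseteq> V \<union> V'" "\<phi> U" "\<psi> U'"
    obtain k where k: "k \<in> frame_maps (quotient_frame ?K C) two_frame"
      "\<And>U. openin (fst X) U \<Longrightarrow> k (q (?i U)) = \<phi> U" "\<And>U. openin (snd X) U \<Longrightarrow> k (q (?j U)) = \<psi> U"
      using \<open>?l\<close> unfolding l by blast
    have kq: "compose (carrier ?K) k q \<in> frame_maps ?K two_frame" by (rule frame_maps_compose[OF K Q(2) k(1)])
    have kqe: "compose (carrier ?K) k q D = k (q D)" if "D \<in> carrier ?K" for D using that by (simp add: compose_def)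
    have cl: "?i U \<sqinter>\<^bsub>?K\<^esub> ?j U' \<in> carrier ?K" "?i V \<squnion>\<^bsub>?K\<^esub> ?j V' \<in> carrier ?K"
      using o by (auto intro!: K.meet_closed K.join_closed ic jc simp del: coproduct_frame_simps)
    have "(?i U \<sqinter>\<^bsub>?K\<^esub> ?j U', ?i V \<squnion>\<^bsub>?K\<^esub> ?j V') \<in> R" unfolding R_def using o \<open>U \<inter> U' \<subseteq> V \<union> V'\<close> by blast
    note frame_maps_mono[OF frame.axioms(1)[OF Q(1)] two_frame_complete k(1)
        frame_mapsD(2)[OF Q(2) cl(1)] frame_mapsD(2)[OF Q(2) cl(2)] Q(4)[OF this]]
    then have "compose (carrier ?K) k q (?i U \<sqinter>\<^bsub>?K\<^esub> ?j U') \<le> compose (carrier ?K) k q (?i V \<squnion>\<^bsub>?K\<^esub> ?j V')"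
      by (simp only: kqe[OF cl(1)] kqe[OF cl(2)] two_frame_simps)
    then show "\<phi> V \<or> \<psi> V'"
      unfolding frame_maps_twoD(4)[OF kq ic[OF o(1)] jc[OF o(2)]] frame_maps_two_join[OF kq ic[OF o(3)] jc[OF o(4)]]
        kqe[OF ic[OF o(1)]] kqe[OF jc[OF o(2)]] kqe[OF ic[OF o(3)]] kqe[OF jc[OF o(4)]]
        k(2)[OF o(1)] k(3)[OF o(2)] k(2)[OF o(3)] k(3)[OF o(4)]
      using \<open>\<phi> U\<close> \<open>\<psi> U'\<close> by simp
  qed
  moreover have "?l" if \<phi>: "?p" and \<psi>: "?n" and "?r"
  proof -
    \<comment> \<open>The only candidate on the coproduct; it factors through the quotient once it
      respects \<open>R\<close>.\<close>
    let ?h = "copairing ?P ?N two_frame \<phi> \<psi>"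
    have h: "?h \<in> frame_maps ?K two_frame" by (rule copairing_frame_map[OF P N two_frame_frame \<phi> \<psi>])
    have hi: "?h (?i U) = \<phi> U" if "openin (fst X) U" for U
      using copairing_inl[OF P N two_frame_frame \<phi> \<psi>, of U] that by simp
    have hj: "?h (?j U) = \<psi> U" if "openin (snd X) U" for U
      using copairing_inr[OF P N two_frame_frame \<phi> \<psi>, of U] that by simp
    have "?h a \<sqsubseteq>\<^bsub>two_frame\<^esub> ?h b" if "(a, b) \<in> R" for a b
    proof -
      obtain U U' V V' where o: "openin (fst X) U" "openin (snd X) U'" "openin (fst X) V" "openin (snd X) V'"
        and le: "U \<inter> U' \<subseteq> V \<union> V'" and ab: "a = ?i U \<sqinter>\<^bsub>?K\<^esub> ?j U'" "b = ?i V \<squnion>\<^bsub>?K\<^esub> ?j V'"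
        using \<open>(a, b) \<in> R\<close> unfolding R_def by blast
      have "\<phi> U \<and> \<psi> U' \<longrightarrow> \<phi> V \<or> \<psi> V'" using \<open>?r\<close> o le by blast
      then show ?thesis
        unfolding ab frame_maps_twoD(4)[OF h ic[OF o(1)] jc[OF o(2)]] frame_maps_two_join[OF h ic[OF o(3)] jc[OF o(4)]]
          hi[OF o(1)] hj[OF o(2)] hi[OF o(3)] hj[OF o(4)] by simp
    qed
    then obtain k where k: "k \<in> frame_maps (quotient_frame ?K C) two_frame" "compose (carrier ?K) k q = ?h"
      using Q(5)[OF two_frame_frame h] by blast
    have "k (q D) = ?h D" if "D \<in> carrier ?K" for D
      using fun_cong[OF k(2), of D] that by (simp add: compose_def)
    then show "?l" unfolding l using \<phi> \<psi> k(1) hi hj ic jc by (intro conjI bexI[of _ k]) simp_all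
  qed
  ultimately show ?thesis using l by blast
qed

text \<open>These topologies concern only the two evaluation maps, so
  \<open>evaluation_topology\<close> is applied to them directly.\<close>

lemma bpt_opens_biframe:
  "openin (fst (bpt (opens_biframe X))) W \<longleftrightarrow> (\<exists>U. openin (fst X) U \<and> W = {f \<in> bipoints (opens_biframe X). fst f U})"
  "openin (snd (bpt (opens_biframe X))) W \<longleftrightarrow> (\<exists>U. openin (snd X) U \<and> W = {f \<in> bipoints (opens_biframe X). snd f U})"
  "topspace (fst (bpt (opens_biframe X))) = bipoints (opens_biframe X)"
  "topspace (snd (bpt (opens_biframe X))) = bipoints (opens_biframe X)"
proof -
  let ?B = "bipoints (opens_biframe X)"
  have p: "fst f \<in> frame_maps (opens_frame (fst X)) two_frame"
    and n: "snd f \<in> frame_maps (opens_frame (snd X)) two_frame" if "f \<in> ?B" for f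
    using bipoints_frame_maps[OF that] by simp_all
  note tp = evaluation_topology[where B = ?B and e = fst, OF opens_frame_frame p]
    and tn = evaluation_topology[where B = ?B and e = snd, OF opens_frame_frame n]
  show "openin (fst (bpt (opens_biframe X))) W \<longleftrightarrow> (\<exists>U. openin (fst X) U \<and> W = {f \<in> ?B. fst f U})"
    using topology_inverse'[OF tp(1)] by (simp add: bpt_def)
  show "openin (snd (bpt (opens_biframe X))) W \<longleftrightarrow> (\<exists>U. openin (snd X) U \<and> W = {f \<in> ?B. snd f U})"
    using topology_inverse'[OF tn(1)] by (simp add: bpt_def)
  show "topspace (fst (bpt (opens_biframe X))) = ?B" "topspace (snd (bpt (opens_biframe X))) = ?B"
    using tp(2) tn(2) by (simp_all add: bpt_def)
qed

lemma neighbourhood_simps: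
  "openin (fst X) U \<Longrightarrow> fst (neighbourhood_bipoint X x) U \<longleftrightarrow> x \<in> U"
  "openin (snd X) U \<Longrightarrow> snd (neighbourhood_bipoint X x) U \<longleftrightarrow> x \<in> U"
  by (simp_all add: neighbourhood_bipoint_def)

lemma neighbourhood_bipoint:
  assumes "bispace X" "x \<in> points X"
  shows "neighbourhood_bipoint X x \<in> bipoints (opens_biframe X)"
proof -
  have x: "x \<in> topspace (fst X)" "x \<in> topspace (snd X)" using assms by (simp_all add: points_def bispace_def)
  have "(\<lambda>U\<in>{U. openin T U}. x \<in> U) \<in> frame_maps (opens_frame T) two_frame" if "x \<in> topspace T" for T
    by (rule frame_maps_opensI) (use that in \<open>auto simp: openin_Union subset_iff\<close>)
  then show ?thesis
    unfolding neighbourhood_bipoint_def bipoints_opens_biframe_iff using x by auto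
qed

lemma evaluation_homeomorphism:
  assumes bij: "bij_betw n (topspace S) (topspace T)"
    and opens: "\<And>W. openin T W \<longleftrightarrow> (\<exists>U. openin S U \<and> W = {f \<in> topspace T. ev f U})"
    and ev: "\<And>U x. openin S U \<Longrightarrow> ev (n x) U \<longleftrightarrow> x \<in> U"
  shows "homeomorphic_map S T n"
proof (rule homeomorphic_mapI_openin[OF bij])
  note surj = bij_betw_imp_surj_on[OF bij, symmetric]
  have img: "n ` U = {f \<in> topspace T. ev f U}" if "openin S U" for U
    unfolding surj by (auto simp: ev[OF that] dest: subsetD[OF openin_subset[OF that]])
  show "openin T (n ` U)" if "openin S U" for U
    unfolding opens using img[OF that] that by (intro exI[of _ U]) simp
  show "openin S {x \<in> topspace S. n x \<in> W}" if "openin T W" for W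
  proof -
    obtain U where U: "openin S U" "W = {f \<in> topspace T. ev f U}" using \<open>openin T W\<close> unfolding opens by (elim exE conjE)
    have "{x \<in> topspace S. n x \<in> W} = U"
      unfolding U(2) surj by (auto simp: ev[OF U(1)] dest: subsetD[OF openin_subset[OF U(1)]])
    then show ?thesis using U(1) by simp
  qed
qed

text \<open>The neighbourhood map matches each open with its evaluation set, and all opens of the
  target are evaluation sets; a bijection is then automatically a homeomorphism on both
  sides.\<close>

lemma bisober_iff:
  assumes X: "bispace X"
  shows "bisober X \<longleftrightarrow> bij_betw (neighbourhood_bipoint X) (points X) (bipoints (opens_biframe X))"
proof
  assume "bisober X"
  then show "bij_betw (neighbourhood_bipoint X) (points X) (bipoints (opens_biframe X))"
    by (simp add: bisober_def bihomeomorphism_def points_def[of "bpt _"] bpt_opens_biframe)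
next
  assume bij: "bij_betw (neighbourhood_bipoint X) (points X) (bipoints (opens_biframe X))"
  have t: "topspace (fst X) = points X" "topspace (snd X) = points X"
    using X by (simp_all add: points_def bispace_def)
  have "homeomorphic_map (fst X) (fst (bpt (opens_biframe X))) (neighbourhood_bipoint X)"
    by (rule evaluation_homeomorphism[where ev = fst])
      (use bij in \<open>simp_all add: t bpt_opens_biframe neighbourhood_simps\<close>)
  moreover have "homeomorphic_map (snd X) (snd (bpt (opens_biframe X))) (neighbourhood_bipoint X)"
    by (rule evaluation_homeomorphism[where ev = snd])
      (use bij in \<open>simp_all add: t bpt_opens_biframe neighbourhood_simps\<close>)
  ultimately show "bisober X"
    using bij by (simp add: bisober_def bihomeomorphism_def points_def[of "bpt _"] bpt_opens_biframe)
qed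

section \<open>Traces of opens on a set of bipoints\<close>

locale bipoint_subset = biframe_locale L for L :: "('p, 'n, 'a) biframe" +
  fixes Y
  assumes Y: "Y \<subseteq> bipoints L"
begin

abbreviation "X \<equiv> bisubspace (bpt L) Y"

definition pos_trace :: "'p \<Rightarrow> (('p \<Rightarrow> bool) \<times> ('n \<Rightarrow> bool)) set"
  where "pos_trace a = {f \<in> Y. fst f a}"

definition neg_trace :: "'n \<Rightarrow> (('p \<Rightarrow> bool) \<times> ('n \<Rightarrow> bool)) set"
  where "neg_trace a = {f \<in> Y. snd f a}"

lemma Y_frame_maps: "f \<in> Y \<Longrightarrow> fst f \<in> frame_maps P two_frame" "f \<in> Y \<Longrightarrow> snd f \<in> frame_maps N two_frame"
  using Y bipoints_frame_maps by blast+

lemma trace_opens: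
  "openin (fst X) U \<longleftrightarrow> (\<exists>a\<in>carrier P. U = pos_trace a)"
  "openin (snd X) U \<longleftrightarrow> (\<exists>a\<in>carrier N. U = neg_trace a)"
proof -
  have *: "{f \<in> bipoints L. Q f} \<inter> Y = {f \<in> Y. Q f}" for Q using Y by blast
  have **: "(\<exists>T. (\<exists>a\<in>A. T = g a) \<and> U = T \<inter> Y) \<longleftrightarrow> (\<exists>a\<in>A. U = g a \<inter> Y)" for A and g :: "'z \<Rightarrow> _" by blast
  show "openin (fst X) U \<longleftrightarrow> (\<exists>a\<in>carrier P. U = pos_trace a)"
    "openin (snd X) U \<longleftrightarrow> (\<exists>a\<in>carrier N. U = neg_trace a)"
    unfolding bisubspace_def fst_conv snd_conv openin_subtopology bpt_opens(1,2)[OF is_biframe] pos_trace_def neg_trace_def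
    by (simp_all only: ** *)
qed

lemma trace_topspace: "topspace (fst X) = Y" "topspace (snd X) = Y"
  using Y by (auto simp: bisubspace_def bpt_topspace)

lemma trace_bispace: "bispace X" "points X = Y"
  by (simp_all add: bispace_def points_def trace_topspace)

lemma evaluation_trace:
  assumes "\<And>f. f \<in> Y \<Longrightarrow> ev f \<in> frame_maps Q two_frame"
  shows "A \<subseteq> carrier Q \<Longrightarrow> {f \<in> Y. ev f (\<Squnion>\<^bsub>Q\<^esub> A)} = (\<Union>a\<in>A. {f \<in> Y. ev f a})"
    and "a \<in> carrier Q \<Longrightarrow> b \<in> carrier Q \<Longrightarrow> {f \<in> Y. ev f (a \<sqinter>\<^bsub>Q\<^esub> b)} = {f \<in> Y. ev f a} \<inter> {f \<in> Y. ev f b}"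
    and "{f \<in> Y. ev f \<top>\<^bsub>Q\<^esub>} = Y"
  by (auto simp: frame_maps_twoD(2-4)[OF assms])

text \<open>Together with \<open>trace_opens\<close> this says that taking traces is a surjective
  frame map onto the opens of the bisubspace.\<close>

lemma pos_trace:
  "a \<in> carrier P \<Longrightarrow> openin (fst X) (pos_trace a)"
  "A \<subseteq> carrier P \<Longrightarrow> pos_trace (\<Squnion>\<^bsub>P\<^esub> A) = \<Union>(pos_trace ` A)"
  "a \<in> carrier P \<Longrightarrow> b \<in> carrier P \<Longrightarrow> pos_trace (a \<sqinter>\<^bsub>P\<^esub> b) = pos_trace a \<inter> pos_trace b"
  "pos_trace \<top>\<^bsub>P\<^esub> = Y"
  unfolding trace_opens by blast (simp_all add: pos_trace_def[abs_def] evaluation_trace[OF Y_frame_maps(1)])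

lemma neg_trace:
  "a \<in> carrier N \<Longrightarrow> openin (snd X) (neg_trace a)"
  "A \<subseteq> carrier N \<Longrightarrow> neg_trace (\<Squnion>\<^bsub>N\<^esub> A) = \<Union>(neg_trace ` A)"
  "a \<in> carrier N \<Longrightarrow> b \<in> carrier N \<Longrightarrow> neg_trace (a \<sqinter>\<^bsub>N\<^esub> b) = neg_trace a \<inter> neg_trace b"
  "neg_trace \<top>\<^bsub>N\<^esub> = Y"
  unfolding trace_opens by blast (simp_all add: neg_trace_def[abs_def] evaluation_trace[OF Y_frame_maps(2)])

end

lemma trace_pullback:
  assumes Q: "frame Q" and o: "\<And>a. a \<in> carrier Q \<Longrightarrow> openin T (tr a)"
    and s: "\<And>A. A \<subseteq> carrier Q \<Longrightarrow> tr (\<Squnion>\<^bsub>Q\<^esub> A) = \<Union>(tr ` A)"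
    and m: "\<And>a b. a \<in> carrier Q \<Longrightarrow> b \<in> carrier Q \<Longrightarrow> tr (a \<sqinter>\<^bsub>Q\<^esub> b) = tr a \<inter> tr b"
    and t: "tr \<top>\<^bsub>Q\<^esub> = topspace T" and \<phi>: "\<phi> \<in> frame_maps (opens_frame T) two_frame"
  shows "(\<lambda>a\<in>carrier Q. \<phi> (tr a)) \<in> frame_maps Q two_frame"
proof (rule frame_maps_twoI)
  interpret Q: frame Q by (rule Q)
  note \<phi>D = frame_maps_opensD[OF \<phi>]
  show "(\<lambda>a\<in>carrier Q. \<phi> (tr a)) (\<Squnion>\<^bsub>Q\<^esub> A) \<longleftrightarrow> (\<exists>a\<in>A. (\<lambda>a\<in>carrier Q. \<phi> (tr a)) a)" if A: "A \<subseteq> carrier Q" for A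
  proof -
    have "\<phi> (\<Union>(tr ` A)) \<longleftrightarrow> (\<exists>U\<in>tr ` A. \<phi> U)" by (rule \<phi>D(2)) (use A o in auto)
    then show ?thesis using A by (auto simp: s)
  qed
  show "(\<lambda>a\<in>carrier Q. \<phi> (tr a)) \<top>\<^bsub>Q\<^esub>" using \<phi>D(3) by (simp add: t)
  show "(\<lambda>a\<in>carrier Q. \<phi> (tr a)) (a \<sqinter>\<^bsub>Q\<^esub> b) \<longleftrightarrow> (\<lambda>a\<in>carrier Q. \<phi> (tr a)) a \<and> (\<lambda>a\<in>carrier Q. \<phi> (tr a)) b"
    if "a \<in> carrier Q" "b \<in> carrier Q" for a b
    using that by (simp add: m \<phi>D(4) o)
qed simp

text \<open>Counterpart of \<open>trace_pullback\<close>: a point of \<open>Q\<close> descends along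
  the surjection \<open>tr\<close> when it is constant on the fibres. The existential in
  \<open>\<phi>\<close> ranges over all preimages, so none is chosen.\<close>

lemma trace_pushforward:
  assumes Q: "frame Q" and o: "\<And>U. openin T U \<longleftrightarrow> (\<exists>a\<in>carrier Q. U = tr a)"
    and s: "\<And>A. A \<subseteq> carrier Q \<Longrightarrow> tr (\<Squnion>\<^bsub>Q\<^esub> A) = \<Union>(tr ` A)"
    and m: "\<And>a b. a \<in> carrier Q \<Longrightarrow> b \<in> carrier Q \<Longrightarrow> tr (a \<sqinter>\<^bsub>Q\<^esub> b) = tr a \<inter> tr b"
    and t: "tr \<top>\<^bsub>Q\<^esub> = topspace T" and h: "h \<in> frame_maps Q two_frame"
    and cons: "\<And>a b. \<lbrakk>a \<in> carrier Q; b \<in> carrier Q; tr a = tr b; h a\<rbrakk> \<Longrightarrow> h b"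
  defines "\<phi> \<equiv> (\<lambda>U\<in>{U. openin T U}. \<exists>a\<in>carrier Q. U = tr a \<and> h a)"
  shows "\<phi> \<in> frame_maps (opens_frame T) two_frame" and "a \<in> carrier Q \<Longrightarrow> \<phi> (tr a) = h a"
proof -
  interpret Q: frame Q by (rule Q)
  note hD = frame_maps_twoD[OF h]
  have eq: "\<phi> (tr a) = h a" if "a \<in> carrier Q" for a
    unfolding \<phi>_def using that cons[OF _ that] o by auto
  then show "a \<in> carrier Q \<Longrightarrow> \<phi> (tr a) = h a" .
  show "\<phi> \<in> frame_maps (opens_frame T) two_frame"
  proof (rule frame_maps_opensI)
    show "\<phi> \<in> extensional {U. openin T U}" by (simp add: \<phi>_def)
    show "\<phi> (topspace T)" unfolding t[symmetric] eq[OF Q.top_closed] by (rule hD(3))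
    show "\<phi> (U \<inter> V) \<longleftrightarrow> \<phi> U \<and> \<phi> V" if UV: "openin T U" "openin T V" for U V
    proof -
      obtain a b where ab: "a \<in> carrier Q" "U = tr a" "b \<in> carrier Q" "V = tr b" using UV unfolding o by blast
      then show ?thesis using eq[of "a \<sqinter>\<^bsub>Q\<^esub> b"] by (simp add: m eq hD(4))
    qed
    show "\<phi> (\<Union>A) \<longleftrightarrow> (\<exists>U\<in>A. \<phi> U)" if A: "A \<subseteq> {U. openin T U}" for A
    proof -
      \<comment> \<open>All elements with trace in \<open>A\<close>; their join is a preimage of
        \<open>\<Union>A\<close> on which \<open>h\<close> can be evaluated.\<close>
      let ?A = "{a \<in> carrier Q. tr a \<in> A}"
      have "A = tr ` ?A" using A unfolding o by blast
      then have "\<Union>A = tr (\<Squnion>\<^bsub>Q\<^esub> ?A)" by (subst s) auto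
      then have "\<phi> (\<Union>A) \<longleftrightarrow> (\<exists>a\<in>?A. h a)" by (simp add: eq hD(2))
      also have "\<dots> \<longleftrightarrow> (\<exists>a\<in>?A. \<phi> (tr a))" by (simp add: eq)
      also have "\<dots> \<longleftrightarrow> (\<exists>U\<in>tr ` ?A. \<phi> U)" by blast
      finally show ?thesis using \<open>A = tr ` ?A\<close> by simp
    qed
  qed
qed

section \<open>Bisobriety as closedness for the base of the patch topology\<close>

context bipoint_subset
begin

text \<open>Points of \<open>Y\<close> approximate \<open>h\<close> on any finite set of conditions.
  So \<open>h\<close> descends to the traces and respects their inclusions, giving a bipoint of the
  opens; by bisobriety a point of \<open>Y\<close> induces it, and that point is
  \<open>h\<close>.\<close>

lemma bipoint_closure_of_extension:
  assumes bis: "bisober X" and h: "h \<in> bipoints L" and "\<And>B. B \<in> basic_opens \<Longrightarrow> h \<in> B \<Longrightarrow> B \<inter> Y \<noteq> {}"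
  shows "h \<in> Y"
proof -
  note hp = bipoints_frame_maps(1)[OF h] and hn = bipoints_frame_maps(2)[OF h]
  have approx: "\<exists>f\<in>Y. fst f a \<and> snd f b \<and> \<not> fst f c \<and> \<not> snd f d"
    if "a \<in> carrier P" "b \<in> carrier N" "c \<in> carrier P" "d \<in> carrier N" "fst h a" "snd h b" "\<not> fst h c" "\<not> snd h d" for a b c d
  proof -
    have "basic_open a b c d \<in> basic_opens" unfolding basic_opens_def using that by blast
    moreover have "h \<in> basic_open a b c d" using that h by (simp add: basic_open_def)
    ultimately have "basic_open a b c d \<inter> Y \<noteq> {}" by (rule assms(3))
    then show ?thesis unfolding basic_open_def by blast
  qed
  note tb = frame_maps_twoD(3)[OF hp] frame_maps_twoD(3)[OF hn]
    frame_maps_two_bottom[OF pos_frame hp] frame_maps_two_bottom[OF neg_frame hn]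
  \<comment> \<open>If \<open>h\<close> were 1 at \<open>a\<close> and 0 at \<open>a'\<close>, some
    point of \<open>Y\<close> would have the same two values and separate the traces. The other two
    conditions are filled with top and bottom.\<close>
  have cp: "fst h a'" if "a \<in> carrier P" "a' \<in> carrier P" "pos_trace a = pos_trace a'" "fst h a" for a a'
    using approx[OF that(1) N.top_closed that(2) N.bottom_closed that(4) tb(2) _ tb(4)] that(3)
    unfolding pos_trace_def by blast
  have cn: "snd h b'" if "b \<in> carrier N" "b' \<in> carrier N" "neg_trace b = neg_trace b'" "snd h b" for b b'
    using approx[OF P.top_closed that(1) P.bottom_closed that(2) tb(1) that(4) tb(3)] that(3)
    unfolding neg_trace_def by blast
  define \<phi> where "\<phi> = (\<lambda>U\<in>{U. openin (fst X) U}. \<exists>a\<in>carrier P. U = pos_trace a \<and> fst h a)"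
  define \<psi> where "\<psi> = (\<lambda>U\<in>{U. openin (snd X) U}. \<exists>a\<in>carrier N. U = neg_trace a \<and> snd h a)"
  have top: "pos_trace \<top>\<^bsub>P\<^esub> = topspace (fst X)" "neg_trace \<top>\<^bsub>N\<^esub> = topspace (snd X)"
    by (simp_all add: pos_trace(4) neg_trace(4) trace_topspace)
  have \<phi>: "\<phi> \<in> frame_maps (opens_frame (fst X)) two_frame"
    unfolding \<phi>_def
    by (rule trace_pushforward(1)[OF pos_frame trace_opens(1) _ _ top(1) hp]; (rule pos_trace(2,3) cp; assumption))
  have \<phi>_trace: "\<phi> (pos_trace a) = fst h a" if "a \<in> carrier P" for a
    unfolding \<phi>_def
    by (rule trace_pushforward(2)[OF pos_frame trace_opens(1) _ _ top(1) hp];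
        (fact that | (rule pos_trace(2,3) cp; assumption)))
  have \<psi>: "\<psi> \<in> frame_maps (opens_frame (snd X)) two_frame"
    unfolding \<psi>_def
    by (rule trace_pushforward(1)[OF neg_frame trace_opens(2) _ _ top(2) hn]; (rule neg_trace(2,3) cn; assumption))
  have \<psi>_trace: "\<psi> (neg_trace a) = snd h a" if "a \<in> carrier N" for a
    unfolding \<psi>_def
    by (rule trace_pushforward(2)[OF neg_frame trace_opens(2) _ _ top(2) hn];
        (fact that | (rule neg_trace(2,3) cn; assumption)))
  have "(\<phi>, \<psi>) \<in> bipoints (opens_biframe X)"
    unfolding bipoints_opens_biframe_iff
  proof (intro conjI \<phi> \<psi> allI impI, elim conjE)
    fix U U' V V' assume o: "openin (fst X) U" "openin (snd X) U'" "openin (fst X) V" "openin (snd X) V'"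
      and le: "U \<inter> U' \<subseteq> V \<union> V'" and u: "\<phi> U" "\<psi> U'"
    obtain a b c d where t: "a \<in> carrier P" "U = pos_trace a" "b \<in> carrier N" "U' = neg_trace b"
      "c \<in> carrier P" "V = pos_trace c" "d \<in> carrier N" "V' = neg_trace d"
      using o unfolding trace_opens by blast
    show "\<phi> V \<or> \<psi> V'"
    \<comment> \<open>A failure is exactly a basic open containing \<open>h\<close>; a point of
      \<open>Y\<close> in it contradicts the inclusion of traces.\<close>
    proof (rule ccontr)
      assume "\<not> (\<phi> V \<or> \<psi> V')"
      then have "\<exists>f\<in>Y. fst f a \<and> snd f b \<and> \<not> fst f c \<and> \<not> snd f d"
        using u t \<phi>_trace \<psi>_trace by (intro approx) simp_all
      then show False using le unfolding t pos_trace_def neg_trace_def by blast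
    qed
  qed
  moreover have "neighbourhood_bipoint X ` Y = bipoints (opens_biframe X)"
    using bis bij_betw_imp_surj_on[of "neighbourhood_bipoint X" Y "bipoints (opens_biframe X)"]
    unfolding bisober_iff[OF trace_bispace(1)] trace_bispace(2) by simp
  ultimately have "(\<phi>, \<psi>) \<in> neighbourhood_bipoint X ` Y" by simp
  then obtain y where y: "y \<in> Y" "neighbourhood_bipoint X y = (\<phi>, \<psi>)" by (elim imageE) simp
  have "h = y"
  proof (rule bipoints_ext[OF h])
    show "y \<in> bipoints L" using y Y by blast
    show "fst h a = fst y a" if "a \<in> carrier P" for a
      using that y \<phi>_trace[OF that] neighbourhood_simps(1)[OF pos_trace(1)[OF that], of y] by (simp add: pos_trace_def)
    show "snd h a = snd y a" if "a \<in> carrier N" for a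
      using that y \<psi>_trace[OF that] neighbourhood_simps(2)[OF neg_trace(1)[OF that], of y] by (simp add: neg_trace_def)
  qed
  then show ?thesis using y by simp
qed

text \<open>Composition with traces yields points \<open>p\<close> and \<open>q\<close> of the two
  parts of \<open>L\<close>. The relations on opens make \<open>(p, q)\<close> a bipoint and also
  force its basic neighbourhoods to meet \<open>Y\<close>, so it lies in \<open>Y\<close>.\<close>

lemma neighbourhood_bipoint_surj:
  assumes closed: "\<And>h. h \<in> bipoints L \<Longrightarrow> (\<And>B. B \<in> basic_opens \<Longrightarrow> h \<in> B \<Longrightarrow> B \<inter> Y \<noteq> {}) \<Longrightarrow> h \<in> Y"
    and g: "(\<phi>, \<psi>) \<in> bipoints (opens_biframe X)"
  shows "\<exists>y\<in>Y. (\<phi>, \<psi>) = neighbourhood_bipoint X y"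
proof -
  have \<phi>: "\<phi> \<in> frame_maps (opens_frame (fst X)) two_frame" and \<psi>: "\<psi> \<in> frame_maps (opens_frame (snd X)) two_frame"
    using g unfolding bipoints_opens_biframe_iff by simp_all
  have "\<phi> (pos_trace c) \<or> \<psi> (neg_trace d)"
    if "a \<in> carrier P" "b \<in> carrier N" "c \<in> carrier P" "d \<in> carrier N" "\<phi> (pos_trace a)" "\<psi> (neg_trace b)"
      "pos_trace a \<inter> neg_trace b \<subseteq> pos_trace c \<union> neg_trace d" for a b c d
    by (rule g[unfolded bipoints_opens_biframe_iff, THEN conjunct2, THEN conjunct2, rule_format,
          of "pos_trace a" "neg_trace b" "pos_trace c" "neg_trace d"])
      (use that pos_trace(1) neg_trace(1) in simp)
  note rel = this
  define p where "p = (\<lambda>a\<in>carrier P. \<phi> (pos_trace a))"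
  define q where "q = (\<lambda>a\<in>carrier N. \<psi> (neg_trace a))"
  have p: "p \<in> frame_maps P two_frame"
    unfolding p_def by (rule trace_pullback[OF pos_frame pos_trace(1,2,3) _ \<phi>]) (simp_all add: pos_trace(4) trace_topspace)
  have q: "q \<in> frame_maps N two_frame"
    unfolding q_def by (rule trace_pullback[OF neg_frame neg_trace(1,2,3) _ \<psi>]) (simp_all add: neg_trace(4) trace_topspace)
  have h: "(p, q) \<in> bipoints L"
  proof (rule bipointI[OF p q], rule ccontr)
    fix x y R assume x: "x \<in> carrier P" and y: "y \<in> carrier N" and R: "R \<subseteq> carrier P \<times> carrier N"
      and le: "emb_pos L x \<sqinter>\<^bsub>M\<^esub> emb_neg L y \<sqsubseteq>\<^bsub>M\<^esub> \<Squnion>\<^bsub>M\<^esub> ((\<lambda>(u, v). emb_pos L u \<sqinter>\<^bsub>M\<^esub> emb_neg L v) ` R)"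
      and px: "p x" and qy: "q y" and no: "\<not> (\<exists>(u, v)\<in>R. p u \<and> q v)"
    \<comment> \<open>Each rectangle of the cover has a side of value 0. The joins of the left and
      of the right sides of value 0 still have value 0, and their traces cover the trace of the
      rectangle of \<open>x\<close> and \<open>y\<close>. This replaces an arbitrary cover by a
      relation of the form in \<open>rel\<close>.\<close>
    let ?U = "{u \<in> fst ` R. \<not> p u}" and ?V = "{v \<in> snd ` R. \<not> q v}"
    have UV: "?U \<subseteq> carrier P" "?V \<subseteq> carrier N" using R by auto
    have "\<not> p (\<Squnion>\<^bsub>P\<^esub> ?U)" "\<not> q (\<Squnion>\<^bsub>N\<^esub> ?V)"
      using frame_maps_twoD(2)[OF p UV(1)] frame_maps_twoD(2)[OF q UV(2)] by simp_all
    moreover have "pos_trace x \<inter> neg_trace y \<subseteq> pos_trace (\<Squnion>\<^bsub>P\<^esub> ?U) \<union> neg_trace (\<Squnion>\<^bsub>N\<^esub> ?V)"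
    proof
      fix f assume f: "f \<in> pos_trace x \<inter> neg_trace y"
      then have "f \<in> Y" "fst f x" "snd f y" by (simp_all add: pos_trace_def neg_trace_def)
      then have "f \<in> bipoints L" using Y by blast
      obtain u v where uv: "(u, v) \<in> R" "fst f u" "snd f v"
        using bipointD[OF \<open>f \<in> bipoints L\<close> x y R le \<open>fst f x\<close> \<open>snd f y\<close>] by (elim bexE) auto
      have "f \<in> pos_trace u" "f \<in> neg_trace v" using uv \<open>f \<in> Y\<close> by (simp_all add: pos_trace_def neg_trace_def)
      moreover have "\<not> p u \<or> \<not> q v" using no uv(1) by blast
      then have "u \<in> ?U \<or> v \<in> ?V" using uv(1) image_eqI[of u fst "(u, v)" R] image_eqI[of v snd "(u, v)" R] by simp
      ultimately show "f \<in> pos_trace (\<Squnion>\<^bsub>P\<^esub> ?U) \<union> neg_trace (\<Squnion>\<^bsub>N\<^esub> ?V)"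
        unfolding pos_trace(2)[OF UV(1)] neg_trace(2)[OF UV(2)] by blast
    qed
    ultimately show False
      using rel[OF x y P.sup_closed[OF UV(1)] N.sup_closed[OF UV(2)]] px qy x y UV by (simp add: p_def q_def)
  qed
  have "(p, q) \<in> Y"
  proof (rule closed[OF h])
    fix B assume B: "B \<in> basic_opens" "(p, q) \<in> B"
    obtain a b c d where abcd: "a \<in> carrier P" "b \<in> carrier N" "c \<in> carrier P" "d \<in> carrier N" "B = basic_open a b c d"
      using B(1) unfolding basic_opens_def by blast
    then have v: "\<phi> (pos_trace a)" "\<psi> (neg_trace b)" "\<not> \<phi> (pos_trace c)" "\<not> \<psi> (neg_trace d)"
      using B(2) by (simp_all add: basic_open_def p_def q_def)
    \<comment> \<open>A basic neighbourhood missing \<open>Y\<close> would amount to an inclusion of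
      traces violated by \<open>\<phi>\<close> and \<open>\<psi>\<close>.\<close>
    then have "\<not> pos_trace a \<inter> neg_trace b \<subseteq> pos_trace c \<union> neg_trace d" using rel abcd by blast
    then show "B \<inter> Y \<noteq> {}" unfolding abcd(5) using Y by (auto simp: basic_open_def pos_trace_def neg_trace_def)
  qed
  moreover have "\<phi> = fst (neighbourhood_bipoint X (p, q))"
  proof (rule extensionalityI[OF frame_maps_opensD(1)[OF \<phi>]])
    fix U assume "U \<in> {U. openin (fst X) U}"
    then obtain a where a: "a \<in> carrier P" "U = pos_trace a" unfolding trace_opens by blast
    then show "\<phi> U = fst (neighbourhood_bipoint X (p, q)) U"
      using \<open>(p, q) \<in> Y\<close> by (simp add: neighbourhood_simps pos_trace(1)) (simp add: pos_trace_def p_def)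
  qed (simp add: neighbourhood_bipoint_def)
  moreover have "\<psi> = snd (neighbourhood_bipoint X (p, q))"
  proof (rule extensionalityI[OF frame_maps_opensD(1)[OF \<psi>]])
    fix U assume "U \<in> {U. openin (snd X) U}"
    then obtain a where a: "a \<in> carrier N" "U = neg_trace a" unfolding trace_opens by blast
    then show "\<psi> U = snd (neighbourhood_bipoint X (p, q)) U"
      using \<open>(p, q) \<in> Y\<close> by (simp add: neighbourhood_simps neg_trace(1)) (simp add: neg_trace_def q_def)
  qed (simp add: neighbourhood_bipoint_def)
  ultimately show ?thesis by (intro bexI[of _ "(p, q)"]) (simp_all add: prod_eq_iff)
qed

theorem bisober_bisubspace_iff:
  "bisober X \<longleftrightarrow> (\<forall>h\<in>bipoints L. (\<forall>B\<in>basic_opens. h \<in> B \<longrightarrow> B \<inter> Y \<noteq> {}) \<longrightarrow> h \<in> Y)"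
proof
  assume "bisober X"
  then show "\<forall>h\<in>bipoints L. (\<forall>B\<in>basic_opens. h \<in> B \<longrightarrow> B \<inter> Y \<noteq> {}) \<longrightarrow> h \<in> Y"
    using bipoint_closure_of_extension by blast
next
  assume closed: "\<forall>h\<in>bipoints L. (\<forall>B\<in>basic_opens. h \<in> B \<longrightarrow> B \<inter> Y \<noteq> {}) \<longrightarrow> h \<in> Y"
  have "bij_betw (neighbourhood_bipoint X) Y (bipoints (opens_biframe X))"
  proof (rule bij_betwI')
    \<comment> \<open>Traces separate the points of \<open>Y\<close>, so injectivity is automatic
      and the content lies in surjectivity.\<close>
    show "neighbourhood_bipoint X f = neighbourhood_bipoint X g \<longleftrightarrow> f = g" if f: "f \<in> Y" and g: "g \<in> Y" for f g
    proof
      assume eq: "neighbourhood_bipoint X f = neighbourhood_bipoint X g"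
      show "f = g"
      proof (rule bipoints_ext)
        show "f \<in> bipoints L" "g \<in> bipoints L" using f g Y by blast+
        show "fst f a = fst g a" if "a \<in> carrier P" for a
          using neighbourhood_simps(1)[OF pos_trace(1)[OF that], of f] neighbourhood_simps(1)[OF pos_trace(1)[OF that], of g]
            eq f g by (simp add: pos_trace_def)
        show "snd f a = snd g a" if "a \<in> carrier N" for a
          using neighbourhood_simps(2)[OF neg_trace(1)[OF that], of f] neighbourhood_simps(2)[OF neg_trace(1)[OF that], of g]
            eq f g by (simp add: neg_trace_def)
      qed
    qed simp
    show "neighbourhood_bipoint X f \<in> bipoints (opens_biframe X)" if "f \<in> Y" for f
      using that by (intro neighbourhood_bipoint) (simp_all add: trace_bispace)
    show "\<exists>y\<in>Y. g = neighbourhood_bipoint X y" if g: "g \<in> bipoints (opens_biframe X)" for g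
      using neighbourhood_bipoint_surj[of "fst g" "snd g"] closed g by simp
  qed
  then show "bisober X" by (simp add: bisober_iff trace_bispace)
qed

end

context biframe_locale
begin

text \<open>For a fixed \<open>Y\<close> both conditions are the same adherence condition, and every
  set of bipoints of the assembly is an image under the bijection \<open>alpha L\<close>.\<close>

theorem patch_closed_bisober:
  "{C. closedin (patch (bpt (assembly L))) C} = {alpha L ` Y | Y. Y \<subseteq> points (bpt L) \<and> bisober (bisubspace (bpt L) Y)}"
proof -
  have *: "closedin (patch (bpt (assembly L))) (alpha L ` Y) \<longleftrightarrow> bisober (bisubspace (bpt L) Y)" if "Y \<subseteq> bipoints L" for Y
  proof -
    interpret bipoint_subset L Y by unfold_locales (rule that)
    show ?thesis by (simp only: bisober_bisubspace_iff patch_closed_iff[OF that])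
  qed
  have "\<exists>Y. Y \<subseteq> bipoints L \<and> C = alpha L ` Y" if "closedin (patch (bpt (assembly L))) C" for C
    using closedin_subset[OF that] unfolding patch_assembly_topspace bij_betw_imp_surj_on[OF alpha_bij, symmetric]
    by (simp add: subset_image_iff)
  then show ?thesis unfolding bpt_opens(3)[OF is_biframe] using * by blast
qed

end

theorem theorem4p24:
  fixes L :: "('p, 'n, 'a) biframe"
  assumes "finitary_biframe L"
  shows
    "(biframe (assembly L) \<and>
     nabla_map L \<in> biframe_maps L (assembly L) \<and>
     inj_on (fst (nabla_map L)) (carrier (pos_part L)) \<and>
     inj_on (snd (nabla_map L)) (carrier (neg_part L)) \<and>
     (\<forall>x\<in>carrier (pos_part L). has_bicomplement_pos (assembly L) (fst (nabla_map L) x)) \<and>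
     (\<forall>y\<in>carrier (neg_part L). has_bicomplement_neg (assembly L) (snd (nabla_map L) y)) \<and>
     (\<forall>M :: ('q, 'm, 'b) biframe. \<forall>f. biframe M \<and> f \<in> biframe_maps L M \<and>
        (\<forall>x\<in>carrier (pos_part L). has_bicomplement_pos M (fst f x)) \<and>
        (\<forall>y\<in>carrier (neg_part L). has_bicomplement_neg M (snd f y)) \<longrightarrow>
        (\<exists>!g. g \<in> biframe_maps (assembly L) M \<and> biframe_comp L g (nabla_map L) = f)))
     \<and>
     (coframe (biquotients L) \<and> anti_isomorphic (main_part (assembly L)) (biquotients L))
     \<and>
     ((\<forall>f\<in>points (bpt L).
        \<exists>!g. g \<in> points (bpt (assembly L)) \<and> biframe_comp L g (nabla_map L) = f) \<and>
     bihomeomorphism (skula (bpt L)) (bpt (assembly L)) (alpha L))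
     \<and>
     {K. closedin (patch (bpt (assembly L))) K} =
     {alpha L ` Y | Y. Y \<subseteq> points (bpt L) \<and> bisober (bisubspace (bpt L) Y)}"
proof -
  interpret biframe_locale L
    by unfold_locales (use assms in \<open>simp add: finitary_biframe_def\<close>)
  have pos: "has_bicomplement_pos (assembly L) (fst (nabla_map L) x)" if "x \<in> carrier (pos_part L)" for x
    using nabla_delta_bicomplementary(1)[OF that] that by (auto simp: has_bicomplement_pos_def nabla_map_def)
  have neg: "has_bicomplement_neg (assembly L) (snd (nabla_map L) y)" if "y \<in> carrier (neg_part L)" for y
    using nabla_delta_bicomplementary(2)[OF that] that by (auto simp: has_bicomplement_neg_def nabla_map_def)
  have univ: "\<forall>M :: ('q, 'm, 'b) biframe. \<forall>f. biframe M \<and> f \<in> biframe_maps L M \<and>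
      (\<forall>x\<in>carrier (pos_part L). has_bicomplement_pos M (fst f x)) \<and>
      (\<forall>y\<in>carrier (neg_part L). has_bicomplement_neg M (snd f y)) \<longrightarrow>
      (\<exists>!g. g \<in> biframe_maps (assembly L) M \<and> biframe_comp L g (nabla_map L) = f)"
    by (intro allI impI, rule assembly_universal) simp_all
  have bipoint: "\<exists>!g. g \<in> points (bpt (assembly L)) \<and> biframe_comp L g (nabla_map L) = f"
    if "f \<in> points (bpt L)" for f
    using that assembly_bipoint_ex1 by (simp add: bpt_opens(3) is_biframe assembly_biframe)
  show ?thesis
    by (intro conjI ballI assembly_biframe nabla_map_biframe_map nabla_map_inj pos neg univ
        biquotients_coframe biquotients_anti_isomorphic bipoint alpha_bihomeomorphism patch_closed_bisober)
qed

end
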